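(* Fix $A>0$. For $x\ge 3$ and an integer $k$ with $2 \le k \le A\log \log x$, define $r=r(k,x)>0$ by $r(e^r-1)= \frac{k}{\log \log x}$. \begin{itemize} \item Let $X(\log \log x)$ be a Poisson random variable with mean $\log\log x$. Then, as $x\to \infty$ (uniformly over integers $k$ with $2\le k\le A\log\log x$), \[\mathbb{E}_{n \le x}(\omega(n)-\log \log x-a)^k \sim \frac{F(e^r)}{e^{ra}}\, \mathbb{E}\big(X(\log \log x)-\log \log x\big)^k .\] \item Let $(X_p)_{p \le x}$ be independent random variables indexed by the primes $p\le x$, with $X_p \sim \mathrm{Bernoulli}(1/p)$. Then, as $x\to \infty$ (uniformly over the same range of $k$), \[\mathbb{E}_{n \le x}\bigg(\omega(n)-\sum_{p\le x} \frac{1}{p}\bigg)^k \sim \frac{e^{-\gamma (e^r-1)}}{\Gamma(e^r)}\, \mathbb{E}\bigg(\sum_{p \le x} X_p - \sum_{p\le x} \frac{1}{p}\bigg)^k.\] \end{itemize} Moreover, if $k=o(\log \log x)$ then $r=o(1)$ and hence $F(e^r)/e^{ra}\sim e^{-\gamma (e^r-1)}/\Gamma(e^r) \sim 1$.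
   Context: $\omega(n)$ denotes the number of distinct prime divisors of $n$. $\mathbb{E}_{n\le x}$ denotes the average over $n$ chosen uniformly at random from the positive integers $n\le x$. Sums and products over $p$ run over primes. $\gamma$ is the Euler–Mascheroni constant, $\Gamma$ the Gamma function. $F$ is the entire function $F(z)=\frac{1}{\Gamma(z)}\prod_{p}\left(1-\frac{1}{p}\right)^z\left(1+\frac{z}{p-1}\right)$, and $a=\gamma+\sum_p\left(\log\left(1-\frac1p\right)+\frac1p\right)$ is the Meissel–Mertens constant. The notation $f\sim g$ means $f/g\to 1$. *)

theory Defs
  imports "HOL-Probability.Probability" "HOL-Number_Theory.Number_Theory"
    "HOL-Library.Landau_Symbols"
begin

definition omega :: "nat \<Rightarrow> nat" where
  "omega n = card (prime_factors n)"

(* Uniform average over the positive integers up to a real x. *)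
definition avg_upto :: "real \<Rightarrow> (nat \<Rightarrow> real) \<Rightarrow> real" where
  "avg_upto x f = measure_pmf.expectation (pmf_of_set {n. 1 \<le> n \<and> real n \<le> x}) f"

definition primes_le :: "real \<Rightarrow> nat set" where
  "primes_le x = {p. prime p \<and> real p \<le> x}"

(* Polymorphic in order to serve both as the entire function (instance complex) and as its
   restriction to the real line (instance real).  At the poles of Gamma the library has
   Gamma z = 0, so that 1 / Gamma z = 0 there, the value of the entire function 1 / Gamma. *)
definition F_fun :: "'a :: {Gamma, ln} \<Rightarrow> 'a" where
  "F_fun z = 1 / Gamma z *
     (\<Prod>p. if prime p then of_real (1 - 1 / real p) powr z * (1 + z / (of_nat p - 1)) else 1)"

definition meissel_mertens :: real where
  "meissel_mertens =
     euler_mascheroni + (\<Sum>p. if prime p then ln (1 - 1 / real p) + 1 / real p else 0)"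

definition r_of :: "nat \<Rightarrow> real \<Rightarrow> real" where
  "r_of k x = (THE r. r > 0 \<and> r * (exp r - 1) = real k / ln (ln x))"

lemma ln_ln_pos:
  assumes "x \<ge> (3 :: real)"
  shows "ln (ln x) > 0"
proof -
  have "exp 1 < x"
    using e_less_272 assms by linarith
  then have "ln (exp 1) < ln x"
    using assms by (subst ln_less_cancel_iff) auto
  then have "ln x > 1" by simp
  then show ?thesis by simp
qed

lemma r_of_ex1:
  assumes "x \<ge> (3 :: real)" "k > 0"
  shows "\<exists>!r. r > 0 \<and> r * (exp r - 1) = real k / ln (ln x)"
proof -
  define c where "c = real k / ln (ln x)"
  have c: "c > 0"
    using assms ln_ln_pos[OF assms(1)] by (simp add: c_def)
  let ?g = "\<lambda>r::real. r * (exp r - 1)"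
  have mono: "?g r < ?g s" if "0 < r" "r < s" for r s
    using that by (intro mult_strict_mono) auto
  have "(c + 1) * 1 \<le> (c + 1) * (exp (c + 1) - 1)"
    using c exp_ge_add_one_self[of "c + 1"] by (intro mult_left_mono) linarith+
  then have "c \<le> (c + 1) * (exp (c + 1) - 1)" by simp
  then have "\<exists>r. 0 \<le> r \<and> r \<le> c + 1 \<and> ?g r = c"
    using c by (intro IVT') (auto intro!: continuous_intros)
  then obtain r where r: "r \<ge> 0" "?g r = c" by blast
  have "r > 0" using r c by (cases "r = 0") auto
  then show ?thesis
    using r mono unfolding c_def[symmetric]
    by (intro ex1I[of _ r]) (auto, metis less_irrefl linorder_less_linear)
qed

(* f / g tends to 1 as x tends to infinity, uniformly in 2 <= k <= A log log x. *)
definition uniformly_asymp ::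
    "real \<Rightarrow> (nat \<Rightarrow> real \<Rightarrow> real) \<Rightarrow> (nat \<Rightarrow> real \<Rightarrow> real) \<Rightarrow> bool" where
  "uniformly_asymp A f g \<longleftrightarrow>
     (\<forall>\<epsilon>>0. \<forall>\<^sub>F x in at_top. \<forall>k. 2 \<le> k \<and> real k \<le> A * ln (ln x) \<longrightarrow>
        \<bar>f k x / g k x - 1\<bar> < \<epsilon>)"

end

theory Submission
  imports Defs "HOL-Complex_Analysis.Complex_Analysis" "HOL-Computational_Algebra.Squarefree"
    "HOL-Real_Asymp.Real_Asymp"
begin

text \<open>
  For a random variable \<open>Z\<close> the \<open>k\<close>-th moment is \<open>k!\<close> times the \<open>k\<close>-th Taylor coefficient of
  \<open>E exp (z Z)\<close>. Write \<open>\<mu> = ln (ln x)\<close> and let \<open>\<Phi> z = exp (\<mu> (exp z - 1 - z))\<close> be the generating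
  function of the centred Poisson variable. The generating function of \<open>omega n - \<mu> - a\<close> is close to
  \<open>G z * \<Phi> z\<close> and that of the centred Bernoulli sum is close to \<open>K z * \<Phi> z\<close>, with entire \<open>G\<close> and \<open>K\<close> for which
  \<open>G r = F (exp r) / exp (r a)\<close> and \<open>G r / K r = exp (- \<gamma> (exp r - 1)) / \<Gamma> (exp r)\<close> on the real line. Both factors have
  value \<open>1\<close> and derivative \<open>0\<close> at the origin. So it suffices to show that the \<open>k\<close>-th coefficient of \<open>g * \<Phi>\<close> is
  asymptotic to \<open>g r\<close> times that of \<open>\<Phi>\<close>, where \<open>r\<close> is the saddle point of \<open>\<Phi> z / z ^ k\<close>. If \<open>k / \<mu>\<close> is bounded
  below this is the saddle point method. In general the quotient of the \<open>(k - j)\<close>-th and the \<open>k\<close>-th coefficient of \<open>\<Phi>\<close>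
  is at most a constant times \<open>k / \<mu> * B ^ j\<close> for \<open>j \<ge> 2\<close>. The coefficients of the entire \<open>g\<close> decay faster than \<open>B ^ (- j)\<close>, and the term \<open>j = 1\<close> is absent, so for
  small \<open>k / \<mu>\<close> only \<open>g 0\<close> contributes.

  For the mean of \<open>w ^ omega n\<close> with complex \<open>w\<close>, write it as a divisor sum over squarefree \<open>m\<close> of
  \<open>(w - 1) ^ omega m\<close>. Inserting \<open>ln m\<close> as a sum over primes and using Mertens' first theorem, the logarithmic mean
  of these weights satisfies a differential equation up to lower order, which determines its growth. The constant is
  read off the Dirichlet series near its singularity.
\<close>

subsection \<open>Mertens' first theorem\<close>

text \<open>The theorem is about a quotient, so every error counts relative to the
  \<open>k\<close>-th coefficient of \<open>\<Phi>\<close>. For each \<delta> > 0 and large \<mu>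
  this coefficient is at least \<open>exp (- \<delta> * \<mu>) * exp (\<mu> * (exp r - 1 - r)) / r ^
  k\<close>. By Cauchy's inequality on \<open>norm z = r\<close>, an error of the generating
  function is therefore harmless once it is below \<open>exp (\<mu> * (exp r - 1 - r))\<close> by a
  fixed power of \<open>ln x = exp \<mu>\<close>. The divisor sum is estimated through absolute
  values, with an error \<open>ln x powr (norm (w - 1) - 1)\<close> up to a small loss in the
  exponent. For \<open>w = exp z\<close> all depends on the inequality
  \<open>norm (exp z - 1) - Re z \<le> exp (norm z) - norm z - c\<close> with some c > 0 for all
  \<open>z\<close>. Its worst case is near z = -0.88, and c = 1/100 is admissible. Where
  \<open>norm v - Re v\<close> is close to 1 or larger (\<open>v = w - 1\<close>), the main term
  drowns in the error, and only an upper bound is proved. The other approximations are softer: a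
  change of \<open>g\<close> that is small on one fixed circle changes the \<open>k\<close>-th
  coefficient of \<open>g * \<Phi>\<close> by little relative to that of \<open>\<Phi>\<close>, for
  all \<open>k\<close> at once. This covers the shift of the centre and the finite products over
  primes.\<close>

lemma card_multiples_upto:
  assumes "d > (0::nat)" shows "card {m\<in>{1..n}. d dvd m} = n div d"
proof -
  have "{m\<in>{1..n}. d dvd m} = (\<lambda>k. d * k) ` {1..n div d}"
  proof (intro equalityI subsetI)
    fix m assume "m \<in> {m\<in>{1..n}. d dvd m}"
    then obtain k where "m = d * k" "1 \<le> m" "m \<le> n" by auto
    with assms show "m \<in> (\<lambda>k. d * k) ` {1..n div d}"
      by (auto simp: less_eq_div_iff_mult_less_eq mult.commute intro!: imageI)
  next
    fix m assume "m \<in> (\<lambda>k. d * k) ` {1..n div d}"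
    with assms show "m \<in> {m\<in>{1..n}. d dvd m}"
      by (auto simp: less_eq_div_iff_mult_less_eq mult.commute)
  qed
  then show ?thesis using assms by (simp add: card_image inj_on_def)
qed

lemma sum_mangoldt_div: "(\<Sum>d=1..n. mangoldt d * real (n div d)) = ln (fact n :: real)"
proof -
  have "ln (fact n :: real) = (\<Sum>m=1..n. ln (real m))"
    by (simp add: fact_prod) (subst ln_prod, auto)
  also have "\<dots> = (\<Sum>m=1..n. \<Sum>d | d dvd m. mangoldt d)"
    by (intro sum.cong refl) (simp add: mangoldt_sum)
  also have "\<dots> = (\<Sum>m=1..n. \<Sum>d\<in>{d\<in>{1..n}. d dvd m}. mangoldt d)"
    by (intro sum.cong refl) (auto dest: dvd_imp_le dvd_pos_nat)
  also have "\<dots> = (\<Sum>d=1..n. \<Sum>m\<in>{m\<in>{1..n}. d dvd m}. mangoldt d)"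
    by (rule sum.swap_restrict) auto
  also have "\<dots> = (\<Sum>d=1..n. mangoldt d * real (n div d))"
  proof (intro sum.cong refl)
    fix d assume d: "d \<in> {1..n}"
    then have "card {m\<in>{1..n}. d dvd m} = n div d" by (intro card_multiples_upto) auto
    then show "(\<Sum>m\<in>{m\<in>{1..n}. d dvd m}. mangoldt d) = (mangoldt d * real (n div d) :: real)"
      by simp
  qed
  finally show ?thesis ..
qed

text \<open>Chebyshev's argument: \<open>2*n div d - 2 * (n div d)\<close> is never negative and
  equals 1 for \<open>n < d \<le> 2*n\<close>, so the new terms are bounded by the logarithm of the
  central binomial coefficient.\<close>

lemma sum_mangoldt_double:
  "(\<Sum>d=1..2*n. mangoldt d) \<le> (\<Sum>d=1..n. mangoldt d :: real) + 2 * real n * ln 2"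
proof -
  have "(\<Sum>d=n+1..2*n. mangoldt d :: real) \<le> (\<Sum>d=1..2*n. mangoldt d * (real (2*n div d) - 2 * real (n div d)))"
  proof -
    have "(\<Sum>d=n+1..2*n. mangoldt d :: real) = (\<Sum>d=n+1..2*n. mangoldt d * (real (2*n div d) - 2 * real (n div d)))"
    proof (intro sum.cong refl)
      fix d assume d: "d \<in> {n+1..2*n}"
      then have "2 * n div d = 1" "n div d = 0"
        by (auto intro!: div_nat_eqI)
      then show "mangoldt d = (mangoldt d * (real (2*n div d) - 2 * real (n div d)) :: real)" by simp
    qed
    also have "\<dots> \<le> (\<Sum>d=1..2*n. mangoldt d * (real (2*n div d) - 2 * real (n div d)))"
    proof (intro sum_mono2 mult_nonneg_nonneg mangoldt_nonneg)
      fix d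
      have "2 * (n div d) \<le> 2 * n div d"
        by (metis div_mult2_eq div_times_less_eq_dividend mult.commute nat_mult_le_cancel_disj
            div_le_mono less_eq_div_iff_mult_less_eq div_by_0 gr0I mult_0_right mult.assoc mult_le_mono2 le0)
      then show "0 \<le> real (2*n div d) - 2 * real (n div d)"
        by (metis diff_ge_0_iff_ge of_nat_le_iff of_nat_mult of_nat_numeral)
    qed auto
    finally show ?thesis .
  qed
  also have "\<dots> = (\<Sum>d=1..2*n. mangoldt d * real (2*n div d)) - 2 * (\<Sum>d=1..2*n. mangoldt d * real (n div d))"
    by (simp add: sum_subtractf algebra_simps sum_distrib_left)
  also have "(\<Sum>d=1..2*n. mangoldt d * real (n div d)) = (\<Sum>d=1..n. mangoldt d * real (n div d))"
    by (rule sum.mono_neutral_right) auto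
  also have "(\<Sum>d=1..2*n. mangoldt d * real (2*n div d)) - 2 * (\<Sum>d=1..n. mangoldt d * real (n div d))
      = ln (fact (2*n)) - 2 * ln (fact n)"
    using sum_mangoldt_div[of "2*n"] sum_mangoldt_div[of n] by simp
  also have "\<dots> = ln (real ((2*n) choose n))"
    by (subst binomial_fact) (auto simp: ln_div ln_mult simp flip: mult_2)
  also have "\<dots> \<le> ln (2 ^ (2*n))"
  proof -
    have "(2*n) choose n \<le> 2 ^ (2*n)" using binomial_le_pow2 by blast
    then have "real ((2*n) choose n) \<le> 2 ^ (2*n)" by (metis of_nat_le_iff of_nat_numeral of_nat_power)
    then show ?thesis by (subst ln_le_cancel_iff) (auto simp: zero_less_binomial)
  qed
  also have "\<dots> = 2 * real n * ln 2" by (simp add: ln_realpow)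
  finally have "(\<Sum>d=n+1..2*n. mangoldt d :: real) \<le> 2 * real n * ln 2" .
  moreover have "(\<Sum>d=1..2*n. mangoldt d :: real) = (\<Sum>d=1..n. mangoldt d) + (\<Sum>d=n+1..2*n. mangoldt d)"
    by (subst sum.union_disjoint[symmetric]) (auto intro!: sum.cong)
  ultimately show ?thesis by simp
qed

lemma sum_mangoldt_le: "(\<Sum>d=1..n. mangoldt d) \<le> 6 * real n"
proof (induction n rule: less_induct)
  case (less n)
  show ?case
  proof (cases "n < 2")
    case True
    then have "n = 0 \<or> n = 1" by auto
    then show ?thesis by auto
  next
    case False
    \<comment> \<open>Halving is rounded up so that \<open>2 * m\<close> covers \<open>n\<close>.
      The constant 6 suffices because \<open>8 * m \<le> 4 * (n + 1) \<le> 6 * n\<close> for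
      \<open>n \<ge> 2\<close>.\<close>
    define m where "m = (n + 1) div 2"
    have m: "m < n" "n \<le> 2 * m" "2 * m \<le> n + 1" using False by (auto simp: m_def)
    have "(\<Sum>d=1..n. mangoldt d :: real) \<le> (\<Sum>d=1..2*m. mangoldt d)"
      using m by (intro sum_mono2) (auto simp: mangoldt_nonneg)
    also have "\<dots> \<le> 6 * real m + 2 * real m * ln 2"
      using sum_mangoldt_double[of m] less[OF m(1)] by linarith
    also have "\<dots> \<le> 6 * real m + 2 * real m"
      using ln_2_less_1 by (intro add_left_mono) (auto intro: mult_left_le)
    also have "\<dots> \<le> 6 * real n" using m False by linarith
    finally show ?thesis .
  qed
qed

lemma of_nat_le_iff_le_nat_floor: "n > 0 \<Longrightarrow> real n \<le> y \<longleftrightarrow> n \<le> nat \<lfloor>y\<rfloor>"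
proof
  assume "n > 0" "n \<le> nat \<lfloor>y\<rfloor>"
  then have "y \<ge> 0" by (cases "y \<ge> 0") auto
  then have "real (nat \<lfloor>y\<rfloor>) \<le> y" by simp
  with \<open>n \<le> nat \<lfloor>y\<rfloor>\<close> show "real n \<le> y" by linarith
qed (rule le_nat_floor)

lemma primes_le_eq: "primes_le y = {p. prime p \<and> p \<le> nat \<lfloor>y\<rfloor>}"
  unfolding primes_le_def using of_nat_le_iff_le_nat_floor prime_gt_0_nat by blast

lemma finite_primes_le [simp, intro]: "finite (primes_le y)"
  unfolding primes_le_eq by simp

lemma sum_ln_primes_le: assumes "y \<ge> 0" shows "(\<Sum>p\<in>primes_le y. ln (real p)) \<le> 6 * y"
proof -
  have "(\<Sum>p\<in>primes_le y. ln (real p)) = (\<Sum>p\<in>primes_le y. mangoldt p)"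
    by (intro sum.cong) (auto simp: primes_le_def)
  also have "\<dots> \<le> (\<Sum>d=1..nat \<lfloor>y\<rfloor>. mangoldt d)"
    by (intro sum_mono2) (auto simp: primes_le_eq mangoldt_nonneg prime_ge_1_nat Suc_le_eq prime_gt_0_nat)
  also have "\<dots> \<le> 6 * real (nat \<lfloor>y\<rfloor>)" by (rule sum_mangoldt_le)
  also have "\<dots> \<le> 6 * y" using assms by simp
  finally show ?thesis .
qed

text \<open>Replacing \<open>n div d\<close> by \<open>n / d\<close> in
  \<open>sum_mangoldt_div\<close> costs at most the sum of \<open>mangoldt d\<close>, hence
  \<open>6 * n\<close>, and \<open>ln (fact n)\<close> lies at most \<open>n\<close> below
  \<open>n * ln n\<close>. Together this is \<open>7 * n\<close>, and everything is divided by
  \<open>n\<close>.\<close>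

lemma sum_mangoldt_over_n:
  assumes "n > 0" shows "\<bar>(\<Sum>d=1..n. mangoldt d / real d) - ln (real n)\<bar> \<le> 7"
proof -
  have 1: "\<bar>(\<Sum>d=1..n. mangoldt d * (real n / real d)) - ln (fact n)\<bar> \<le> 6 * real n"
  proof -
    have "\<bar>(\<Sum>d=1..n. mangoldt d * (real n / real d)) - ln (fact n)\<bar>
        = \<bar>\<Sum>d=1..n. mangoldt d * (real n / real d - real (n div d))\<bar>"
      by (simp add: sum_mangoldt_div[symmetric] sum_subtractf algebra_simps)
    also have "\<dots> \<le> (\<Sum>d=1..n. mangoldt d * 1)"
    proof (rule order.trans[OF sum_abs], rule sum_mono)
      fix d assume "d \<in> {1..n}"
      have "\<bar>real n / real d - real (n div d)\<bar> \<le> 1"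
        using floor_divide_of_nat_eq[of n d, where ?'a = real] by linarith
      then show "\<bar>mangoldt d * (real n / real d - real (n div d))\<bar> \<le> mangoldt d * 1"
        unfolding abs_mult by (intro mult_mono) (auto simp: mangoldt_nonneg)
    qed
    also have "\<dots> \<le> 6 * real n" using sum_mangoldt_le by simp
    finally show ?thesis .
  qed
  have 2: "ln (fact n) \<le> real n * ln (real n)"
  proof -
    have "(fact n :: real) \<le> real n ^ n" using fact_le_power[of n, where ?'a=real] by simp
    then have "ln (fact n) \<le> ln (real n ^ n)" using assms by (subst ln_le_cancel_iff) auto
    then show ?thesis using assms by (simp add: ln_realpow)
  qed
  have 3: "ln (fact n) \<ge> real n * ln (real n) - real n"
  proof -
    \<comment> \<open>A single term of the exponential series gives the crude Stirling bound
      \<open>n ^ n / fact n \<le> exp n\<close>.\<close>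
    have "(\<Sum>k\<in>{n}. real n ^ k /\<^sub>R fact k) \<le> (\<Sum>k. real n ^ k /\<^sub>R fact k)"
      by (intro sum_le_suminf summable_exp_generic) auto
    then have "real n ^ n / fact n \<le> exp (real n)"
      by (simp add: exp_def divide_inverse mult.commute)
    then have "ln (real n ^ n / fact n) \<le> ln (exp (real n))"
      using assms by (subst ln_le_cancel_iff) auto
    then have "ln (real n ^ n / fact n) \<le> real n" by simp
    then show ?thesis using assms by (simp add: ln_div ln_realpow)
  qed
  have "\<bar>real n * ((\<Sum>d=1..n. mangoldt d / real d) - ln (real n))\<bar> \<le> real n * 7"
    using 1 2 3 by (simp add: algebra_simps sum_distrib_left abs_le_iff)
  then show ?thesis using assms by (simp add: abs_mult)
qed

lemma ln_le_2_sqrt: "x > 0 \<Longrightarrow> ln x \<le> 2 * sqrt x" for x :: real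
  using ln_le_minus_one[of "sqrt x"] by (simp add: ln_sqrt)

lemma sum_ln_over_square_bounded:
  obtains C where "C > 0" "\<And>A :: nat set. finite A \<Longrightarrow> (\<Sum>n\<in>A. ln (real n) / real n ^ 2) \<le> C"
proof -
  have sm: "summable (\<lambda>n. 2 * real n powr (-3/2))"
    by (intro summable_mult) (simp add: summable_real_powr_iff)
  define C where "C = (\<Sum>n. 2 * real n powr (-3/2)) + 1"
  have nn: "(\<Sum>n. 2 * real n powr (-3/2)) \<ge> 0" by (intro suminf_nonneg sm) auto
  show ?thesis
  proof (rule that[of C])
    show "C > 0" using nn by (simp add: C_def)
    fix A :: "nat set" assume A: "finite A"
    have "(\<Sum>n\<in>A. ln (real n) / real n ^ 2) \<le> (\<Sum>n\<in>A. 2 * real n powr (-3/2))"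
    proof (rule sum_mono)
      fix n :: nat
      show "ln (real n) / real n ^ 2 \<le> 2 * real n powr (-3/2)"
      proof (cases "n = 0")
        case False
        then have "ln (real n) / real n ^ 2 \<le> 2 * sqrt (real n) / real n ^ 2"
          by (intro divide_right_mono ln_le_2_sqrt) auto
        also have "\<dots> = 2 * (real n powr (1/2) / real n powr 2)"
          using False by (simp add: powr_half_sqrt)
        also have "\<dots> = 2 * real n powr (-3/2)"
          by (subst powr_diff[symmetric]) simp
        finally show ?thesis .
      qed auto
    qed
    also have "\<dots> \<le> (\<Sum>n. 2 * real n powr (-3/2))"
      by (intro sum_le_suminf sm A) auto
    finally show "(\<Sum>n\<in>A. ln (real n) / real n ^ 2) \<le> C" by (simp add: C_def)
  qed
qed

lemma sum_prime_power_reciprocals_le: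
  assumes "prime p" shows "(\<Sum>k=2..n. 1 / real (p ^ k)) \<le> 2 / real p ^ 2"
proof -
  have p: "real p \<ge> 2" using prime_ge_2_nat[OF assms] by simp
  have "(\<Sum>k=2..n. 1 / real (p ^ k)) \<le> (\<Sum>k=2..n. (1 / real p ^ 2) * (1/2) ^ (k - 2))"
  proof (rule sum_mono)
    fix k assume "k \<in> {2..n}"
    then obtain j where k: "k = 2 + j" using le_Suc_ex by force
    have "(2::real) ^ j \<le> real p ^ j" using p by (intro power_mono) auto
    then show "1 / real (p ^ k) \<le> (1 / real p ^ 2) * (1/2) ^ (k - 2)"
      using p by (simp add: k power_add divide_simps) (simp add: mult_left_mono power2_eq_square)?
  qed
  also have "\<dots> = (1 / real p ^ 2) * (\<Sum>k=2..n. (1/2) ^ (k - 2))" by (simp add: sum_distrib_left)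
  also have "\<dots> \<le> (1 / real p ^ 2) * 2"
  proof (rule mult_left_mono)
    show "(\<Sum>k=2..n. (1/2::real) ^ (k - 2)) \<le> 2"
  proof -
    have "(\<Sum>k=2..n. (1/2::real) ^ (k - 2)) = (\<Sum>j\<in>(\<lambda>k. k - 2) ` {2..n}. (1/2) ^ j)"
      by (subst sum.reindex) (auto simp: inj_on_def)
    also have "\<dots> \<le> (\<Sum>j<n. (1/2) ^ j)" by (intro sum_mono2) auto
    also have "\<dots> \<le> 2" by (simp add: sum_gp_strict)
    finally show ?thesis .
  qed
  qed auto
  finally show ?thesis by simp
qed

theorem Mertens_first:
  obtains C where "C > 0" "\<And>y. y \<ge> 1 \<Longrightarrow> \<bar>(\<Sum>p\<in>primes_le y. ln (real p) / real p) - ln y\<bar> \<le> C"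
proof -
  obtain C0 where C0: "C0 > 0" "\<And>A :: nat set. finite A \<Longrightarrow> (\<Sum>n\<in>A. ln (real n) / real n ^ 2) \<le> C0"
    using sum_ln_over_square_bounded by blast
  show ?thesis
  \<comment> \<open>The constant collects 7 from \<open>sum_mangoldt_over_n\<close>, 1 from rounding
    \<open>y\<close> down to an integer, and \<open>2 * C0\<close> from the proper prime
    powers.\<close>
  proof (rule that[of "8 + 2 * C0"])
    show "8 + 2 * C0 > 0" using C0 by simp
    fix y :: real assume y: "y \<ge> 1"
    define n where "n = nat \<lfloor>y\<rfloor>"
    have n: "n > 0" "real n \<le> y" "y < real n + 1" using y by (auto simp: n_def)
    have P: "primes_le y = {p. prime p \<and> p \<le> n}" by (simp add: primes_le_eq n_def)
    have ln_n: "ln y - 1 \<le> ln (real n)" "ln (real n) \<le> ln y"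
    proof -
      have "ln y \<le> ln (exp 1 * real n)"
      proof (subst ln_le_cancel_iff)
        have "y \<le> 2 * real n" using n by linarith
        also have "\<dots> \<le> exp 1 * real n" using exp_ge_add_one_self[of 1] by (intro mult_right_mono) auto
        finally show "y \<le> exp 1 * real n" .
      qed (use y n in auto)
      then show "ln y - 1 \<le> ln (real n)" using n by (simp add: ln_mult)
      show "ln (real n) \<le> ln y" using n by simp
    qed
    define N where "N = {d\<in>{1..n}. \<not> prime d}"
    have split: "(\<Sum>d=1..n. mangoldt d / real d) = (\<Sum>p\<in>primes_le y. ln (real p) / real p) + (\<Sum>d\<in>N. mangoldt d / real d)"
    proof -
      have "{1..n} = primes_le y \<union> N" "primes_le y \<inter> N = {}"
        by (auto simp: P N_def prime_gt_0_nat Suc_le_eq)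
      moreover have "finite N" by (auto simp: N_def)
      ultimately have "(\<Sum>d=1..n. mangoldt d / real d) = (\<Sum>d\<in>primes_le y. mangoldt d / real d) + (\<Sum>d\<in>N. mangoldt d / real d)"
        by (simp add: sum.union_disjoint)
      moreover have "(\<Sum>d\<in>primes_le y. mangoldt d / real d) = (\<Sum>p\<in>primes_le y. ln (real p) / real p)"
        by (intro sum.cong) (auto simp: P)
      ultimately show ?thesis by simp
    qed
    \<comment> \<open>The non-primes with \<open>mangoldt d \<noteq> 0\<close> are powers
      \<open>p ^ k\<close> with \<open>k \<ge> 2\<close>. The full rectangle of pairs
      \<open>(p, k)\<close> only adds non-negative terms and lets the sum over \<open>k\<close> be
      evaluated for each \<open>p\<close>.\<close>
    have "(\<Sum>d\<in>N. mangoldt d / real d) \<le> (\<Sum>d\<in>(\<lambda>(p,k). p ^ k) ` (primes_le y \<times> {2..n}). mangoldt d / real d)"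
    proof -
      have "(\<Sum>d\<in>N. mangoldt d / real d) = (\<Sum>d\<in>{d\<in>N. primepow d}. mangoldt d / real d)"
        by (intro sum.mono_neutral_right) (auto simp: N_def mangoldt_def)
      also have "\<dots> \<le> (\<Sum>d\<in>(\<lambda>(p,k). p ^ k) ` (primes_le y \<times> {2..n}). mangoldt d / real d)"
      proof (intro sum_mono2)
        show "{d\<in>N. primepow d} \<subseteq> (\<lambda>(p,k). p ^ k) ` (primes_le y \<times> {2..n})"
        proof
          fix d assume d: "d \<in> {d\<in>N. primepow d}"
          then obtain p k where pk: "prime p" "k > 0" "d = p ^ k" by (auto simp: primepow_def)
          have "k \<noteq> 1" using d pk by (auto simp: N_def)
          have "p \<le> p ^ k" using pk by (metis self_le_power prime_ge_1_nat)
          moreover have "k < p ^ k" using pk by (intro power_gt_expt prime_gt_Suc_0_nat)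
          ultimately show "d \<in> (\<lambda>(p,k). p ^ k) ` (primes_le y \<times> {2..n})"
            using d pk \<open>k \<noteq> 1\<close> by (auto simp: N_def P intro!: image_eqI[of _ _ "(p,k)"])
        qed
      qed (auto simp: mangoldt_nonneg)
      finally show ?thesis .
    qed
    also have "\<dots> \<le> (\<Sum>(p,k)\<in>primes_le y \<times> {2..n}. mangoldt (p ^ k) / real (p ^ k))"
      by (rule order.trans[OF sum_image_le]) (auto simp: mangoldt_nonneg case_prod_beta)
    also have "\<dots> = (\<Sum>p\<in>primes_le y. \<Sum>k=2..n. mangoldt (p ^ k) / real (p ^ k))"
      by (simp add: sum.cartesian_product)
    also have "\<dots> = (\<Sum>p\<in>primes_le y. ln (real p) * (\<Sum>k=2..n. 1 / real (p ^ k)))"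
      by (intro sum.cong refl) (auto simp: P sum_distrib_left)
    also have "\<dots> \<le> (\<Sum>p\<in>primes_le y. ln (real p) * (2 / real p ^ 2))"
      by (intro sum_mono mult_left_mono sum_prime_power_reciprocals_le) (auto simp: P prime_gt_0_nat Suc_le_eq)
    also have "\<dots> = 2 * (\<Sum>p\<in>primes_le y. ln (real p) / real p ^ 2)" by (simp add: sum_distrib_left algebra_simps)
    also have "\<dots> \<le> 2 * C0" using C0(2)[of "primes_le y"] by simp
    finally have up: "(\<Sum>d\<in>N. mangoldt d / real d) \<le> 2 * C0" .
    have "(\<Sum>d\<in>N. mangoldt d / real d) \<ge> 0" by (intro sum_nonneg) (auto simp: mangoldt_nonneg)
    with up split sum_mangoldt_over_n[OF n(1)] ln_n
    show "\<bar>(\<Sum>p\<in>primes_le y. ln (real p) / real p) - ln y\<bar> \<le> 8 + 2 * C0" by linarith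
  qed
qed

subsection \<open>Logarithmic means over squarefree numbers\<close>

text \<open>For \<open>v = w - 1\<close> this is the Dirichlet convolution of
  \<open>w ^ omega n\<close> with the Moebius function.\<close>

definition sqfree_power :: "'a \<Rightarrow> nat \<Rightarrow> 'a :: real_normed_field" where
  "sqfree_power v m = (if squarefree m then v ^ omega m else 0)"

text \<open>The cutoff is parametrised by \<open>u = ln x\<close>, the scale on which the means
  satisfy a differential equation and on which their Laplace transform is a Dirichlet
  series.\<close>

definition nats_le_exp :: "real \<Rightarrow> nat set" where
  "nats_le_exp u = {m. m > 0 \<and> ln (real m) \<le> u}"

definition log_mean :: "'a \<Rightarrow> real \<Rightarrow> 'a :: real_normed_field" where
  "log_mean v u = (\<Sum>m\<in>nats_le_exp u. sqfree_power v m / of_nat m)"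

text \<open>The integral of \<open>log_mean v\<close> from \<open>0\<close> to \<open>u\<close>, as
  a finite sum.\<close>

definition log_mean_int :: "'a \<Rightarrow> real \<Rightarrow> 'a :: real_normed_field" where
  "log_mean_int v u = (\<Sum>m\<in>nats_le_exp u. sqfree_power v m / of_nat m * of_real (u - ln (real m)))"

lemma nats_le_exp_eq: "nats_le_exp u = {m. m > 0 \<and> real m \<le> exp u}"
  unfolding nats_le_exp_def by (intro Collect_cong conj_cong refl) (metis ln_ge_iff of_nat_0_less_iff exp_le_cancel_iff exp_ln)

lemma finite_nats_le_exp [simp, intro]: "finite (nats_le_exp u)"
proof (rule finite_subset)
  show "nats_le_exp u \<subseteq> {..nat \<lfloor>exp u\<rfloor>}" by (auto simp: nats_le_exp_eq le_nat_floor)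
qed auto

lemma norm_sqfree_power: "norm (sqfree_power v m) = sqfree_power (norm v) m"
  by (simp add: sqfree_power_def norm_power)

lemma sqfree_power_nonneg: "t \<ge> 0 \<Longrightarrow> sqfree_power t m \<ge> (0::real)"
  by (simp add: sqfree_power_def)

lemma sqfree_power_mono: "0 \<le> s \<Longrightarrow> s \<le> t \<Longrightarrow> sqfree_power s m \<le> (sqfree_power t m :: real)"
  by (simp add: sqfree_power_def power_mono)

lemma omega_1 [simp]: "omega (Suc 0) = 0" "omega 1 = 0" "omega 0 = 0" by (simp_all add: omega_def)

lemma squarefree_prime_mult:
  fixes p m :: nat assumes "prime p" "m > 0"
  shows "squarefree (p * m) \<and> p dvd p * m \<longleftrightarrow> squarefree m \<and> \<not> p dvd m"
proof
  assume "squarefree (p * m) \<and> p dvd p * m"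
  then have sq: "squarefree (p * m)" ..
  have "\<not> p dvd m"
  proof
    assume "p dvd m"
    then have "p\<^sup>2 dvd p * m" by (simp add: power2_eq_square)
    then have "p dvd 1" using sq unfolding squarefree_def by blast
    with assms show False by simp
  qed
  with sq show "squarefree m \<and> \<not> p dvd m"
    using squarefree_multD(2) by blast
next
  assume "squarefree m \<and> \<not> p dvd m"
  then show "squarefree (p * m) \<and> p dvd p * m"
    using assms squarefree_mult_coprime[OF prime_imp_coprime squarefree_prime, of p m] by simp
qed

lemma omega_prime_mult:
  assumes "prime p" "m > 0" "\<not> p dvd m"
  shows "omega (p * m) = Suc (omega m)"
proof -
  have "prime_factors (p * m) = insert p (prime_factors m)"
    using assms by (simp add: prime_factors_product prime_prime_factors)
  then show ?thesis using assms by (simp add: omega_def in_prime_factors_iff)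
qed

text \<open>Writing a squarefree multiple \<open>m'\<close> of a prime \<open>p\<close> as \<open>m' = p * m\<close> exchanges the sum over
  \<open>m'\<close> and its prime divisors for a sum over \<open>m\<close> and the primes up to \<open>exp u / m\<close>.\<close>

lemma sum_sqfree_power_additive:
  fixes v :: "'a :: real_normed_field" and q g :: "nat \<Rightarrow> real"
  assumes q: "\<And>p m. q (p * m) = q p * q m"
  shows "(\<Sum>m\<in>nats_le_exp u. sqfree_power v m * of_real (q m * (\<Sum>p\<in>prime_factors m. g p)))
       = v * (\<Sum>m\<in>nats_le_exp u. sqfree_power v m *
            of_real (q m * (\<Sum>p | prime p \<and> ln (real p) \<le> u - ln (real m) \<and> \<not> p dvd m. q p * g p)))"
    (is "?L = v * ?R")
proof -
  define N where "N = {m\<in>nats_le_exp u. squarefree m}"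
  define P where "P = (\<lambda>m. {p. prime p \<and> ln (real p) \<le> u - ln (real m) \<and> \<not> p dvd m})"
  have fN: "finite N" by (simp add: N_def)
  have fP: "finite (P m)" if "m \<in> N" for m
  proof (rule finite_subset)
    show "P m \<subseteq> nats_le_exp u" using that
      by (auto simp: P_def nats_le_exp_def N_def prime_gt_0_nat) (smt (verit) ln_ge_zero of_nat_1 of_nat_less_iff of_nat_mono Suc_leI One_nat_def)
  qed auto
  have fact: "prime_factors m = {p. prime p \<and> p dvd m}" if "m \<in> N" for m
    using that by (auto simp: N_def nats_le_exp_def prime_factors_dvd)
  have "?L = (\<Sum>m\<in>N. sqfree_power v m * of_real (q m * (\<Sum>p\<in>prime_factors m. g p)))"
    unfolding N_def by (intro sum.mono_neutral_right) (auto simp: sqfree_power_def)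
  also have "\<dots> = (\<Sum>m\<in>N. \<Sum>p\<in>prime_factors m. v ^ omega m * of_real (q m * g p))"
    by (intro sum.cong refl) (auto simp: N_def sqfree_power_def sum_distrib_left of_real_sum)
  also have "\<dots> = (\<Sum>(m,p)\<in>Sigma N prime_factors. v ^ omega m * of_real (q m * g p))"
    by (subst sum.Sigma) (auto simp: fN)
  also have "\<dots> = (\<Sum>(m,p)\<in>Sigma N P. v * (v ^ omega m * of_real (q m * (q p * g p))))"
  proof (rule sum.reindex_bij_witness[of _ "\<lambda>(m,p). (p * m, p)" "\<lambda>(m,p). (m div p, p)"], goal_cases)
    case (1 a) then show ?case by (auto simp: fact)
  next
    case (2 a)
    obtain m p where a: "a = (m, p)" "m \<in> N" "prime p" "p dvd m" using 2 fact by (cases a) auto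
    then obtain m' where m': "m = p * m'" by (auto elim: dvdE)
    have pos: "m' > 0" "p > 0" using a m' by (auto simp: N_def nats_le_exp_def)
    have "squarefree m' \<and> \<not> p dvd m'" using squarefree_prime_mult[of p m'] a m' pos by (auto simp: N_def)
    moreover have "ln (real m) = ln (real p) + ln (real m')" using pos m' by (simp add: ln_mult)
    moreover have "ln (real p) \<ge> 0" using pos by (simp add: Suc_leI)
    then have "ln (real m') \<le> ln (real p) + ln (real m')" by simp
    then have "ln (real m') \<le> u" using calculation a by (auto simp: N_def nats_le_exp_def)
    ultimately show ?case using a pos m' by (auto simp: N_def nats_le_exp_def P_def)
  next
    case (3 a) then show ?case by (auto simp: P_def prime_gt_0_nat)
  next
    case (4 a)
    obtain m p where a: "a = (m, p)" "m \<in> N" "p \<in> P m" using 4 by (cases a) auto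
    have pos: "m > 0" "p > 0" "prime p" using a by (auto simp: N_def nats_le_exp_def P_def prime_gt_0_nat)
    have *: "squarefree (p * m) \<and> p dvd p * m" using squarefree_prime_mult[of p m] a pos by (auto simp: N_def P_def)
    moreover have "ln (real (p * m)) = ln (real p) + ln (real m)" using pos by (simp add: ln_mult)
    ultimately have "p * m \<in> N" using a pos by (auto simp: N_def nats_le_exp_def P_def)
    then show ?case using a pos fact by auto
  next
    case (5 a)
    obtain m p where a: "a = (m, p)" "m \<in> N" "prime p" "p dvd m" using 5 fact by (cases a) auto
    then obtain m' where m': "m = p * m'" by (auto elim: dvdE)
    have pos: "m' > 0" "p > 0" using a m' by (auto simp: N_def nats_le_exp_def)
    have "\<not> p dvd m'" using squarefree_prime_mult[of p m'] a m' pos by (auto simp: N_def)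
    then have "omega m = Suc (omega m')" using omega_prime_mult a m' pos by auto
    then show ?case using a m' pos q by (simp add: mult_ac)
  qed
  also have "\<dots> = (\<Sum>m\<in>N. \<Sum>p\<in>P m. v * (v ^ omega m * of_real (q m * (q p * g p))))"
    by (subst sum.Sigma) (auto simp: fN fP)
  also have "\<dots> = v * (\<Sum>m\<in>N. sqfree_power v m * of_real (q m * (\<Sum>p\<in>P m. q p * g p)))"
    by (auto simp: N_def sqfree_power_def sum_distrib_left of_real_sum intro!: sum.cong)
  also have "(\<Sum>m\<in>N. sqfree_power v m * of_real (q m * (\<Sum>p\<in>P m. q p * g p))) = ?R"
    unfolding N_def P_def by (intro sum.mono_neutral_left) (auto simp: sqfree_power_def)
  finally show ?thesis .
qed

lemma ln_squarefree: "squarefree m \<Longrightarrow> ln (real m) = (\<Sum>p\<in>prime_factors m. ln (real p))"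
proof -
  assume sq: "squarefree m"
  have "m \<noteq> 0" using sq not_squarefree_0 by metis
  have "(\<Prod>p\<in>prime_factors m. p) = m"
  proof -
    have "m = (\<Prod>p\<in>prime_factors m. p ^ multiplicity p m)"
      using \<open>m \<noteq> 0\<close> prod_prime_factors[of m] by simp
    also have "\<dots> = (\<Prod>p\<in>prime_factors m. p)"
    proof (intro prod.cong refl)
      fix p assume p: "p \<in> prime_factors m"
      then have "multiplicity p m = 1"
        using sq \<open>m \<noteq> 0\<close> squarefree_factorial_semiring'[of m] by (auto simp: in_prime_factors_iff)
      then show "p ^ multiplicity p m = p" by simp
    qed
    finally show ?thesis ..
  qed
  from arg_cong[OF this, of "\<lambda>n. ln (real n)"]
  have "ln (real m) = ln (\<Prod>p\<in>prime_factors m. real p)" by simp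
  also have "\<dots> = (\<Sum>p\<in>prime_factors m. ln (real p))"
    by (rule ln_prod) (auto simp: in_prime_factors_iff)
  finally show ?thesis .
qed

lemma sum_sqfree_power_ln:
  fixes v :: "'a :: real_normed_field" and q :: "nat \<Rightarrow> real"
  assumes q: "\<And>p m. q (p * m) = q p * q m"
  shows "(\<Sum>m\<in>nats_le_exp u. sqfree_power v m * of_real (q m * ln (real m)))
       = v * (\<Sum>m\<in>nats_le_exp u. sqfree_power v m *
            of_real (q m * (\<Sum>p | prime p \<and> ln (real p) \<le> u - ln (real m) \<and> \<not> p dvd m. q p * ln (real p))))"
  unfolding sum_sqfree_power_additive[OF q, symmetric]
  by (intro sum.cong refl) (simp add: sqfree_power_def ln_squarefree)

lemma primes_le_exp: "primes_le (exp y) = {p. prime p \<and> ln (real p) \<le> y}"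
  unfolding primes_le_def
  by (metis (no_types, lifting) exp_le_cancel_iff exp_ln of_nat_0_less_iff prime_gt_0_nat)

text \<open>The difference \<open>u * log_mean v u - log_mean_int v u\<close> is the mean weighted
  by \<open>ln m\<close>. Exchanging \<open>m\<close> with its prime divisors turns it into
  \<open>v\<close> times a mean weighted by the sum of \<open>ln p / p\<close> over
  \<open>p \<le> exp u / m\<close> with \<open>p\<close> not dividing \<open>m\<close>. By Mertens
  this weight is \<open>u - ln m + O(1)\<close> but for the primes dividing \<open>m\<close>. So
  \<open>T = log_mean_int v\<close> satisfies \<open>u * T' = (1 + v) * T\<close> up to a term of
  the size of \<open>log_mean (norm v) u\<close>.\<close>

lemma log_mean_recursion:
  fixes v :: "'a :: real_normed_field"
  obtains K where "K > 0" "\<And>(v::'a) u. u \<ge> 0 \<Longrightarrow> norm v \<le> V \<Longrightarrow>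
    norm (of_real u * log_mean v u - (1 + v) * log_mean_int v u) \<le> K * log_mean (norm v) u"
proof -
  obtain C where C: "C > 0" "\<And>y. y \<ge> 1 \<Longrightarrow> \<bar>(\<Sum>p\<in>primes_le y. ln (real p) / real p) - ln y\<bar> \<le> C"
    using Mertens_first by blast
  obtain C0 where C0: "C0 > 0" "\<And>A :: nat set. finite A \<Longrightarrow> (\<Sum>n\<in>A. ln (real n) / real n ^ 2) \<le> C0"
    using sum_ln_over_square_bounded by blast
  define K where "K = \<bar>V\<bar> * C + \<bar>V\<bar> * (\<bar>V\<bar> * C0) + 1"
  show ?thesis
  proof (rule that[of K])
    show "K > 0" using C(1) C0(1) by (simp add: K_def add_nonneg_pos)
    fix v :: 'a and u :: real assume u: "u \<ge> 0" and v: "norm v \<le> V"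
    define t where "t = norm v"
    have t: "0 \<le> t" "t \<le> \<bar>V\<bar>" using v by (auto simp: t_def)
    define A where "A = (\<lambda>m. \<Sum>p | prime p \<and> ln (real p) \<le> u - ln (real m). ln (real p) / real p)"
    define B where "B = (\<lambda>m. \<Sum>p | prime p \<and> ln (real p) \<le> u - ln (real m) \<and> \<not> p dvd m. ln (real p) / real p)"
    have Bdiff: "0 \<le> A m - B m \<and> A m - B m \<le> (\<Sum>p\<in>prime_factors m. ln (real p) / real p)" if "m > 0" for m
    proof -
      have f: "finite {p. prime p \<and> ln (real p) \<le> u - ln (real m)}"
        using finite_primes_le[of "exp (u - ln (real m))"] by (simp add: primes_le_exp)
      have "A m - B m = (\<Sum>p | prime p \<and> ln (real p) \<le> u - ln (real m) \<and> p dvd m. ln (real p) / real p)"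
        unfolding A_def B_def by (subst sum_diff[symmetric]) (auto intro!: sum.cong f finite_subset[OF _ f])
      moreover have "\<dots> \<le> (\<Sum>p\<in>prime_factors m. ln (real p) / real p)"
        using that by (intro sum_mono2) (auto simp: prime_factors_dvd prime_gt_0_nat Suc_le_eq)
      moreover have "\<dots> \<ge> 0" by (intro sum_nonneg divide_nonneg_nonneg ln_ge_zero) (auto dest!: prime_factors_gt_0_nat)
      moreover have "(\<Sum>p | prime p \<and> ln (real p) \<le> u - ln (real m) \<and> p dvd m. ln (real p) / real p) \<ge> 0"
        by (intro sum_nonneg) (auto simp: prime_gt_0_nat Suc_le_eq)
      ultimately show ?thesis by linarith
    qed
    have Abd: "\<bar>A m - (u - ln (real m))\<bar> \<le> C" if "m \<in> nats_le_exp u" for m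
      using C(2)[of "exp (u - ln (real m))"] that unfolding A_def primes_le_exp by (simp add: nats_le_exp_def)
    have "of_real u * log_mean v u - log_mean_int v u = (\<Sum>m\<in>nats_le_exp u. sqfree_power v m * of_real (1 / real m * ln (real m)))"
      unfolding log_mean_def log_mean_int_def sum_distrib_left sum_subtractf[symmetric]
      by (intro sum.cong refl) (simp add: right_diff_distrib mult.commute)
    also have "\<dots> = v * (\<Sum>m\<in>nats_le_exp u. sqfree_power v m / of_nat m * of_real (B m))"
      unfolding B_def by (subst sum_sqfree_power_ln) auto
    finally have 1: "of_real u * log_mean v u - (1 + v) * log_mean_int v u
       = v * (\<Sum>m\<in>nats_le_exp u. sqfree_power v m / of_nat m * of_real (B m - (u - ln (real m))))"
      by (simp add: log_mean_int_def algebra_simps sum_subtractf sum.distrib)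
    have "norm (of_real u * log_mean v u - (1 + v) * log_mean_int v u)
       \<le> t * (\<Sum>m\<in>nats_le_exp u. sqfree_power t m / real m * \<bar>B m - (u - ln (real m))\<bar>)"
      unfolding 1 norm_mult t_def[symmetric]
      by (intro mult_left_mono order.trans[OF norm_sum] sum_mono)
         (auto simp: norm_mult norm_divide norm_sqfree_power t_def simp del: of_real_diff)
    also have "\<dots> \<le> t * (\<Sum>m\<in>nats_le_exp u. sqfree_power t m / real m * (C + (\<Sum>p\<in>prime_factors m. ln (real p) / real p)))"
    proof (intro mult_left_mono sum_mono)
      fix m assume m: "m \<in> nats_le_exp u"
      show "\<bar>B m - (u - ln (real m))\<bar> \<le> C + (\<Sum>p\<in>prime_factors m. ln (real p) / real p)"
        using Abd[OF m] Bdiff[of m] m by (auto simp: nats_le_exp_def)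
    qed (use t in \<open>auto intro!: divide_nonneg_nonneg sqfree_power_nonneg\<close>)
    also have "\<dots> = t * C * log_mean t u + t * (\<Sum>m\<in>nats_le_exp u. sqfree_power t m * of_real (1 / real m * (\<Sum>p\<in>prime_factors m. ln (real p) / real p)))"
      by (simp add: log_mean_def algebra_simps sum.distrib sum_distrib_left)
    also have "\<dots> \<le> t * C * log_mean t u + t * (t * C0 * log_mean t u)"
    proof (intro add_left_mono mult_left_mono t)
    \<comment> \<open>A second exchange disposes of the primes dividing \<open>m\<close>: each of
      them now carries the weight \<open>ln p / p ^ 2\<close>, whose sum converges.\<close>
    have "(\<Sum>m\<in>nats_le_exp u. sqfree_power t m * of_real (1 / real m * (\<Sum>p\<in>prime_factors m. ln (real p) / real p)))
      = t * (\<Sum>m\<in>nats_le_exp u. sqfree_power t m * of_real (1 / real m *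
         (\<Sum>p | prime p \<and> ln (real p) \<le> u - ln (real m) \<and> \<not> p dvd m. 1 / real p * (ln (real p) / real p))))"
      by (rule sum_sqfree_power_additive) auto
    also have "\<dots> \<le> t * (\<Sum>m\<in>nats_le_exp u. sqfree_power t m * (1 / real m * C0))"
    proof (intro mult_left_mono sum_mono t sqfree_power_nonneg)
      fix m assume m: "m \<in> nats_le_exp u"
      let ?P = "{p. prime p \<and> ln (real p) \<le> u - ln (real m) \<and> \<not> p dvd m}"
      have f: "finite ?P"
        using finite_primes_le[of "exp (u - ln (real m))"] by (rule finite_subset[rotated]) (auto simp: primes_le_exp)
      show "of_real (1 / real m * (\<Sum>p\<in>?P. 1 / real p * (ln (real p) / real p))) \<le> 1 / real m * C0"
        using C0(2)[OF f] by (simp add: power2_eq_square divide_right_mono)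
    qed
    also have "\<dots> = t * C0 * log_mean t u" by (simp add: log_mean_def sum_distrib_left mult_ac)
    finally show "(\<Sum>m\<in>nats_le_exp u. sqfree_power t m * of_real (1 / real m * (\<Sum>p\<in>prime_factors m. ln (real p) / real p)))
       \<le> t * C0 * log_mean t u" .
    qed
    finally have "norm (of_real u * log_mean v u - (1 + v) * log_mean_int v u) \<le> (t * C + t * (t * C0)) * log_mean t u"
      by (simp add: algebra_simps)
    also have "\<dots> \<le> K * log_mean t u"
    proof (rule mult_right_mono)
      have "t * C \<le> \<bar>V\<bar> * C" "t * (t * C0) \<le> \<bar>V\<bar> * (\<bar>V\<bar> * C0)" using t C(1) C0(1)
        by (intro mult_mono mult_nonneg_nonneg; simp)+
      then show "t * C + t * (t * C0) \<le> K" by (simp add: K_def)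
      show "log_mean t u \<ge> 0" unfolding log_mean_def using t by (intro sum_nonneg divide_nonneg_nonneg sqfree_power_nonneg) auto
    qed
    finally show "norm (of_real u * log_mean v u - (1 + v) * log_mean_int v u) \<le> K * log_mean (norm v) u"
      by (simp add: t_def)
  qed
qed

lemma nats_le_exp_mono: "u \<le> w \<Longrightarrow> nats_le_exp u \<subseteq> nats_le_exp w"
  by (auto simp: nats_le_exp_def)

text \<open>With \<open>max\<close> the index set no longer depends on \<open>u\<close>, which
  exhibits \<open>log_mean_int\<close> on \<open>{..b}\<close> as a finite sum of continuous,
  piecewise linear functions.\<close>

lemma log_mean_int_eq_max:
  assumes "u \<le> b"
  shows "log_mean_int v u = (\<Sum>m\<in>nats_le_exp b. sqfree_power v m / of_nat m * of_real (max 0 (u - ln (real m))))"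
proof -
  have "log_mean_int v u = (\<Sum>m\<in>nats_le_exp u. sqfree_power v m / of_nat m * of_real (max 0 (u - ln (real m))))"
    unfolding log_mean_int_def by (intro sum.cong) (auto simp: nats_le_exp_def max_def)
  also have "\<dots> = (\<Sum>m\<in>nats_le_exp b. sqfree_power v m / of_nat m * of_real (max 0 (u - ln (real m))))"
    by (intro sum.mono_neutral_left nats_le_exp_mono assms finite_nats_le_exp) (auto simp: nats_le_exp_def)
  finally show ?thesis .
qed

lemma continuous_on_log_mean_int: "continuous_on {a..b} (log_mean_int v)"
proof -
  have "continuous_on {a..b} (\<lambda>u. \<Sum>m\<in>nats_le_exp b. sqfree_power v m / of_nat m * of_real (max 0 (u - ln (real m))))"
    by (intro continuous_intros)
  then show ?thesis
    by (rule continuous_on_eq) (simp add: log_mean_int_eq_max[of _ b])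
qed

lemma has_vector_derivative_log_mean_int:
  assumes "u < b" "u \<notin> (\<lambda>m. ln (real m)) ` nats_le_exp b"
  shows "(log_mean_int v has_vector_derivative log_mean v u) (at u)"
proof -
  have "((\<lambda>u. \<Sum>m\<in>nats_le_exp b. sqfree_power v m / of_nat m * of_real (max 0 (u - ln (real m)))) has_vector_derivative
      (\<Sum>m\<in>nats_le_exp b. sqfree_power v m / of_nat m * of_real (if ln (real m) \<le> u then 1 else 0))) (at u)"
  proof (intro has_vector_derivative_sum has_vector_derivative_mult_right
      bounded_linear.has_vector_derivative[OF bounded_linear_of_real])
    fix m assume "m \<in> nats_le_exp b"
    then have ne: "ln (real m) \<noteq> u" using assms by auto
    show "((\<lambda>u. max 0 (u - ln (real m))) has_vector_derivative (if ln (real m) \<le> u then 1 else 0)) (at u)"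
    proof (cases "ln (real m) \<le> u")
      case True
      have "((\<lambda>u. u - ln (real m)) has_vector_derivative 1) (at u)"
        by (auto intro!: derivative_eq_intros)
      then have "((\<lambda>u. max 0 (u - ln (real m))) has_vector_derivative 1) (at u)"
        by (rule has_vector_derivative_transform_within_open[of _ _ _ "{ln (real m)<..}"]) (use True ne in auto)
      with True show ?thesis by simp
    next
      case False
      have "((\<lambda>u. 0) has_vector_derivative 0) (at u)"
        by (auto intro!: derivative_eq_intros)
      then have "((\<lambda>u. max 0 (u - ln (real m))) has_vector_derivative 0) (at u)"
        by (rule has_vector_derivative_transform_within_open[of _ _ _ "{..<ln (real m)}"]) (use False in auto)
      with False show ?thesis by simp
    qed
  qed
  also have "(\<Sum>m\<in>nats_le_exp b. sqfree_power v m / of_nat m * of_real (if ln (real m) \<le> u then 1 else 0)) = log_mean v u"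
    unfolding log_mean_def
    by (intro sum.mono_neutral_cong_right nats_le_exp_mono finite_nats_le_exp) (use assms in \<open>auto simp: nats_le_exp_def\<close>)
  finally show ?thesis
    by (rule has_vector_derivative_transform_within_open[of _ _ _ "{..<b}"]) (use assms in \<open>auto simp: log_mean_int_eq_max[of _ b]\<close>)
qed

text \<open>Integration by parts against a step function: \<open>log_mean v\<close> jumps only at
  finitely many points \<open>ln m\<close>, and there the fundamental theorem asks no more than the
  continuity of \<open>log_mean_int v\<close>.\<close>

lemma has_integral_log_mean_int_mult:
  fixes v :: "'a :: {real_normed_field, banach}"
  assumes "a \<le> b" and g: "\<And>x. x \<in> {a..b} \<Longrightarrow> (g has_vector_derivative g' x) (at x)"
  shows "((\<lambda>x. log_mean_int v x * g' x + log_mean v x * g x) has_integral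
           (log_mean_int v b * g b - log_mean_int v a * g a)) {a..b}"
proof (rule fundamental_theorem_of_calculus_interior_strong[of "(\<lambda>m. ln (real m)) ` nats_le_exp b"])
  show "finite ((\<lambda>m. ln (real m)) ` nats_le_exp b)" by simp
  show "a \<le> b" by fact
  fix x assume x: "x \<in> {a<..<b} - (\<lambda>m. ln (real m)) ` nats_le_exp b"
  then show "((\<lambda>x. log_mean_int v x * g x) has_vector_derivative log_mean_int v x * g' x + log_mean v x * g x) (at x)"
    by (intro has_vector_derivative_mult has_vector_derivative_log_mean_int[of _ b] g) auto
next
  have "continuous_on {a..b} g"
    using g by (meson continuous_at_imp_continuous_on has_vector_derivative_continuous)
  then show "continuous_on {a..b} (\<lambda>x. log_mean_int v x * g x)"
    by (intro continuous_on_mult continuous_on_log_mean_int)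
qed

lemma log_mean_nonneg: "t \<ge> 0 \<Longrightarrow> log_mean t u \<ge> (0::real)"
  unfolding log_mean_def by (intro sum_nonneg divide_nonneg_nonneg sqfree_power_nonneg) auto

lemma log_mean_mono:
  assumes "0 \<le> s" "s \<le> t" "u \<le> w" shows "log_mean s u \<le> (log_mean t w :: real)"
proof -
  have "log_mean s u \<le> log_mean t u"
    unfolding log_mean_def using assms by (intro sum_mono divide_right_mono sqfree_power_mono) auto
  also have "\<dots> \<le> log_mean t w"
    unfolding log_mean_def using assms
    by (intro sum_mono2 nats_le_exp_mono divide_nonneg_nonneg sqfree_power_nonneg) auto
  finally show ?thesis .
qed

lemma log_mean_int_le: "t \<ge> 0 \<Longrightarrow> u \<ge> 0 \<Longrightarrow> log_mean_int t u \<le> u * (log_mean t u :: real)"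
  unfolding log_mean_def log_mean_int_def sum_distrib_left
  by (subst mult.commute, intro sum_mono mult_left_mono divide_nonneg_nonneg sqfree_power_nonneg)
     (auto simp: nats_le_exp_def Suc_le_eq)

lemma log_mean_int_nonneg: "t \<ge> 0 \<Longrightarrow> log_mean_int t u \<ge> (0::real)"
  unfolding log_mean_int_def
  by (intro sum_nonneg mult_nonneg_nonneg divide_nonneg_nonneg sqfree_power_nonneg) (auto simp: nats_le_exp_def)

text \<open>A Gronwall argument for \<open>log_mean_int\<close>, whose derivative is \<open>log_mean\<close>.\<close>

lemma log_mean_le:
  obtains C where "C > 0" "\<And>t u. 0 \<le> t \<Longrightarrow> t \<le> V \<Longrightarrow> 1 \<le> u \<Longrightarrow> log_mean t u \<le> C * u powr t"
proof -
  obtain K where K: "K > 0" "\<And>(t::real) u. u \<ge> 0 \<Longrightarrow> norm t \<le> V \<Longrightarrow>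
    norm (of_real u * log_mean t u - (1 + t) * log_mean_int t u) \<le> K * log_mean (norm t) u"
    using log_mean_recursion[where ?'a = real and V = V] by blast
  define W where "W = \<bar>V\<bar>"
  define Z where "Z = (K + 1) * log_mean W (K + 1)"
  define C where "C = (1 + W) * Z + log_mean W (K + 1) + 1"
  have Z: "Z \<ge> 0" unfolding Z_def using K(1) by (intro mult_nonneg_nonneg log_mean_nonneg) (auto simp: W_def)
  have C: "C > 0" unfolding C_def using Z by (intro add_nonneg_pos add_nonneg_nonneg mult_nonneg_nonneg log_mean_nonneg) (auto simp: W_def)
  have "log_mean t u \<le> C * u powr t" if t: "0 \<le> t" "t \<le> V" and u: "1 \<le> u" for t u
  proof (cases "u \<le> K + 1")
    case True
    have "log_mean t u \<le> log_mean W (K + 1)" using t True by (intro log_mean_mono) (auto simp: W_def)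
    also have "\<dots> \<le> C * 1" using Z by (simp add: C_def W_def)
    also have "\<dots> \<le> C * u powr t" using u t C by (intro mult_left_mono) (auto intro: ge_one_powr_ge_zero)
    finally show ?thesis .
  next
    case False
    \<comment> \<open>For a real base the error of the recursion is itself a multiple of
      \<open>log_mean t x\<close>, so it is absorbed by moving the origin to
      \<open>K\<close>.\<close>
    have rec: "(x - K) * log_mean t x \<le> (1 + t) * log_mean_int t x" if "x \<ge> 0" for x
      using K(2)[of x t] t that by (simp add: algebra_simps abs_le_iff)
    \<comment> \<open>The integrating factor: by \<open>rec\<close>, the product of
      \<open>log_mean_int t x\<close> and \<open>?g x\<close> is non-increasing for
      \<open>x > K\<close>. The comparison starts at \<open>K + 1\<close>, where \<open>?g\<close>
      is 1.\<close>
    let ?g = "\<lambda>x. (x - K) powr (-1 - t)" let ?g' = "\<lambda>x. (-1 - t) * (x - K) powr (-2 - t)"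
    have I: "((\<lambda>x. log_mean_int t x * ?g' x + log_mean t x * ?g x) has_integral
           (log_mean_int t u * ?g u - log_mean_int t (K + 1) * ?g (K + 1))) {K + 1..u}"
    proof (rule has_integral_log_mean_int_mult)
      fix x assume x: "x \<in> {K + 1..u}"
      have "(?g has_real_derivative ?g' x) (at x)"
        using x by (auto intro!: derivative_eq_intros)
      then show "(?g has_vector_derivative ?g' x) (at x)"
        by (simp add: has_real_derivative_iff_has_vector_derivative)
    qed (use False in auto)
    have "log_mean_int t u * ?g u - log_mean_int t (K + 1) * ?g (K + 1) \<le> 0"
    proof (rule has_integral_le[OF I])
      show "((\<lambda>x. 0) has_integral 0) {K + 1..u}" by simp
      fix x assume x: "x \<in> {K + 1..u}"
      have "?g x = (x - K) * (x - K) powr (-2 - t)"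
        using x powr_mult_base[of "x - K" "-2 - t"] by simp
      then have "log_mean_int t x * ?g' x + log_mean t x * ?g x =
        log_mean_int t x * ?g' x + log_mean t x * ((x - K) * (x - K) powr (-2 - t))" by simp
      also have "\<dots> = ((x - K) * log_mean t x - (1 + t) * log_mean_int t x) * (x - K) powr (-2 - t)"
        by (simp add: algebra_simps)
      also have "\<dots> \<le> 0" using rec[of x] x K(1) by (intro mult_nonpos_nonneg) auto
      finally show "log_mean_int t x * ?g' x + log_mean t x * ?g x \<le> 0" .
    qed
    then have "log_mean_int t u * ?g u \<le> log_mean_int t (K + 1)" by simp
    also have "\<dots> \<le> (K + 1) * log_mean t (K + 1)" using t K by (intro log_mean_int_le) auto
    also have "\<dots> \<le> Z" unfolding Z_def using t K by (intro mult_left_mono log_mean_mono) (auto simp: W_def)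
    finally have 1: "log_mean_int t u * ?g u \<le> Z" .
    have g: "?g u * (u - K) powr (1 + t) = 1" using False by (subst powr_add[symmetric]) auto
    have "log_mean_int t u = log_mean_int t u * ?g u * (u - K) powr (1 + t)"
      using g by (simp add: mult.assoc)
    also have "\<dots> \<le> Z * (u - K) powr (1 + t)" using 1 by (intro mult_right_mono) auto
    finally have "(1 + t) * log_mean_int t u \<le> (1 + W) * (Z * (u - K) powr (1 + t))"
      using t Z by (intro mult_mono) (auto simp: W_def log_mean_int_nonneg)
    with rec[of u] u have "(u - K) * log_mean t u \<le> (1 + W) * (Z * (u - K) powr (1 + t))" by linarith
    also have "(u - K) powr (1 + t) = (u - K) * (u - K) powr t"
      using False powr_mult_base[of "u - K" t] by simp
    finally have "(u - K) * log_mean t u \<le> (u - K) * ((1 + W) * Z * (u - K) powr t)" by (simp add: mult_ac)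
    then have "log_mean t u \<le> (1 + W) * Z * (u - K) powr t" using False by simp
    also have "\<dots> \<le> (1 + W) * Z * u powr t"
      using False Z t K by (intro mult_left_mono powr_mono2 mult_nonneg_nonneg) (auto simp: W_def)
    also have "\<dots> \<le> C * u powr t"
      by (intro mult_right_mono) (auto simp: C_def W_def log_mean_nonneg intro!: add_nonneg_nonneg)
    finally show ?thesis .
  qed
  with C show ?thesis using that by blast
qed

text \<open>This gains a factor \<open>1 / u\<close> over the trivial bound
  \<open>exp u * log_mean t u\<close>. In \<open>u = (u - ln m) + ln m\<close> the first part is at
  most \<open>exp u / m\<close> by \<open>y \<le> exp y\<close>. The second is handled by the
  exchange of \<open>m\<close> with its primes, now without the weight \<open>1 / m\<close>, and
  Chebyshev's bound.\<close>

lemma sum_sqfree_power_le: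
  obtains C where "C > 0" "\<And>t u. 0 \<le> t \<Longrightarrow> t \<le> V \<Longrightarrow> 1 \<le> u \<Longrightarrow>
    (\<Sum>m\<in>nats_le_exp u. sqfree_power t m) \<le> C * exp u * u powr (t - 1)"
proof -
  obtain C where C: "C > 0" "\<And>t u. 0 \<le> t \<Longrightarrow> t \<le> V \<Longrightarrow> 1 \<le> u \<Longrightarrow> log_mean t u \<le> C * u powr t"
    using log_mean_le[where V = V] by blast
  have "(\<Sum>m\<in>nats_le_exp u. sqfree_power t m) \<le> ((6 * \<bar>V\<bar> + 1) * C) * exp u * u powr (t - 1)"
    if t: "0 \<le> t" "t \<le> V" and u: "1 \<le> u" for t u
  proof -
    let ?h = "sqfree_power t"
    have 1: "(\<Sum>m\<in>nats_le_exp u. ?h m * (u - ln (real m))) \<le> exp u * log_mean t u"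
      unfolding log_mean_def sum_distrib_left
    proof (rule sum_mono)
      fix m assume m: "m \<in> nats_le_exp u"
      then have pos: "m > 0" by (simp add: nats_le_exp_def)
      have "u - ln (real m) \<le> exp (u - ln (real m))" using exp_ge_add_one_self[of "u - ln (real m)"] by linarith
      also have "\<dots> = exp u / real m" using pos by (simp add: exp_diff)
      finally show "?h m * (u - ln (real m)) \<le> exp u * (?h m / real m)"
        using t by (simp add: mult_left_mono sqfree_power_nonneg)
          (metis (no_types, opaque_lifting) mult.commute mult_left_mono sqfree_power_nonneg times_divide_eq_right)
    qed
    have "(\<Sum>m\<in>nats_le_exp u. ?h m * ln (real m)) = t * (\<Sum>m\<in>nats_le_exp u. ?h m *
         (\<Sum>p | prime p \<and> ln (real p) \<le> u - ln (real m) \<and> \<not> p dvd m. ln (real p)))"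
      using sum_sqfree_power_ln[of "\<lambda>_. 1" t u] by simp
    also have "\<dots> \<le> t * (\<Sum>m\<in>nats_le_exp u. ?h m * (6 * (exp u / real m)))"
    proof (intro mult_left_mono sum_mono t sqfree_power_nonneg)
      fix m assume m: "m \<in> nats_le_exp u"
      have "(\<Sum>p | prime p \<and> ln (real p) \<le> u - ln (real m) \<and> \<not> p dvd m. ln (real p)) \<le> (\<Sum>p\<in>primes_le (exp (u - ln (real m))). ln (real p))"
        using finite_primes_le[of "exp (u - ln (real m))"] unfolding primes_le_exp
        by (intro sum_mono2) (auto simp: prime_gt_0_nat Suc_le_eq)
      also have "\<dots> \<le> 6 * exp (u - ln (real m))" by (intro sum_ln_primes_le) auto
      finally show "(\<Sum>p | prime p \<and> ln (real p) \<le> u - ln (real m) \<and> \<not> p dvd m. ln (real p)) \<le> 6 * (exp u / real m)"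
        using m by (simp add: exp_diff nats_le_exp_def)
    qed
    also have "\<dots> = 6 * t * (exp u * log_mean t u)" by (simp add: log_mean_def sum_distrib_left mult_ac)
    also have "\<dots> \<le> 6 * \<bar>V\<bar> * (exp u * log_mean t u)"
      using t by (intro mult_right_mono mult_nonneg_nonneg log_mean_nonneg) auto
    finally have 2: "(\<Sum>m\<in>nats_le_exp u. ?h m * ln (real m)) \<le> 6 * \<bar>V\<bar> * (exp u * log_mean t u)" .
    have "u * (\<Sum>m\<in>nats_le_exp u. ?h m) = (\<Sum>m\<in>nats_le_exp u. ?h m * (u - ln (real m))) + (\<Sum>m\<in>nats_le_exp u. ?h m * ln (real m))"
      by (simp add: sum_distrib_left sum.distrib[symmetric] algebra_simps)
    also have "\<dots> \<le> (6 * \<bar>V\<bar> + 1) * (exp u * log_mean t u)" using 1 2 by (simp add: algebra_simps)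
    also have "\<dots> \<le> (6 * \<bar>V\<bar> + 1) * (exp u * (C * u powr t))"
      using C t u by (intro mult_left_mono) auto
    also have "u powr t = u * u powr (t - 1)" using u powr_mult_base[of u "t - 1"] by simp
    finally have "u * (\<Sum>m\<in>nats_le_exp u. ?h m) \<le> u * ((6 * \<bar>V\<bar> + 1) * C * exp u * u powr (t - 1))"
      by (simp add: mult_ac)
    then show ?thesis using u by simp
  qed
  moreover have "(6 * \<bar>V\<bar> + 1) * C > 0" using C by (intro mult_pos_pos) auto
  ultimately show ?thesis using that by blast
qed

section \<open>Growth of the logarithmic means for a complex base\<close>

lemma norm_of_real_powr: "x \<ge> 0 \<Longrightarrow> norm (of_real x powr z :: complex) = x powr Re z"
  by (subst norm_powr_real_powr) auto

lemma log_mean_recursion_powr: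
  obtains C where "C > 0" "\<And>v u. norm (v::complex) \<le> V \<Longrightarrow> 1 \<le> u \<Longrightarrow>
    norm (of_real u * log_mean v u - (1 + v) * log_mean_int v u) \<le> C * u powr norm v"
proof -
  obtain K where K: "K > 0" "\<And>(v::complex) u. u \<ge> 0 \<Longrightarrow> norm v \<le> V \<Longrightarrow>
    norm (of_real u * log_mean v u - (1 + v) * log_mean_int v u) \<le> K * log_mean (norm v) u"
    using log_mean_recursion[where ?'a = complex and V = V] by blast
  obtain C where C: "C > 0" "\<And>t u. 0 \<le> t \<Longrightarrow> t \<le> V \<Longrightarrow> 1 \<le> u \<Longrightarrow> log_mean t u \<le> C * u powr t"
    using log_mean_le[where V = V] by blast
  show ?thesis
  proof (rule that[of "K * C"])
    show "K * C > 0" using K C by simp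
    fix v :: complex and u :: real assume v: "norm v \<le> V" and u: "1 \<le> u"
    have "norm (of_real u * log_mean v u - (1 + v) * log_mean_int v u) \<le> K * log_mean (norm v) u"
      using K(2) v u by simp
    also have "\<dots> \<le> K * (C * u powr norm v)" using K(1) C(2) v u by (intro mult_left_mono) auto
    finally show "norm (of_real u * log_mean v u - (1 + v) * log_mean_int v u) \<le> K * C * u powr norm v" by simp
  qed
qed

lemma has_integral_powr_minus_1:
  fixes a b e :: real
  assumes "0 < a" "a \<le> b" "e \<noteq> 0"
  shows "((\<lambda>x. x powr (e - 1)) has_integral (b powr e / e - a powr e / e)) {a..b}"
proof (rule fundamental_theorem_of_calculus)
  fix x assume "x \<in> {a..b}"
  then have "((\<lambda>x. x powr e / e) has_real_derivative x powr (e - 1)) (at x within {a..b})"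
    using assms by (auto intro!: derivative_eq_intros)
  then show "((\<lambda>x. x powr e / e) has_vector_derivative x powr (e - 1)) (at x within {a..b})"
    by (simp add: has_real_derivative_iff_has_vector_derivative)
qed fact

text \<open>By the recursion the derivative of \<open>log_mean_int v u * u powr (-1 - v)\<close> has
  size \<open>u powr (norm v - 2 - Re v)\<close>, which is integrated. The exponent \<open>e\<close>
  is only an upper bound, so that the exponent 0 with its logarithm can be avoided and both signs of
  \<open>e\<close> are available.\<close>

lemma log_mean_int_quotient_diff:
  obtains C where "C > 0" "\<And>v a b e. norm (v::complex) \<le> V \<Longrightarrow> 1 \<le> a \<Longrightarrow> a \<le> b \<Longrightarrow> norm v - 1 - Re v \<le> e \<Longrightarrow> e \<noteq> 0 \<Longrightarrow>
    norm (log_mean_int v b * of_real b powr (-1 - v) - log_mean_int v a * of_real a powr (-1 - v)) \<le> C * (b powr e / e - a powr e / e)"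
proof -
  obtain C where C: "C > 0" "\<And>v u. norm (v::complex) \<le> V \<Longrightarrow> 1 \<le> u \<Longrightarrow>
    norm (of_real u * log_mean v u - (1 + v) * log_mean_int v u) \<le> C * u powr norm v"
    using log_mean_recursion_powr[where V = V] by blast
  show ?thesis
  proof (rule that[OF C(1)])
    fix v :: complex and a b e :: real
    assume v: "norm v \<le> V" and a: "1 \<le> a" and b: "a \<le> b" and e: "norm v - 1 - Re v \<le> e" "e \<noteq> 0"
    let ?g = "\<lambda>x. of_real x powr (-1 - v)" let ?g' = "\<lambda>x. (-1 - v) * of_real x powr (-2 - v)"
    let ?f = "\<lambda>x. log_mean_int v x * ?g' x + log_mean v x * ?g x"
    have I: "(?f has_integral (log_mean_int v b * ?g b - log_mean_int v a * ?g a)) {a..b}"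
    proof (rule has_integral_log_mean_int_mult)
      fix x assume x: "x \<in> {a..b}"
      have "((\<lambda>z. z powr (-1 - v)) has_field_derivative (-1 - v) * of_real x powr (-1 - v - 1)) (at (of_real x))"
        by (rule has_field_derivative_powr) (use x a in auto)
      then show "(?g has_vector_derivative ?g' x) (at x)"
        by (intro has_vector_derivative_real_field) simp
    qed fact
    have I2: "((\<lambda>x. C * x powr (e - 1)) has_integral C * (b powr e / e - a powr e / e)) {a..b}"
      using a b e by (intro has_integral_mult_right has_integral_powr_minus_1) auto
    have bd: "norm (?f x) \<le> C * x powr (e - 1)" if x: "x \<in> {a..b}" for x
    proof -
      have x1: "x \<ge> 1" using x a by auto
      have "?g x = of_real x * of_real x powr (-2 - v)"
        using x1 powr_add[of "of_real x :: complex" 1 "-2 - v"] by simp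
      then have "?f x = log_mean_int v x * ?g' x + log_mean v x * (of_real x * of_real x powr (-2 - v))" by simp
      also have "\<dots> = (of_real x * log_mean v x - (1 + v) * log_mean_int v x) * of_real x powr (-2 - v)"
        by (simp add: algebra_simps)
      finally have "norm (?f x) = norm (of_real x * log_mean v x - (1 + v) * log_mean_int v x) * x powr (-2 - Re v)"
        using x1 by (simp add: norm_mult norm_of_real_powr)
      also have "\<dots> \<le> C * x powr norm v * x powr (-2 - Re v)"
        using C(2)[OF v x1] by (intro mult_right_mono) auto
      also have "\<dots> = C * x powr (norm v - 1 - Re v - 1)"
        by (simp add: mult.assoc powr_add[symmetric] algebra_simps)
      also have "\<dots> \<le> C * x powr (e - 1)" using C(1) x1 e by (intro mult_left_mono powr_mono) auto
      finally show ?thesis .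
    qed
    have "norm (integral {a..b} ?f) \<le> integral {a..b} (\<lambda>x. C * x powr (e - 1))"
      using I I2 bd by (intro integral_norm_bound_integral) auto
    then show "norm (log_mean_int v b * ?g b - log_mean_int v a * ?g a) \<le> C * (b powr e / e - a powr e / e)"
      unfolding integral_unique[OF I] integral_unique[OF I2] .
  qed
qed

text \<open>Near the positive axis the exponent \<open>e\<close> is at most \<open>- \<eta>\<close>,
  so the quotient from \<open>log_mean_int_quotient_diff\<close> converges. Its limit is
  \<open>q\<close>, and the tail of the integral gives the rate. Only \<open>C\<close> is uniform in
  \<open>v\<close>; the value of \<open>q\<close> comes later from the Laplace transform.\<close>

lemma log_mean_int_asymp:
  assumes \<eta>: "\<eta> > 0"
  obtains C where "C > 0" "\<And>v. norm (v::complex) \<le> V \<Longrightarrow> norm v - Re v \<le> 1 - \<eta> \<Longrightarrow>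
    \<exists>q. \<forall>u\<ge>1. norm (log_mean_int v u - q * of_real u powr (1 + v)) \<le> C * u powr norm v"
proof -
  obtain C where C: "C > 0" "\<And>v a b e. norm (v::complex) \<le> V \<Longrightarrow> 1 \<le> a \<Longrightarrow> a \<le> b \<Longrightarrow> norm v - 1 - Re v \<le> e \<Longrightarrow> e \<noteq> 0 \<Longrightarrow>
    norm (log_mean_int v b * of_real b powr (-1 - v) - log_mean_int v a * of_real a powr (-1 - v)) \<le> C * (b powr e / e - a powr e / e)"
    using log_mean_int_quotient_diff[where V = V] by blast
  have "\<exists>q. \<forall>u\<ge>1. norm (log_mean_int v u - q * of_real u powr (1 + v)) \<le> C / \<eta> * u powr norm v"
    if v: "norm v \<le> V" and cr: "norm v - Re v \<le> 1 - \<eta>" for v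
  proof -
    define e where "e = norm v - 1 - Re v"
    define Q where "Q = (\<lambda>u. log_mean_int v u * of_real u powr (-1 - v))"
    have e: "e \<le> -\<eta>" using cr by (simp add: e_def)
    have Qd: "norm (Q b - Q a) \<le> C / \<eta> * a powr e" if "1 \<le> a" "a \<le> b" for a b
    proof -
      have "norm (Q b - Q a) \<le> C * (b powr e / e - a powr e / e)"
        unfolding Q_def using that v e \<eta> by (intro C(2)) (auto simp: e_def)
      also have "b powr e / e - a powr e / e \<le> a powr e / \<eta>"
      proof -
        have "b powr e / e \<le> 0" using e \<eta> by (simp add: divide_le_0_iff)
        moreover have "- (a powr e / e) = a powr e / (- e)" by simp
        moreover have "a powr e / (- e) \<le> a powr e / \<eta>" using e \<eta> by (intro divide_left_mono mult_pos_pos) auto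
        ultimately show ?thesis by linarith
      qed
      finally show ?thesis using C(1) by (simp add: mult_left_mono)
    qed
    have lim0: "(\<lambda>n. C / \<eta> * real n powr e) \<longlonglongrightarrow> C / \<eta> * 0"
      using e \<eta> by (intro tendsto_mult tendsto_const tendsto_neg_powr filterlim_real_sequentially) auto
    have "Cauchy (\<lambda>n. Q (real n))"
    proof (rule CauchyI')
      fix \<epsilon> :: real assume "\<epsilon> > 0"
      then have "eventually (\<lambda>n. C / \<eta> * real n powr e < \<epsilon>) sequentially"
        using lim0 by (auto dest: order_tendstoD(2))
      then obtain M where M: "\<And>n. n \<ge> M \<Longrightarrow> C / \<eta> * real n powr e < \<epsilon>" by (auto simp: eventually_sequentially)
      show "\<exists>M. \<forall>m\<ge>M. \<forall>n>m. dist (Q (real m)) (Q (real n)) < \<epsilon>"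
      proof (intro exI[of _ "max M 1"] allI impI)
        fix m n assume mn: "max M 1 \<le> m" "m < n"
        have "norm (Q (real m) - Q (real n)) \<le> C / \<eta> * real m powr e"
          using mn Qd[of "real m" "real n"] by (simp add: norm_minus_commute)
        also have "\<dots> < \<epsilon>" using M mn by auto
        finally show "dist (Q (real m)) (Q (real n)) < \<epsilon>" by (simp add: dist_norm)
      qed
    qed
    then obtain q where q: "(\<lambda>n. Q (real n)) \<longlonglongrightarrow> q" using Cauchy_convergent_iff convergent_def by blast
    show ?thesis
    proof (intro exI[of _ q] allI impI)
      fix u :: real assume u: "u \<ge> 1"
      have "(\<lambda>n. norm (Q (real n) - Q u)) \<longlonglongrightarrow> norm (q - Q u)" by (intro tendsto_intros q)
      then have nq: "norm (q - Q u) \<le> C / \<eta> * u powr e"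
      proof (rule tendsto_upperbound)
        show "\<forall>\<^sub>F n in sequentially. norm (Q (real n) - Q u) \<le> C / \<eta> * u powr e"
          using eventually_ge_at_top[of "nat \<lceil>u\<rceil>"]
          by eventually_elim (use u in \<open>intro Qd, auto simp: nat_le_iff ceiling_le_iff\<close>)
      qed auto
      have one: "of_real u powr (-1 - v) * of_real u powr (1 + v) = (1::complex)"
        using u by (subst powr_add[symmetric]) auto
      have "log_mean_int v u - q * of_real u powr (1 + v) = - (q - Q u) * of_real u powr (1 + v)"
        using one by (simp add: Q_def algebra_simps)
      then have "norm (log_mean_int v u - q * of_real u powr (1 + v)) = norm (q - Q u) * u powr (1 + Re v)"
        using u by (simp add: norm_mult norm_of_real_powr norm_minus_commute)
      also have "\<dots> \<le> C / \<eta> * u powr e * u powr (1 + Re v)" using nq by (intro mult_right_mono) auto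
      also have "\<dots> = C / \<eta> * u powr norm v" by (simp add: mult.assoc powr_add[symmetric] e_def)
      finally show "norm (log_mean_int v u - q * of_real u powr (1 + v)) \<le> C / \<eta> * u powr norm v" .
    qed
  qed
  moreover have "C / \<eta> > 0" using C \<eta> by simp
  ultimately show ?thesis using that by blast
qed

text \<open>Away from the positive axis the quotient is only bounded by \<open>u powr e\<close>.
  Adding \<open>2 * \<eta>\<close> to the exponent ensures \<open>e \<ge> \<eta>\<close>, hence a
  uniform constant, even when \<open>norm v - 1 - Re v\<close> is as small as
  \<open>- \<eta>\<close>.\<close>

lemma log_mean_le_off_axis:
  assumes \<eta>: "\<eta> > 0"
  obtains C where "C > 0" "\<And>v u. norm (v::complex) \<le> V \<Longrightarrow> norm v - Re v \<ge> 1 - \<eta> \<Longrightarrow> u \<ge> 1 \<Longrightarrow>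
    norm (log_mean v u) \<le> C * u powr (norm v - 1 + 2 * \<eta>)"
proof -
  obtain C where C: "C > 0" "\<And>v a b e. norm (v::complex) \<le> V \<Longrightarrow> 1 \<le> a \<Longrightarrow> a \<le> b \<Longrightarrow> norm v - 1 - Re v \<le> e \<Longrightarrow> e \<noteq> 0 \<Longrightarrow>
    norm (log_mean_int v b * of_real b powr (-1 - v) - log_mean_int v a * of_real a powr (-1 - v)) \<le> C * (b powr e / e - a powr e / e)"
    using log_mean_int_quotient_diff[where V = V] by blast
  obtain K where K: "K > 0" "\<And>v u. norm (v::complex) \<le> V \<Longrightarrow> 1 \<le> u \<Longrightarrow>
    norm (of_real u * log_mean v u - (1 + v) * log_mean_int v u) \<le> K * u powr norm v"
    using log_mean_recursion_powr[where V = V] by blast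
  define B where "B = log_mean \<bar>V\<bar> (1::real)"
  have B: "B \<ge> 0" unfolding B_def by (intro log_mean_nonneg) auto
  define D where "D = K + (1 + \<bar>V\<bar>) * (C / \<eta> + B)"
  have "norm (log_mean v u) \<le> D * u powr (norm v - 1 + 2 * \<eta>)"
    if v: "norm v \<le> V" and cr: "norm v - Re v \<ge> 1 - \<eta>" and u: "u \<ge> 1" for v :: complex and u
  proof -
    define e where "e = norm v - 1 - Re v + 2 * \<eta>"
    have e: "e \<ge> \<eta>" using cr by (simp add: e_def)
    have "norm (log_mean_int v u * of_real u powr (-1 - v) - log_mean_int v 1 * of_real 1 powr (-1 - v)) \<le> C * (u powr e / e - 1 powr e / e)"
      using v u e \<eta> by (intro C(2)) (auto simp: e_def)
    also have "\<dots> \<le> C * (u powr e / \<eta>)"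
    proof (rule mult_left_mono)
      have "u powr e / e \<le> u powr e / \<eta>" using e \<eta> by (intro divide_left_mono) auto
      moreover have "1 powr e / e \<ge> 0" using e \<eta> by auto
      ultimately show "u powr e / e - 1 powr e / e \<le> u powr e / \<eta>" by linarith
    qed (use C in auto)
    finally have 1: "norm (log_mean_int v u * of_real u powr (-1 - v) - log_mean_int v 1) \<le> C / \<eta> * u powr e" by simp
    have "norm (log_mean_int v 1) \<le> log_mean_int (norm v) 1"
      unfolding log_mean_int_def
      by (rule order.trans[OF norm_sum], intro sum_mono)
         (auto simp: norm_mult norm_divide norm_sqfree_power nats_le_exp_def simp del: of_real_diff)
    also have "\<dots> \<le> log_mean (norm v) 1" using log_mean_int_le[of "norm v" 1] by simp
    also have "\<dots> \<le> B" unfolding B_def using v by (intro log_mean_mono) auto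
    also have "\<dots> \<le> B * u powr e" using B u e \<eta> mult_left_mono[OF ge_one_powr_ge_zero[of u e] B] by simp
    finally have "norm (log_mean_int v u * of_real u powr (-1 - v)) \<le> (C / \<eta> + B) * u powr e"
      using 1 norm_triangle_sub[of "log_mean_int v u * of_real u powr (-1 - v)" "log_mean_int v 1"] by (simp add: algebra_simps)
    then have "norm (log_mean_int v u) * u powr (-1 - Re v) \<le> (C / \<eta> + B) * u powr e"
      using u by (simp add: norm_mult norm_of_real_powr)
    then have "norm (log_mean_int v u) * u powr (-1 - Re v) * u powr (1 + Re v) \<le> (C / \<eta> + B) * u powr e * u powr (1 + Re v)"
      by (rule mult_right_mono) auto
    then have T: "norm (log_mean_int v u) \<le> (C / \<eta> + B) * u powr (norm v + 2 * \<eta>)"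
      using u by (simp add: mult.assoc powr_add[symmetric] e_def add_ac)
    have "u * norm (log_mean v u) = norm (of_real u * log_mean v u)" using u by (simp add: norm_mult)
    also have "\<dots> \<le> norm (of_real u * log_mean v u - (1 + v) * log_mean_int v u) + norm ((1 + v) * log_mean_int v u)"
      using norm_triangle_sub[of "of_real u * log_mean v u" "(1 + v) * log_mean_int v u"] by (simp add: add.commute)
    also have "\<dots> \<le> K * u powr norm v + (1 + \<bar>V\<bar>) * ((C / \<eta> + B) * u powr (norm v + 2 * \<eta>))"
    proof (rule add_mono)
      show "norm (of_real u * log_mean v u - (1 + v) * log_mean_int v u) \<le> K * u powr norm v" by (intro K v u)
      have "norm (1 + v) \<le> 1 + \<bar>V\<bar>" using v norm_triangle_ineq[of 1 v] by simp
      then show "norm ((1 + v) * log_mean_int v u) \<le> (1 + \<bar>V\<bar>) * ((C / \<eta> + B) * u powr (norm v + 2 * \<eta>))"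
        unfolding norm_mult using T by (intro mult_mono) auto
    qed
    also have "\<dots> \<le> K * u powr (norm v + 2 * \<eta>) + (1 + \<bar>V\<bar>) * ((C / \<eta> + B) * u powr (norm v + 2 * \<eta>))"
      using K u \<eta> by (intro add_right_mono mult_left_mono powr_mono) auto
    also have "\<dots> = D * u powr (norm v + 2 * \<eta>)" by (simp add: D_def algebra_simps add_divide_distrib)
    also have "u powr (norm v + 2 * \<eta>) = u * u powr (norm v - 1 + 2 * \<eta>)"
      using u powr_mult_base[of u "norm v - 1 + 2 * \<eta>"] by simp
    finally have "u * norm (log_mean v u) \<le> u * (D * u powr (norm v - 1 + 2 * \<eta>))" by (simp add: mult_ac)
    then show ?thesis using u by simp
  qed
  moreover have "D > 0" unfolding D_def using K(1) C(1) B \<eta> by (intro add_pos_nonneg mult_nonneg_nonneg add_nonneg_nonneg) auto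
  ultimately show ?thesis using that by blast
qed

subsection \<open>Products over primes\<close>

text \<open>\<open>weierstrass_factor 1 (-y)\<close> is \<open>(1 + y) * exp (-y)\<close>. The
  exponential removes the linear term, so that the product over primes converges up to
  \<open>s = 0\<close>. The argument is a pair because convergence has to be uniform in
  \<open>v\<close> and \<open>s\<close> jointly.\<close>

definition prime_factor_at :: "nat \<Rightarrow> complex \<times> real \<Rightarrow> complex" where
  "prime_factor_at p = (\<lambda>(v, s). if prime p then weierstrass_factor 1 (- v * of_real (real p powr (-1 - s))) else 1)"

definition prime_product :: "complex \<Rightarrow> real \<Rightarrow> complex" where
  "prime_product v s = lim (\<lambda>N. \<Prod>p<N. prime_factor_at p (v, s))"

lemma weierstrass_factor_1_minus: "weierstrass_factor 1 (-y) = (1 + y) * exp (-y)"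
  by (simp add: weierstrass_factor_def)

text \<open>The factor differs from 1 by at most \<open>3 * norm z ^ 2\<close> when
  \<open>norm z \<le> 1/2\<close>. As \<open>norm z \<le> R / p\<close> for all
  \<open>s \<ge> 0\<close>, there is a summable majorant independent of \<open>s\<close>.\<close>

lemma uniform_limit_prime_product:
  "uniform_limit (cball 0 R \<times> {0..1}) (\<lambda>N x. \<Prod>p<N. prime_factor_at p x) (\<lambda>(v, s). prime_product v s) sequentially"
proof -
  have "uniformly_convergent_on (cball 0 R \<times> {0..1}) (\<lambda>N x. \<Prod>p<N. prime_factor_at p x)"
  proof (rule uniformly_convergent_on_prod')
    show "compact (cball (0::complex) R \<times> {0..1::real})" by (intro compact_Times) auto
    show "continuous_on (cball 0 R \<times> {0..1}) (prime_factor_at p)" for p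
    proof (cases "prime p")
      case True
      then have "p > 0" by (simp add: prime_gt_0_nat)
      with True show ?thesis
        unfolding prime_factor_at_def case_prod_beta by (auto intro!: continuous_intros)
    qed (auto simp: prime_factor_at_def case_prod_beta)
    show "uniformly_convergent_on (cball 0 R \<times> {0..1}) (\<lambda>N x. \<Sum>n<N. norm (prime_factor_at n x - 1))"
    proof (rule Weierstrass_m_test'_ev)
      show "summable (\<lambda>n. 3 * R\<^sup>2 * (1 / real n ^ 2))"
        using inverse_power_summable[of 2, where ?'a = real] by (simp add: divide_inverse summable_mult)
      show "\<forall>\<^sub>F n in sequentially. \<forall>x\<in>cball 0 R \<times> {0..1}. norm (norm (prime_factor_at n x - 1)) \<le> 3 * R\<^sup>2 * (1 / real n ^ 2)"
        using eventually_ge_at_top[of "max 1 (nat \<lceil>2 * R\<rceil>)"]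
      proof eventually_elim
        case (elim n)
        have n: "n > 0" "real n \<ge> 2 * R" using elim by auto
        show ?case
        proof
          fix x :: "complex \<times> real" assume "x \<in> cball 0 R \<times> {0..1}"
          then obtain v s where x: "x = (v, s)" "norm v \<le> R" "0 \<le> s" "s \<le> 1" by (cases x) auto
          show "norm (norm (prime_factor_at n x - 1)) \<le> 3 * R\<^sup>2 * (1 / real n ^ 2)"
          proof (cases "prime n")
            case True
            define z where "z = - v * of_real (real n powr (-1 - s))"
            have "real n powr (-1 - s) \<le> real n powr (-1)" using x n by (intro powr_mono) auto
            also have "\<dots> = 1 / real n" using n by (simp add: powr_minus divide_inverse)
            finally have "norm z \<le> R * (1 / real n)"
              unfolding z_def norm_mult using x norm_ge_zero[of v] by (intro mult_mono) (auto intro: order.trans[of 0 "norm v"])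
            then have z: "norm z \<le> R / real n" by simp
            also have "\<dots> \<le> 1 / 2" using n by (simp add: field_simps)
            finally have "norm (weierstrass_factor 1 z - 1) \<le> 3 * norm z ^ Suc 1" by (rule weierstrass_factor_bound)
            also have "\<dots> \<le> 3 * (R / real n) ^ Suc 1" using z by (intro mult_left_mono power_mono) auto
            finally show ?thesis using True x by (simp add: prime_factor_at_def z_def power_divide power2_eq_square)
          qed (auto simp: prime_factor_at_def x)
        qed
      qed
    qed
  qed
  then show ?thesis
    unfolding uniformly_convergent_uniform_limit_iff prime_product_def case_prod_beta prod.collapse .
qed

lemma prime_product_LIMSEQ:
  assumes "0 \<le> s" "s \<le> 1"
  shows "(\<lambda>N. \<Prod>p<N. prime_factor_at p (v, s)) \<longlonglongrightarrow> prime_product v s"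
  using tendsto_uniform_limitI[OF uniform_limit_prime_product[of "norm v"], of "(v, s)"] assms by simp

lemma prime_product_continuous: "((\<lambda>s. prime_product v s) \<longlongrightarrow> prime_product v 0) (at_right 0)"
proof -
  have "continuous_on (cball 0 (norm v) \<times> {0..1}) (\<lambda>(v, s). prime_product v s)"
  proof (rule uniform_limit_theorem[OF _ uniform_limit_prime_product])
    show "\<forall>\<^sub>F N in sequentially. continuous_on (cball 0 (norm v) \<times> {0..1}) (\<lambda>x. \<Prod>p<N. prime_factor_at p x)"
    proof (intro always_eventually allI continuous_on_prod)
      fix p
      show "continuous_on (cball 0 (norm v) \<times> {0..1}) (prime_factor_at p)"
        by (cases "prime p")
           (auto simp: prime_factor_at_def case_prod_beta prime_gt_0_nat intro!: continuous_intros)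
    qed
  qed auto
  then have "continuous_on {0..1} ((\<lambda>(v, s). prime_product v s) \<circ> (\<lambda>s. (v, s)))"
    by (intro continuous_on_compose) (auto intro!: continuous_intros elim!: continuous_on_subset)
  then have "((\<lambda>s. prime_product v s) \<longlongrightarrow> prime_product v 0) (at 0 within {0..1})"
    by (simp add: continuous_on_def o_def)
  then show ?thesis by (simp add: at_within_Icc_at_right)
qed

lemma prod_primes_le_eq: "(\<Prod>p\<in>primes_le x. f p) = (\<Prod>p<Suc (nat \<lfloor>x\<rfloor>). if prime p then f p else 1)"
  unfolding primes_le_eq by (rule prod.mono_neutral_cong_left) auto

lemma uniform_limit_primes_le:
  "uniform_limit (cball 0 R) (\<lambda>x v. \<Prod>p\<in>primes_le x. weierstrass_factor 1 (- v / of_nat p)) (\<lambda>v. prime_product v 0) at_top"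
proof -
  have "uniform_limit (cball 0 R) (\<lambda>N v. \<Prod>p<N. prime_factor_at p (v, 0)) (\<lambda>v. prime_product v 0) sequentially"
    using uniform_limit_compose'[OF uniform_limit_prime_product[of R], of "\<lambda>v. (v, 0)" "cball 0 R"] by auto
  moreover have "filterlim (\<lambda>x. Suc (nat \<lfloor>x\<rfloor>)) sequentially (at_top :: real filter)"
    by (rule filterlim_compose[OF filterlim_Suc])
       (rule filterlim_compose[OF filterlim_nat_sequentially filterlim_floor_sequentially])
  ultimately have "uniform_limit (cball 0 R) (\<lambda>x v. \<Prod>p<Suc (nat \<lfloor>x\<rfloor>). prime_factor_at p (v, 0)) (\<lambda>v. prime_product v 0) (at_top :: real filter)"
    by (rule filterlim_compose)
  moreover have "(\<Prod>p<Suc (nat \<lfloor>x\<rfloor>). prime_factor_at p (v, 0)) = (\<Prod>p\<in>primes_le x. weierstrass_factor 1 (- v / of_nat p))" for x v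
    unfolding prod_primes_le_eq
    by (intro prod.cong refl) (auto simp: prime_factor_at_def powr_minus divide_inverse prime_gt_0_nat)
  ultimately show ?thesis by simp
qed

lemma holomorphic_prime_product: "(\<lambda>v. prime_product v 0) holomorphic_on UNIV"
proof (rule holomorphic_uniform_sequence[where f = "\<lambda>n v. \<Prod>p\<in>primes_le (real n). weierstrass_factor 1 (- v / of_nat p)"])
  show "(\<lambda>v. \<Prod>p\<in>primes_le (real n). weierstrass_factor 1 (- v / of_nat p)) holomorphic_on UNIV" for n
    by (intro holomorphic_intros) (auto simp: primes_le_def prime_gt_0_nat)
  fix v :: complex assume "v \<in> UNIV"
  have "uniform_limit (cball 0 (norm v + 1)) (\<lambda>n v. \<Prod>p\<in>primes_le (real n). weierstrass_factor 1 (- v / of_nat p)) (\<lambda>v. prime_product v 0) sequentially"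
    by (rule filterlim_compose[OF uniform_limit_primes_le filterlim_real_sequentially])
  then have "uniform_limit (cball v 1) (\<lambda>n v. \<Prod>p\<in>primes_le (real n). weierstrass_factor 1 (- v / of_nat p)) (\<lambda>v. prime_product v 0) sequentially"
    by (rule uniform_limit_on_subset) (auto simp: dist_norm, metis add.commute add_le_cancel_left norm_minus_commute norm_triangle_sub order_trans)
  then show "\<exists>d>0. cball v d \<subseteq> UNIV \<and> uniform_limit (cball v d) (\<lambda>n v. \<Prod>p\<in>primes_le (real n). weierstrass_factor 1 (- v / of_nat p)) (\<lambda>v. prime_product v 0) sequentially"
    by (intro exI[of _ 1]) auto
qed auto

lemma prime_product_0 [simp]: "prime_product 0 s = 1"
  by (simp add: prime_product_def prime_factor_at_def cong: if_cong)

text \<open>The Weierstrass factors have no linear term, and derivatives pass to locally uniform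
  limits. This is the source of the vanishing derivative of \<open>moment_factor\<close> and
  \<open>bernoulli_factor\<close> at the origin.\<close>

lemma deriv_prime_product_0: "deriv (\<lambda>v. prime_product v 0) 0 = 0"
proof -
  let ?f = "\<lambda>n v. \<Prod>p\<in>primes_le (real n). weierstrass_factor 1 (- v / of_nat p)"
  have "uniform_limit (cball 0 1) ?f (\<lambda>v. prime_product v 0) sequentially"
    by (rule filterlim_compose[OF uniform_limit_primes_le filterlim_real_sequentially])
  then have ul: "uniform_limit (ball 0 1) ?f (\<lambda>v. prime_product v 0) sequentially"
    by (rule uniform_limit_on_subset) auto
  have "(\<lambda>n. (deriv ^^ 1) (?f n) 0) \<longlonglongrightarrow> (deriv ^^ 1) (\<lambda>v. prime_product v 0) 0"
  proof (rule higher_deriv_complex_uniform_limit[OF ul])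
    show "\<forall>\<^sub>F n in sequentially. ?f n holomorphic_on ball 0 1"
      by (intro always_eventually allI holomorphic_intros) (auto simp: primes_le_def prime_gt_0_nat)
  qed auto
  moreover have "deriv (?f n) 0 = 0" for n
  proof -
    have "(?f n has_field_derivative (\<Sum>p\<in>primes_le (real n). 0 * (\<Prod>q\<in>primes_le (real n) - {p}. weierstrass_factor 1 (- 0 / of_nat q)))) (at 0)"
    proof (rule has_field_derivative_prod)
      fix p assume "p \<in> primes_le (real n)"
      then have "p > 0" by (simp add: primes_le_def prime_gt_0_nat)
      then show "((\<lambda>v. weierstrass_factor 1 (- v / of_nat p)) has_field_derivative 0) (at 0)"
        unfolding weierstrass_factor_def by (auto intro!: derivative_eq_intros)
    qed
    then show ?thesis by (intro DERIV_imp_deriv) simp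
  qed
  ultimately have "(\<lambda>n::nat. 0) \<longlonglongrightarrow> deriv (\<lambda>v. prime_product v 0) 0" by simp
  then show ?thesis by (rule LIMSEQ_unique[OF tendsto_const, symmetric])
qed

section \<open>Euler products and the zeta function near its pole, with argument
  \<open>1 + s\<close>\<close>

definition prime_zeta :: "real \<Rightarrow> real" where
  "prime_zeta s = (\<Sum>p. if prime p then real p powr (-1 - s) else 0)"

lemma summable_powr_1: "s > 0 \<Longrightarrow> summable (\<lambda>n. real n powr (-1 - s))"
  by (simp add: summable_real_powr_iff)

lemma prime_zeta_sums: "s > 0 \<Longrightarrow> (\<lambda>p. if prime p then real p powr (-1 - s) else 0) sums prime_zeta s"
  unfolding prime_zeta_def
  by (rule summable_sums, rule summable_comparison_test'[OF summable_powr_1[of s], of 0]) auto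

text \<open>For \<open>s > 0\<close> the sum of \<open>p powr (-1 - s)\<close> converges, so the
  convergence factors can be collected into one exponential. The whole singularity at
  \<open>s = 0\<close> then sits in \<open>prime_zeta\<close>.\<close>

lemma euler_product_LIMSEQ:
  assumes s: "0 < s" "s \<le> 1"
  shows "(\<lambda>N. \<Prod>p | p < N \<and> prime p. 1 + v * of_real (real p powr (-1 - s))) \<longlonglongrightarrow> prime_product v s * exp (v * of_real (prime_zeta s))"
proof -
  have "(\<lambda>N. (\<Prod>p<N. prime_factor_at p (v, s)) * exp (v * of_real (\<Sum>p<N. if prime p then real p powr (-1 - s) else 0)))
     \<longlonglongrightarrow> prime_product v s * exp (v * of_real (prime_zeta s))"
    using s prime_zeta_sums[of s] by (intro tendsto_intros prime_product_LIMSEQ) (auto simp: sums_def)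
  moreover have "(\<Prod>p<N. prime_factor_at p (v, s)) * exp (v * of_real (\<Sum>p<N. if prime p then real p powr (-1 - s) else 0))
      = (\<Prod>p | p < N \<and> prime p. 1 + v * of_real (real p powr (-1 - s)))" for N
  proof -
    have "exp (v * of_real (\<Sum>p<N. if prime p then real p powr (-1 - s) else 0))
       = (\<Prod>p<N. exp (v * of_real (if prime p then real p powr (-1 - s) else 0)))"
      by (simp add: sum_distrib_left exp_sum)
    then have "(\<Prod>p<N. prime_factor_at p (v, s)) * exp (v * of_real (\<Sum>p<N. if prime p then real p powr (-1 - s) else 0))
      = (\<Prod>p<N. prime_factor_at p (v, s) * exp (v * of_real (if prime p then real p powr (-1 - s) else 0)))"
      by (simp add: prod.distrib)
    also have "\<dots> = (\<Prod>p<N. if prime p then 1 + v * of_real (real p powr (-1 - s)) else 1)"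
      by (intro prod.cong refl)
         (auto simp: prime_factor_at_def weierstrass_factor_1_minus[simplified] mult.assoc exp_minus)
    also have "\<dots> = (\<Prod>p | p < N \<and> prime p. 1 + v * of_real (real p powr (-1 - s)))"
      by (rule prod.mono_neutral_cong_right) auto
    finally show ?thesis .
  qed
  ultimately show ?thesis by simp
qed

definition sqfree_over :: "nat set \<Rightarrow> nat set" where
  "sqfree_over P = {m. squarefree m \<and> prime_factors m \<subseteq> P}"

text \<open>Induction on \<open>P\<close>: the squarefree numbers over \<open>insert p P\<close> are
  those over \<open>P\<close> and their multiples by \<open>p\<close>. The completely multiplicative
  weight \<open>q\<close> is left open since the lemma serves the real and complex Dirichlet series,
  and with \<open>q = 1\<close> the divisor sum for \<open>w ^ omega n\<close>.\<close>

lemma prod_prime_euler: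
  fixes v :: "'a :: real_normed_field" and q :: "nat \<Rightarrow> 'a"
  assumes "finite P" "\<And>p. p \<in> P \<Longrightarrow> prime p" and q: "\<And>p m. q (p * m) = q p * q m" "q 1 = 1"
  shows "finite (sqfree_over P) \<and> (\<Sum>m\<in>sqfree_over P. sqfree_power v m * q m) = (\<Prod>p\<in>P. 1 + v * q p)"
  using assms(1,2)
proof (induction P rule: finite_induct)
  case empty
  have "sqfree_over {} = {1}"
    by (auto simp: sqfree_over_def prime_factorization_empty_iff)
  then show ?case using q by (simp add: sqfree_power_def)
next
  case (insert p P)
  have p: "prime p" using insert by auto
  have IH: "finite (sqfree_over P)" "(\<Sum>m\<in>sqfree_over P. sqfree_power v m * q m) = (\<Prod>p\<in>P. 1 + v * q p)"
    using insert by auto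
  have pos: "m > 0" if "m \<in> sqfree_over P" for m P
    using that by (cases m) (auto simp: sqfree_over_def)
  have notdvd: "\<not> p dvd m" if "m \<in> sqfree_over P" for m
    using that pos[OF that] p insert(2) by (auto simp: sqfree_over_def prime_factors_dvd)
  have eq: "sqfree_over (insert p P) = sqfree_over P \<union> (*) p ` sqfree_over P"
  proof (intro equalityI subsetI)
    fix m assume m: "m \<in> sqfree_over (insert p P)"
    show "m \<in> sqfree_over P \<union> (*) p ` sqfree_over P"
    proof (cases "p dvd m")
      case True
      then obtain k where k: "m = p * k" by blast
      then have kpos: "k > 0" using pos[OF m] by auto
      have k2: "squarefree k" "\<not> p dvd k" using squarefree_prime_mult[OF p kpos] m k by (auto simp: sqfree_over_def)
      have "prime_factors k \<subseteq> P"
        using m k k2 kpos p by (auto simp: sqfree_over_def prime_factors_dvd)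
      then show ?thesis using k k2 by (auto simp: sqfree_over_def)
    next
      case False
      then show ?thesis using m pos[OF m] by (auto simp: sqfree_over_def prime_factors_dvd)
    qed
  next
    fix m assume "m \<in> sqfree_over P \<union> (*) p ` sqfree_over P"
    then consider "m \<in> sqfree_over P" | k where "m = p * k" "k \<in> sqfree_over P" by auto
    then show "m \<in> sqfree_over (insert p P)"
    proof cases
      case 2
      have "squarefree m" using squarefree_prime_mult[OF p pos[OF 2(2)]] notdvd[OF 2(2)] 2 by (auto simp: sqfree_over_def)
      moreover have "prime_factors m = insert p (prime_factors k)"
        using 2 p pos[OF 2(2)] by (simp add: prime_factors_product prime_prime_factors)
      ultimately show ?thesis using 2 by (auto simp: sqfree_over_def)
    qed (auto simp: sqfree_over_def)
  qed
  have disj: "sqfree_over P \<inter> (*) p ` sqfree_over P = {}"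
    using notdvd dvd_triv_left by blast
  have "(\<Sum>m\<in>(*) p ` sqfree_over P. sqfree_power v m * q m) = (\<Sum>m\<in>sqfree_over P. v * q p * (sqfree_power v m * q m))"
  proof (subst sum.reindex)
    show "inj_on ((*) p) (sqfree_over P)" using p by (auto simp: inj_on_def prime_gt_0_nat)
    show "sum ((\<lambda>m. sqfree_power v m * q m) \<circ> (*) p) (sqfree_over P) = (\<Sum>m\<in>sqfree_over P. v * q p * (sqfree_power v m * q m))"
    proof (intro sum.cong refl)
      fix m assume m: "m \<in> sqfree_over P"
      have "squarefree (p * m)" "squarefree m" using squarefree_prime_mult[OF p pos[OF m]] notdvd[OF m] m by (auto simp: sqfree_over_def)
      moreover have "omega (p * m) = Suc (omega m)" using omega_prime_mult p pos m notdvd by blast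
      ultimately show "((\<lambda>m. sqfree_power v m * q m) \<circ> (*) p) m = v * q p * (sqfree_power v m * q m)"
        using q by (simp add: sqfree_power_def mult_ac)
    qed
  qed
  then have img: "(\<Sum>m\<in>(*) p ` sqfree_over P. sqfree_power v m * q m) = v * q p * (\<Sum>m\<in>sqfree_over P. sqfree_power v m * q m)"
    by (simp only: sum_distrib_left)
  have "(\<Sum>m\<in>sqfree_over (insert p P). sqfree_power v m * q m) = (1 + v * q p) * (\<Sum>m\<in>sqfree_over P. sqfree_power v m * q m)"
    unfolding eq using IH(1) disj
    by (subst sum.union_disjoint) (simp_all only: finite_imageI img distrib_right mult_1_left)
  then show ?case using IH insert(1,2) eq by simp
qed

lemma filterlim_finite_subsets_at_top_sequentially:
  assumes "\<And>n::nat. finite (A n)" "\<And>n. A n \<subseteq> S" "\<And>x. x \<in> S \<Longrightarrow> eventually (\<lambda>n. x \<in> A n) F"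
  shows "filterlim A (finite_subsets_at_top S) F"
  unfolding filterlim_finite_subsets_at_top
proof (intro allI impI)
  fix X assume X: "finite X \<and> X \<subseteq> S"
  have "eventually (\<lambda>n. \<forall>x\<in>X. x \<in> A n) F"
    using X assms(3) by (intro eventually_ball_finite) auto
  then show "eventually (\<lambda>n. finite (A n) \<and> X \<subseteq> A n \<and> A n \<subseteq> S) F"
    by eventually_elim (use assms in auto)
qed

text \<open>The Euler product evaluates the series along the sets of squarefree numbers with all
  primes below \<open>N\<close>. Absolute convergence, bounded by
  \<open>exp (norm v * prime_zeta s)\<close>, makes the value independent of the order, so the next
  lemma can truncate by size instead.\<close>

lemma sqfree_dirichlet_has_sum:
  assumes s: "0 < s" "s \<le> 1"
  shows "((\<lambda>m. sqfree_power v m * of_real (real m powr (-1 - s))) has_sum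
           prime_product v s * exp (v * of_real (prime_zeta s))) {m. squarefree m}"
proof -
  define q where "q = (\<lambda>m::nat. real m powr (-1 - s))"
  define P where "P = (\<lambda>N. {p::nat. p < N \<and> prime p})"
  have q: "q (p * m) = q p * q m" "q 1 = 1" "q m \<ge> 0" for p m by (auto simp: q_def powr_mult)
  have q': "complex_of_real (q (p * m)) = of_real (q p) * of_real (q m)" "complex_of_real (q 1) = 1" for p m
    using q by auto
  have fin: "finite (sqfree_over (P N))" for N
    by (rule conjunct1, rule prod_prime_euler[OF _ _ q']) (auto simp: P_def)
  have euler: "(\<Sum>m\<in>sqfree_over (P N). sqfree_power v m * complex_of_real (q m)) = (\<Prod>p\<in>P N. 1 + v * of_real (q p))" for N v
    by (rule conjunct2, rule prod_prime_euler[OF _ _ q']) (auto simp: P_def)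
  have eulerR: "(\<Sum>m\<in>sqfree_over (P N). sqfree_power t m * q m) = (\<Prod>p\<in>P N. 1 + t * q p)" for N and t :: real
    by (rule conjunct2, rule prod_prime_euler[OF _ _ q(1,2)]) (auto simp: P_def)
  have mem: "m \<in> sqfree_over (P N)" if "squarefree m" "m < N" for m N
  proof -
    have "m \<noteq> 0" using that(1) by (metis not_squarefree_0)
    with that show ?thesis by (auto simp: sqfree_over_def P_def prime_factors_dvd dest: dvd_imp_le)
  qed
  have "(\<lambda>m. norm (sqfree_power v m * complex_of_real (q m))) summable_on {m. squarefree m}"
  proof (rule nonneg_bdd_above_summable_on)
    show "bdd_above (sum (\<lambda>m. norm (sqfree_power v m * complex_of_real (q m))) ` {F. F \<subseteq> {m. squarefree m} \<and> finite F})"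
    proof (rule bdd_aboveI2)
      fix F assume F: "F \<in> {F. F \<subseteq> {m::nat. squarefree m} \<and> finite F}"
      define N where "N = Suc (Max (insert 0 F))"
      have "(\<Sum>m\<in>F. norm (sqfree_power v m * complex_of_real (q m))) \<le> (\<Sum>m\<in>sqfree_over (P N). sqfree_power (norm v) m * q m)"
      proof -
        have "(\<Sum>m\<in>F. norm (sqfree_power v m * complex_of_real (q m))) = (\<Sum>m\<in>F. sqfree_power (norm v) m * q m)"
          using q by (simp add: norm_mult norm_sqfree_power)
        also have "\<dots> \<le> (\<Sum>m\<in>sqfree_over (P N). sqfree_power (norm v) m * q m)"
        proof (intro sum_mono2 fin)
          show "F \<subseteq> sqfree_over (P N)"
          proof
            fix m assume "m \<in> F"
            then show "m \<in> sqfree_over (P N)" using F by (intro mem) (auto simp: N_def less_Suc_eq_le)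
          qed
        qed (auto intro!: mult_nonneg_nonneg sqfree_power_nonneg q)
        finally show ?thesis .
      qed
      also have "\<dots> \<le> exp (\<Sum>p\<in>P N. norm v * q p)"
        unfolding eulerR
        by (subst exp_sum) (auto simp: P_def intro!: prod_mono exp_ge_add_one_self add_nonneg_nonneg mult_nonneg_nonneg q)
      also have "\<dots> \<le> exp (norm v * prime_zeta s)"
      proof -
        have "(\<Sum>p\<in>P N. q p) = (\<Sum>p<N. if prime p then q p else 0)"
          unfolding P_def by (rule sum.mono_neutral_cong_left) auto
        also have "\<dots> \<le> prime_zeta s"
          unfolding prime_zeta_def q_def
          by (rule sum_le_suminf[OF sums_summable[OF prime_zeta_sums[OF s(1)]]]) auto
        finally show ?thesis by (simp add: sum_distrib_left[symmetric] mult_left_mono)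
      qed
      finally show "(\<Sum>m\<in>F. norm (sqfree_power v m * complex_of_real (q m))) \<le> exp (norm v * prime_zeta s)" .
    qed
  qed auto
  then have "(\<lambda>m. sqfree_power v m * complex_of_real (q m)) summable_on {m. squarefree m}"
    by (rule abs_summable_summable)
  then obtain S where S: "((\<lambda>m. sqfree_power v m * complex_of_real (q m)) has_sum S) {m. squarefree m}"
    unfolding summable_on_def by blast
  have "filterlim (\<lambda>N. sqfree_over (P N)) (finite_subsets_at_top {m. squarefree m}) sequentially"
  proof (rule filterlim_finite_subsets_at_top_sequentially)
    fix m assume "m \<in> {m::nat. squarefree m}"
    then have m: "squarefree m" by simp
    show "\<forall>\<^sub>F N in sequentially. m \<in> sqfree_over (P N)"
      using eventually_gt_at_top[of m] by eventually_elim (use m in \<open>auto intro: mem\<close>)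
  qed (rule fin, auto simp: sqfree_over_def)
  then have "(\<lambda>N. \<Sum>m\<in>sqfree_over (P N). sqfree_power v m * complex_of_real (q m)) \<longlonglongrightarrow> S"
    using S unfolding has_sum_def by (rule filterlim_compose[rotated])
  moreover have "(\<lambda>N. \<Sum>m\<in>sqfree_over (P N). sqfree_power v m * complex_of_real (q m)) \<longlonglongrightarrow> prime_product v s * exp (v * of_real (prime_zeta s))"
    unfolding euler using euler_product_LIMSEQ[OF s, of v] by (simp add: P_def q_def)
  ultimately have "S = prime_product v s * exp (v * of_real (prime_zeta s))" by (rule LIMSEQ_unique)
  with S show ?thesis by (simp add: q_def)
qed

lemma sqfree_dirichlet_limit:
  assumes s: "0 < s" "s \<le> 1"
  shows "((\<lambda>U. \<Sum>m\<in>nats_le_exp U. sqfree_power v m * of_real (real m powr (-1 - s))) \<longlongrightarrow>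
           prime_product v s * exp (v * of_real (prime_zeta s))) at_top"
proof -
  let ?A = "\<lambda>U. {m\<in>nats_le_exp U. squarefree m}"
  have "filterlim ?A (finite_subsets_at_top {m. squarefree m}) at_top"
    unfolding filterlim_finite_subsets_at_top
  proof (intro allI impI)
    fix X :: "nat set" assume X: "finite X \<and> X \<subseteq> {m. squarefree m}"
    have "eventually (\<lambda>U. \<forall>m\<in>X. ln (real m) \<le> U) at_top"
      using X by (intro eventually_ball_finite) (auto simp: eventually_ge_at_top)
    then show "eventually (\<lambda>U. finite (?A U) \<and> X \<subseteq> ?A U \<and> ?A U \<subseteq> {m. squarefree m}) at_top"
    proof eventually_elim
      case (elim U)
      have "m > 0" if "m \<in> X" for m using X that by (cases m) auto
      with elim X have "X \<subseteq> ?A U" by (auto simp: nats_le_exp_def)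
      then show ?case by auto
    qed
  qed
  then have "((\<lambda>U. \<Sum>m\<in>?A U. sqfree_power v m * of_real (real m powr (-1 - s))) \<longlongrightarrow>
           prime_product v s * exp (v * of_real (prime_zeta s))) at_top"
    using sqfree_dirichlet_has_sum[OF s, of v] unfolding has_sum_def by (rule filterlim_compose[rotated])
  moreover have "(\<Sum>m\<in>?A U. sqfree_power v m * complex_of_real (real m powr (-1 - s))) = (\<Sum>m\<in>nats_le_exp U. sqfree_power v m * of_real (real m powr (-1 - s)))" for U
    by (rule sum.mono_neutral_left) (auto simp: sqfree_power_def)
  ultimately show ?thesis by simp
qed

text \<open>The Riemann zeta function at \<open>1 + s\<close>; the term \<open>n = 0\<close> is 0
  because \<open>0 powr y = 0\<close>.\<close>

definition zeta_real :: "real \<Rightarrow> real" where "zeta_real s = (\<Sum>n. real n powr (-1 - s))"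

text \<open>The sieve of Eratosthenes: multiplying by \<open>1 - N powr (-1 - s)\<close> for a prime
  \<open>N\<close> subtracts exactly the multiples of \<open>N\<close> among the numbers that are
  left.\<close>

lemma zeta_sieve:
  assumes s: "s > 0"
  shows "((\<lambda>n. real n powr (-1 - s)) has_sum zeta_real s * (\<Prod>p | p < N \<and> prime p. 1 - real p powr (-1 - s)))
           {n. n > 0 \<and> (\<forall>p<N. prime p \<longrightarrow> \<not> p dvd n)}"
proof (induction N)
  case 0
  have "((\<lambda>n. real n powr (-1 - s)) has_sum zeta_real s) UNIV"
    using summable_powr_1[OF s] by (intro norm_summable_imp_has_sum) (auto simp: zeta_real_def)
  then have "((\<lambda>n. real n powr (-1 - s)) has_sum zeta_real s) {n. n > 0}"
    by (subst has_sum_cong_neutral[where T = UNIV and g = "\<lambda>n. real n powr (-1 - s)"]) auto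
  then show ?case by simp
next
  case (Suc N)
  let ?A = "\<lambda>N. {n::nat. n > 0 \<and> (\<forall>p<N. prime p \<longrightarrow> \<not> p dvd n)}"
  let ?q = "\<lambda>n::nat. real n powr (-1 - s)"
  let ?Z = "\<lambda>N. zeta_real s * (\<Prod>p | p < N \<and> prime p. 1 - real p powr (-1 - s))"
  show ?case
  proof (cases "prime N")
    case False
    then have "?A (Suc N) = ?A N" "{p. p < Suc N \<and> prime p} = {p. p < N \<and> prime p}" by (auto simp: less_Suc_eq)
    with Suc show ?thesis by simp
  next
    case True
    then have N: "N > 0" by (simp add: prime_gt_0_nat)
    have set: "{p. p < Suc N \<and> prime p} = insert N {p. p < N \<and> prime p}" using True by (auto simp: less_Suc_eq)
    have "((\<lambda>n. ?q N * ?q n) has_sum (?q N * ?Z N)) (?A N)" by (intro has_sum_cmult_right Suc)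
    then have "((?q \<circ> (*) N) has_sum (?q N * ?Z N)) (?A N)" by (simp add: o_def powr_mult)
    then have 1: "(?q has_sum (?q N * ?Z N)) ((*) N ` ?A N)"
      by (subst has_sum_reindex) (use N in \<open>auto simp: inj_on_def\<close>)
    have sub: "(*) N ` ?A N \<subseteq> ?A N"
    proof safe
      fix m p assume m: "m > 0" "\<forall>p<N. prime p \<longrightarrow> \<not> p dvd m" and p: "p < N" "prime p" "p dvd N * m"
      then have "p dvd N \<or> p dvd m" using prime_dvd_mult_iff by blast
      then show False using m p True primes_dvd_imp_eq[of p N] by auto
    qed (use N in auto)
    have eq: "?A N - (*) N ` ?A N = ?A (Suc N)"
    proof (intro equalityI subsetI)
      fix n assume n: "n \<in> ?A N - (*) N ` ?A N"
      have "\<not> N dvd n"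
      proof
        assume "N dvd n"
        then obtain k where "n = N * k" by blast
        with n have "k \<in> ?A N" by auto
        with n \<open>n = N * k\<close> show False by blast
      qed
      with n show "n \<in> ?A (Suc N)" by (auto simp: less_Suc_eq)
    next
      fix n assume "n \<in> ?A (Suc N)"
      then show "n \<in> ?A N - (*) N ` ?A N" using True by (auto simp: less_Suc_eq)
    qed
    have "(?q has_sum (?Z N - ?q N * ?Z N)) (?A N - (*) N ` ?A N)"
      using has_sum_Diff[OF Suc 1 sub] .
    then show ?thesis unfolding eq set by (subst prod.insert) (auto simp: algebra_simps)
  qed
qed

text \<open>After sieving by the primes below \<open>N\<close> there remain \<open>n = 1\<close> and
  some numbers \<open>n \<ge> N\<close>, so the sieved sum lies between 1 and 1 plus a tail of the
  series. Its limit 1 is compared with the Euler product for \<open>v = -1\<close>.\<close>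

lemma zeta_euler_product:
  assumes s: "0 < s" "s \<le> 1"
  shows "complex_of_real (zeta_real s) * (prime_product (-1) s * exp (- of_real (prime_zeta s))) = 1"
proof -
  let ?q = "\<lambda>n::nat. real n powr (-1 - s)"
  let ?X = "\<lambda>N. zeta_real s * (\<Prod>p | p < N \<and> prime p. 1 - ?q p)"
  let ?A = "\<lambda>N. {n::nat. n > 0 \<and> (\<forall>p<N. prime p \<longrightarrow> \<not> p dvd n)}"
  have all: "(?q has_sum zeta_real s) UNIV"
    using summable_powr_1[OF s(1)] by (intro norm_summable_imp_has_sum) (auto simp: zeta_real_def)
  have lo: "1 \<le> ?X N" for N
  proof (rule has_sum_mono2[OF _ zeta_sieve[OF s(1), of N]])
    show "(?q has_sum 1) {1}" by (simp add: has_sum_finite_iff)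
  qed (auto simp: prime_nat_iff)
  have hi: "?X N \<le> 1 + (zeta_real s - (\<Sum>n<N. ?q n))" if "N > 1" for N
  proof (rule has_sum_mono2[OF zeta_sieve[OF s(1), of N]])
    have "(?q has_sum (\<Sum>n<N. ?q n)) {..<N}" by (simp add: has_sum_finite_iff)
    from has_sum_Diff[OF all this]
    have t: "(?q has_sum (zeta_real s - (\<Sum>n<N. ?q n))) (UNIV - {..<N})" by simp
    have "(?q has_sum 1) {1}" by (simp add: has_sum_finite_iff)
    from has_sum_Un_disjoint[OF this t]
    show "(?q has_sum (1 + (zeta_real s - (\<Sum>n<N. ?q n)))) ({1} \<union> (UNIV - {..<N}))"
      using that by simp
    show "?A N \<subseteq> {1} \<union> (UNIV - {..<N})"
    proof
      fix n assume n: "n \<in> ?A N"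
      show "n \<in> {1} \<union> (UNIV - {..<N})"
      proof (cases "n = 1 \<or> n \<ge> N")
        case False
        then obtain p where p: "prime p" "p dvd n" using prime_factor_nat by blast
        then have "p \<le> n" using n by (auto dest: dvd_imp_le)
        then show ?thesis using False n p by auto
      qed auto
    qed
  qed auto
  have "(\<lambda>N. ?X N) \<longlonglongrightarrow> 1"
  proof (rule tendsto_sandwich[of "\<lambda>_. 1" _ _ "\<lambda>N. 1 + (zeta_real s - (\<Sum>n<N. ?q n))"])
    have "(\<lambda>N. 1 + (zeta_real s - (\<Sum>n<N. ?q n))) \<longlonglongrightarrow> 1 + (zeta_real s - zeta_real s)"
      using summable_LIMSEQ[OF summable_powr_1[OF s(1)]] by (intro tendsto_intros) (simp add: zeta_real_def)
    then show "(\<lambda>N. 1 + (zeta_real s - (\<Sum>n<N. ?q n))) \<longlonglongrightarrow> 1" by simp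
    show "\<forall>\<^sub>F N in sequentially. ?X N \<le> 1 + (zeta_real s - (\<Sum>n<N. ?q n))"
      using eventually_gt_at_top[of 1] by eventually_elim (rule hi)
  qed (use lo in auto)
  then have "(\<lambda>N. complex_of_real (?X N)) \<longlonglongrightarrow> complex_of_real 1" by (rule tendsto_of_real)
  moreover have "(\<lambda>N. complex_of_real (zeta_real s) * (\<Prod>p | p < N \<and> prime p. 1 + (-1) * of_real (?q p))) \<longlonglongrightarrow> of_real (zeta_real s) * (prime_product (-1) s * exp ((-1) * of_real (prime_zeta s)))"
    by (intro tendsto_intros euler_product_LIMSEQ s)
  ultimately have "complex_of_real 1 = of_real (zeta_real s) * (prime_product (-1) s * exp ((-1) * of_real (prime_zeta s)))"
    by (intro LIMSEQ_unique[where X = "\<lambda>N. complex_of_real (?X N)"]) auto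
  then show ?thesis by simp
qed

text \<open>By the mean value theorem each difference of consecutive values of
  \<open>x powr (-s)\<close> lies between two neighbouring terms of the series times
  \<open>s\<close>, and the differences telescope to 1.\<close>

lemma zeta_real_bounds:
  assumes s: "0 < s" shows "1 \<le> s * zeta_real s" "s * zeta_real s \<le> s + 1"
proof -
  let ?q = "\<lambda>n::nat. real n powr (-1 - s)"
  let ?d = "\<lambda>n. real (Suc n) powr (-s) - real (Suc (Suc n)) powr (-s)"
  have "(\<lambda>n. real (Suc n) powr (-s)) \<longlonglongrightarrow> 0"
    by (rule tendsto_neg_powr[OF _ filterlim_compose[OF filterlim_real_sequentially filterlim_Suc]]) (use s in auto)
  from telescope_sums'[OF this] have d: "?d sums 1" by simp
  have mvt: "s * ?q (Suc (Suc n)) \<le> ?d n \<and> ?d n \<le> s * ?q (Suc n)" for n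
  proof -
    have "\<exists>z. real (Suc n) < z \<and> z < real (Suc (Suc n)) \<and>
        real (Suc (Suc n)) powr (-s) - real (Suc n) powr (-s) = (real (Suc (Suc n)) - real (Suc n)) * (-s * z powr (-s - 1))"
      by (rule MVT2) (auto intro!: derivative_eq_intros)
    then obtain z where z: "real (Suc n) < z" "z < real (Suc (Suc n))" "?d n = s * z powr (-s - 1)" by auto
    have eq: "-s - 1 = -1 - s" by simp
    have "?q (Suc (Suc n)) \<le> z powr (-s - 1)" "z powr (-s - 1) \<le> ?q (Suc n)"
      unfolding eq using powr_mono2'[of "-1-s" z "real (Suc (Suc n))"] powr_mono2'[of "-1-s" "real (Suc n)" z] z s
      by simp_all
    with z s show ?thesis by (auto intro: mult_left_mono)
  qed
  have q1: "(\<lambda>n. ?q (Suc n)) sums zeta_real s"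
    using summable_sums[OF summable_powr_1[OF s]] unfolding zeta_real_def[symmetric] by (subst sums_Suc_iff) simp
  then have q2: "(\<lambda>n. ?q (Suc (Suc n))) sums (zeta_real s - 1)"
    by (subst sums_Suc_iff) simp
  have "1 \<le> s * zeta_real s" by (rule sums_le[OF _ d sums_mult[OF q1]]) (use mvt in auto)
  moreover have "s * (zeta_real s - 1) \<le> 1" by (rule sums_le[OF _ sums_mult[OF q2] d]) (use mvt in auto)
  ultimately show "1 \<le> s * zeta_real s" "s * zeta_real s \<le> s + 1" by (auto simp: algebra_simps)
qed

lemma summable_meissel_mertens:
  "summable (\<lambda>p. if prime p then ln (1 - 1 / real p) + 1 / real p else 0)"
proof (rule summable_comparison_test')
  show "summable (\<lambda>p. 2 * (1 / real p ^ 2))"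
    using inverse_power_summable[of 2, where ?'a = real] by (simp add: divide_inverse summable_mult)
  fix p :: nat
  show "norm (if prime p then ln (1 - 1 / real p) + 1 / real p else 0) \<le> 2 * (1 / real p ^ 2)" if "p \<ge> 0"
  proof (cases "prime p")
    case True
    then have "real p \<ge> 2" using prime_ge_2_nat by simp
    then have "\<bar>ln (1 + (- (1 / real p))) - (- (1 / real p))\<bar> \<le> 2 * (- (1 / real p))\<^sup>2"
      by (intro abs_ln_one_plus_x_minus_x_bound_nonpos) (auto simp: field_simps)
    with True show ?thesis by (simp add: power_divide)
  qed auto
qed

text \<open>This is where the constant \<open>meissel_mertens\<close> enters: at
  \<open>v = -1\<close> the prime product is that of \<open>(1 - 1/p) * exp (1/p)\<close>.\<close>

lemma prime_product_minus_1: "prime_product (-1) 0 = of_real (exp (meissel_mertens - euler_mascheroni))"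
proof -
  let ?f = "\<lambda>p. if prime p then ln (1 - 1 / real p) + 1 / real p else 0"
  have "(\<lambda>N. complex_of_real (exp (\<Sum>p<N. ?f p))) \<longlonglongrightarrow> of_real (exp (meissel_mertens - euler_mascheroni))"
    using summable_LIMSEQ[OF summable_meissel_mertens]
    by (intro tendsto_of_real tendsto_exp) (simp add: meissel_mertens_def)
  moreover have "complex_of_real (exp (\<Sum>p<N. ?f p)) = (\<Prod>p<N. prime_factor_at p (-1, 0))" for N
  proof -
    have "complex_of_real (exp (\<Sum>p<N. ?f p)) = (\<Prod>p<N. complex_of_real (exp (?f p)))"
      by (simp add: exp_sum)
    also have "\<dots> = (\<Prod>p<N. prime_factor_at p (-1, 0))"
    proof (intro prod.cong refl)
      fix p
      show "complex_of_real (exp (?f p)) = prime_factor_at p (-1, 0)"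
      proof (cases "prime p")
        case True
        then have p: "p > 1" using prime_gt_1_nat by blast
        then have "exp (?f p) = (1 - 1 / real p) * exp (1 / real p)"
          using True by (simp add: exp_add)
        then show ?thesis using True p
          by (simp add: prime_factor_at_def weierstrass_factor_def powr_minus divide_inverse exp_of_real)
      qed (simp add: prime_factor_at_def)
    qed
    finally show ?thesis .
  qed
  ultimately show ?thesis using prime_product_LIMSEQ[of 0 "-1"] LIMSEQ_unique by auto
qed

text \<open>Equivalently, \<open>prime_zeta s = ln (1/s) + meissel_mertens - euler_mascheroni +
  o(1)\<close>. Multiply \<open>zeta_euler_product\<close> by \<open>s\<close> and use that
  \<open>s * zeta_real s\<close> tends to 1.\<close>

lemma exp_prime_zeta_limit:
  "((\<lambda>s. s * exp (prime_zeta s)) \<longlongrightarrow> exp (meissel_mertens - euler_mascheroni)) (at_right 0)"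
proof -
  have ev: "eventually (\<lambda>s::real. 0 < s \<and> s \<le> 1) (at_right 0)"
    using eventually_at_right_less[of 0] eventually_at_right_real[of 0 1] by (auto elim: eventually_elim2)
  have z: "((\<lambda>s. s * zeta_real s) \<longlongrightarrow> 1) (at_right 0)"
  proof (rule tendsto_sandwich[of "\<lambda>_. 1" _ _ "\<lambda>s. s + 1"])
    have "((\<lambda>s::real. s + 1) \<longlongrightarrow> 0 + 1) (at_right 0)" by (intro tendsto_intros)
    then show "((\<lambda>s::real. s + 1) \<longlongrightarrow> 1) (at_right 0)" by simp
  qed (use ev zeta_real_bounds in \<open>auto elim!: eventually_mono\<close>)
  have "((\<lambda>s. complex_of_real (s * zeta_real s) * prime_product (-1) s) \<longlongrightarrow> of_real 1 * prime_product (-1) 0) (at_right 0)"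
    by (intro tendsto_intros z prime_product_continuous)
  moreover have "eventually (\<lambda>s. complex_of_real (s * zeta_real s) * prime_product (-1) s = of_real (s * exp (prime_zeta s))) (at_right 0)"
    using ev
  proof eventually_elim
    case (elim s)
    have "complex_of_real (zeta_real s) * prime_product (-1) s
        = of_real (zeta_real s) * (prime_product (-1) s * exp (- of_real (prime_zeta s))) * exp (of_real (prime_zeta s))"
      by (simp add: exp_minus)
    also have "\<dots> = exp (of_real (prime_zeta s))" using zeta_euler_product[of s] elim by simp
    finally show ?case by (simp add: exp_of_real mult.assoc)
  qed
  ultimately have "((\<lambda>s. complex_of_real (s * exp (prime_zeta s))) \<longlongrightarrow> of_real 1 * prime_product (-1) 0) (at_right 0)"
    by (rule Lim_transform_eventually)
  then show ?thesis unfolding prime_product_minus_1 of_real_1 mult_1_left by (rule tendsto_of_real_iff[THEN iffD1])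
qed

text \<open>The Dirichlet series has the singularity \<open>s powr (-v)\<close>. Taking the
  logarithm of the real limit before multiplying by \<open>v\<close> avoids any choice of
  branch.\<close>

lemma sqfree_dirichlet_at_0:
  "((\<lambda>s. of_real s powr v * (prime_product v s * exp (v * of_real (prime_zeta s)))) \<longlongrightarrow>
      prime_product v 0 * exp (v * of_real (meissel_mertens - euler_mascheroni))) (at_right 0)"
proof -
  have "((\<lambda>s. ln (s * exp (prime_zeta s))) \<longlongrightarrow> ln (exp (meissel_mertens - euler_mascheroni))) (at_right 0)"
    by (intro tendsto_ln exp_prime_zeta_limit) auto
  then have "((\<lambda>s. prime_product v s * exp (v * of_real (ln (s * exp (prime_zeta s))))) \<longlongrightarrow>
      prime_product v 0 * exp (v * of_real (meissel_mertens - euler_mascheroni))) (at_right 0)"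
    by (intro tendsto_intros prime_product_continuous) simp
  then show ?thesis
  proof (rule Lim_transform_eventually)
    show "eventually (\<lambda>s. prime_product v s * exp (v * of_real (ln (s * exp (prime_zeta s)))) =
       of_real s powr v * (prime_product v s * exp (v * of_real (prime_zeta s)))) (at_right 0)"
      using eventually_at_right_less[of 0]
    proof eventually_elim
      case (elim s)
      then have "of_real s powr v = exp (v * of_real (ln s))" by (simp add: powr_def Ln_of_real)
      then show ?case using elim by (simp add: ln_mult exp_add ring_distribs)
    qed
  qed
qed

subsection \<open>Laplace transforms and the main term of the means\<close>

lemma tendsto_integral_Icc_at_top:
  fixes f :: "real \<Rightarrow> 'a :: banach"
  assumes "(f has_integral i) {0..}"
  shows "((\<lambda>U. integral {0..U} f) \<longlongrightarrow> i) at_top"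
proof (rule tendstoI)
  fix e :: real assume "e > 0"
  with assms obtain B where B: "B > 0" "\<And>a b. ball 0 B \<subseteq> cbox a b \<Longrightarrow>
      norm (integral (cbox a b) (\<lambda>x. if x \<in> {0..} then f x else 0) - i) < e"
    unfolding has_integral_alt'[of f] by blast
  show "\<forall>\<^sub>F U in at_top. dist (integral {0..U} f) i < e"
    using eventually_gt_at_top[of B]
  proof eventually_elim
    case (elim U)
    have "ball 0 B \<subseteq> cbox (-U) U" using elim by (auto simp: dist_norm)
    from B(2)[OF this, unfolded cbox_interval integral_restrict_Int]
    have "norm (integral ({0..} \<inter> {-U..U}) f - i) < e" .
    moreover have "{0..} \<inter> {-U..U} = {0..U}" using elim B by auto
    ultimately show ?case by (simp only: dist_norm)
  qed
qed

lemma integral_powr_exp_le: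
  fixes a s U :: real
  assumes "a \<ge> 0" "s > 0" "U \<ge> 0"
  shows "(\<lambda>u. u powr a * exp (- s * u)) integrable_on {0..U}"
    "integral {0..U} (\<lambda>u. u powr a * exp (- s * u)) \<le> Gamma (a + 1) * s powr (- a - 1)"
proof -
  let ?f = "\<lambda>t. t powr a / exp t"
  have G: "(?f has_integral Gamma (a + 1)) {0..}" using Gamma_integral_real[of "a + 1"] assms by simp
  have int: "?f integrable_on {0..s * U}"
    using G by (intro integrable_on_subinterval[of ?f "{0..}"]) auto
  have le: "integral {0..s * U} ?f \<le> Gamma (a + 1)"
    using G int by (subst integral_unique[OF G, symmetric], intro integral_subset_le) auto
  have "((\<lambda>x. ?f (s * x)) has_integral (1 / \<bar>s\<bar>) *\<^sub>R integral {0..s * U} ?f) ((\<lambda>x. x / s) ` {0..s * U})"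
    using int assms by (intro has_integral_stretch_real) (auto simp: has_integral_iff)
  moreover have "(\<lambda>x. x / s) ` {0..s * U} = {0..U}"
    using assms by (auto simp: image_iff field_simps intro!: bexI[of _ "s * _"])
  ultimately have "((\<lambda>x. ?f (s * x)) has_integral (1 / s) * integral {0..s * U} ?f) {0..U}" using assms by simp
  then have "((\<lambda>x. s powr (-a) * ?f (s * x)) has_integral s powr (-a) * ((1 / s) * integral {0..s * U} ?f)) {0..U}"
    by (rule has_integral_mult_right)
  moreover have "s powr (-a) * (1 / s * integral {0..s * U} ?f) = s powr (-a - 1) * integral {0..s * U} ?f"
    using assms by (simp add: powr_diff)
  ultimately have "((\<lambda>x. s powr (-a) * ?f (s * x)) has_integral s powr (- a - 1) * integral {0..s * U} ?f) {0..U}" by simp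
  then have I: "((\<lambda>u. u powr a * exp (- s * u)) has_integral s powr (- a - 1) * integral {0..s * U} ?f) {0..U}"
    by (rule has_integral_eq[rotated]) (use assms in \<open>auto simp: powr_mult powr_minus exp_minus field_simps\<close>)
  then show "(\<lambda>u. u powr a * exp (- s * u)) integrable_on {0..U}" by blast
  show "integral {0..U} (\<lambda>u. u powr a * exp (- s * u)) \<le> Gamma (a + 1) * s powr (- a - 1)"
    unfolding integral_unique[OF I] using mult_left_mono[OF le, of "s powr (- a - 1)"]
    by (simp add: mult.commute)
qed

lemma integral_complex_powr_exp:
  fixes z :: complex
  assumes "Re z > 0" "s > 0"
  shows "\<And>U. U \<ge> 0 \<Longrightarrow> (\<lambda>u. of_real u powr (z - 1) * of_real (exp (- s * u))) integrable_on {0..U}"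
    "((\<lambda>U. integral {0..U} (\<lambda>u. of_real u powr (z - 1) * of_real (exp (- s * u)))) \<longlongrightarrow> Gamma z * of_real s powr (- z)) at_top"
proof -
  let ?f = "\<lambda>t. of_real t powr (z - 1) / of_real (exp t) :: complex"
  have G: "(?f has_integral Gamma z) {0..}" using Gamma_integral_complex assms by blast
  have I: "((\<lambda>u. of_real u powr (z - 1) * of_real (exp (- s * u))) has_integral of_real s powr (- z) * integral {0..s * U} ?f) {0..U}"
    if "U \<ge> 0" for U
  proof -
    have int: "?f integrable_on {0..s * U}"
      using G by (intro integrable_on_subinterval[of ?f "{0..}"]) auto
    have "((\<lambda>x. ?f (s * x)) has_integral (1 / \<bar>s\<bar>) *\<^sub>R integral {0..s * U} ?f) ((\<lambda>x. x / s) ` {0..s * U})"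
      using int assms by (intro has_integral_stretch_real) (auto simp: has_integral_iff)
    moreover have "(\<lambda>x. x / s) ` {0..s * U} = {0..U}"
      using assms by (auto simp: image_iff field_simps intro!: bexI[of _ "s * _"])
    ultimately have "((\<lambda>x. ?f (s * x)) has_integral integral {0..s * U} ?f / of_real s) {0..U}"
      using assms by (simp add: scaleR_conv_of_real divide_inverse mult.commute)
    then have "((\<lambda>x. of_real s powr (1 - z) * ?f (s * x)) has_integral of_real s powr (1 - z) * (integral {0..s * U} ?f / of_real s)) {0..U}"
      by (rule has_integral_mult_right)
    moreover have "of_real s powr (1 - z) * (integral {0..s * U} ?f / of_real s) = of_real s powr (- z) * integral {0..s * U} ?f"
      using assms by (simp add: powr_diff powr_minus divide_inverse)
    ultimately have "((\<lambda>x. of_real s powr (1 - z) * ?f (s * x)) has_integral of_real s powr (- z) * integral {0..s * U} ?f) {0..U}" by simp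
    then show ?thesis
    proof (rule has_integral_eq[rotated])
      fix x assume "x \<in> {0..U}"
      then have "(of_real s * of_real x :: complex) powr (z - 1) = of_real s powr (z - 1) * of_real x powr (z - 1)"
        using assms by (intro powr_times_real) auto
      moreover have "of_real s powr (1 - z) * of_real s powr (z - 1) = (1 :: complex)"
        using assms by (subst powr_add[symmetric]) auto
      ultimately have "of_real s powr (1 - z) * of_real (s * x) powr (z - 1) = of_real x powr (z - 1)"
        by (simp flip: mult.assoc)
      then show "of_real s powr (1 - z) * ?f (s * x) = of_real x powr (z - 1) * of_real (exp (- s * x))"
        by (simp add: exp_minus divide_inverse flip: mult.assoc of_real_inverse)
    qed
  qed
  then show "\<And>U. U \<ge> 0 \<Longrightarrow> (\<lambda>u. of_real u powr (z - 1) * of_real (exp (- s * u))) integrable_on {0..U}" by blast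
  have "filterlim (\<lambda>U. s * U) at_top at_top" using assms
    by (intro filterlim_tendsto_pos_mult_at_top[OF tendsto_const] filterlim_ident) auto
  from filterlim_compose[OF tendsto_integral_Icc_at_top[OF G] this]
  have "((\<lambda>U. of_real s powr (- z) * integral {0..s * U} ?f) \<longlongrightarrow> of_real s powr (- z) * Gamma z) at_top"
    by (intro tendsto_intros)
  then have "((\<lambda>U. integral {0..U} (\<lambda>u. of_real u powr (z - 1) * of_real (exp (- s * u)))) \<longlongrightarrow> of_real s powr (- z) * Gamma z) at_top"
  proof (rule Lim_transform_eventually)
    show "\<forall>\<^sub>F U in at_top. of_real s powr (- z) * integral {0..s * U} ?f = integral {0..U} (\<lambda>u. of_real u powr (z - 1) * of_real (exp (- s * u)))"
      using eventually_ge_at_top[of 0] by eventually_elim (rule integral_unique[OF I, symmetric])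
  qed
  then show "((\<lambda>U. integral {0..U} (\<lambda>u. of_real u powr (z - 1) * of_real (exp (- s * u)))) \<longlongrightarrow> Gamma z * of_real s powr (- z)) at_top"
    by (simp add: mult.commute)
qed

lemma has_integral_max_exp:
  fixes s :: real
  assumes "s > 0" "0 \<le> l" "l \<le> U"
  shows "((\<lambda>u. max 0 (u - l) * exp (- s * u)) has_integral (exp (- s * l) - exp (- s * U) * (1 + s * (U - l))) / s\<^sup>2) {0..U}"
proof -
  have "((\<lambda>u. max 0 (u - l) * exp (- s * u)) has_integral 0) {0..l}"
    by (rule has_integral_is_0) auto
  moreover have "((\<lambda>u. max 0 (u - l) * exp (- s * u)) has_integral
      (- exp (- s * U) * (1 + s * (U - l)) / s\<^sup>2) - (- exp (- s * l) * (1 + s * (l - l)) / s\<^sup>2)) {l..U}"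
  proof (rule fundamental_theorem_of_calculus)
    fix x assume x: "x \<in> {l..U}"
    have "((\<lambda>u. - exp (- s * u) * (1 + s * (u - l)) / s\<^sup>2) has_real_derivative (x - l) * exp (- s * x)) (at x within {l..U})"
      using assms by (auto intro!: derivative_eq_intros simp: field_simps power2_eq_square)
    then show "((\<lambda>u. - exp (- s * u) * (1 + s * (u - l)) / s\<^sup>2) has_vector_derivative max 0 (x - l) * exp (- s * x)) (at x within {l..U})"
      using x by (simp add: has_real_derivative_iff_has_vector_derivative max_def)
  qed fact
  ultimately have "((\<lambda>u. max 0 (u - l) * exp (- s * u)) has_integral
      0 + ((- exp (- s * U) * (1 + s * (U - l)) / s\<^sup>2) - (- exp (- s * l) * (1 + s * (l - l)) / s\<^sup>2))) {0..U}"
    by (rule has_integral_combine[rotated 2]) (use assms in auto)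
  then show ?thesis by (simp add: diff_divide_distrib)
qed

lemma has_integral_log_mean_int_exp:
  fixes v :: complex
  assumes "s > 0" "U \<ge> 0"
  shows "((\<lambda>u. log_mean_int v u * of_real (exp (- s * u))) has_integral
     (\<Sum>m\<in>nats_le_exp U. sqfree_power v m / of_nat m *
       of_real ((exp (- s * ln (real m)) - exp (- s * U) * (1 + s * (U - ln (real m)))) / s\<^sup>2))) {0..U}"
proof -
  have "((\<lambda>u. \<Sum>m\<in>nats_le_exp U. sqfree_power v m / of_nat m * of_real (max 0 (u - ln (real m)) * exp (- s * u))) has_integral
     (\<Sum>m\<in>nats_le_exp U. sqfree_power v m / of_nat m *
       of_real ((exp (- s * ln (real m)) - exp (- s * U) * (1 + s * (U - ln (real m)))) / s\<^sup>2))) {0..U}"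
  proof (intro has_integral_sum has_integral_mult_right has_integral_of_real has_integral_max_exp assms finite_nats_le_exp)
    fix m assume "m \<in> nats_le_exp U"
    then show "0 \<le> ln (real m)" "ln (real m) \<le> U" by (auto simp: nats_le_exp_def Suc_le_eq)
  qed
  then show ?thesis
    by (rule has_integral_eq[rotated]) (auto simp: log_mean_int_eq_max[of _ U] sum_distrib_right mult.assoc)
qed

text \<open>The Laplace transform of \<open>max 0 (u - l)\<close> is
  \<open>exp (- s * l) / s\<^sup>2\<close>, so \<open>s\<^sup>2\<close> times that of
  \<open>log_mean_int v\<close> is the Dirichlet series at \<open>1 + s\<close>. The boundary terms
  \<open>R\<close> vanish because \<open>log_mean (norm v)\<close> grows only polynomially.\<close>

lemma log_mean_laplace:
  assumes s: "0 < s" "s \<le> 1"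
  shows "((\<lambda>U. of_real (s\<^sup>2) * integral {0..U} (\<lambda>u. log_mean_int v u * of_real (exp (- s * u)))) \<longlongrightarrow>
           prime_product v s * exp (v * of_real (prime_zeta s))) at_top"
proof -
  obtain C where C: "C > 0" "\<And>t u. 0 \<le> t \<Longrightarrow> t \<le> norm v \<Longrightarrow> 1 \<le> u \<Longrightarrow> log_mean t u \<le> C * u powr t"
    using log_mean_le[where V = "norm v"] by blast
  define R where "R = (\<lambda>U. \<Sum>m\<in>nats_le_exp U. sqfree_power v m / of_nat m * of_real (exp (- s * U) * (1 + s * (U - ln (real m)))))"
  have "((\<lambda>U. C * (exp (- s * U) * (1 + s * U) * U powr norm v)) \<longlongrightarrow> 0) at_top"
    using s by real_asymp
  moreover have "eventually (\<lambda>U. norm (R U) \<le> C * (exp (- s * U) * (1 + s * U) * U powr norm v)) at_top"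
    using eventually_ge_at_top[of 1]
  proof eventually_elim
    case (elim U)
    have "norm (R U) \<le> (\<Sum>m\<in>nats_le_exp U. sqfree_power (norm v) m / real m * (exp (- s * U) * (1 + s * U)))"
      unfolding R_def
    proof (rule order.trans[OF norm_sum], rule sum_mono)
      fix m assume m: "m \<in> nats_le_exp U"
      then have l: "0 \<le> ln (real m)" "ln (real m) \<le> U" by (auto simp: nats_le_exp_def Suc_le_eq)
      have "\<bar>exp (- s * U) * (1 + s * (U - ln (real m)))\<bar> \<le> exp (- s * U) * (1 + s * U)"
        unfolding abs_mult using s l by (intro mult_mono) (auto simp: abs_of_nonneg)
      then show "norm (sqfree_power v m / of_nat m * of_real (exp (- s * U) * (1 + s * (U - ln (real m))))) \<le> sqfree_power (norm v) m / real m * (exp (- s * U) * (1 + s * U))"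
        unfolding norm_mult norm_divide norm_sqfree_power norm_of_nat norm_of_real
        by (intro mult_left_mono divide_nonneg_nonneg sqfree_power_nonneg) auto
    qed
    also have "\<dots> = (exp (- s * U) * (1 + s * U)) * log_mean (norm v) U"
      by (simp add: log_mean_def sum_distrib_left mult_ac)
    also have "\<dots> \<le> (exp (- s * U) * (1 + s * U)) * (C * U powr norm v)"
      using elim s C by (intro mult_left_mono mult_nonneg_nonneg) auto
    finally show ?case by (simp add: mult_ac)
  qed
  ultimately have R: "(R \<longlongrightarrow> 0) at_top" by (rule Lim_null_comparison[rotated])
  have "((\<lambda>U. (\<Sum>m\<in>nats_le_exp U. sqfree_power v m * of_real (real m powr (-1 - s))) - R U) \<longlongrightarrow>
     prime_product v s * exp (v * of_real (prime_zeta s)) - 0) at_top"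
    by (intro tendsto_diff R sqfree_dirichlet_limit s)
  then have "((\<lambda>U. of_real (s\<^sup>2) * integral {0..U} (\<lambda>u. log_mean_int v u * of_real (exp (- s * u)))) \<longlongrightarrow>
     prime_product v s * exp (v * of_real (prime_zeta s)) - 0) at_top"
  proof (rule Lim_transform_eventually)
    show "\<forall>\<^sub>F U in at_top. (\<Sum>m\<in>nats_le_exp U. sqfree_power v m * of_real (real m powr (-1 - s))) - R U
      = of_real (s\<^sup>2) * integral {0..U} (\<lambda>u. log_mean_int v u * of_real (exp (- s * u)))"
      using eventually_ge_at_top[of 0]
    proof eventually_elim
      case (elim U)
      show ?case
        unfolding integral_unique[OF has_integral_log_mean_int_exp[OF s(1) elim]] R_def sum_distrib_left sum_subtractf[symmetric]
      proof (intro sum.cong refl)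
        fix m assume m: "m \<in> nats_le_exp U"
        then have m0: "m > 0" by (simp add: nats_le_exp_def)
        define X where "X = exp (- s * U) * (1 + s * (U - ln (real m)))"
        have e: "real m powr (-1 - s) = exp (- s * ln (real m)) / real m"
          using m0 by (simp add: powr_def algebra_simps exp_add exp_minus exp_diff divide_inverse)
        have "s\<^sup>2 * ((exp (- s * ln (real m)) - X) / s\<^sup>2) = exp (- s * ln (real m)) - X" using s by simp
        then have "complex_of_real (s\<^sup>2) * of_real ((exp (- s * ln (real m)) - X) / s\<^sup>2) = of_real (exp (- s * ln (real m))) - of_real X"
          by (metis of_real_diff of_real_mult)
        then have "complex_of_real (s\<^sup>2) * (sqfree_power v m / of_nat m * of_real ((exp (- s * ln (real m)) - X) / s\<^sup>2)) = sqfree_power v m / of_nat m * (of_real (exp (- s * ln (real m))) - of_real X)"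
          by (metis mult.left_commute)
        also have "\<dots> = sqfree_power v m * of_real (real m powr (-1 - s)) - sqfree_power v m / of_nat m * of_real X"
          unfolding e by (simp add: right_diff_distrib)
        finally show "sqfree_power v m * of_real (real m powr (-1 - s)) - sqfree_power v m / of_nat m * of_real (exp (- s * U) * (1 + s * (U - ln (real m))))
          = complex_of_real (s\<^sup>2) * (sqfree_power v m / of_nat m * of_real ((exp (- s * ln (real m)) - exp (- s * U) * (1 + s * (U - ln (real m)))) / s\<^sup>2))"
          by (simp add: X_def)
      qed
    qed
  qed
  then show ?thesis by simp
qed

lemma log_mean_int_norm_le: "norm (log_mean_int v u) \<le> log_mean_int (norm v) u"
  unfolding log_mean_int_def
  by (rule order.trans[OF norm_sum], intro sum_mono)
     (auto simp: norm_mult norm_divide norm_sqfree_power nats_le_exp_def simp del: of_real_diff)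

text \<open>An Abelian argument: the coefficient of the main term of \<open>log_mean_int\<close> is read off its
  Laplace transform near \<open>0\<close>.\<close>

lemma log_mean_int_coefficient:
  fixes v q :: complex
  assumes v: "norm v - Re v < 1"
    and q: "\<And>u. u \<ge> 1 \<Longrightarrow> norm (log_mean_int v u - q * of_real u powr (1 + v)) \<le> C * u powr norm v" and C: "C \<ge> 0"
  shows "q * Gamma (2 + v) = prime_product v 0 * exp (v * of_real (meissel_mertens - euler_mascheroni))"
proof -
  have Re: "Re v > -1/2" using v complex_Re_le_cmod[of "-v"] by simp
  \<comment> \<open>Covers \<open>0 \<le> u < 1\<close>, where the asymptotic formula is not
    assumed. In the final estimate it contributes only \<open>B * s\<close>.\<close>
  define B where "B = log_mean (norm v) 1 + norm q"
  have B: "B \<ge> 0" unfolding B_def by (intro add_nonneg_nonneg log_mean_nonneg) auto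
  have bd: "norm (log_mean_int v u - q * of_real u powr (1 + v)) \<le> C * u powr norm v + B" if u: "u \<ge> 0" for u
  proof (cases "u \<ge> 1")
    case True
    then show ?thesis using q[OF True] B by linarith
  next
    case False
    have "norm (log_mean_int v u) \<le> log_mean_int (norm v) u" by (rule log_mean_int_norm_le)
    also have "\<dots> \<le> u * log_mean (norm v) u" using u by (intro log_mean_int_le) auto
    also have "\<dots> \<le> 1 * log_mean (norm v) 1" using False u by (intro mult_mono log_mean_mono log_mean_nonneg) auto
    finally have 1: "norm (log_mean_int v u) \<le> log_mean (norm v) 1" by simp
    have "u powr (1 + Re v) \<le> 1" using u False Re by (intro powr_le1) auto
    then have "norm (q * of_real u powr (1 + v)) \<le> norm q"
      using u by (simp add: norm_mult norm_of_real_powr mult_left_le)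
    with 1 have "norm (log_mean_int v u - q * of_real u powr (1 + v)) \<le> B"
      unfolding B_def by (intro order.trans[OF norm_triangle_ineq4] add_mono)
    moreover have "0 \<le> C * u powr norm v" using C by simp
    ultimately show ?thesis by linarith
  qed
  let ?H = "\<lambda>s. prime_product v s * exp (v * of_real (prime_zeta s))"
  have main: "norm (?H s - q * Gamma (2 + v) * of_real s powr (- v)) \<le> C * Gamma (norm v + 1) * s powr (1 - norm v) + B * s"
    if s: "0 < s" "s \<le> 1" for s
  proof -
    let ?T = "\<lambda>u. log_mean_int v u * of_real (exp (- s * u))"
    let ?P = "\<lambda>u. of_real u powr (2 + v - 1) * of_real (exp (- s * u)) :: complex"
    have Re2: "Re (2 + v) > 0" using Re by simp
    have lim: "((\<lambda>U. of_real (s\<^sup>2) * integral {0..U} ?T - of_real (s\<^sup>2) * (q * integral {0..U} ?P)) \<longlongrightarrow> ?H s - of_real (s\<^sup>2) * (q * (Gamma (2 + v) * of_real s powr (- (2 + v))))) at_top"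
      by (intro tendsto_diff log_mean_laplace s tendsto_mult tendsto_const integral_complex_powr_exp(2) Re2)
    have "norm (?H s - of_real (s\<^sup>2) * (q * (Gamma (2 + v) * of_real s powr (- (2 + v))))) \<le> s\<^sup>2 * (C * (Gamma (norm v + 1) * s powr (- norm v - 1)) + B * (Gamma (0 + 1) * s powr (- 0 - 1)))"
    proof (rule tendsto_upperbound[OF tendsto_norm[OF lim]])
      show "\<forall>\<^sub>F U in at_top. norm (of_real (s\<^sup>2) * integral {0..U} ?T - of_real (s\<^sup>2) * (q * integral {0..U} ?P)) \<le> s\<^sup>2 * (C * (Gamma (norm v + 1) * s powr (- norm v - 1)) + B * (Gamma (0 + 1) * s powr (- 0 - 1)))"
        using eventually_ge_at_top[of 0]
      proof eventually_elim
        case (elim U)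
        let ?r = "\<lambda>a u. u powr a * exp (- s * u)"
        have iT: "?T integrable_on {0..U}" using has_integral_log_mean_int_exp[OF s(1) elim] by blast
        have iP: "?P integrable_on {0..U}" using integral_complex_powr_exp(1)[OF Re2 s(1) elim] .
        have iPq: "(\<lambda>u. q * ?P u) integrable_on {0..U}" using iP by (rule integrable_on_mult_right)
        have ir: "?r a integrable_on {0..U}" "integral {0..U} (?r a) \<le> Gamma (a + 1) * s powr (- a - 1)" if "a \<ge> 0" for a
          using integral_powr_exp_le[OF that s(1) elim] by auto
        have "norm (integral {0..U} (\<lambda>u. ?T u - q * ?P u)) \<le> integral {0..U} (\<lambda>u. C * ?r (norm v) u + B * exp (- s * u))"
        proof (rule integral_norm_bound_integral)
          show "(\<lambda>u. ?T u - q * ?P u) integrable_on {0..U}" by (intro integrable_diff iT iPq)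
          show "(\<lambda>u. C * ?r (norm v) u + B * exp (- s * u)) integrable_on {0..U}"
            by (intro integrable_add integrable_on_mult_right ir integrable_continuous_real continuous_intros) auto
          fix u assume u: "u \<in> {0..U}"
          have "?T u - q * ?P u = (log_mean_int v u - q * of_real u powr (1 + v)) * of_real (exp (- s * u))"
            by (simp add: algebra_simps)
          then have "norm (?T u - q * ?P u) = norm (log_mean_int v u - q * of_real u powr (1 + v)) * exp (- s * u)"
            by (simp add: norm_mult)
          also have "\<dots> \<le> (C * u powr norm v + B) * exp (- s * u)"
            using bd[of u] u by (intro mult_right_mono) auto
          finally show "norm (?T u - q * ?P u) \<le> C * ?r (norm v) u + B * exp (- s * u)" by (simp add: algebra_simps)
        qed
        also have "\<dots> = C * integral {0..U} (?r (norm v)) + B * integral {0..U} (\<lambda>u. exp (- s * u))"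
        proof (subst integral_add)
          show "(\<lambda>u. C * ?r (norm v) u) integrable_on {0..U}" by (intro integrable_on_mult_right ir) auto
          show "(\<lambda>u. B * exp (- s * u)) integrable_on {0..U}" by (intro integrable_continuous_real continuous_intros)
        qed (simp only: integral_mult_right)
        also have "integral {0..U} (\<lambda>u. exp (- s * u)) = integral {0..U} (?r 0)"
          by (rule integral_spike[of "{0}"]) auto
        also have "C * integral {0..U} (?r (norm v)) + B * integral {0..U} (?r 0) \<le> C * (Gamma (norm v + 1) * s powr (- norm v - 1)) + B * (Gamma (0 + 1) * s powr (- 0 - 1))"
          by (intro add_mono mult_left_mono ir C B) auto
        finally have "norm (integral {0..U} ?T - q * integral {0..U} ?P) \<le> C * (Gamma (norm v + 1) * s powr (- norm v - 1)) + B * (Gamma (0 + 1) * s powr (- 0 - 1))"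
          using integral_diff[OF iT iPq] by simp
        then have "s\<^sup>2 * norm (integral {0..U} ?T - q * integral {0..U} ?P) \<le> s\<^sup>2 * (C * (Gamma (norm v + 1) * s powr (- norm v - 1)) + B * (Gamma (0 + 1) * s powr (- 0 - 1)))"
          by (rule mult_left_mono) auto
        moreover have "norm (of_real (s\<^sup>2) * integral {0..U} ?T - of_real (s\<^sup>2) * (q * integral {0..U} ?P)) = s\<^sup>2 * norm (integral {0..U} ?T - q * integral {0..U} ?P)"
          by (simp add: norm_mult norm_power flip: right_diff_distrib)
        ultimately show ?case by simp
      qed
    qed auto
    also have "of_real (s\<^sup>2) * (q * (Gamma (2 + v) * of_real s powr (- (2 + v)))) = q * Gamma (2 + v) * of_real s powr (- v)"
    proof -
      have "of_real (s\<^sup>2) * (of_real s powr (- (2 + v))) = (of_real s powr (- v) :: complex)"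
      proof -
        have "of_real (s\<^sup>2) = (of_real s powr 2 :: complex)" using s powr_complexpow[of "complex_of_real s" 2] by simp
        then have "of_real (s\<^sup>2) * (of_real s powr (- (2 + v))) = (of_real s powr (2 + - (2 + v)) :: complex)"
          by (simp only: powr_add)
        then show ?thesis by simp
      qed
      then show ?thesis by (metis (no_types, lifting) mult.assoc mult.commute)
    qed
    also have "s\<^sup>2 * (C * (Gamma (norm v + 1) * s powr (- norm v - 1)) + B * (Gamma (0 + 1) * s powr (- 0 - 1))) = C * Gamma (norm v + 1) * s powr (1 - norm v) + B * s"
    proof -
      have "s\<^sup>2 = s powr 2" using s by simp
      then have e1: "s\<^sup>2 * s powr (- norm v - 1) = s powr (1 - norm v)"
        using s by (simp add: powr_add[symmetric] del: powr_numeral)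
      have e2: "s\<^sup>2 * s powr (- 0 - 1) = s"
        using s by (simp add: powr_minus power2_eq_square)
      have e3: "s\<^sup>2 * (C * (G * a) + B * (G' * b)) = C * G * (s\<^sup>2 * a) + B * G' * (s\<^sup>2 * b)" for G G' a b
        by (simp add: algebra_simps)
      show ?thesis unfolding e3 e1 e2 by simp
    qed
    finally show ?thesis .
  qed
  \<comment> \<open>After multiplication by \<open>s powr v\<close> the main error has the exponent
    \<open>1 - norm v + Re v\<close>, which is positive exactly by the hypothesis on
    \<open>v\<close>.\<close>
  have "((\<lambda>s. of_real s powr v * ?H s - q * Gamma (2 + v)) \<longlongrightarrow> 0) (at_right 0)"
  proof (rule Lim_null_comparison)
    show "eventually (\<lambda>s. norm (of_real s powr v * ?H s - q * Gamma (2 + v)) \<le> C * Gamma (norm v + 1) * s powr (1 - norm v + Re v) + B * s powr (1 + Re v)) (at_right 0)"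
      using eventually_at_right_less[of 0] eventually_at_right_real[of 0 1, OF zero_less_one]
    proof eventually_elim
      case (elim s)
      then have s: "0 < s" "s \<le> 1" by auto
      have "of_real s powr v * (of_real s powr (- v)) = (1 :: complex)" using s by (subst powr_add[symmetric]) auto
      then have "of_real s powr v * ?H s - q * Gamma (2 + v) = of_real s powr v * (?H s - q * Gamma (2 + v) * of_real s powr (- v))"
        by (simp add: right_diff_distrib mult.left_commute)
      then have "norm (of_real s powr v * ?H s - q * Gamma (2 + v)) = s powr Re v * norm (?H s - q * Gamma (2 + v) * of_real s powr (- v))"
        using s by (simp only: norm_mult norm_of_real_powr)
      also have "\<dots> \<le> s powr Re v * (C * Gamma (norm v + 1) * s powr (1 - norm v) + B * s)"
        by (intro mult_left_mono main s) auto
      also have "\<dots> = C * Gamma (norm v + 1) * s powr (1 - norm v + Re v) + B * s powr (1 + Re v)"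
        using s powr_add[of s "1 - norm v" "Re v"] powr_add[of s 1 "Re v"] by (simp add: algebra_simps)
      finally show ?case .
    qed
    have "((\<lambda>s. s powr e) \<longlongrightarrow> 0) (at_right 0)" if "e > 0" for e :: real
      using that by real_asymp
    then have "((\<lambda>s. C * Gamma (norm v + 1) * s powr (1 - norm v + Re v) + B * s powr (1 + Re v)) \<longlongrightarrow> C * Gamma (norm v + 1) * 0 + B * 0) (at_right 0)"
      using v Re by (intro tendsto_intros) auto
    then show "((\<lambda>s. C * Gamma (norm v + 1) * s powr (1 - norm v + Re v) + B * s powr (1 + Re v)) \<longlongrightarrow> 0) (at_right 0)" by simp
  qed
  then have "((\<lambda>s. of_real s powr v * ?H s) \<longlongrightarrow> q * Gamma (2 + v)) (at_right 0)"
    using Lim_null by blast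
  then show ?thesis using sqfree_dirichlet_at_0 tendsto_unique[OF trivial_limit_at_right_real] by blast
qed

text \<open>The constant of the main term. Writing it with \<open>rGamma\<close> makes it entire, so
  it is bounded on every disc and may be composed with \<open>exp z - 1\<close>.\<close>

definition log_mean_coeff :: "complex \<Rightarrow> complex" where
  "log_mean_coeff v = prime_product v 0 * exp (v * of_real (meissel_mertens - euler_mascheroni)) * rGamma (1 + v)"

lemma holomorphic_log_mean_coeff: "log_mean_coeff holomorphic_on UNIV"
  unfolding log_mean_coeff_def
  by (intro holomorphic_intros holomorphic_prime_product)

text \<open>The estimate has to be uniform on a full disc, as \<open>exp z - 1\<close> takes all
  directions. Near the positive axis the asymptotics of the integral is inserted into the recursion.
  Elsewhere both the mean and the main term are below the error, since there
  \<open>Re v < norm v - 1 + \<eta>\<close>.\<close>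

theorem log_mean_asymp:
  assumes \<eta>: "0 < \<eta>" "\<eta> \<le> 1 / 2"
  obtains C where "C > 0" "\<And>v u. norm (v::complex) \<le> V \<Longrightarrow> u \<ge> 1 \<Longrightarrow>
    norm (log_mean v u - log_mean_coeff v * of_real u powr v) \<le> C * u powr (norm v - 1 + 2 * \<eta>)"
proof -
  obtain C1 where C1: "C1 > 0" "\<And>v. norm (v::complex) \<le> V \<Longrightarrow> norm v - Re v \<le> 1 - \<eta> \<Longrightarrow>
    \<exists>q. \<forall>u\<ge>1. norm (log_mean_int v u - q * of_real u powr (1 + v)) \<le> C1 * u powr norm v"
    using log_mean_int_asymp[OF \<eta>(1), where V = V] by blast
  obtain C2 where C2: "C2 > 0" "\<And>v u. norm (v::complex) \<le> V \<Longrightarrow> norm v - Re v \<ge> 1 - \<eta> \<Longrightarrow> u \<ge> 1 \<Longrightarrow>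
    norm (log_mean v u) \<le> C2 * u powr (norm v - 1 + 2 * \<eta>)"
    using log_mean_le_off_axis[OF \<eta>(1), where V = V] by blast
  obtain C3 where C3: "C3 > 0" "\<And>v u. norm (v::complex) \<le> V \<Longrightarrow> 1 \<le> u \<Longrightarrow>
    norm (of_real u * log_mean v u - (1 + v) * log_mean_int v u) \<le> C3 * u powr norm v"
    using log_mean_recursion_powr[where V = V] by blast
  have "compact (log_mean_coeff ` cball 0 V)"
    using holomorphic_log_mean_coeff by (intro compact_continuous_image holomorphic_on_imp_continuous_on) (auto elim: holomorphic_on_subset)
  then obtain D where D: "D > 0" "\<And>v. norm v \<le> V \<Longrightarrow> norm (log_mean_coeff v) \<le> D"
    using bounded_pos[of "log_mean_coeff ` cball 0 V"] compact_imp_bounded by (auto simp: image_iff)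
  define C where "C = C3 + (1 + \<bar>V\<bar>) * C1 + C2 + D"
  have "norm (log_mean v u - log_mean_coeff v * of_real u powr v) \<le> C * u powr (norm v - 1 + 2 * \<eta>)"
    if v: "norm v \<le> V" and u: "u \<ge> 1" for v :: complex and u
  proof (cases "norm v - Re v \<le> 1 - \<eta>")
    case True
    then obtain q where q: "\<And>u. u \<ge> 1 \<Longrightarrow> norm (log_mean_int v u - q * of_real u powr (1 + v)) \<le> C1 * u powr norm v"
      using C1(2)[OF v] by blast
    have "Re v > -1/2" using True \<eta> complex_Re_le_cmod[of "-v"] by simp
    then have nz: "1 + v \<notin> \<int>\<^sub>\<le>\<^sub>0" by (auto elim!: nonpos_Ints_cases simp: complex_eq_iff)
    have "q * Gamma (2 + v) = prime_product v 0 * exp (v * of_real (meissel_mertens - euler_mascheroni))"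
      using True \<eta> C1 q by (intro log_mean_int_coefficient[where C = C1]) auto
    moreover have "Gamma (2 + v) = (1 + v) * Gamma (1 + v)"
      using Gamma_plus1[OF nz] by (simp add: add_ac)
    moreover have "Gamma (1 + v) * rGamma (1 + v) = 1"
      using nz by (simp add: rGamma_inverse_Gamma Gamma_eq_zero_iff)
    \<comment> \<open>Differentiating \<open>q * u powr (1 + v)\<close> brings down
      \<open>1 + v\<close>, which cancels in
      \<open>Gamma (2 + v) = (1 + v) * Gamma (1 + v)\<close>.\<close>
    ultimately have coeff: "(1 + v) * q = log_mean_coeff v"
      unfolding log_mean_coeff_def by (metis (no_types, lifting) mult.assoc mult.commute mult_1_right)
    have "norm (of_real u * (log_mean v u - log_mean_coeff v * of_real u powr v)) \<le> C3 * u powr norm v + (1 + \<bar>V\<bar>) * (C1 * u powr norm v)"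
    proof -
      have "of_real u powr (1 + v) = of_real u * (of_real u powr v :: complex)" using u by (simp add: powr_add)
      then have "of_real u * (log_mean v u - log_mean_coeff v * of_real u powr v) =
        (of_real u * log_mean v u - (1 + v) * log_mean_int v u) + (1 + v) * (log_mean_int v u - q * of_real u powr (1 + v))"
        unfolding coeff[symmetric] by (simp add: algebra_simps)
      moreover have "norm (1 + v) \<le> 1 + \<bar>V\<bar>" using v norm_triangle_ineq[of 1 v] by simp
      ultimately show ?thesis
        using C3(2)[OF v u] q[OF u]
        by (auto simp: norm_mult intro!: order.trans[OF norm_triangle_ineq] add_mono mult_mono)
    qed
    also have "\<dots> \<le> C * u powr norm v"
      using C2 D by (simp add: C_def algebra_simps)
    also have "u powr norm v = u * u powr (norm v - 1)" using u powr_mult_base[of u "norm v - 1"] by simp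
    finally have "norm (log_mean v u - log_mean_coeff v * of_real u powr v) \<le> C * u powr (norm v - 1)"
      using u by (simp add: norm_mult)
    also have "\<dots> \<le> C * u powr (norm v - 1 + 2 * \<eta>)"
      using u \<eta> C1(1) C2(1) C3(1) D(1) by (intro mult_left_mono powr_mono) (auto simp: C_def intro!: add_nonneg_nonneg mult_nonneg_nonneg)
    finally show ?thesis .
  next
    case False
    have "norm (log_mean_coeff v * of_real u powr v) \<le> D * u powr Re v"
      using D v u by (simp add: norm_mult norm_of_real_powr mult_right_mono)
    also have "\<dots> \<le> D * u powr (norm v - 1 + 2 * \<eta>)"
      using False u D \<eta> by (intro mult_left_mono powr_mono) auto
    finally have "norm (log_mean v u - log_mean_coeff v * of_real u powr v) \<le> C2 * u powr (norm v - 1 + 2 * \<eta>) + D * u powr (norm v - 1 + 2 * \<eta>)"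
      using False C2(2)[OF v _ u] by (intro order.trans[OF norm_triangle_ineq4] add_mono) auto
    also have "\<dots> \<le> C * u powr (norm v - 1 + 2 * \<eta>)"
    proof -
      have "0 \<le> (1 + \<bar>V\<bar>) * C1" using C1(1) by simp
      then show ?thesis unfolding C_def distrib_right[symmetric] using C3(1) by (intro mult_right_mono) auto
    qed
    finally show ?thesis .
  qed
  moreover have "C > 0"
  proof -
    have "0 \<le> (1 + \<bar>V\<bar>) * C1" using C1(1) by simp
    then show ?thesis unfolding C_def using C2(1) C3(1) D(1) by linarith
  qed
  ultimately show ?thesis using that by blast
qed

subsection \<open>Mertens' second theorem\<close>

lemma holomorphic_sqfree_power [holomorphic_intros]: "(\<lambda>v. sqfree_power v m) holomorphic_on A"
  by (cases "squarefree m") (auto simp: sqfree_power_def intro!: holomorphic_intros)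

lemma log_mean_coeff_0 [simp]: "log_mean_coeff 0 = 1"
  by (simp add: log_mean_coeff_def)

text \<open>The prime product contributes 0, the exponential
  \<open>meissel_mertens - euler_mascheroni\<close>, and \<open>rGamma (1 + v)\<close> contributes
  \<open>- Digamma 1\<close>, which is \<open>euler_mascheroni\<close>.\<close>

lemma has_field_derivative_log_mean_coeff_0:
  "(log_mean_coeff has_field_derivative of_real meissel_mertens) (at 0)"
proof -
  have "((\<lambda>v. prime_product v 0) has_field_derivative 0) (at 0)"
    using holomorphic_derivI[OF holomorphic_prime_product, of 0] deriv_prime_product_0 by simp
  moreover have "((\<lambda>v::complex. rGamma (1 + v)) has_field_derivative - rGamma (1 + 0) * Digamma (1 + 0) * (0 + 1)) (at 0)"
    by (rule DERIV_chain2[OF has_field_derivative_rGamma_no_nonpos_int])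
       (auto intro!: derivative_eq_intros)
  ultimately show ?thesis
    unfolding log_mean_coeff_def
    by (auto intro!: derivative_eq_intros simp: Digamma_1 algebra_simps)
qed

lemma log_mean_0: "u \<ge> 0 \<Longrightarrow> log_mean (0::complex) u = 1"
proof -
  assume u: "u \<ge> 0"
  have "log_mean (0::complex) u = (\<Sum>m\<in>{1}. sqfree_power 0 m / of_nat m)"
    unfolding log_mean_def
  proof (intro sum.mono_neutral_right finite_nats_le_exp)
    show "\<forall>m\<in>nats_le_exp u - {1}. sqfree_power (0::complex) m / of_nat m = 0"
      by (auto simp: nats_le_exp_def sqfree_power_def omega_def prime_factorization_empty_iff card_gt_0_iff)
  qed (use u in \<open>auto simp: nats_le_exp_def\<close>)
  then show ?thesis by (simp add: sqfree_power_def)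
qed

lemma omega_eq_1_squarefree_iff: "squarefree m \<and> omega m = 1 \<longleftrightarrow> prime m"
proof
  assume m: "squarefree m \<and> omega m = 1"
  then obtain p where p: "prime_factors m = {p}" by (auto simp: omega_def card_1_singleton_iff)
  then have pp: "prime p" "p dvd m" by (auto simp: set_eq_iff in_prime_factors_iff)
  have "m \<noteq> 0" using m not_squarefree_0 by metis
  obtain k where k: "m = p * k" using pp by blast
  with \<open>m \<noteq> 0\<close> have kpos: "k > 0" by (cases k) auto
  have nd: "\<not> p dvd k" using squarefree_prime_mult[OF pp(1) kpos] m k by simp
  have "k = 1"
  proof (rule ccontr)
    assume "k \<noteq> 1"
    then obtain q where q: "prime q" "q dvd k" using prime_factor_nat by blast
    then have "q \<in> prime_factors m" using k \<open>m \<noteq> 0\<close> by (auto simp: in_prime_factors_iff)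
    with p q nd show False by auto
  qed
  with k pp show "prime m" by simp
next
  assume "prime m"
  then show "squarefree m \<and> omega m = 1" by (auto simp: omega_def prime_prime_factors squarefree_prime)
qed

lemma has_field_derivative_log_mean_0:
  "((\<lambda>v::complex. log_mean v u) has_field_derivative of_real (\<Sum>p\<in>primes_le (exp u). 1 / real p)) (at 0)"
proof -
  have "((\<lambda>v::complex. log_mean v u) has_field_derivative (\<Sum>m\<in>nats_le_exp u. if squarefree m \<and> omega m = 1 then 1 / of_nat m else 0)) (at 0)"
    unfolding log_mean_def
  proof (intro DERIV_sum)
    fix m assume "m \<in> nats_le_exp u"
    then have m: "m > 0" by (simp add: nats_le_exp_def)
    show "((\<lambda>v::complex. sqfree_power v m / of_nat m) has_field_derivative (if squarefree m \<and> omega m = 1 then 1 / of_nat m else 0)) (at 0)"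
    proof (cases "squarefree m")
      case True
      have "((\<lambda>v::complex. v ^ omega m / of_nat m) has_field_derivative (of_nat (omega m) * 0 ^ (omega m - 1)) / of_nat m) (at 0)"
        using m by (auto intro!: derivative_eq_intros)
      moreover have "(of_nat (omega m) * (0::complex) ^ (omega m - 1)) = (if omega m = 1 then 1 else 0)"
        by (cases "omega m"; cases "omega m - 1") auto
      ultimately show ?thesis using True by (simp add: sqfree_power_def if_distrib[of "\<lambda>x. x / _"] cong: if_cong)
    qed (simp add: sqfree_power_def)
  qed
  also have "(\<Sum>m\<in>nats_le_exp u. if squarefree m \<and> omega m = 1 then 1 / of_nat m else 0) = (\<Sum>m\<in>primes_le (exp u). 1 / complex_of_nat m)"
    unfolding omega_eq_1_squarefree_iff
    by (rule sum.mono_neutral_cong_right[OF finite_nats_le_exp])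
       (auto simp: primes_le_def nats_le_exp_eq prime_gt_0_nat)
  also have "\<dots> = of_real (\<Sum>p\<in>primes_le (exp u). 1 / real p)" by simp
  finally show ?thesis .
qed

text \<open>The derivative of \<open>log_mean v u * u powr (- v)\<close> at \<open>v = 0\<close> is
  the sum of the reciprocals of the primes minus \<open>ln u\<close>. These functions converge
  uniformly near 0 to \<open>log_mean_coeff\<close>, and so do their derivatives at 0.\<close>

theorem Mertens_second:
  "((\<lambda>x. (\<Sum>p\<in>primes_le x. 1 / real p) - ln (ln x)) \<longlongrightarrow> meissel_mertens) at_top"
proof -
  obtain C where C: "C > 0" "\<And>v u. norm (v::complex) \<le> 1/8 \<Longrightarrow> u \<ge> 1 \<Longrightarrow>
    norm (log_mean v u - log_mean_coeff v * of_real u powr v) \<le> C * u powr (norm v - 1 + 2 * (1/8))"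
    using log_mean_asymp[of "1/8" "1/8"] by auto
  let ?f = "\<lambda>u (v::complex). log_mean v u * of_real u powr (- v)"
  \<comment> \<open>With both the radius and \<eta> equal to 1/8 the exponent is
    \<open>norm v - 3/4 - Re v\<close>, which is at most \<open>2/8 - 3/4 = -1/2\<close>.\<close>
  have bd: "norm (?f u v - log_mean_coeff v) \<le> C * u powr (-1/2)" if v: "norm v \<le> 1/8" and u: "u \<ge> 1" for u v
  proof -
    have "of_real u powr v * of_real u powr (- v) = (1::complex)" using u by (subst powr_add[symmetric]) auto
    then have "?f u v - log_mean_coeff v = (log_mean v u - log_mean_coeff v * of_real u powr v) * of_real u powr (- v)"
      by (simp add: algebra_simps)
    then have "norm (?f u v - log_mean_coeff v) = norm (log_mean v u - log_mean_coeff v * of_real u powr v) * u powr (- Re v)"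
      using u by (simp add: norm_mult norm_of_real_powr)
    also have "\<dots> \<le> C * u powr (norm v - 1 + 2 * (1/8)) * u powr (- Re v)"
      by (intro mult_right_mono C(2) v u) auto
    also have "\<dots> = C * u powr (norm v - 3/4 - Re v)" by (simp add: mult.assoc powr_add[symmetric])
    also have "\<dots> \<le> C * u powr (-1/2)"
      using C(1) u v complex_Re_le_cmod[of "-v"] by (intro mult_left_mono powr_mono) auto
    finally show ?thesis .
  qed
  have "uniform_limit (ball 0 (1/8)) ?f log_mean_coeff at_top"
  proof (rule uniform_limitI)
    fix e :: real assume e: "e > 0"
    have "((\<lambda>u. C * u powr (-1/2)) \<longlongrightarrow> 0) at_top" by real_asymp
    then have "\<forall>\<^sub>F u in at_top. C * u powr (-1/2) < e" using e by (auto dest: order_tendstoD(2))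
    then show "\<forall>\<^sub>F u in at_top. \<forall>v\<in>ball 0 (1/8). dist (?f u v) (log_mean_coeff v) < e"
      using eventually_ge_at_top[of 1]
    proof eventually_elim
      case (elim u)
      show ?case
      proof
        fix v :: complex assume "v \<in> ball 0 (1/8)"
        then have "norm (?f u v - log_mean_coeff v) \<le> C * u powr (-1/2)" using elim by (intro bd) auto
        with elim show "dist (?f u v) (log_mean_coeff v) < e" by (simp add: dist_norm)
      qed
    qed
  qed
  then have "((\<lambda>u. (deriv ^^ 1) (?f u) 0) \<longlongrightarrow> (deriv ^^ 1) log_mean_coeff 0) at_top"
  proof (rule higher_deriv_complex_uniform_limit)
    show "\<forall>\<^sub>F u in at_top. ?f u holomorphic_on ball 0 (1/8)"
      using eventually_gt_at_top[of 0]
    proof eventually_elim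
      case (elim u)
      then show ?case unfolding log_mean_def
        by (auto intro!: holomorphic_intros simp: powr_def nats_le_exp_def)
    qed
  qed auto
  then have "((\<lambda>u. deriv (?f u) 0) \<longlongrightarrow> of_real meissel_mertens) at_top"
    using DERIV_imp_deriv[OF has_field_derivative_log_mean_coeff_0] by simp
  then have "((\<lambda>u. complex_of_real ((\<Sum>p\<in>primes_le (exp u). 1 / real p) - ln u)) \<longlongrightarrow> of_real meissel_mertens) at_top"
  proof (rule Lim_transform_eventually)
    show "\<forall>\<^sub>F u in at_top. deriv (?f u) 0 = complex_of_real ((\<Sum>p\<in>primes_le (exp u). 1 / real p) - ln u)"
      using eventually_ge_at_top[of 1]
    proof eventually_elim
      case (elim u)
      have "((\<lambda>v::complex. of_real u powr (- v)) has_field_derivative - of_real (ln u)) (at 0)"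
        using elim by (auto intro!: derivative_eq_intros simp: powr_def Ln_of_real)
      from DERIV_mult[OF has_field_derivative_log_mean_0[of u] this]
      have "(?f u has_field_derivative (of_real (\<Sum>p\<in>primes_le (exp u). 1 / real p) - of_real (ln u))) (at 0)"
        using elim by (simp add: log_mean_0)
      from DERIV_imp_deriv[OF this] show ?case by simp
    qed
  qed
  then have "((\<lambda>u. (\<Sum>p\<in>primes_le (exp u). 1 / real p) - ln u) \<longlongrightarrow> meissel_mertens) at_top"
    by (rule tendsto_of_real_iff[THEN iffD1])
  from filterlim_compose[OF this ln_at_top]
  have "((\<lambda>x. (\<Sum>p\<in>primes_le (exp (ln x)). 1 / real p) - ln (ln x)) \<longlongrightarrow> meissel_mertens) at_top" .
  then show ?thesis
  proof (rule Lim_transform_eventually)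
    show "\<forall>\<^sub>F x in at_top. (\<Sum>p\<in>primes_le (exp (ln x)). 1 / real p) - ln (ln x) = (\<Sum>p\<in>primes_le x. 1 / real p) - ln (ln x)"
      using eventually_gt_at_top[of 0] by eventually_elim simp
  qed
qed

subsection \<open>The moment generating function of \<open>omega\<close>\<close>

text \<open>A counterpart of \<open>avg_upto\<close> that also takes complex values, for the
  generating functions.\<close>

definition mean_upto :: "real \<Rightarrow> (nat \<Rightarrow> 'a) \<Rightarrow> 'a :: real_normed_field" where
  "mean_upto x f = (\<Sum>n | 1 \<le> n \<and> real n \<le> x. f n) / of_nat (nat \<lfloor>x\<rfloor>)"

lemma nats_upto_eq: "x > 0 \<Longrightarrow> {n. 1 \<le> n \<and> real n \<le> x} = nats_le_exp (ln x)"
  by (auto simp: nats_le_exp_eq)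

lemma nats_upto_eq_Icc: "{n. 1 \<le> n \<and> real n \<le> x} = {1..nat \<lfloor>x\<rfloor>}"
  using of_nat_le_iff_le_nat_floor[of _ x] by auto

lemma avg_upto_eq_mean_upto: "x \<ge> 1 \<Longrightarrow> avg_upto x f = mean_upto x f"
  unfolding avg_upto_def mean_upto_def nats_upto_eq_Icc
  by (subst integral_pmf_of_set) (auto simp: Suc_le_eq)

text \<open>The Euler product over the primes dividing \<open>n\<close> with weight 1: each factor
  is \<open>1 + (w - 1)\<close>, and the squarefree numbers over these primes are the squarefree
  divisors of \<open>n\<close>.\<close>

lemma power_omega_eq_sum_divisors:
  fixes w :: "'a :: real_normed_field"
  assumes "n > 0"
  shows "w ^ omega n = (\<Sum>d | d dvd n. sqfree_power (w - 1) d)"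
proof -
  have "(\<Sum>d\<in>sqfree_over (prime_factors n). sqfree_power (w - 1) d * 1) = (\<Prod>p\<in>prime_factors n. 1 + (w - 1) * 1)"
    by (rule conjunct2, rule prod_prime_euler[where q = "\<lambda>_. 1"]) auto
  then have "w ^ omega n = (\<Sum>d\<in>sqfree_over (prime_factors n). sqfree_power (w - 1) d)"
    by (simp add: omega_def)
  also have "sqfree_over (prime_factors n) = {d. d dvd n \<and> squarefree d}"
  proof (intro equalityI subsetI)
    fix d assume d: "d \<in> sqfree_over (prime_factors n)"
    then have d0: "d \<noteq> 0" using not_squarefree_0 unfolding sqfree_over_def by (metis (mono_tags) mem_Collect_eq)
    have "d dvd n"
    proof (rule multiplicity_le_imp_dvd[OF d0])
      fix p :: nat assume p: "prime p"
      show "multiplicity p d \<le> multiplicity p n"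
      proof (cases "p dvd d")
        case True
        then have "p dvd n" using d d0 p by (auto simp: sqfree_over_def in_prime_factors_iff subset_iff)
        then have "multiplicity p n \<ge> 1" using p assms
            by (simp add: Suc_le_eq prime_multiplicity_gt_zero_iff)
        moreover have "multiplicity p d = 1" using True d d0 p squarefree_factorial_semiring'[OF d0]
          by (auto simp: sqfree_over_def in_prime_factors_iff)
        ultimately show ?thesis by simp
      qed (simp add: not_dvd_imp_multiplicity_0)
    qed
    with d show "d \<in> {d. d dvd n \<and> squarefree d}" by (auto simp: sqfree_over_def)
  next
    fix d assume "d \<in> {d. d dvd n \<and> squarefree d}"
    then show "d \<in> sqfree_over (prime_factors n)"
      using assms by (auto simp: sqfree_over_def in_prime_factors_iff intro: dvd_trans)
  qed
  also have "(\<Sum>d | d dvd n \<and> squarefree d. sqfree_power (w - 1) d) = (\<Sum>d | d dvd n. sqfree_power (w - 1) d)"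
    by (rule sum.mono_neutral_left) (use assms in \<open>auto simp: sqfree_power_def\<close>)
  finally show ?thesis .
qed

text \<open>Interchanging the sums leaves \<open>N div d\<close> in place of \<open>N / d\<close>.
  The difference is at most 1, so the total error is the sum of
  \<open>sqfree_power (norm (w - 1)) d\<close>, for which \<open>sum_sqfree_power_le\<close> saves a
  factor \<open>ln x\<close>. The factor 2 comes from \<open>x \<le> 2 * N\<close> for the integer
  part \<open>N\<close> of \<open>x\<close>.\<close>

lemma mean_power_omega_log_mean:
  obtains C where "C > 0" "\<And>(w::complex) x. norm (w - 1) \<le> V \<Longrightarrow> x \<ge> exp 1 \<Longrightarrow>
    norm (mean_upto x (\<lambda>n. w ^ omega n) - log_mean (w - 1) (ln x)) \<le> C * ln x powr (norm (w - 1) - 1)"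
proof -
  obtain C where C: "C > 0" "\<And>t u. 0 \<le> t \<Longrightarrow> t \<le> V \<Longrightarrow> 1 \<le> u \<Longrightarrow>
    (\<Sum>m\<in>nats_le_exp u. sqfree_power t m) \<le> C * exp u * u powr (t - 1)"
    using sum_sqfree_power_le[where V = V] by blast
  have "norm (mean_upto x (\<lambda>n. w ^ omega n) - log_mean (w - 1) (ln x)) \<le> 2 * C * ln x powr (norm (w - 1) - 1)"
    if w: "norm (w - 1) \<le> V" and ex: "x \<ge> exp 1" for w :: complex and x
  proof -
    have x: "x \<ge> 2" using exp_ge_add_one_self[of 1] ex by simp
    then have u: "ln x \<ge> 1" using ex by (subst ln_ge_iff) auto
    define N where "N = nat \<lfloor>x\<rfloor>"
    have N: "real N \<le> x" "x \<le> 2 * real N" "N > 0" using x by (auto simp: N_def le_nat_floor) linarith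
    have set: "nats_le_exp (ln x) = {1..N}" "{n. 1 \<le> n \<and> real n \<le> x} = {1..N}"
      using nats_upto_eq[of x] nats_upto_eq_Icc[of x] x by (auto simp: N_def)
    have "(\<Sum>n=1..N. w ^ omega n) = (\<Sum>n=1..N. \<Sum>d | d dvd n. sqfree_power (w - 1) d)"
      by (intro sum.cong refl power_omega_eq_sum_divisors) auto
    also have "\<dots> = (\<Sum>n=1..N. \<Sum>d\<in>{d\<in>{1..N}. d dvd n}. sqfree_power (w - 1) d)"
      by (intro sum.cong refl) (auto dest: dvd_imp_le dvd_pos_nat)
    also have "\<dots> = (\<Sum>d=1..N. \<Sum>n\<in>{n\<in>{1..N}. d dvd n}. sqfree_power (w - 1) d)"
      by (rule sum.swap_restrict) auto
    also have "\<dots> = (\<Sum>d=1..N. of_nat (N div d) * sqfree_power (w - 1) d)"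
    proof (intro sum.cong refl)
      fix d assume "d \<in> {1..N}"
      then have "d > 0" by simp
      then show "(\<Sum>n\<in>{n\<in>{1..N}. d dvd n}. sqfree_power (w - 1) d) = of_nat (N div d) * sqfree_power (w - 1) d"
        by (simp only: sum_constant card_multiples_upto)
    qed
    finally have "(\<Sum>n=1..N. w ^ omega n) - of_nat N * log_mean (w - 1) (ln x)
       = (\<Sum>d=1..N. of_real (real (N div d) - real N / real d) * sqfree_power (w - 1) d)"
      unfolding log_mean_def set
      by (simp add: sum_distrib_left sum_subtractf[symmetric] algebra_simps)
    also have "norm \<dots> \<le> (\<Sum>d=1..N. sqfree_power (norm (w - 1)) d)"
    proof (rule order.trans[OF norm_sum], rule sum_mono)
      fix d
      have "\<bar>real (N div d) - real N / real d\<bar> \<le> 1"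
        using floor_divide_of_nat_eq[of N d, where ?'a = real] by linarith
      then show "norm (complex_of_real (real (N div d) - real N / real d) * sqfree_power (w - 1) d) \<le> sqfree_power (norm (w - 1)) d"
        unfolding norm_mult norm_of_real norm_sqfree_power
        by (intro mult_left_le_one_le sqfree_power_nonneg) auto
    qed
    also have "\<dots> \<le> C * exp (ln x) * ln x powr (norm (w - 1) - 1)"
      using C(2)[of "norm (w - 1)" "ln x"] w u set by simp
    also have "\<dots> \<le> C * (2 * real N) * ln x powr (norm (w - 1) - 1)"
      using N x C(1) by (intro mult_right_mono mult_left_mono) auto
    finally have "norm ((\<Sum>n=1..N. w ^ omega n) - of_nat N * log_mean (w - 1) (ln x)) \<le> real N * (2 * C * ln x powr (norm (w - 1) - 1))"
      by (simp add: mult_ac)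
    moreover have "(\<Sum>n=1..N. w ^ omega n) - of_nat N * log_mean (w - 1) (ln x) = of_nat N * (mean_upto x (\<lambda>n. w ^ omega n) - log_mean (w - 1) (ln x))"
      using N unfolding mean_upto_def set N_def[symmetric] by (simp add: algebra_simps)
    ultimately show ?thesis using N by (simp add: norm_mult)
  qed
  moreover have "2 * C > 0" using C by simp
  ultimately show ?thesis using that by blast
qed

section \<open>An inequality for the exponential function on circles\<close>

lemma exp_le_chord:
  fixes c y :: real assumes "-1 \<le> c" "c \<le> 1"
  shows "exp (c * y) \<le> cosh y + c * sinh y"
proof -
  have "exp (((1 - c) / 2) *\<^sub>R (-y) + ((1 + c) / 2) *\<^sub>R y) \<le> ((1 - c) / 2) * exp (-y) + ((1 + c) / 2) * exp y"
    using convex_onD[OF exp_convex, of "(1 + c) / 2" "-y" y] assms by (simp add: field_simps)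
  also have "((1 - c) / 2) *\<^sub>R (-y) + ((1 + c) / 2) *\<^sub>R y = c * y" by (simp add: field_simps)
  also have "((1 - c) / 2) * exp (-y) + ((1 + c) / 2) * exp y = cosh y + c * sinh y"
    by (simp add: cosh_def sinh_def field_simps)
  finally show ?thesis .
qed

text \<open>Integrate the derivative of \<open>exp (t z)\<close> over \<open>t\<close> from 0 to 1
  and bound its norm by the chord. The result is linear in the cosine \<open>Re z / r\<close>, so
  later only the two real points of the circle have to be checked.\<close>

lemma norm_exp_minus_1_le_chord:
  fixes z :: complex
  assumes "r = norm z" "r > 0"
  shows "norm (exp z - 1) \<le> sinh r + (Re z / r) * (cosh r - 1)"
proof -
  define c where "c = Re z / r"
  have c: "-1 \<le> c" "c \<le> 1" using assms abs_Re_le_cmod[of z] by (auto simp: c_def field_simps abs_le_iff)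
  have Re: "Re z = c * r" using assms by (simp add: c_def)
  have "norm (exp (1 *\<^sub>R z) - exp (0 *\<^sub>R z)) \<le> (sinh (1 * r) + c * cosh (1 * r)) - (sinh (0 * r) + c * cosh (0 * r))"
  proof (rule differentiable_bound_general[where f' = "\<lambda>t. exp (t *\<^sub>R z) * z" and \<phi>' = "\<lambda>t. (cosh (t * r) + c * sinh (t * r)) * r"])
    show "continuous_on {0..1} (\<lambda>t. exp (t *\<^sub>R z))" by (intro continuous_intros)
    show "continuous_on {0..1} (\<lambda>t. sinh (t * r) + c * cosh (t * r))" by (intro continuous_intros)
    fix t :: real assume t: "0 < t" "t < 1"
    show "((\<lambda>t. exp (t *\<^sub>R z)) has_vector_derivative exp (t *\<^sub>R z) * z) (at t)"
      by (auto intro!: derivative_eq_intros exp_scaleR_has_vector_derivative_right)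
    have "((\<lambda>t. sinh (t * r) + c * cosh (t * r)) has_real_derivative (cosh (t * r) + c * sinh (t * r)) * r) (at t)"
      by (auto intro!: derivative_eq_intros simp: algebra_simps)
    then show "((\<lambda>t. sinh (t * r) + c * cosh (t * r)) has_vector_derivative (cosh (t * r) + c * sinh (t * r)) * r) (at t)"
      by (simp add: has_real_derivative_iff_has_vector_derivative)
    have "exp (c * (t * r)) * r \<le> (cosh (t * r) + c * sinh (t * r)) * r"
      using assms by (intro mult_right_mono exp_le_chord c) auto
    then show "norm (exp (t *\<^sub>R z) * z) \<le> (cosh (t * r) + c * sinh (t * r)) * r"
      using assms(1) Re by (simp add: norm_mult mult_ac)
  qed auto
  then show ?thesis by (simp add: c_def algebra_simps diff_divide_distrib)
qed

text \<open>The left side is smallest where \<open>sinh r = 1\<close>, that is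
  \<open>exp r = 1 + sqrt 2\<close>, with a value of about 0.066. The logarithm is replaced by its
  tangent at 12/5, close to this point, which leaves a quadratic inequality in
  \<open>E = exp r\<close>.\<close>

lemma exp_plus_exp_minus_ge: "exp r + exp (- r) - 1 - 2 * r \<ge> (1 / 100 :: real)"
proof -
  define E where "E = exp r"
  have E: "E > 0" by (simp add: E_def)
  have "(12/5 :: real) \<le> exp (9/10)"
  proof -
    have "1 + 3/10 + (3/10)\<^sup>2 / 2 \<le> exp (3/10 :: real)" by (rule exp_lower_Taylor_quadratic) auto
    then have "(1 + 3/10 + (3/10)\<^sup>2 / 2) ^ 3 \<le> exp (3/10 :: real) ^ 3" by (rule power_mono) (auto simp: power2_eq_square)
    also have "exp (3/10 :: real) ^ 3 = exp (9/10)" by (simp add: exp_of_nat_mult[symmetric])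
    finally show ?thesis by (simp add: power2_eq_square power3_eq_cube)
  qed
  then have "ln (12/5 :: real) \<le> ln (exp (9/10))" by (subst ln_le_cancel_iff) auto
  then have "ln (12/5 :: real) \<le> 9/10" by simp
  moreover have "ln (E / (12/5)) \<le> E / (12/5) - 1" using E by (intro ln_le_minus_one) auto
  moreover have "ln (E / (12/5)) = r - ln (12/5)" using E by (subst ln_div) (auto simp: E_def)
  ultimately have r: "r \<le> E * 5 / 12 - 1/10" by simp
  \<comment> \<open>The number 243/100 completes the square, as
    \<open>2 * (243/100) / 6 = 81/100\<close>. The surplus of 81/100 over the required 8/10 is the
    final 1/100.\<close>
  have "(E / 6 + 1 / E - 81/100) * E = (E - 243/100)\<^sup>2 / 6 + (1 - (243/100)\<^sup>2 / 6)"
    using E by (simp add: power2_eq_square field_simps)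
  also have "\<dots> > 0" by (intro add_nonneg_pos) (auto simp: power2_eq_square)
  finally have "E / 6 + 1 / E > 81/100" using E by (simp add: zero_less_mult_iff)
  with r show ?thesis by (simp add: E_def exp_minus inverse_eq_divide)
qed

text \<open>This compares the exponent of the error for \<open>exp z\<close> with the growth of
  \<open>poisson_fun\<close> at the real point of the same circle; the 1/100 is the power of
  \<open>ln x\<close> that is saved. The chord bound is linear in \<open>c\<close>, so the cases
  \<open>c = 1\<close> and \<open>c = -1\<close> suffice.\<close>

lemma norm_exp_minus_1_le:
  fixes z :: complex
  shows "norm (exp z - 1) - Re z \<le> exp (norm z) - norm z - 1 / 100"
proof (cases "z = 0")
  case False
  define r c where "r = norm z" and "c = Re z / r"
  have r: "r > 0" using False by (simp add: r_def)
  have c: "-1 \<le> c" "c \<le> 1" using r abs_Re_le_cmod[of z] by (auto simp: r_def c_def field_simps abs_le_iff)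
  have "norm (exp z - 1) \<le> sinh r + c * (cosh r - 1)"
    using norm_exp_minus_1_le_chord[of r z] r by (simp add: r_def c_def)
  moreover have "Re z = c * r" using r by (simp add: c_def)
  ultimately have "norm (exp z - 1) - Re z \<le> sinh r + c * (cosh r - 1 - r)" by (simp add: algebra_simps)
  also have "\<dots> \<le> exp r - r - 1 / 100"
  proof -
    have 1: "sinh r + (cosh r - 1 - r) \<le> exp r - r - 1 / 100"
      using sinh_plus_cosh[of r] by simp
    have 2: "sinh r - (cosh r - 1 - r) \<le> exp r - r - 1 / 100"
      using exp_plus_exp_minus_ge[of r] cosh_minus_sinh[of r] by simp
    define y where "y = cosh r - 1 - r"
    have "\<bar>c * y\<bar> \<le> 1 * \<bar>y\<bar>"
      unfolding abs_mult using c by (intro mult_right_mono) auto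
    with 1 2 show ?thesis unfolding y_def[symmetric] by linarith
  qed
  finally show ?thesis by (simp add: r_def)
qed simp

subsection \<open>Poisson moments\<close>

definition taylor_coeff :: "(complex \<Rightarrow> complex) \<Rightarrow> nat \<Rightarrow> complex" where
  "taylor_coeff f k = (deriv ^^ k) f 0 / fact k"

text \<open>The Taylor coefficients \<open>\<phi>\<close> of \<open>exp (\<mu> (exp z - 1 - z))\<close>, that is, the central moments of the
  Poisson distribution with mean \<open>\<mu>\<close> divided by factorials.\<close>

fun poisson_coeff :: "real \<Rightarrow> nat \<Rightarrow> real" where
  "poisson_coeff \<mu> 0 = 1"
| "poisson_coeff \<mu> (Suc k) = \<mu> / real (Suc k) * (\<Sum>i<k. poisson_coeff \<mu> i / fact (k - i))"

definition poisson_fun :: "real \<Rightarrow> complex \<Rightarrow> complex" where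
  "poisson_fun \<mu> z = exp (of_real \<mu> * (exp z - 1 - z))"

lemma holomorphic_poisson_fun [holomorphic_intros]: "poisson_fun \<mu> holomorphic_on A"
  unfolding poisson_fun_def by (intro holomorphic_intros)

lemma taylor_coeff_mult:
  assumes "f holomorphic_on UNIV" "g holomorphic_on UNIV"
  shows "taylor_coeff (\<lambda>z. f z * g z) n = (\<Sum>i\<le>n. taylor_coeff f i * taylor_coeff g (n - i))"
proof -
  have "(deriv ^^ n) (\<lambda>w. f w * g w) 0 = (\<Sum>i = 0..n. of_nat (n choose i) * (deriv ^^ i) f 0 * (deriv ^^ (n-i)) g 0)"
    by (rule higher_deriv_mult[OF assms]) auto
  then show ?thesis unfolding taylor_coeff_def
    by (auto simp: sum_divide_distrib binomial_fact atLeast0AtMost intro!: sum.cong)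
qed

lemma taylor_coeff_exp: "taylor_coeff exp k = 1 / fact k"
proof -
  have "(deriv ^^ k) exp = (exp :: complex \<Rightarrow> complex)" by (induction k) (auto intro!: ext DERIV_imp_deriv DERIV_exp)
  then show ?thesis by (simp add: taylor_coeff_def)
qed

text \<open>Compare coefficients in \<open>f' = \<mu> * (exp z - 1) * f\<close> for
  \<open>f = poisson_fun \<mu>\<close>. The factor \<open>exp z - 1\<close> has no constant term,
  which is why the recursion for the index \<open>Suc k\<close> stops below
  \<open>k\<close>.\<close>

lemma poisson_coeff_taylor: "taylor_coeff (poisson_fun \<mu>) k = of_real (poisson_coeff \<mu> k)"
proof (induction k rule: less_induct)
  case (less k)
  show ?case
  proof (cases k)
    case 0
    then show ?thesis by (simp add: taylor_coeff_def poisson_fun_def)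
  next
    case (Suc n)
    let ?h = "\<lambda>z::complex. of_real \<mu> * (exp z - 1)"
    have hh: "?h holomorphic_on UNIV" by (intro holomorphic_intros)
    have d: "deriv (poisson_fun \<mu>) = (\<lambda>z. ?h z * poisson_fun \<mu> z)"
    proof
      fix z show "deriv (poisson_fun \<mu>) z = ?h z * poisson_fun \<mu> z"
        unfolding poisson_fun_def by (rule DERIV_imp_deriv) (auto intro!: derivative_eq_intros)
    qed
    have th: "taylor_coeff ?h i = (if i = 0 then 0 else of_real \<mu> / fact i)" for i
    proof -
      have "(deriv ^^ i) ?h 0 = of_real \<mu> * (deriv ^^ i) (\<lambda>z. exp z - 1) 0"
        by (rule higher_deriv_cmult[of _ UNIV]) (auto intro!: holomorphic_intros)
      also have "(deriv ^^ i) (\<lambda>z. exp z - 1) 0 = (deriv ^^ i) exp (0::complex) - (deriv ^^ i) (\<lambda>_. 1) 0"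
        by (rule higher_deriv_diff[of _ UNIV]) (auto intro!: holomorphic_intros)
      finally show ?thesis using taylor_coeff_exp[of i] by (auto simp: taylor_coeff_def)
    qed
    have "taylor_coeff (poisson_fun \<mu>) k = taylor_coeff (\<lambda>z. ?h z * poisson_fun \<mu> z) n / of_nat (Suc n)"
      unfolding taylor_coeff_def Suc funpow_Suc_right o_def d by simp
    also have "taylor_coeff (\<lambda>z. ?h z * poisson_fun \<mu> z) n = (\<Sum>i\<le>n. taylor_coeff ?h i * taylor_coeff (poisson_fun \<mu>) (n - i))"
      by (rule taylor_coeff_mult[OF hh holomorphic_poisson_fun])
    also have "\<dots> = (\<Sum>i\<in>{1..n}. of_real \<mu> / fact i * of_real (poisson_coeff \<mu> (n - i)))"
      by (rule sum.mono_neutral_cong_right) (auto simp: th less Suc)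
    also have "\<dots> = (\<Sum>i<n. of_real \<mu> / fact (n - i) * of_real (poisson_coeff \<mu> i))"
      by (rule sum.reindex_bij_witness[of _ "\<lambda>i. n - i" "\<lambda>i. n - i"]) auto
    also have "\<dots> / of_nat (Suc n) = of_real (poisson_coeff \<mu> k)"
      by (simp add: Suc sum_distrib_left sum_divide_distrib divide_simps mult.commute)
    finally show ?thesis .
  qed
qed

declare poisson_coeff.simps(2) [simp del]

lemma poisson_coeff_nonneg: "\<mu> \<ge> 0 \<Longrightarrow> poisson_coeff \<mu> k \<ge> 0"
proof (induction k rule: less_induct)
  case (less k)
  then show ?case by (cases k) (auto simp: poisson_coeff.simps(2) intro!: mult_nonneg_nonneg sum_nonneg divide_nonneg_nonneg)
qed

lemma poisson_coeff_1 [simp]: "poisson_coeff \<mu> (Suc 0) = 0"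
  by (simp add: poisson_coeff.simps(2))

lemma poisson_coeff_ge:
  assumes "\<mu> \<ge> 0" "i \<le> k"
  shows "\<mu> / (real (k + 2) * fact (Suc k - i)) * poisson_coeff \<mu> i \<le> poisson_coeff \<mu> (k + 2)"
proof -
  have "poisson_coeff \<mu> i / fact (Suc k - i) \<le> (\<Sum>i<Suc k. poisson_coeff \<mu> i / fact (Suc k - i))"
    using assms by (intro member_le_sum) (auto intro!: divide_nonneg_nonneg poisson_coeff_nonneg)
  then have "\<mu> / real (k + 2) * (poisson_coeff \<mu> i / fact (Suc k - i)) \<le> \<mu> / real (k + 2) * (\<Sum>i<Suc k. poisson_coeff \<mu> i / fact (Suc k - i))"
    using assms by (intro mult_left_mono) auto
  then show ?thesis by (simp add: poisson_coeff.simps(2))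
qed

text \<open>Iterating the steps \<open>k \<rightarrow> k - 2\<close> and, once if \<open>j\<close> is odd, \<open>k \<rightarrow> k - 3\<close>.\<close>

lemma poisson_coeff_decr:
  assumes \<mu>: "\<mu> > 0" and "2 \<le> j" "j \<le> k" "k \<le> n"
  shows "poisson_coeff \<mu> (k - j) \<le> (2 * real n / \<mu>) ^ (j div 2) * poisson_coeff \<mu> k"
  using assms(2-)
proof (induction j arbitrary: k rule: less_induct)
  case (less j)
  have step2: "poisson_coeff \<mu> (k - 2) \<le> 2 * real n / \<mu> * poisson_coeff \<mu> k" if "2 \<le> k" "k \<le> n" for k
  proof -
    define l where "l = k - 2"
    have l: "k = l + 2" using that by (simp add: l_def)
    have "\<mu> / real k * poisson_coeff \<mu> l \<le> poisson_coeff \<mu> k" using poisson_coeff_ge[of \<mu> l l] \<mu> l by simp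
    then have "poisson_coeff \<mu> l \<le> real k / \<mu> * poisson_coeff \<mu> k" using \<mu> that by (simp add: field_simps)
    also have "\<dots> \<le> 2 * real n / \<mu> * poisson_coeff \<mu> k"
      using that \<mu> by (intro mult_right_mono divide_right_mono poisson_coeff_nonneg) auto
    finally show ?thesis using l by simp
  qed
  \<comment> \<open>Dropping all but one term of the recursion here leaves \<open>fact 2\<close> in
    the denominator; this is the 2 in the common factor \<open>2 * n / \<mu>\<close>, while
    \<open>n\<close> bounds all indices met on the way down.\<close>
  have step3: "poisson_coeff \<mu> (k - 3) \<le> 2 * real n / \<mu> * poisson_coeff \<mu> k" if "3 \<le> k" "k \<le> n" for k
  proof -
    define l where "l = k - 3"
    have l: "k = l + 3" using that by (simp add: l_def)
    have "\<mu> / (real k * 2) * poisson_coeff \<mu> l \<le> poisson_coeff \<mu> k" using poisson_coeff_ge[of \<mu> l "Suc l"] \<mu> l by (simp add: fact_numeral numeral_eq_Suc)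
    then have "poisson_coeff \<mu> l \<le> 2 * real k / \<mu> * poisson_coeff \<mu> k" using \<mu> that by (simp add: field_simps)
    also have "\<dots> \<le> 2 * real n / \<mu> * poisson_coeff \<mu> k"
      using that \<mu> by (intro mult_right_mono divide_right_mono poisson_coeff_nonneg) auto
    finally show ?thesis using l by simp
  qed
  consider "j = 2" | "j = 3" | "j \<ge> 4" using less.prems by linarith
  then show ?case
  proof cases
    case 1 then show ?thesis using step2 less.prems by simp
  next
    case 2 then show ?thesis using step3 less.prems by simp
  next
    case 3
    have "k - j = (k - 2) - (j - 2)" using 3 less.prems by linarith
    then have "poisson_coeff \<mu> (k - j) = poisson_coeff \<mu> ((k - 2) - (j - 2))" by (simp only:)
    also have "\<dots> \<le> (2 * real n / \<mu>) ^ ((j - 2) div 2) * poisson_coeff \<mu> (k - 2)"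
      using 3 less.prems by (intro less.IH) auto
    also have "\<dots> \<le> (2 * real n / \<mu>) ^ ((j - 2) div 2) * (2 * real n / \<mu> * poisson_coeff \<mu> k)"
      using 3 less.prems \<mu> by (intro mult_left_mono step2) auto
    also have "\<dots> = (2 * real n / \<mu>) ^ Suc ((j - 2) div 2) * poisson_coeff \<mu> k" by simp
    also have "Suc ((j - 2) div 2) = j div 2" using 3 by linarith
    finally show ?thesis .
  qed
qed

lemma poisson_coeff_pos:
  assumes "\<mu> > 0" "k \<ge> 2" shows "poisson_coeff \<mu> k > 0"
proof -
  have "1 \<le> (2 * real k / \<mu>) ^ (k div 2) * poisson_coeff \<mu> k"
    using poisson_coeff_decr[of \<mu> k k k] assms by simp
  then show ?thesis using assms poisson_coeff_nonneg[of \<mu> k] by (cases "poisson_coeff \<mu> k = 0") auto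
qed

lemma sum_power_fact_le_exp: "x \<ge> 0 \<Longrightarrow> finite I \<Longrightarrow> (\<Sum>i\<in>I. x ^ i / fact i) \<le> exp (x::real)"
  using sum_le_suminf[OF summable_exp_generic[of x], of I] by (simp add: exp_def divide_inverse mult.commute)

text \<open>The first bound controls arbitrary entire factors. The second has the extra factor
  \<open>k / \<mu>\<close>, which makes all terms with \<open>j \<ge> 2\<close> negligible when
  \<open>k / \<mu>\<close> is small. The exponent \<open>j div 2\<close> in
  \<open>poisson_coeff_decr\<close> is at least 1 for \<open>j \<ge> 2\<close>, which yields this
  factor.\<close>

lemma poisson_coeff_decr_geometric:
  assumes A: "A > 0"
  obtains B where "B \<ge> 1" "\<And>\<mu> j k. \<mu> > 0 \<Longrightarrow> 2 \<le> k \<Longrightarrow> real k \<le> A * \<mu> \<Longrightarrow> j \<le> k \<Longrightarrow>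
    poisson_coeff \<mu> (k - j) \<le> B ^ j * poisson_coeff \<mu> k \<and>
    (2 \<le> j \<longrightarrow> poisson_coeff \<mu> (k - j) \<le> 2 * real k / \<mu> * B ^ j * poisson_coeff \<mu> k)"
proof -
  define c where "c = max 1 (2 * A)"
  \<comment> \<open>The constant produced by the case \<open>j = 1\<close> below; it also exceeds
    \<open>c\<^sup>2\<close>, as the case \<open>j \<ge> 2\<close> requires.\<close>
  define B where "B = 4 * c\<^sup>2 * exp c"
  have c: "c \<ge> 1" by (simp add: c_def)
  have ec: "exp c \<ge> 1" using c by simp
  have "c\<^sup>2 * 1 \<le> c\<^sup>2 * (4 * exp c)" using ec by (intro mult_left_mono) (linarith, simp)
  then have c2B: "c\<^sup>2 \<le> B" by (simp add: B_def)
  have c2: "c \<le> c\<^sup>2" using c by (simp add: power2_eq_square)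
  have B1: "B \<ge> 1" "c \<le> B" using c c2 c2B by linarith+
  have "poisson_coeff \<mu> (k - j) \<le> B ^ j * poisson_coeff \<mu> k \<and>
    (2 \<le> j \<longrightarrow> poisson_coeff \<mu> (k - j) \<le> 2 * real k / \<mu> * B ^ j * poisson_coeff \<mu> k)" if \<mu>: "\<mu> > 0" and k: "2 \<le> k" "real k \<le> A * \<mu>" and j: "j \<le> k" for \<mu> j k
  proof -
    have kl: "2 * real k / \<mu> \<le> c"
    proof -
      have "2 * real k / \<mu> \<le> 2 * A" using k \<mu> by (simp add: field_simps)
      then show ?thesis by (simp add: c_def)
    qed
    have pos: "poisson_coeff \<mu> k > 0" using poisson_coeff_pos \<mu> k by blast
    have big: "poisson_coeff \<mu> (k - i) \<le> 2 * real k / \<mu> * c ^ i * poisson_coeff \<mu> k" if i: "2 \<le> i" "i \<le> k" for i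
    proof -
      have "poisson_coeff \<mu> (k - i) \<le> (2 * real k / \<mu>) ^ (i div 2) * poisson_coeff \<mu> k"
        using poisson_coeff_decr[of \<mu> i k k] i \<mu> by simp
      also have "(2 * real k / \<mu>) ^ (i div 2) = 2 * real k / \<mu> * (2 * real k / \<mu>) ^ (i div 2 - 1)"
        using i by (cases "i div 2") auto
      also have "\<dots> \<le> 2 * real k / \<mu> * c ^ (i div 2 - 1)"
        using \<mu> kl by (intro mult_left_mono power_mono) auto
      also have "\<dots> \<le> 2 * real k / \<mu> * c ^ i"
        using \<mu> c by (intro mult_left_mono power_increasing) auto
      finally show ?thesis using pos by (simp add: mult_right_mono)
    qed
    consider "j = 0" | "j = 1" | "j \<ge> 2" by linarith
    then show ?thesis
    proof cases
      case 1 then show ?thesis by simp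
    next
      case 2
      show ?thesis
      proof (cases "k = 2")
        case True
        then show ?thesis using 2 pos B1(1) by simp
      next
        case False
        then obtain l where l: "k = Suc (Suc l)" "l \<ge> 1" using k by (metis One_nat_def Suc_1 Suc_leI le_Suc_ex add_2_eq_Suc less_one not_le add_0_right)
        \<comment> \<open>One step down is out of reach of the steps by 2 and 3. Instead the
          coefficient \<open>k - 1\<close> is expanded by its recursion into coefficients at
          distance at least 3 from \<open>k\<close>. Each is bounded with a factor
          \<open>k / \<mu>\<close>, and this cancels the \<mu> in front of the recursion.\<close>
        have "poisson_coeff \<mu> (k - 1) = \<mu> / real (Suc l) * (\<Sum>i<l. poisson_coeff \<mu> i / fact (l - i))"
          using l by (simp add: poisson_coeff.simps(2))
        also have "\<dots> \<le> \<mu> / real (Suc l) * (\<Sum>i<l. (2 * real k / \<mu> * c ^ (k - i) * poisson_coeff \<mu> k) / fact (l - i))"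
        proof (intro mult_left_mono sum_mono divide_right_mono)
          fix i assume "i \<in> {..<l}"
          then show "poisson_coeff \<mu> i \<le> 2 * real k / \<mu> * c ^ (k - i) * poisson_coeff \<mu> k"
            using big[of "k - i"] l by simp
        qed (use \<mu> in auto)
        also have "\<dots> = 2 * real k / real (Suc l) * poisson_coeff \<mu> k * (\<Sum>i<l. c ^ (k - i) / fact (l - i))"
        proof -
          have "\<mu> / a * (2 * b / \<mu> * x * y / f) = 2 * b / a * y * (x / f)" for a b x y f :: real
            using \<mu> by simp
          then show ?thesis by (simp only: sum_distrib_left)
        qed
        also have "(\<Sum>i<l. c ^ (k - i) / fact (l - i)) = (\<Sum>i\<in>{1..l}. c\<^sup>2 * (c ^ i / fact i))"
          by (rule sum.reindex_bij_witness[of _ "\<lambda>i. l - i" "\<lambda>i. l - i"]) (auto simp: l power2_eq_square Suc_diff_le mult.assoc)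
        also have "\<dots> = c\<^sup>2 * (\<Sum>i\<in>{1..l}. c ^ i / fact i)" by (simp add: sum_distrib_left)
        also have "2 * real k / real (Suc l) * poisson_coeff \<mu> k * (c\<^sup>2 * (\<Sum>i\<in>{1..l}. c ^ i / fact i)) \<le> 4 * poisson_coeff \<mu> k * (c\<^sup>2 * exp c)"
        proof (intro mult_mono mult_nonneg_nonneg)
          show "2 * real k / real (Suc l) \<le> 4" using l by (simp add: field_simps)
          show "(\<Sum>i\<in>{1..l}. c ^ i / fact i) \<le> exp c" using c by (intro sum_power_fact_le_exp) auto
        qed (use c pos in \<open>auto intro!: sum_nonneg\<close>)
        finally have "poisson_coeff \<mu> (k - 1) \<le> 4 * c\<^sup>2 * exp c * poisson_coeff \<mu> k" by (simp add: mult_ac)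
        then show ?thesis using 2 by (simp add: B_def)
      qed
    next
      case 3
      have "poisson_coeff \<mu> (k - j) \<le> 2 * real k / \<mu> * c ^ j * poisson_coeff \<mu> k" using big 3 j by blast
      moreover have "2 * real k / \<mu> * c ^ j * poisson_coeff \<mu> k \<le> 2 * real k / \<mu> * B ^ j * poisson_coeff \<mu> k"
        using pos \<mu> c B1 by (intro mult_right_mono mult_left_mono power_mono) auto
      moreover have "2 * real k / \<mu> * c ^ j * poisson_coeff \<mu> k \<le> B ^ j * poisson_coeff \<mu> k"
      proof (rule mult_right_mono)
        have "2 * real k / \<mu> * c ^ j \<le> c * c ^ j" using kl c by (intro mult_right_mono) auto
        also have "c * c ^ j = c ^ Suc j" by simp
        also have "\<dots> \<le> c ^ (2 * j)" using c 3 by (intro power_increasing) auto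
        also have "\<dots> = (c\<^sup>2) ^ j" by (simp add: power_mult)
        also have "\<dots> \<le> B ^ j" using c2B by (intro power_mono) auto
        finally show "2 * real k / \<mu> * c ^ j \<le> B ^ j" .
      qed (use pos in auto)
      ultimately show ?thesis by linarith
    qed
  qed
  with B1 that show ?thesis by blast
qed

subsection \<open>The saddle point method\<close>

lemma taylor_coeff_integral:
  assumes f: "f holomorphic_on UNIV" and r: "r > 0"
  shows "((\<lambda>t. f (of_real r * cis t) * cis (- (of_nat k * t))) has_integral 2 * of_real pi * taylor_coeff f k * of_real r ^ k) {-pi..pi}"
proof -
  let ?h = "\<lambda>t. f (of_real r * cis t) * cis (- (of_nat k * t))"
  have cont: "continuous_on A ?h" for A
    by (intro continuous_intros continuous_on_compose2[OF holomorphic_on_imp_continuous_on[OF f]]) auto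
  have "((\<lambda>u. f u / (u - 0) ^ Suc k) has_contour_integral (2 * pi * \<i> / fact k * (deriv ^^ k) f 0)) (circlepath 0 r)"
    by (intro Cauchy_has_contour_integral_higher_derivative_circlepath)
       (use r f in \<open>auto intro: holomorphic_on_imp_continuous_on holomorphic_on_subset\<close>)
  then have "((\<lambda>t. f (0 + r * cis t) / (0 + r * cis t - 0) ^ Suc k * r * \<i> * cis t) has_integral (2 * pi * \<i> / fact k * (deriv ^^ k) f 0)) {0..2*pi}"
    unfolding circlepath_def by (subst (asm) has_contour_integral_part_circlepath_iff) auto
  then have "((\<lambda>t. (of_real r ^ k / \<i>) * (f (0 + r * cis t) / (0 + r * cis t - 0) ^ Suc k * r * \<i> * cis t)) has_integral (of_real r ^ k / \<i>) * (2 * pi * \<i> / fact k * (deriv ^^ k) f 0)) {0..2*pi}"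
    by (rule has_integral_mult_right)
  moreover have "(of_real r ^ k / \<i>) * (2 * pi * \<i> / fact k * (deriv ^^ k) f 0) = 2 * of_real pi * taylor_coeff f k * of_real r ^ k"
    by (simp add: taylor_coeff_def field_simps)
  moreover have "(of_real r ^ k / \<i>) * (f (0 + r * cis t) / (0 + r * cis t - 0) ^ Suc k * r * \<i> * cis t) = ?h t" for t
  proof -
    have "cis (- (of_nat k * t)) * cis t ^ k = 1"
      by (subst Complex.DeMoivre, subst cis_mult) simp
    then have "cis (- (of_nat k * t)) = 1 / cis t ^ k" by (simp add: field_simps)
    then show ?thesis using r by (simp add: field_simps power_mult_distrib)
  qed
  ultimately have I: "(?h has_integral 2 * of_real pi * taylor_coeff f k * of_real r ^ k) {0..2*pi}" by simp
  have int: "?h integrable_on {a..b}" for a b by (intro integrable_continuous_real cont)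
  have per: "?h (t + 2 * pi) = ?h t" for t
  proof -
    have "cis (2 * pi * (- real k)) = 1" by (rule cis_multiple_2pi) auto
    moreover have "cis (- (real k * (t + 2 * pi))) = cis (- (real k * t)) * cis (2 * pi * (- real k))"
      by (simp add: cis_mult algebra_simps)
    moreover have "cis (t + 2 * pi) = cis t" by (simp add: cis_mult[symmetric])
    ultimately show ?thesis by simp
  qed
  \<comment> \<open>Periodicity moves the interval so that the saddle point \<open>t = 0\<close>
    lies in its interior.\<close>
  have "integral {-pi..pi} ?h = integral {-pi..0} ?h + integral {0..pi} ?h"
    by (rule Henstock_Kurzweil_Integration.integral_combine[symmetric]) (auto intro: int)
  also have "integral {-pi..0} ?h = integral {pi - 2*pi..2*pi - 2*pi} (\<lambda>t. ?h (t + 2 * pi))"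
    unfolding per by simp
  also have "\<dots> = integral {pi..2*pi} ?h" by (rule integral_shift_real_ivl)
  also have "integral {pi..2*pi} ?h + integral {0..pi} ?h = integral {0..2*pi} ?h"
    by (subst add.commute, rule Henstock_Kurzweil_Integration.integral_combine) (auto intro: int)
  also have "\<dots> = 2 * of_real pi * taylor_coeff f k * of_real r ^ k" using I by (rule integral_unique)
  finally show ?thesis using int[of "-pi" pi] by (metis integrable_integral)
qed

lemma norm_exp_ii_Taylor:
  fixes t :: real
  shows "norm (cis t - 1) \<le> \<bar>t\<bar>" "norm (cis t - 1 - \<i> * t) \<le> t\<^sup>2"
    "norm (cis t - 1 - \<i> * t + t\<^sup>2 / 2) \<le> \<bar>t\<bar> ^ 3"
proof -
  have e: "cis t = exp (\<i> * t)" by (simp add: cis_conv_exp)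
  show "norm (cis t - 1) \<le> \<bar>t\<bar>"
    using Taylor_exp[of "\<i> * t" 0] by (simp add: e norm_mult)
  show "norm (cis t - 1 - \<i> * t) \<le> t\<^sup>2"
    using Taylor_exp[of "\<i> * t" 1] by (simp add: e norm_mult algebra_simps power2_eq_square)
  have "norm (cis t - 1 - \<i> * t + t\<^sup>2 / 2) \<le> \<bar>t\<bar> ^ 3 / 2"
    using Taylor_exp[of "\<i> * t" 2] by (simp add: e norm_mult algebra_simps eval_nat_numeral power2_eq_square)
  then show "norm (cis t - 1 - \<i> * t + t\<^sup>2 / 2) \<le> \<bar>t\<bar> ^ 3"
    by (rule order.trans) simp
qed

text \<open>With \<open>\<zeta> = r * (cis t - 1)\<close> the first two terms are
  \<open>exp z - 1 - z\<close> at \<open>z = r * cis t\<close> minus its value at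
  \<open>z = r\<close>. The linear term in \<open>t\<close> is purely imaginary and equals that of
  \<open>k * t / \<mu>\<close> at the saddle point; the quadratic one is real and negative.\<close>

lemma saddle_expansion:
  fixes r t :: real
  defines "\<zeta> \<equiv> of_real r * (cis t - 1)"
  assumes r: "0 \<le> r" "r \<le> R" and t: "\<bar>t\<bar> \<le> 1"
  shows "norm (exp (of_real r) * (exp \<zeta> - 1) - \<zeta> - \<i> * of_real (r * (exp r - 1)) * t + of_real (((exp r - 1) * r + exp r * r\<^sup>2) / 2 * t\<^sup>2))
     \<le> (exp R * R + exp R * R\<^sup>2 + exp R * (exp R * R ^ 3)) * \<bar>t\<bar> ^ 3"
proof -
  define d1 where "d1 = cis t - 1 - \<i> * t + t\<^sup>2 / 2"
  define d2 where "d2 = exp \<zeta> - 1 - \<zeta> - \<zeta>\<^sup>2 / 2"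
  have R: "R \<ge> 0" using r by simp
  have e1: "exp r - 1 \<le> exp R" "exp r \<le> exp R" "exp r \<ge> 1" using r by (auto intro: order.trans[of _ "exp r"])
  have nz: "norm \<zeta> \<le> r * \<bar>t\<bar>"
    unfolding \<zeta>_def norm_mult using norm_exp_ii_Taylor(1)[of t] r by (auto intro: mult_left_mono)
  then have nzR: "norm \<zeta> \<le> R" using r t R mult_mono[of r R "\<bar>t\<bar>" 1] by simp
  have d1: "norm d1 \<le> \<bar>t\<bar> ^ 3" unfolding d1_def using norm_exp_ii_Taylor(3)[of t] by simp
  have d2: "norm d2 \<le> exp R * (R ^ 3 * \<bar>t\<bar> ^ 3)"
  proof -
    have "norm d2 \<le> exp \<bar>Re \<zeta>\<bar> * norm \<zeta> ^ 3 / 2"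
      unfolding d2_def using Taylor_exp[of \<zeta> 2] by (simp add: eval_nat_numeral algebra_simps)
    also have "\<dots> \<le> exp \<bar>Re \<zeta>\<bar> * norm \<zeta> ^ 3" by simp
    also have "\<dots> \<le> exp R * (R * \<bar>t\<bar>) ^ 3"
    proof (intro mult_mono power_mono)
      show "exp \<bar>Re \<zeta>\<bar> \<le> exp R" using abs_Re_le_cmod[of \<zeta>] nzR by simp
      show "norm \<zeta> \<le> R * \<bar>t\<bar>" using nz r by (meson abs_ge_zero mult_right_mono order_trans)
    qed auto
    finally show ?thesis by (simp add: power_mult_distrib)
  qed
  have sq: "norm (\<zeta>\<^sup>2 + of_real (r\<^sup>2 * t\<^sup>2)) \<le> 2 * (R\<^sup>2 * \<bar>t\<bar> ^ 3)"
  proof -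
    have "\<zeta>\<^sup>2 + of_real (r\<^sup>2 * t\<^sup>2) = (\<zeta> - \<i> * r * t) * (\<zeta> + \<i> * r * t)"
      by (simp add: algebra_simps power2_eq_square)
    moreover have "norm (\<zeta> - \<i> * r * t) \<le> r * t\<^sup>2"
    proof -
      have "\<zeta> - \<i> * r * t = r * (cis t - 1 - \<i> * t)" by (simp add: \<zeta>_def algebra_simps)
      then show ?thesis using norm_exp_ii_Taylor(2)[of t] r by (simp add: norm_mult mult_left_mono)
    qed
    moreover have "norm (\<zeta> + \<i> * r * t) \<le> 2 * r * \<bar>t\<bar>"
      using norm_triangle_ineq[of \<zeta> "\<i> * r * t"] nz r by (simp add: norm_mult)
    ultimately have "norm (\<zeta>\<^sup>2 + of_real (r\<^sup>2 * t\<^sup>2)) \<le> (r * t\<^sup>2) * (2 * r * \<bar>t\<bar>)"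
      unfolding norm_mult using r by (simp add: norm_mult mult_mono)
    also have "\<dots> = 2 * (r\<^sup>2 * \<bar>t\<bar> ^ 3)" by (simp add: power2_eq_square power3_eq_cube abs_mult_self_eq mult_ac)
    also have "\<dots> \<le> 2 * (R\<^sup>2 * \<bar>t\<bar> ^ 3)" using r by (intro mult_left_mono mult_right_mono power_mono) auto
    finally show ?thesis .
  qed
  have "exp (of_real r) * (exp \<zeta> - 1) - \<zeta> - \<i> * of_real (r * (exp r - 1)) * t + of_real (((exp r - 1) * r + exp r * r\<^sup>2) / 2 * t\<^sup>2)
    = of_real ((exp r - 1) * r) * d1 + of_real (exp r / 2) * (\<zeta>\<^sup>2 + of_real (r\<^sup>2 * t\<^sup>2)) + of_real (exp r) * d2"
    by (simp add: d1_def d2_def \<zeta>_def exp_of_real field_simps)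
  also have "norm \<dots> \<le> exp R * R * \<bar>t\<bar> ^ 3 + exp R / 2 * (2 * (R\<^sup>2 * \<bar>t\<bar> ^ 3)) + exp R * (exp R * (R ^ 3 * \<bar>t\<bar> ^ 3))"
  proof (intro order.trans[OF norm_triangle_ineq] add_mono)
    show "norm (of_real ((exp r - 1) * r) * d1) \<le> exp R * R * \<bar>t\<bar> ^ 3"
      unfolding norm_mult norm_of_real abs_mult
    proof (intro mult_mono d1)
      show "\<bar>exp r - 1\<bar> \<le> exp R" using e1 by linarith
    qed (use r in auto)
    show "norm (complex_of_real (exp r / 2) * (\<zeta>\<^sup>2 + of_real (r\<^sup>2 * t\<^sup>2))) \<le> exp R / 2 * (2 * (R\<^sup>2 * \<bar>t\<bar> ^ 3))"
      unfolding norm_mult norm_of_real using e1 sq by (intro mult_mono) auto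
    show "norm (complex_of_real (exp r) * d2) \<le> exp R * (exp R * (R ^ 3 * \<bar>t\<bar> ^ 3))"
      unfolding norm_mult norm_of_real using e1 d2 by (intro mult_mono) auto
  qed
  also have "\<dots> = (exp R * R + exp R * R\<^sup>2 + exp R * (exp R * R ^ 3)) * \<bar>t\<bar> ^ 3" by (simp add: algebra_simps)
  finally show ?thesis .
qed

definition saddle_exponent :: "real \<Rightarrow> complex \<Rightarrow> complex" where
  "saddle_exponent r z = (exp z - 1 - z) - of_real (exp r - 1 - r)"

text \<open>The chord bound holds all around the circle, so a single inequality shows that the
  integrand is largest at \<open>t = 0\<close>.\<close>

lemma Re_saddle_exponent_le:
  assumes r: "r \<ge> 0"
  shows "Re (saddle_exponent r (of_real r * cis t)) \<le> - (1 - cos t) * (sinh r - r)"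
proof -
  have "Re (exp (of_real r * cis t)) \<le> norm (exp (of_real r * cis t))" by (rule complex_Re_le_cmod)
  also have "\<dots> = exp (cos t * r)" by (simp add: mult.commute)
  also have "\<dots> \<le> cosh r + cos t * sinh r" by (rule exp_le_chord) auto
  finally have "Re (saddle_exponent r (of_real r * cis t)) \<le> cosh r + cos t * sinh r - 1 - r * cos t - (exp r - 1 - r)"
    by (simp add: saddle_exponent_def)
  also have "\<dots> = - (1 - cos t) * (sinh r - r)"
    by (simp add: cosh_plus_sinh[symmetric] algebra_simps)
  finally show ?thesis .
qed

lemma sinh_minus_pos: assumes "r > (0::real)" shows "sinh r - r > 0"
proof -
  have "\<exists>z>0. z < r \<and> (sinh r - r) - (sinh 0 - 0) = (r - 0) * (cosh z - 1)"
    by (rule MVT2) (use assms in \<open>auto intro!: derivative_eq_intros\<close>)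
  then obtain z where "z > 0" "sinh r - r = r * (cosh z - 1)" by auto
  moreover have "cosh z > 1" using \<open>z > 0\<close> cosh_real_strict_mono[of 0 z] by simp
  ultimately show ?thesis using assms by simp
qed

lemma sinh_minus_mono: assumes "0 \<le> s" "s \<le> (r::real)" shows "sinh s - s \<le> sinh r - r"
proof (rule DERIV_nonneg_imp_nondecreasing[OF assms(2)])
  fix x
  show "\<exists>y. ((\<lambda>x. sinh x - x) has_real_derivative y) (at x) \<and> y \<ge> 0"
    by (rule exI[of _ "cosh x - 1"]) (auto intro!: derivative_eq_intros simp: cosh_real_ge_1)
qed

lemma one_minus_cos_ge:
  assumes "0 \<le> s" "s \<le> 1/4" "s \<le> \<bar>t\<bar>" "\<bar>t\<bar> \<le> pi"
  shows "1 - cos t \<ge> s\<^sup>2 / 4"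
proof -
  have "cos t \<le> cos s"
    using cos_monotone_0_pi_le[of s "\<bar>t\<bar>"] assms by simp
  moreover have "cos s \<le> 1 - s\<^sup>2 / 4"
  proof -
    have "Re (cis s - 1 - \<i> * s + s\<^sup>2 / 2) \<le> \<bar>s\<bar> ^ 3"
      using norm_exp_ii_Taylor(3)[of s] complex_Re_le_cmod order.trans by blast
    then have "cos s - 1 + s\<^sup>2 / 2 \<le> s * s\<^sup>2" using assms by (simp add: power3_eq_cube power2_eq_square)
    also have "\<dots> \<le> 1/4 * s\<^sup>2" using assms by (intro mult_right_mono) auto
    finally show ?thesis by simp
  qed
  ultimately show ?thesis by simp
qed

definition saddle_kernel :: "real \<Rightarrow> nat \<Rightarrow> real \<Rightarrow> real \<Rightarrow> complex" where
  "saddle_kernel \<mu> k r t = exp (of_real \<mu> * saddle_exponent r (of_real r * cis t) - \<i> * of_real (real k * t))"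

lemma poisson_fun_saddle_kernel:
  "poisson_fun \<mu> (of_real r * cis t) * cis (- (real k * t)) = of_real (exp (\<mu> * (exp r - 1 - r))) * saddle_kernel \<mu> k r t"
  unfolding poisson_fun_def saddle_kernel_def saddle_exponent_def cis_conv_exp exp_of_real[symmetric] exp_add[symmetric]
  by (simp add: algebra_simps)

lemma norm_saddle_kernel_le:
  assumes "\<mu> \<ge> 0" "r \<ge> 0"
  shows "norm (saddle_kernel \<mu> k r t) \<le> exp (- \<mu> * (1 - cos t) * (sinh r - r))"
  using mult_left_mono[OF Re_saddle_exponent_le[OF assms(2), of t] assms(1)]
  by (simp add: saddle_kernel_def algebra_simps)

lemma norm_saddle_kernel_le_1:
  assumes "\<mu> \<ge> 0" "r \<ge> 0"
  shows "norm (saddle_kernel \<mu> k r t) \<le> 1"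
proof -
  have "\<mu> * (1 - cos t) * (sinh r - r) \<ge> 0"
    using assms sinh_minus_mono[of 0 r] by (intro mult_nonneg_nonneg) auto
  then show ?thesis using norm_saddle_kernel_le[OF assms, of k t] by (auto intro: order.trans)
qed

text \<open>The arc is cut at the scale \<open>\<mu> powr (-1/3)\<close>: up to there the cubic term
  \<open>\<mu> * t ^ 3\<close> of the exponent stays bounded, and beyond it
  \<open>\<mu> * t\<^sup>2\<close> is at least of order \<open>\<mu> powr (1/3)\<close>, which beats
  every power of \<mu>.\<close>

lemma saddle_kernel_far:
  assumes "\<mu> \<ge> 1" "0 \<le> r0" "r0 \<le> r" "0 \<le> \<kappa>" "\<kappa> \<le> 1/4" "\<kappa> * \<mu> powr (-1/3) \<le> \<bar>t\<bar>" "\<bar>t\<bar> \<le> pi"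
  shows "norm (saddle_kernel \<mu> k r t) \<le> exp (- ((sinh r0 - r0) * \<kappa>\<^sup>2 / 4) * \<mu> powr (1/3))"
proof -
  define s where "s = \<kappa> * \<mu> powr (-1/3)"
  have "\<mu> powr (-1/3) \<le> \<mu> powr 0" using assms by (intro powr_mono) auto
  then have s1: "\<mu> powr (-1/3) \<le> 1" using assms by simp
  have "\<kappa> * \<mu> powr (-1/3) \<le> 1/4 * 1" using assms s1 by (intro mult_mono) auto
  then have s: "0 \<le> s" "s \<le> 1/4" using assms by (auto simp: s_def)
  have cs: "1 - cos t \<ge> s\<^sup>2 / 4" using assms s by (intro one_minus_cos_ge) (auto simp: s_def)
  have sr: "0 \<le> sinh r0 - r0" "sinh r0 - r0 \<le> sinh r - r"
    using assms sinh_minus_mono[of 0 r0] sinh_minus_mono[of r0 r] by auto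
  have "\<mu> * s\<^sup>2 = \<kappa>\<^sup>2 * \<mu> powr (1/3)"
  proof -
    have "\<mu> * (\<mu> powr (-1/3))\<^sup>2 = \<mu> powr 1 * \<mu> powr (-2/3)"
      using assms by (simp add: powr_powr flip: powr_numeral)
    also have "\<dots> = \<mu> powr (1/3)" by (subst powr_add[symmetric]) simp
    finally show ?thesis by (simp add: s_def power_mult_distrib)
  qed
  then have "(sinh r0 - r0) * \<kappa>\<^sup>2 / 4 * \<mu> powr (1/3) = \<mu> * (s\<^sup>2 / 4) * (sinh r0 - r0)" by simp
  also have "\<dots> \<le> \<mu> * (1 - cos t) * (sinh r - r)"
    using assms cs sr by (intro mult_mono mult_nonneg_nonneg) auto
  finally have "- \<mu> * (1 - cos t) * (sinh r - r) \<le> - ((sinh r0 - r0) * \<kappa>\<^sup>2 / 4) * \<mu> powr (1/3)"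
    by (simp only: minus_mult_left[symmetric] neg_le_iff_le)
  then have "exp (- \<mu> * (1 - cos t) * (sinh r - r)) \<le> exp (- ((sinh r0 - r0) * \<kappa>\<^sup>2 / 4) * \<mu> powr (1/3))"
    by (simp only: exp_le_cancel_iff)
  moreover have "norm (saddle_kernel \<mu> k r t) \<le> exp (- \<mu> * (1 - cos t) * (sinh r - r))"
    using assms by (intro norm_saddle_kernel_le) auto
  ultimately show ?thesis by (rule order.trans[rotated])
qed

text \<open>The hypothesis on \<open>k\<close> cancels the linear term of
  \<open>saddle_expansion\<close>. What is left in the phase is cubic, so close to the saddle the
  kernel stays in the right half-plane.\<close>

lemma saddle_kernel_near:
  assumes \<mu>: "\<mu> \<ge> 0" and r: "0 \<le> r" "r \<le> R" and k: "\<mu> * (r * (exp r - 1)) = real k" and t: "\<bar>t\<bar> \<le> 1"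
  defines "K \<equiv> exp R * R + exp R * R\<^sup>2 + exp R * (exp R * R ^ 3)"
  shows "\<exists>E. saddle_kernel \<mu> k r t = exp E \<and> \<bar>Im E\<bar> \<le> \<mu> * (K * \<bar>t\<bar> ^ 3) \<and>
    Re E \<ge> - \<mu> * ((exp R * R + exp R * R\<^sup>2) / 2 * t\<^sup>2 + K * \<bar>t\<bar> ^ 3)"
proof -
  define s where "s = ((exp r - 1) * r + exp r * r\<^sup>2) / 2"
  define E where "E = of_real \<mu> * saddle_exponent r (of_real r * cis t) - \<i> * of_real (real k * t)"
  define D where "D = E + of_real (\<mu> * (s * t\<^sup>2))"
  have "s \<le> (exp R * R + exp R * R\<^sup>2) / 2"
  proof -
    have e: "exp r - 1 \<le> exp R" "exp r \<le> exp R" "exp r \<ge> 1" using r by (auto intro: order.trans[of _ "exp r"])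
    have "(exp r - 1) * r \<le> exp R * R" by (rule mult_mono) (use e r in linarith)+
    moreover have "exp r * r\<^sup>2 \<le> exp R * R\<^sup>2" using e r by (intro mult_mono power_mono) auto
    ultimately show ?thesis by (simp add: s_def)
  qed
  then have s: "\<mu> * (s * t\<^sup>2) \<le> \<mu> * ((exp R * R + exp R * R\<^sup>2) / 2 * t\<^sup>2)"
    using \<mu> by (intro mult_left_mono mult_right_mono) auto
  have e: "exp (of_real r * cis t) = exp (of_real r) * exp (of_real r * (cis t - 1))"
    by (subst exp_add[symmetric]) (simp add: algebra_simps)
  have se: "saddle_exponent r (of_real r * cis t) = exp (of_real r) * (exp (of_real r * (cis t - 1)) - 1) - of_real r * (cis t - 1)"
    unfolding saddle_exponent_def e by (simp add: exp_of_real algebra_simps)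
  have "D = of_real \<mu> * (exp (of_real r) * (exp (of_real r * (cis t - 1)) - 1) - of_real r * (cis t - 1)
      - \<i> * of_real (r * (exp r - 1)) * t + of_real (((exp r - 1) * r + exp r * r\<^sup>2) / 2 * t\<^sup>2))"
    unfolding D_def E_def se k[symmetric] s_def by (simp add: algebra_simps)
  then have "norm D = \<mu> * norm (exp (of_real r) * (exp (of_real r * (cis t - 1)) - 1) - of_real r * (cis t - 1)
      - \<i> * of_real (r * (exp r - 1)) * t + of_real (((exp r - 1) * r + exp r * r\<^sup>2) / 2 * t\<^sup>2))"
    using \<mu> by (simp only: norm_mult norm_of_real abs_of_nonneg)
  also have "\<dots> \<le> \<mu> * (K * \<bar>t\<bar> ^ 3)"
    unfolding K_def using \<mu> by (intro mult_left_mono saddle_expansion r t)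
  finally have D: "norm D \<le> \<mu> * (K * \<bar>t\<bar> ^ 3)" .
  have "Im D = Im E" "Re D = Re E + \<mu> * (s * t\<^sup>2)" by (simp_all add: D_def)
  then have "\<bar>Im E\<bar> \<le> \<mu> * (K * \<bar>t\<bar> ^ 3)" "Re E \<ge> - (\<mu> * (s * t\<^sup>2)) - \<mu> * (K * \<bar>t\<bar> ^ 3)"
    using D abs_Im_le_cmod[of D] abs_Re_le_cmod[of D] by linarith+
  with s have "\<bar>Im E\<bar> \<le> \<mu> * (K * \<bar>t\<bar> ^ 3)" "Re E \<ge> - \<mu> * ((exp R * R + exp R * R\<^sup>2) / 2 * t\<^sup>2 + K * \<bar>t\<bar> ^ 3)"
    by (auto simp: algebra_simps)
  moreover have "saddle_kernel \<mu> k r t = exp E" by (simp add: saddle_kernel_def E_def)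
  ultimately show ?thesis by blast
qed

lemma has_integral_saddle_kernel:
  assumes "r > 0" "g holomorphic_on UNIV"
  shows "((\<lambda>t. g (of_real r * cis t) * saddle_kernel \<mu> k r t) has_integral
     2 * of_real pi * taylor_coeff (\<lambda>z. g z * poisson_fun \<mu> z) k * of_real (r ^ k / exp (\<mu> * (exp r - 1 - r)))) {-pi..pi}"
proof -
  let ?e = "exp (\<mu> * (exp r - 1 - r))"
  have "((\<lambda>t. g (of_real r * cis t) * poisson_fun \<mu> (of_real r * cis t) * cis (- (of_nat k * t))) has_integral
      2 * of_real pi * taylor_coeff (\<lambda>z. g z * poisson_fun \<mu> z) k * of_real r ^ k) {-pi..pi}"
    using assms by (intro taylor_coeff_integral[of "\<lambda>z. g z * poisson_fun \<mu> z"] holomorphic_intros)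
  then have "((\<lambda>t. of_real (1 / ?e) * (g (of_real r * cis t) * poisson_fun \<mu> (of_real r * cis t) * cis (- (of_nat k * t)))) has_integral
      of_real (1 / ?e) * (2 * of_real pi * taylor_coeff (\<lambda>z. g z * poisson_fun \<mu> z) k * of_real r ^ k)) {-pi..pi}"
    by (rule has_integral_mult_right)
  moreover have "of_real (1 / ?e) * (g (of_real r * cis t) * poisson_fun \<mu> (of_real r * cis t) * cis (- (of_nat k * t))) = g (of_real r * cis t) * saddle_kernel \<mu> k r t" for t
    unfolding mult.assoc[of "g _"] poisson_fun_saddle_kernel by simp
  moreover have "of_real (1 / ?e) * (2 * of_real pi * taylor_coeff (\<lambda>z. g z * poisson_fun \<mu> z) k * of_real r ^ k)
     = 2 * of_real pi * taylor_coeff (\<lambda>z. g z * poisson_fun \<mu> z) k * of_real (r ^ k / ?e)"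
    by simp
  ultimately show ?thesis by (simp only:)
qed

lemma has_integral_indicator_Icc:
  fixes m :: real assumes "0 \<le> a" "a \<le> pi"
  shows "((\<lambda>t. if t \<in> {-a..a} then m else 0) has_integral 2 * a * m) {-pi..pi}"
proof -
  have "((\<lambda>t. m) has_integral 2 * a * m) {-a..a}"
    using has_integral_const_real[of m "-a" a] assms by simp
  then show ?thesis using assms by (subst has_integral_restrict) auto
qed

text \<open>A lower bound of the right order is enough, since the theorem compares two coefficients.
  The real part of the kernel is at least \<open>m\<close> on
  \<open>\<bar>t\<bar> \<le> \<mu> powr (-1/2)\<close>, non-negative up to \<theta>, and of modulus
  at most \<open>e\<close> beyond.\<close>

lemma poisson_coeff_saddle_ge:
  assumes r0: "0 < r0" "r0 \<le> R"
  obtains c where "c > 0" "\<forall>\<^sub>F \<mu> in at_top. \<forall>k r. r0 \<le> r \<and> r \<le> R \<and> \<mu> * (r * (exp r - 1)) = real k \<longrightarrow>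
    poisson_coeff \<mu> k * r ^ k \<ge> c * \<mu> powr (-1/2) * exp (\<mu> * (exp r - 1 - r))"
proof -
  define K where "K = exp R * R + exp R * R\<^sup>2 + exp R * (exp R * R ^ 3)"
  define S where "S = (exp R * R + exp R * R\<^sup>2) / 2"
  \<comment> \<open>So small that \<open>K * \<kappa> ^ 3 \<le> 1\<close>; then the phase is at most
    1 for \<open>\<bar>t\<bar> \<le> \<theta>\<close> and its cosine at least
    \<open>cos 1 > 0\<close>.\<close>
  define \<kappa> where "\<kappa> = 1 / (4 * (K + 1))"
  define d where "d = (sinh r0 - r0) * \<kappa>\<^sup>2 / 4"
  \<comment> \<open>For \<open>\<bar>t\<bar> \<le> \<mu> powr (-1/2)\<close> the quadratic part of
    the exponent is at most \<open>S\<close> and the cubic part at most 1.\<close>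
  define m where "m = exp (- S - 1) * cos 1"
  have R: "R > 0" using r0 by simp
  have K: "K > 0" unfolding K_def using R by (intro add_pos_pos mult_pos_pos) auto
  have \<kappa>: "\<kappa> > 0" "\<kappa> \<le> 1/4" "K * \<kappa> ^ 3 \<le> 1"
  proof -
    show k0: "\<kappa> > 0" "\<kappa> \<le> 1/4" using K by (auto simp: \<kappa>_def field_simps)
    have "K * \<kappa> \<le> 1" using K by (simp add: \<kappa>_def field_simps)
    moreover have "\<kappa>\<^sup>2 \<le> 1" using k0 by (simp add: power_le_one)
    ultimately have "(K * \<kappa>) * \<kappa>\<^sup>2 \<le> 1 * 1" using K k0 by (intro mult_mono) auto
    then show "K * \<kappa> ^ 3 \<le> 1" by (simp add: power3_eq_cube power2_eq_square mult.assoc)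
  qed
  have d: "d > 0" using \<kappa> sinh_minus_pos[OF r0(1)] by (simp add: d_def)
  have m: "m > 0" unfolding m_def using pi_gt3 by (intro mult_pos_pos cos_gt_zero_pi) auto
  have ev1: "\<forall>\<^sub>F \<mu> in at_top. pi * exp (- d * \<mu> powr (1/3)) \<le> \<mu> powr (-1/2) * m / 2"
    using d m by real_asymp
  have ev2: "\<forall>\<^sub>F \<mu> in at_top. \<mu> powr (-1/2) \<le> \<kappa> * \<mu> powr (-1/3)"
    using \<kappa> by real_asymp
  have "\<forall>\<^sub>F \<mu> in at_top. \<forall>k r. r0 \<le> r \<and> r \<le> R \<and> \<mu> * (r * (exp r - 1)) = real k \<longrightarrow>
    poisson_coeff \<mu> k * r ^ k \<ge> (m / (2 * pi)) * \<mu> powr (-1/2) * exp (\<mu> * (exp r - 1 - r))"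
    using ev1 ev2 eventually_ge_at_top[of 1]
  proof eventually_elim
    case (elim \<mu>)
    define a where "a = \<mu> powr (-1/2)"
    define \<theta> where "\<theta> = \<kappa> * \<mu> powr (-1/3)"
    define e where "e = exp (- d * \<mu> powr (1/3))"
    have "\<mu> powr (-1/3) \<le> \<mu> powr 0" using elim by (intro powr_mono) auto
    then have \<theta>: "0 \<le> \<theta>" "\<theta> \<le> 1/4" using \<kappa> elim mult_mono[of \<kappa> "1/4" "\<mu> powr (-1/3)" 1] by (auto simp: \<theta>_def)
    have a: "0 \<le> a" "a \<le> \<theta>" "a \<le> pi" using elim \<theta> pi_gt3 by (auto simp: a_def \<theta>_def)
    have \<mu>a: "\<mu> * a\<^sup>2 = 1"
    proof -
      have "a\<^sup>2 = \<mu> powr (-1)" using elim by (simp add: a_def powr_powr flip: powr_numeral)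
      then show ?thesis using elim by (simp add: powr_minus)
    qed
    have \<mu>\<theta>: "\<mu> * (K * \<theta> ^ 3) \<le> 1"
    proof -
      have "(\<mu> powr (-1/3)) ^ 3 = \<mu> powr (-1)" using elim by (simp add: powr_powr flip: powr_numeral)
      then have "\<theta> ^ 3 = \<kappa> ^ 3 * \<mu> powr (-1)" by (simp only: \<theta>_def power_mult_distrib)
      then have "\<mu> * (K * \<theta> ^ 3) = K * \<kappa> ^ 3" using elim by (simp add: powr_minus)
      then show ?thesis using \<kappa>(3) by (simp only:)
    qed
    show ?case
    proof (intro allI impI, elim conjE)
      fix k r assume r: "r0 \<le> r" "r \<le> R" and k: "\<mu> * (r * (exp r - 1)) = real k"
      have rpos: "r > 0" using r r0 by simp
      define X where "X = exp (\<mu> * (exp r - 1 - r))"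
      have X: "X > 0" by (simp add: X_def)
      have lb: "(if t \<in> {-a..a} then m else 0) - e \<le> Re (saddle_kernel \<mu> k r t)" if t: "t \<in> {-pi..pi}" for t
      proof (cases "\<bar>t\<bar> \<le> \<theta>")
        case True
        have t1: "\<bar>t\<bar> \<le> 1" using True \<theta> by simp
        obtain E where E: "saddle_kernel \<mu> k r t = exp E" "\<bar>Im E\<bar> \<le> \<mu> * (K * \<bar>t\<bar> ^ 3)" "Re E \<ge> - \<mu> * (S * t\<^sup>2 + K * \<bar>t\<bar> ^ 3)"
          using saddle_kernel_near[of \<mu> r R k t] elim r rpos k t1 unfolding K_def S_def by auto
        have cub: "\<mu> * (K * \<bar>t\<bar> ^ 3) \<le> 1"
        proof -
          have "\<mu> * (K * \<bar>t\<bar> ^ 3) \<le> \<mu> * (K * \<theta> ^ 3)" using True K elim by (intro mult_left_mono power_mono) auto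
          with \<mu>\<theta> show ?thesis by linarith
        qed
        have "cos 1 \<le> cos \<bar>Im E\<bar>" using E(2) cub pi_gt3 by (intro cos_monotone_0_pi_le) auto
        then have c: "cos 1 \<le> cos (Im E)" by simp
        have c1: "cos 1 > (0::real)" using pi_gt3 by (intro cos_gt_zero_pi) auto
        have Re: "Re (saddle_kernel \<mu> k r t) = exp (Re E) * cos (Im E)" by (simp add: E(1) Re_exp)
        have e0: "e \<ge> 0" by (simp add: e_def)
        show ?thesis
        proof (cases "t \<in> {-a..a}")
          case True
          then have "t\<^sup>2 \<le> a\<^sup>2" using a by (intro power2_le_iff_abs_le[THEN iffD2]) auto
          then have "\<mu> * (S * t\<^sup>2) \<le> \<mu> * (S * a\<^sup>2)" using elim R by (intro mult_left_mono) (auto simp: S_def)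
          also have "\<dots> = S" using \<mu>a by (metis mult.left_commute mult.right_neutral)
          finally have "Re E \<ge> - S - 1" using E(3) cub by (simp add: algebra_simps)
          then have "m \<le> exp (Re E) * cos (Im E)" unfolding m_def using c c1 by (intro mult_mono) auto
          with True Re e0 show ?thesis by simp
        next
          case False
          have "0 \<le> exp (Re E) * cos (Im E)" using c c1 by simp
          moreover have "(if t \<in> {-a..a} then m else 0) = 0" using False by (rule if_not_P)
          ultimately show ?thesis using Re e0 by linarith
        qed
      next
        case False
        then have "t \<notin> {-a..a}" using a by auto
        moreover have "norm (saddle_kernel \<mu> k r t) \<le> e"
          unfolding e_def d_def using False t elim r r0 \<kappa> by (intro saddle_kernel_far) (auto simp: \<theta>_def)
        moreover have "- norm (saddle_kernel \<mu> k r t) \<le> Re (saddle_kernel \<mu> k r t)"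
          using abs_Re_le_cmod[of "saddle_kernel \<mu> k r t"] by linarith
        moreover have "(if t \<in> {-a..a} then m else 0) = 0" using calculation(1) by (rule if_not_P)
        ultimately show ?thesis by linarith
      qed
      have "((\<lambda>t. 1 * saddle_kernel \<mu> k r t) has_integral 2 * of_real pi * taylor_coeff (\<lambda>z. 1 * poisson_fun \<mu> z) k * of_real (r ^ k / X)) {-pi..pi}"
        using has_integral_saddle_kernel[OF rpos, of "\<lambda>_. 1"] by (simp add: X_def)
      then have "((\<lambda>t. saddle_kernel \<mu> k r t) has_integral of_real (2 * pi * poisson_coeff \<mu> k * (r ^ k / X))) {-pi..pi}"
        by (simp add: poisson_coeff_taylor)
      from has_integral_Re[OF this]
      have I: "((\<lambda>t. Re (saddle_kernel \<mu> k r t)) has_integral (2 * pi * poisson_coeff \<mu> k * (r ^ k / X))) {-pi..pi}" by simp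
      have J: "((\<lambda>t. (if t \<in> {-a..a} then m else 0) - e) has_integral (2 * a * m - 2 * pi * e)) {-pi..pi}"
        using has_integral_diff[OF has_integral_indicator_Icc[OF a(1,3), of m] has_integral_const_real[of e "-pi" pi]] by simp
      have "2 * a * m - 2 * pi * e \<le> 2 * pi * poisson_coeff \<mu> k * (r ^ k / X)"
        by (rule has_integral_le[OF J I lb])
      moreover have "2 * pi * e \<le> a * m" using elim(1) by (simp add: e_def a_def)
      ultimately have "a * m \<le> 2 * pi * (poisson_coeff \<mu> k * (r ^ k / X))" by simp
      then show "m / (2 * pi) * \<mu> powr (-1/2) * exp (\<mu> * (exp r - 1 - r)) \<le> poisson_coeff \<mu> k * r ^ k"
        unfolding X_def[symmetric] a_def[symmetric] using X by (simp add: field_simps)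
    qed
  qed
  moreover have "m / (2 * pi) > 0" using m by simp
  ultimately show ?thesis using that by blast
qed

text \<open>After subtracting \<open>g r\<close>, the integrand is of order \<theta> on an arc of
  length \<open>2 * \<theta>\<close>. With \<theta> of order \<open>\<mu> powr (-1/3)\<close> this
  gives \<open>\<mu> powr (-2/3)\<close>, which is small against the
  \<open>\<mu> powr (-1/2)\<close> of the lower bound. On the remaining arc the kernel is
  exponentially small in \<open>\<mu> powr (1/3)\<close>.\<close>

lemma taylor_coeff_saddle:
  assumes g: "g holomorphic_on UNIV" and r0: "0 < r0" "r0 \<le> R" and \<epsilon>: "\<epsilon> > 0"
  shows "\<forall>\<^sub>F \<mu> in at_top. \<forall>k r. r0 \<le> r \<and> r \<le> R \<and> \<mu> * (r * (exp r - 1)) = real k \<longrightarrow>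
    norm (taylor_coeff (\<lambda>z. g z * poisson_fun \<mu> z) k - g (of_real r) * of_real (poisson_coeff \<mu> k)) \<le> \<epsilon> * poisson_coeff \<mu> k"
proof -
  obtain c where c: "c > 0" and lower: "\<forall>\<^sub>F \<mu> in at_top. \<forall>k r. r0 \<le> r \<and> r \<le> R \<and> \<mu> * (r * (exp r - 1)) = real k \<longrightarrow>
    poisson_coeff \<mu> k * r ^ k \<ge> c * \<mu> powr (-1/2) * exp (\<mu> * (exp r - 1 - r))"
    using poisson_coeff_saddle_ge[OF r0] by blast
  define d where "d = (sinh r0 - r0) * (1/4)\<^sup>2 / 4"
  have d: "d > 0" using sinh_minus_pos[OF r0(1)] by (simp add: d_def)
  have R: "R > 0" using r0 by simp
  have "bounded (deriv g ` cball 0 R)"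
    using g by (intro compact_imp_bounded compact_continuous_image holomorphic_on_imp_continuous_on)
       (auto intro: holomorphic_on_subset[OF holomorphic_deriv[OF g]])
  then obtain M where M: "M > 0" "\<And>z. norm z \<le> R \<Longrightarrow> norm (deriv g z) \<le> M"
    using bounded_pos[of "deriv g ` cball 0 R"] by (auto simp: image_iff)
  have lip: "norm (g z - g w) \<le> M * norm (z - w)" if "norm z \<le> R" "norm w \<le> R" for z w
  proof (rule field_differentiable_bound[of "cball 0 R" g "deriv g"])
    fix z :: complex assume "z \<in> cball 0 R"
    show "(g has_field_derivative deriv g z) (at z within cball 0 R)"
      using g by (meson UNIV_I has_field_derivative_at_within holomorphic_derivI open_UNIV)
  qed (use M that in auto)
  define D where "D = 2 * M * R"
  have D: "D > 0" using M R by (simp add: D_def)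
  have ev1: "\<forall>\<^sub>F \<mu> in at_top. D * (1/4 * \<mu> powr (-1/3)) * (2 * (1/4 * \<mu> powr (-1/3))) + 2 * pi * (D * exp (- d * \<mu> powr (1/3))) \<le> 2 * pi * (\<epsilon> * (c * \<mu> powr (-1/2)))"
    using d D c \<epsilon> by real_asymp
  show ?thesis using lower ev1 eventually_ge_at_top[of 1]
  proof eventually_elim
    case (elim \<mu>)
    define \<theta> where "\<theta> = 1/4 * \<mu> powr (-1/3)"
    define e where "e = exp (- d * \<mu> powr (1/3))"
    have "\<mu> powr (-1/3) \<le> \<mu> powr 0" using elim by (intro powr_mono) auto
    then have \<theta>: "0 \<le> \<theta>" "\<theta> \<le> 1/4" using elim by (auto simp: \<theta>_def)
    have \<theta>pi: "\<theta> \<le> pi" using \<theta> pi_gt3 by linarith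
    show ?case
    proof (intro allI impI, elim conjE)
      fix k r assume r: "r0 \<le> r" "r \<le> R" and k: "\<mu> * (r * (exp r - 1)) = real k"
      have rpos: "r > 0" using r r0 by simp
      define X where "X = exp (\<mu> * (exp r - 1 - r))"
      define Y where "Y = taylor_coeff (\<lambda>z. g z * poisson_fun \<mu> z) k - g (of_real r) * of_real (poisson_coeff \<mu> k)"
      have X: "X > 0" by (simp add: X_def)
      have I1: "((\<lambda>t. g (of_real r * cis t) * saddle_kernel \<mu> k r t) has_integral 2 * of_real pi * taylor_coeff (\<lambda>z. g z * poisson_fun \<mu> z) k * of_real (r ^ k / X)) {-pi..pi}"
        unfolding X_def by (rule has_integral_saddle_kernel[OF rpos g])
      have I2: "((\<lambda>t. g (of_real r) * saddle_kernel \<mu> k r t) has_integral 2 * of_real pi * taylor_coeff (\<lambda>z. g (of_real r) * poisson_fun \<mu> z) k * of_real (r ^ k / X)) {-pi..pi}"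
        unfolding X_def by (rule has_integral_saddle_kernel[OF rpos]) (intro holomorphic_intros)
      have "taylor_coeff (\<lambda>z. g (of_real r) * poisson_fun \<mu> z) k = g (of_real r) * of_real (poisson_coeff \<mu> k)"
        unfolding poisson_coeff_taylor[symmetric] taylor_coeff_def
        by (subst higher_deriv_cmult[of _ UNIV]) (auto intro: holomorphic_intros)
      with has_integral_diff[OF I1 I2]
      have I: "((\<lambda>t. (g (of_real r * cis t) - g (of_real r)) * saddle_kernel \<mu> k r t) has_integral 2 * of_real pi * Y * of_real (r ^ k / X)) {-pi..pi}"
        by (simp add: Y_def algebra_simps)
      have J: "((\<lambda>t. (if t \<in> {-\<theta>..\<theta>} then D * \<theta> else 0) + D * e) has_integral (2 * \<theta> * (D * \<theta>) + 2 * pi * (D * e))) {-pi..pi}"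
        using has_integral_add[OF has_integral_indicator_Icc[OF \<theta>(1) \<theta>pi, of "D * \<theta>"] has_integral_const_real[of "D * e" "-pi" pi]] by simp
      have bd: "norm ((g (of_real r * cis t) - g (of_real r)) * saddle_kernel \<mu> k r t) \<le> (if t \<in> {-\<theta>..\<theta>} then D * \<theta> else 0) + D * e" if t: "t \<in> {-pi..pi}" for t
      proof -
        have l: "norm (g (of_real r * cis t) - g (of_real r)) \<le> M * norm (of_real r * (cis t - 1))"
          using lip[of "of_real r * cis t" "of_real r"] r rpos by (simp add: norm_mult right_diff_distrib)
        have e0: "D * e \<ge> 0" using D by (simp add: e_def)
        show ?thesis
        proof (cases "t \<in> {-\<theta>..\<theta>}")
          case True
          have "norm (of_real r * (cis t - 1)) \<le> R * \<theta>"
            unfolding norm_mult norm_of_real using r rpos True norm_exp_ii_Taylor(1)[of t] by (intro mult_mono) auto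
          then have "norm (g (of_real r * cis t) - g (of_real r)) \<le> M * (R * \<theta>)"
            using l M(1) by (meson mult_left_mono order_trans less_imp_le)
          also have "\<dots> \<le> D * \<theta>" using M(1) R \<theta> by (simp add: D_def)
          finally have "norm (g (of_real r * cis t) - g (of_real r)) * norm (saddle_kernel \<mu> k r t) \<le> (D * \<theta>) * 1"
            using norm_saddle_kernel_le_1[of \<mu> r k t] elim rpos D \<theta> by (intro mult_mono) auto
          with True e0 show ?thesis by (simp add: norm_mult)
        next
          case False
          have "norm (cis t - 1) \<le> 2" using norm_triangle_ineq4[of "cis t" 1] by simp
          then have "norm (of_real r * (cis t - 1)) \<le> R * 2"
            unfolding norm_mult norm_of_real using r rpos by (intro mult_mono) auto
          then have "norm (g (of_real r * cis t) - g (of_real r)) \<le> M * (R * 2)"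
            using l M(1) by (meson mult_left_mono order_trans less_imp_le)
          also have "\<dots> = D" by (simp add: D_def)
          finally have "norm (g (of_real r * cis t) - g (of_real r)) \<le> D" .
          moreover have "norm (saddle_kernel \<mu> k r t) \<le> e"
            unfolding e_def d_def using False t elim r r0 by (intro saddle_kernel_far) (auto simp: \<theta>_def)
          ultimately have "norm (g (of_real r * cis t) - g (of_real r)) * norm (saddle_kernel \<mu> k r t) \<le> D * e"
            using D by (intro mult_mono) auto
          moreover have "(if t \<in> {-\<theta>..\<theta>} then D * \<theta> else 0) = 0" using False by (rule if_not_P)
          ultimately show ?thesis by (simp only: norm_mult add_0)
        qed
      qed
      have "norm (2 * of_real pi * Y * of_real (r ^ k / X)) \<le> 2 * \<theta> * (D * \<theta>) + 2 * pi * (D * e)"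
        using integral_norm_bound_integral[OF has_integral_integrable[OF I] has_integral_integrable[OF J] bd]
        unfolding integral_unique[OF I] integral_unique[OF J] by simp
      also have "\<dots> \<le> 2 * pi * (\<epsilon> * (c * \<mu> powr (-1/2)))"
        using elim(2) by (simp add: \<theta>_def e_def algebra_simps)
      finally have "2 * pi * (norm Y * (r ^ k / X)) \<le> 2 * pi * (\<epsilon> * (c * \<mu> powr (-1/2)))"
        using X rpos by (simp add: norm_mult norm_divide norm_power)
      then have "norm Y * (r ^ k / X) \<le> \<epsilon> * (c * \<mu> powr (-1/2))"
        by (rule mult_left_le_imp_le) simp
      also have "\<dots> \<le> \<epsilon> * (poisson_coeff \<mu> k * (r ^ k / X))"
      proof (rule mult_left_mono)
        have "c * \<mu> powr (-1/2) * X \<le> poisson_coeff \<mu> k * r ^ k" using elim(1) r k by (simp add: X_def)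
        then show "c * \<mu> powr (-1/2) \<le> poisson_coeff \<mu> k * (r ^ k / X)" using X by (simp add: field_simps)
      qed (use \<epsilon> in auto)
      finally have "norm Y * (r ^ k / X) \<le> (\<epsilon> * poisson_coeff \<mu> k) * (r ^ k / X)" by (simp only: mult.assoc)
      then show "norm Y \<le> \<epsilon> * poisson_coeff \<mu> k"
        by (rule mult_right_le_imp_le) (use X rpos in simp)
    qed
  qed
qed

subsection \<open>Taylor coefficients uniformly in \<open>k\<close>\<close>

lemma norm_taylor_coeff_le:
  assumes "f holomorphic_on UNIV" "\<rho> > 0" "\<And>z. norm z = \<rho> \<Longrightarrow> norm (f z) \<le> M"
  shows "norm (taylor_coeff f k) \<le> M / \<rho> ^ k"
proof -
  have "norm ((deriv ^^ k) f 0) \<le> fact k * M / \<rho> ^ k"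
    using assms by (intro Cauchy_inequality) (auto intro: holomorphic_on_subset holomorphic_on_imp_continuous_on)
  then show ?thesis by (simp add: taylor_coeff_def norm_divide field_simps)
qed

lemma sum_half_powers_le: "finite I \<Longrightarrow> (\<Sum>j\<in>I. (1/2::real) ^ j) \<le> 2"
  using sum_le_suminf[of "\<lambda>j. (1/2::real) ^ j" I] by (simp add: suminf_geometric)

lemma taylor_coeff_mult_poisson:
  assumes "g holomorphic_on UNIV"
  shows "taylor_coeff (\<lambda>z. g z * poisson_fun \<mu> z) k = (\<Sum>j\<le>k. taylor_coeff g j * of_real (poisson_coeff \<mu> (k - j)))"
  unfolding taylor_coeff_mult[OF assms holomorphic_poisson_fun] poisson_coeff_taylor ..

text \<open>With \<open>saddle_point_sq_ge\<close> this shows that \<open>r\<close> has the order of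
  \<open>sqrt (k / \<mu>)\<close>, so bounds on \<open>k / \<mu>\<close> and on \<open>r\<close> can
  be translated into each other.\<close>

lemma saddle_point_le_sqrt:
  assumes "r > 0" "r * (exp r - 1) \<le> (A::real)"
  shows "r \<le> sqrt A"
proof -
  have "r * r \<le> r * (exp r - 1)" using assms(1) exp_ge_add_one_self[of r]
    by (intro mult_left_mono; linarith)
  then have "r * r \<le> A" using assms(2) by linarith
  then have "r\<^sup>2 \<le> A" by (simp only: power2_eq_square)
  then show ?thesis using assms by (intro real_le_rsqrt)
qed

lemma saddle_point_sq_ge:
  assumes "r > 0" "r \<le> R"
  shows "r * (exp r - 1) \<le> r\<^sup>2 * exp (R::real)"
proof -
  have "exp r * (1 - r) \<le> exp r * exp (- r)" using exp_ge_add_one_self[of "-r"] by (intro mult_left_mono) auto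
  then have "exp r - 1 \<le> r * exp r" by (simp add: exp_minus algebra_simps)
  also have "\<dots> \<le> r * exp R" using assms by (intro mult_left_mono) auto
  finally have "r * (exp r - 1) \<le> r * (r * exp R)" using assms by (intro mult_left_mono) auto
  then show ?thesis by (simp add: power2_eq_square)
qed

text \<open>If \<open>k\<close> is small compared to \<open>\<mu>\<close>, all but the constant term of \<open>g\<close> are negligible; there is no
  linear term, which is decisive for odd \<open>k\<close>.\<close>

lemma taylor_coeff_small_k:
  assumes g: "g holomorphic_on UNIV" "g 0 = 1" "deriv g 0 = 0" and A: "A > 0" and \<epsilon>: "\<epsilon> > 0"
  obtains \<delta> where "\<delta> > 0" "\<And>\<mu> k r. \<mu> > 0 \<Longrightarrow> 2 \<le> k \<Longrightarrow> real k \<le> A * \<mu> \<Longrightarrow> real k \<le> \<delta> * \<mu> \<Longrightarrow> r > 0 \<Longrightarrow> \<mu> * (r * (exp r - 1)) = real k \<Longrightarrow>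
    norm (taylor_coeff (\<lambda>z. g z * poisson_fun \<mu> z) k - g (of_real r) * of_real (poisson_coeff \<mu> k)) \<le> \<epsilon> * poisson_coeff \<mu> k"
proof -
  obtain B where B: "B \<ge> 1" "\<And>\<mu> j k. \<mu> > 0 \<Longrightarrow> 2 \<le> k \<Longrightarrow> real k \<le> A * \<mu> \<Longrightarrow> j \<le> k \<Longrightarrow>
    poisson_coeff \<mu> (k - j) \<le> B ^ j * poisson_coeff \<mu> k \<and>
    (2 \<le> j \<longrightarrow> poisson_coeff \<mu> (k - j) \<le> 2 * real k / \<mu> * B ^ j * poisson_coeff \<mu> k)"
    using poisson_coeff_decr_geometric[OF A] by blast
  \<comment> \<open>Cauchy's inequality on the circle of radius \<open>2 * B\<close> makes the
    coefficients of \<open>g\<close> beat \<open>B ^ j\<close> by \<open>(1/2) ^ j\<close>.\<close>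
  have "bounded (g ` sphere 0 (2 * B))"
    using g by (intro compact_imp_bounded compact_continuous_image holomorphic_on_imp_continuous_on) (auto intro: holomorphic_on_subset)
  then obtain M where M: "M > 0" "\<And>z. norm z = 2 * B \<Longrightarrow> norm (g z) \<le> M"
    using bounded_pos[of "g ` sphere 0 (2 * B)"] by (auto simp: image_iff)
  have gj: "norm (taylor_coeff g j) \<le> M / (2 * B) ^ j" for j
    using B M by (intro norm_taylor_coeff_le g) auto
  have "isCont g 0" using g by (meson UNIV_I analytic_at_imp_isCont analytic_on_holomorphic open_UNIV analytic_at_two holomorphic_on_imp_continuous_on continuous_on_eq_continuous_at)
  then obtain s where s: "s > 0" "\<And>z. dist z 0 < s \<Longrightarrow> dist (g z) (g 0) < \<epsilon> / 2"
    using \<epsilon> unfolding continuous_at_eps_delta by (metis half_gt_zero)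
  \<comment> \<open>The first bound makes the sum over \<open>j \<ge> 2\<close> at most
    \<open>\<epsilon> / 2\<close> times the coefficient, the second forces
    \<open>r \<le> sqrt \<delta> < s\<close> and thereby \<open>g r\<close> close to
    \<open>g 0 = 1\<close>.\<close>
  define \<delta> where "\<delta> = min (\<epsilon> / (8 * M)) (s\<^sup>2 / 4)"
  have \<delta>: "\<delta> > 0" "4 * M * \<delta> \<le> \<epsilon> / 2" "sqrt \<delta> < s"
  proof -
    show "\<delta> > 0" using \<epsilon> M s by (simp add: \<delta>_def)
    have "4 * M * \<delta> \<le> 4 * M * (\<epsilon> / (8 * M))" using M by (intro mult_left_mono) (auto simp: \<delta>_def)
    then show "4 * M * \<delta> \<le> \<epsilon> / 2" using M by simp
    have "\<delta> \<le> s\<^sup>2 / 4" "0 < s\<^sup>2" using s by (auto simp: \<delta>_def)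
    then have "\<delta> < s\<^sup>2" by linarith
    then show "sqrt \<delta> < s" using s by (metis real_sqrt_less_mono real_sqrt_unique less_imp_le)
  qed
  show ?thesis
  proof (rule that[OF \<delta>(1)])
    fix \<mu> k r assume \<mu>: "\<mu> > 0" and k: "2 \<le> k" "real k \<le> A * \<mu>" "real k \<le> \<delta> * \<mu>" and r: "r > 0" "\<mu> * (r * (exp r - 1)) = real k"
    have pos: "poisson_coeff \<mu> k > 0" using poisson_coeff_pos[OF \<mu> k(1)] .
    have km: "real k / \<mu> \<le> \<delta>" using k \<mu> by (simp add: field_simps)
    have "r * (exp r - 1) = real k / \<mu>" using r(2) \<mu> by (simp add: field_simps)
    then have "r \<le> sqrt \<delta>" using saddle_point_le_sqrt[OF r(1), of \<delta>] km by simp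
    then have "dist (of_real r :: complex) 0 < s" using \<delta>(3) r by simp
    then have g1: "norm (1 - g (of_real r)) \<le> \<epsilon> / 2" using s(2)[of "of_real r"] g(2) by (simp add: dist_norm norm_minus_commute)
    have "{..k} = {0, 1} \<union> {2..k}" using k by auto
    then have "taylor_coeff (\<lambda>z. g z * poisson_fun \<mu> z) k = (\<Sum>j\<in>{0, 1} \<union> {2..k}. taylor_coeff g j * of_real (poisson_coeff \<mu> (k - j)))"
      by (simp only: taylor_coeff_mult_poisson[OF g(1)])
    also have "\<dots> = (\<Sum>j\<in>{0, 1}. taylor_coeff g j * of_real (poisson_coeff \<mu> (k - j))) + (\<Sum>j\<in>{2..k}. taylor_coeff g j * of_real (poisson_coeff \<mu> (k - j)))"
      by (rule sum.union_disjoint) auto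
    also have "(\<Sum>j\<in>{0, 1}. taylor_coeff g j * of_real (poisson_coeff \<mu> (k - j))) = of_real (poisson_coeff \<mu> k)"
      using g by (simp add: taylor_coeff_def)
    finally have eq: "taylor_coeff (\<lambda>z. g z * poisson_fun \<mu> z) k - g (of_real r) * of_real (poisson_coeff \<mu> k)
      = (1 - g (of_real r)) * of_real (poisson_coeff \<mu> k) + (\<Sum>j\<in>{2..k}. taylor_coeff g j * of_real (poisson_coeff \<mu> (k - j)))"
      by (simp add: algebra_simps)
    have "norm (\<Sum>j\<in>{2..k}. taylor_coeff g j * of_real (poisson_coeff \<mu> (k - j))) \<le> (\<Sum>j\<in>{2..k}. 2 * M * \<delta> * poisson_coeff \<mu> k * (1/2) ^ j)"
    proof (rule order.trans[OF norm_sum], rule sum_mono)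
      fix j assume j: "j \<in> {2..k}"
      have "norm (taylor_coeff g j * of_real (poisson_coeff \<mu> (k - j))) \<le> M / (2 * B) ^ j * (2 * real k / \<mu> * B ^ j * poisson_coeff \<mu> k)"
        unfolding norm_mult norm_of_real using B(2)[OF \<mu> k(1,2), of j] j gj[of j] poisson_coeff_nonneg[of \<mu> "k - j"] \<mu> M B(1)
        by (intro mult_mono) auto
      also have "\<dots> = 2 * M * (real k / \<mu>) * poisson_coeff \<mu> k * (1/2) ^ j"
        using B(1) by (simp add: power_mult_distrib power_divide mult_ac)
      also have "\<dots> \<le> 2 * M * \<delta> * poisson_coeff \<mu> k * (1/2) ^ j"
        using km M(1) pos by (intro mult_right_mono mult_left_mono) auto
      finally show "norm (taylor_coeff g j * of_real (poisson_coeff \<mu> (k - j))) \<le> 2 * M * \<delta> * poisson_coeff \<mu> k * (1/2) ^ j" .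
    qed
    also have "\<dots> = 2 * M * \<delta> * poisson_coeff \<mu> k * (\<Sum>j\<in>{2..k}. (1/2) ^ j)" by (simp only: sum_distrib_left)
    also have "\<dots> \<le> 2 * M * \<delta> * poisson_coeff \<mu> k * 2"
      using M(1) pos \<delta>(1) by (intro mult_left_mono sum_half_powers_le) auto
    also have "\<dots> = 4 * M * \<delta> * poisson_coeff \<mu> k" by simp
    also have "\<dots> \<le> \<epsilon> / 2 * poisson_coeff \<mu> k" using \<delta>(2) pos by (intro mult_right_mono) auto
    finally have 2: "norm (\<Sum>j\<in>{2..k}. taylor_coeff g j * of_real (poisson_coeff \<mu> (k - j))) \<le> \<epsilon> / 2 * poisson_coeff \<mu> k" .
    have "norm ((1 - g (of_real r)) * of_real (poisson_coeff \<mu> k)) \<le> \<epsilon> / 2 * poisson_coeff \<mu> k"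
      unfolding norm_mult norm_of_real using g1 pos \<epsilon> by (intro mult_mono) auto
    with 2 have "norm (taylor_coeff (\<lambda>z. g z * poisson_fun \<mu> z) k - g (of_real r) * of_real (poisson_coeff \<mu> k)) \<le> \<epsilon> / 2 * poisson_coeff \<mu> k + \<epsilon> / 2 * poisson_coeff \<mu> k"
      unfolding eq by (intro order.trans[OF norm_triangle_ineq] add_mono)
    then show "norm (taylor_coeff (\<lambda>z. g z * poisson_fun \<mu> z) k - g (of_real r) * of_real (poisson_coeff \<mu> k)) \<le> \<epsilon> * poisson_coeff \<mu> k"
      by (simp add: algebra_simps)
  qed
qed

lemma saddle_point_exp_le: "exp r - 1 - r \<le> r * (exp r - 1 :: real)"
proof -
  have "exp r * (1 - r) \<le> exp r * exp (- r)" using exp_ge_add_one_self[of "-r"] by (intro mult_left_mono) auto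
  then show ?thesis by (simp add: exp_minus algebra_simps)
qed

text \<open>Smallness of the entire factor on one fixed circle suffices for all \<open>k\<close>:
  its coefficients are at most \<open>\<epsilon> / (2 * B) ^ j\<close>, against the growth
  \<open>B ^ j\<close> of the Poisson coefficients, and the geometric series sums to 2.\<close>

lemma taylor_coeff_perturb:
  assumes A: "A > 0"
  obtains \<rho> where "\<rho> > 0" "\<And>f \<mu> k \<epsilon>. f holomorphic_on UNIV \<Longrightarrow> (\<And>z. norm z = \<rho> \<Longrightarrow> norm (f z) \<le> \<epsilon>) \<Longrightarrow>
     \<mu> > 0 \<Longrightarrow> 2 \<le> k \<Longrightarrow> real k \<le> A * \<mu> \<Longrightarrow>
     norm (taylor_coeff (\<lambda>z. f z * poisson_fun \<mu> z) k) \<le> 2 * \<epsilon> * poisson_coeff \<mu> k"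
proof -
  obtain B where B: "B \<ge> 1" "\<And>\<mu> j k. \<mu> > 0 \<Longrightarrow> 2 \<le> k \<Longrightarrow> real k \<le> A * \<mu> \<Longrightarrow> j \<le> k \<Longrightarrow>
    poisson_coeff \<mu> (k - j) \<le> B ^ j * poisson_coeff \<mu> k \<and>
    (2 \<le> j \<longrightarrow> poisson_coeff \<mu> (k - j) \<le> 2 * real k / \<mu> * B ^ j * poisson_coeff \<mu> k)"
    using poisson_coeff_decr_geometric[OF A] by blast
  show ?thesis
  proof (rule that[of "2 * B"])
    fix f :: "complex \<Rightarrow> complex" and \<mu> \<epsilon> :: real and k :: nat
    assume f: "f holomorphic_on UNIV" "\<And>z. norm z = 2 * B \<Longrightarrow> norm (f z) \<le> \<epsilon>" and \<mu>: "\<mu> > 0" and k: "2 \<le> k" "real k \<le> A * \<mu>"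
    have "norm (f (of_real (2 * B))) \<le> \<epsilon>" using B(1) by (intro f(2)) simp
    then have \<epsilon>: "\<epsilon> \<ge> 0" using norm_ge_zero order_trans by blast
    have fj: "norm (taylor_coeff f j) \<le> \<epsilon> / (2 * B) ^ j" for j
      using B f by (intro norm_taylor_coeff_le) auto
    have pos: "poisson_coeff \<mu> k > 0" using poisson_coeff_pos[OF \<mu> k(1)] .
    have "norm (taylor_coeff (\<lambda>z. f z * poisson_fun \<mu> z) k) \<le> (\<Sum>j\<le>k. \<epsilon> * poisson_coeff \<mu> k * (1/2) ^ j)"
      unfolding taylor_coeff_mult_poisson[OF f(1)]
    proof (rule order.trans[OF norm_sum], rule sum_mono)
      fix j assume j: "j \<in> {..k}"
      have "norm (taylor_coeff f j * of_real (poisson_coeff \<mu> (k - j))) \<le> \<epsilon> / (2 * B) ^ j * (B ^ j * poisson_coeff \<mu> k)"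
        unfolding norm_mult norm_of_real using B(2)[OF \<mu> k, of j] j fj[of j] poisson_coeff_nonneg[of \<mu> "k - j"] \<mu> \<epsilon> B(1)
        by (intro mult_mono) auto
      also have "\<dots> = \<epsilon> * poisson_coeff \<mu> k * (1/2) ^ j"
        using B(1) by (simp add: power_mult_distrib power_divide mult_ac)
      finally show "norm (taylor_coeff f j * of_real (poisson_coeff \<mu> (k - j))) \<le> \<epsilon> * poisson_coeff \<mu> k * (1/2) ^ j" .
    qed
    also have "\<dots> = \<epsilon> * poisson_coeff \<mu> k * (\<Sum>j\<le>k. (1/2) ^ j)" by (simp only: sum_distrib_left)
    also have "\<dots> \<le> \<epsilon> * poisson_coeff \<mu> k * 2"
      using \<epsilon> pos by (intro mult_left_mono sum_half_powers_le) auto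
    finally show "norm (taylor_coeff (\<lambda>z. f z * poisson_fun \<mu> z) k) \<le> 2 * \<epsilon> * poisson_coeff \<mu> k" by (simp add: mult_ac)
  qed (use B in auto)
qed

lemma saddle_point_bounds:
  assumes "\<mu> > 0" "r > 0" "\<mu> * (r * (exp r - 1)) = real k" "real k \<le> A * \<mu>"
  shows "r \<le> sqrt A" "real k / \<mu> \<le> r\<^sup>2 * exp (sqrt A)"
proof -
  have e: "r * (exp r - 1) = real k / \<mu>" using assms by (simp add: field_simps)
  have "real k / \<mu> \<le> A" using assms by (simp add: field_simps)
  then show r: "r \<le> sqrt A" using e assms by (intro saddle_point_le_sqrt) auto
  show "real k / \<mu> \<le> r\<^sup>2 * exp (sqrt A)" unfolding e[symmetric] using assms(2) r by (rule saddle_point_sq_ge)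
qed

theorem taylor_coeff_asymp:
  assumes g: "g holomorphic_on UNIV" "g 0 = 1" "deriv g 0 = 0" and A: "A > 0" and \<epsilon>: "\<epsilon> > 0"
  shows "\<forall>\<^sub>F \<mu> in at_top. \<forall>k r. 2 \<le> k \<and> real k \<le> A * \<mu> \<and> r > 0 \<and> \<mu> * (r * (exp r - 1)) = real k \<longrightarrow>
    norm (taylor_coeff (\<lambda>z. g z * poisson_fun \<mu> z) k - g (of_real r) * of_real (poisson_coeff \<mu> k)) \<le> \<epsilon> * poisson_coeff \<mu> k"
proof -
  obtain \<delta> where \<delta>: "\<delta> > 0" "\<And>\<mu> k r. \<mu> > 0 \<Longrightarrow> 2 \<le> k \<Longrightarrow> real k \<le> A * \<mu> \<Longrightarrow> real k \<le> \<delta> * \<mu> \<Longrightarrow> r > 0 \<Longrightarrow> \<mu> * (r * (exp r - 1)) = real k \<Longrightarrow>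
    norm (taylor_coeff (\<lambda>z. g z * poisson_fun \<mu> z) k - g (of_real r) * of_real (poisson_coeff \<mu> k)) \<le> \<epsilon> * poisson_coeff \<mu> k"
    using taylor_coeff_small_k[OF g A \<epsilon>] by blast
  \<comment> \<open>If \<open>k > \<delta> * \<mu>\<close>, the saddle point equation forces
    \<open>r\<^sup>2 \<ge> \<delta> * exp (- sqrt A)\<close>, so the saddle point method applies
    with this \<open>r0\<close>.\<close>
  define r0 where "r0 = min (sqrt A) (sqrt (\<delta> * exp (- sqrt A)))"
  have r0: "0 < r0" "r0 \<le> sqrt A" using A \<delta> by (auto simp: r0_def)
  show ?thesis using taylor_coeff_saddle[OF g(1) r0 \<epsilon>] eventually_gt_at_top[of 0]
  proof eventually_elim
    case (elim \<mu>)
    show ?case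
    proof (intro allI impI, elim conjE)
      fix k r assume k: "2 \<le> k" "real k \<le> A * \<mu>" and r: "r > 0" "\<mu> * (r * (exp r - 1)) = real k"
      show "norm (taylor_coeff (\<lambda>z. g z * poisson_fun \<mu> z) k - g (of_real r) * of_real (poisson_coeff \<mu> k)) \<le> \<epsilon> * poisson_coeff \<mu> k"
      proof (cases "real k \<le> \<delta> * \<mu>")
        case True
        with \<delta>(2) elim k r show ?thesis by blast
      next
        case False
        note b = saddle_point_bounds[OF elim(2) r k(2)]
        have "\<delta> \<le> real k / \<mu>" using False elim by (simp add: field_simps)
        with b(2) have "\<delta> * exp (- sqrt A) \<le> r\<^sup>2" by (simp add: exp_minus field_simps)
        then have "sqrt (\<delta> * exp (- sqrt A)) \<le> r" using r by (intro real_le_lsqrt) auto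
        then have "r0 \<le> r" by (simp add: r0_def)
        with elim(1) b(1) r show ?thesis by blast
      qed
    qed
  qed
qed

text \<open>Turns Cauchy's inequality on the circle of radius \<open>r\<close> into a relative
  error. For \<open>k\<close> of order \<mu> the loss is only \<open>\<mu> powr (-1/2)\<close>. For
  \<open>k \<le> \<epsilon> * \<mu>\<close> the saddle point method gives nothing uniform, but then
  both sides can be compared crudely, with a loss exponential in \<open>k\<close> only, apart from a
  factor of order \<open>1 / \<mu>\<close>.\<close>

lemma poisson_coeff_ge_exp:
  assumes A: "A > 0" and \<delta>: "\<delta> > 0"
  shows "\<forall>\<^sub>F \<mu> in at_top. \<forall>k r. 2 \<le> k \<and> real k \<le> A * \<mu> \<and> r > 0 \<and> \<mu> * (r * (exp r - 1)) = real k \<longrightarrow>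
    exp (\<mu> * (exp r - 1 - r)) * exp (- \<delta> * \<mu>) \<le> poisson_coeff \<mu> k * r ^ k"
proof -
  define b where "b = exp (- sqrt A) / 2"
  have b: "0 < b" "b \<le> 1" using A by (auto simp: b_def) (metis divide_le_eq_1 exp_le_one_iff neg_le_0_iff_le one_le_numeral order_trans real_sqrt_ge_0_iff less_imp_le zero_less_numeral)
  \<comment> \<open>Chosen such that \<open>k * (1 - ln b) \<le> \<delta> * \<mu> / 2\<close> for
    \<open>k \<le> \<epsilon> * \<mu>\<close>: the loss \<open>(exp 1 / b) ^ k\<close> then uses
    half of the permitted exponent.\<close>
  define \<epsilon> where "\<epsilon> = \<delta> / (2 * (1 - ln b))"
  have lnb: "ln b \<le> 0" using b by simp
  have \<epsilon>: "\<epsilon> > 0" using \<delta> lnb by (simp add: \<epsilon>_def)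
  define r0 where "r0 = min (sqrt A) (sqrt (\<epsilon> * exp (- sqrt A)))"
  have r0: "0 < r0" "r0 \<le> sqrt A" using A \<epsilon> by (auto simp: r0_def)
  obtain c where c: "c > 0" and lower: "\<forall>\<^sub>F \<mu> in at_top. \<forall>k r. r0 \<le> r \<and> r \<le> sqrt A \<and> \<mu> * (r * (exp r - 1)) = real k \<longrightarrow>
    poisson_coeff \<mu> k * r ^ k \<ge> c * \<mu> powr (-1/2) * exp (\<mu> * (exp r - 1 - r))"
    using poisson_coeff_saddle_ge[OF r0] by blast
  have ev1: "\<forall>\<^sub>F \<mu> in at_top. exp (- \<delta> * \<mu>) \<le> c * \<mu> powr (-1/2)" using \<delta> c by real_asymp
  have ev2: "\<forall>\<^sub>F \<mu> in at_top. exp (- \<delta> / 2 * \<mu>) \<le> b / \<mu>" using \<delta> b by real_asymp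
  show ?thesis using lower ev1 ev2 eventually_ge_at_top[of 1]
  proof eventually_elim
    case (elim \<mu>)
    show ?case
    proof (intro allI impI, elim conjE)
      fix k r assume k: "2 \<le> k" "real k \<le> A * \<mu>" and r: "r > 0" "\<mu> * (r * (exp r - 1)) = real k"
      have \<mu>: "\<mu> > 0" using elim by simp
      note bd = saddle_point_bounds[OF \<mu> r k(2)]
      define X where "X = exp (\<mu> * (exp r - 1 - r))"
      have X: "X > 0" by (simp add: X_def)
      show "exp (\<mu> * (exp r - 1 - r)) * exp (- \<delta> * \<mu>) \<le> poisson_coeff \<mu> k * r ^ k"
      proof (cases "real k \<le> \<epsilon> * \<mu>")
        case False
        have "\<epsilon> \<le> real k / \<mu>" using False \<mu> by (simp add: field_simps)
        with bd(2) have "\<epsilon> * exp (- sqrt A) \<le> r\<^sup>2" by (simp add: exp_minus field_simps)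
        then have "sqrt (\<epsilon> * exp (- sqrt A)) \<le> r" using r by (intro real_le_lsqrt) auto
        then have "r0 \<le> r" by (simp add: r0_def)
        then have "c * \<mu> powr (-1/2) * X \<le> poisson_coeff \<mu> k * r ^ k" using elim(1) bd(1) r unfolding X_def by blast
        moreover have "exp (- \<delta> * \<mu>) * X \<le> c * \<mu> powr (-1/2) * X" using elim(2) X by (intro mult_right_mono) auto
        ultimately show ?thesis unfolding X_def[symmetric] by (simp add: mult.commute)
      next
        case True
        define q where "q = 2 * real k / \<mu>"
        have q: "q > 0" using k \<mu> by (simp add: q_def)
        have "q * b \<le> r\<^sup>2"
        proof -
          have "q * b = real k / \<mu> * exp (- sqrt A)" by (simp add: q_def b_def)
          also have "\<dots> \<le> r\<^sup>2 * exp (sqrt A) * exp (- sqrt A)" using bd(2) by (intro mult_right_mono) auto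
          also have "\<dots> = r\<^sup>2" by (simp add: exp_minus)
          finally show ?thesis .
        qed
        have 1: "1 \<le> q ^ (k div 2) * poisson_coeff \<mu> k"
          using poisson_coeff_decr[OF \<mu>, of k k k] k by (simp add: q_def)
        have "q \<ge> 1 / \<mu>" using k \<mu> by (simp add: q_def divide_right_mono)
        \<comment> \<open>For odd \<open>k\<close> one factor \<open>r\<close> is not paired with
          \<open>q\<close>. It may tend to 0, but not faster than of order \<open>1 / \<mu>\<close>,
          which the other half of the exponent covers.\<close>
        have rb: "b / \<mu> \<le> r ^ (k mod 2)"
        proof (cases "even k")
          case True
          then show ?thesis using b elim by (simp add: even_iff_mod_2_eq_zero divide_le_eq)
        next
          case False
          have "b / \<mu> \<le> q * b" using mult_right_mono[OF \<open>q \<ge> 1 / \<mu>\<close>, of b] b by simp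
          then have "b / \<mu> \<le> r\<^sup>2" using \<open>q * b \<le> r\<^sup>2\<close> by linarith
          moreover have "b / \<mu> \<le> 1" using b elim by (simp add: divide_le_eq)
          ultimately have "b / \<mu> \<le> r"
            using r by (cases "r \<le> 1") (auto simp: power2_eq_square intro: order.trans mult_left_le_one_le)
          then show ?thesis using False by (simp add: odd_iff_mod_2_eq_one)
        qed
        have "b ^ k * (b / \<mu>) \<le> b ^ (k div 2) * r ^ (k mod 2)"
          using b rb \<mu> by (intro mult_mono power_decreasing) auto
        also have "\<dots> \<le> b ^ (k div 2) * r ^ (k mod 2) * (q ^ (k div 2) * poisson_coeff \<mu> k)"
          using mult_left_mono[OF 1, of "b ^ (k div 2) * r ^ (k mod 2)"] b r by simp
        also have "\<dots> = (q * b) ^ (k div 2) * r ^ (k mod 2) * poisson_coeff \<mu> k" by (simp add: power_mult_distrib mult_ac)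
        also have "\<dots> \<le> (r\<^sup>2) ^ (k div 2) * r ^ (k mod 2) * poisson_coeff \<mu> k"
          using \<open>q * b \<le> r\<^sup>2\<close> q b r \<mu> by (intro mult_right_mono power_mono poisson_coeff_nonneg) auto
        also have "(r\<^sup>2) ^ (k div 2) * r ^ (k mod 2) = r ^ k"
          by (metis power_add power_mult mult_div_mod_eq)
        finally have 2: "b ^ k * (b / \<mu>) \<le> poisson_coeff \<mu> k * r ^ k" by (simp add: mult.commute)
        have "X \<le> exp (real k)"
        proof -
          have "\<mu> * (exp r - 1 - r) \<le> \<mu> * (r * (exp r - 1))" using \<mu> by (intro mult_left_mono saddle_point_exp_le) auto
          then show ?thesis using r by (simp add: X_def)
        qed
        moreover have "exp (real k) * exp (- \<delta> / 2 * \<mu>) \<le> b ^ k"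
        proof -
          have "real k * (1 - ln b) \<le> \<epsilon> * \<mu> * (1 - ln b)" using True lnb by (intro mult_right_mono) auto
          also have "\<dots> = \<delta> / 2 * \<mu>"
          proof -
            have gen: "\<delta> / (2 * n) * \<mu> * n = \<delta> / 2 * \<mu>" if "n \<noteq> 0" for n using that by simp
            have "1 - ln b \<noteq> 0" using lnb by linarith
            from gen[OF this] show ?thesis unfolding \<epsilon>_def .
          qed
          finally have "real k + - \<delta> / 2 * \<mu> \<le> real k * ln b" by (simp add: algebra_simps)
          then have "exp (real k + - \<delta> / 2 * \<mu>) \<le> exp (real k * ln b)" by simp
          also have "exp (real k * ln b) = b ^ k" using b by (simp add: exp_of_nat_mult)
          finally show ?thesis by (simp only: exp_add)
        qed
        ultimately have "X * exp (- \<delta> / 2 * \<mu>) \<le> b ^ k"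
          by (meson exp_ge_zero mult_right_mono order_trans)
        then have "X * exp (- \<delta> / 2 * \<mu>) * exp (- \<delta> / 2 * \<mu>) \<le> b ^ k * (b / \<mu>)"
          using elim(3) b by (intro mult_mono) auto
        moreover have "exp (- \<delta> * \<mu>) = exp (- \<delta> / 2 * \<mu>) * exp (- \<delta> / 2 * \<mu>)" by (simp add: exp_add[symmetric])
        ultimately show ?thesis using 2 unfolding X_def[symmetric] by (simp only: mult.assoc)
      qed
    qed
  qed
qed

subsection \<open>The factors of the asymptotic formula\<close>

lemma has_field_derivative_exp_sum_iterated:
  fixes b c :: "'i \<Rightarrow> complex"
  shows "(deriv ^^ k) (\<lambda>z. \<Sum>i\<in>I. c i * exp (b i * z)) = (\<lambda>z. \<Sum>i\<in>I. c i * b i ^ k * exp (b i * z))"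
proof (induction k)
  case (Suc k)
  have "deriv (\<lambda>z. \<Sum>i\<in>I. c i * b i ^ k * exp (b i * z)) z = (\<Sum>i\<in>I. c i * b i ^ Suc k * exp (b i * z))" for z
    by (rule DERIV_imp_deriv, rule DERIV_sum) (auto intro!: derivative_eq_intros)
  then show ?case using Suc by auto
qed simp

lemma taylor_coeff_exp_sum:
  fixes b c :: "'i \<Rightarrow> complex"
  shows "taylor_coeff (\<lambda>z. \<Sum>i\<in>I. c i * exp (b i * z)) k = (\<Sum>i\<in>I. c i * b i ^ k) / fact k"
  unfolding taylor_coeff_def has_field_derivative_exp_sum_iterated by simp

text \<open>The factor \<open>G\<close> of the overview. The main term is
  \<open>log_mean_coeff v * ln x powr v\<close> with \<open>v = exp z - 1\<close>. Centring
  multiplies it by \<open>exp (- z * (\<mu> + meissel_mertens))\<close>, and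
  \<open>exp (\<mu> * (v - z))\<close> is split off as \<open>poisson_fun\<close>.\<close>

definition moment_factor :: "complex \<Rightarrow> complex" where
  "moment_factor z = exp (- (z * of_real meissel_mertens)) * log_mean_coeff (exp z - 1)"

text \<open>The factor \<open>K\<close> of the overview: the limit of the normalised products
  \<open>bernoulli_factor_upto\<close>.\<close>

definition bernoulli_factor :: "complex \<Rightarrow> complex" where
  "bernoulli_factor z = prime_product (exp z - 1) 0 * exp (of_real meissel_mertens * (exp z - 1 - z))"

lemma holomorphic_moment_factor [holomorphic_intros]: "moment_factor holomorphic_on UNIV"
proof -
  have "log_mean_coeff \<circ> (\<lambda>z. exp z - 1) holomorphic_on UNIV"
    by (rule holomorphic_on_compose[OF _ holomorphic_on_subset[OF holomorphic_log_mean_coeff]]) (auto intro!: holomorphic_intros)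
  then show ?thesis unfolding moment_factor_def o_def by (intro holomorphic_intros)
qed

lemma holomorphic_bernoulli_factor [holomorphic_intros]: "bernoulli_factor holomorphic_on UNIV"
proof -
  have "(\<lambda>v. prime_product v 0) \<circ> (\<lambda>z. exp z - 1) holomorphic_on UNIV"
    by (rule holomorphic_on_compose[OF _ holomorphic_on_subset[OF holomorphic_prime_product]]) (auto intro!: holomorphic_intros)
  then show ?thesis unfolding bernoulli_factor_def o_def by (intro holomorphic_intros)
qed

lemma moment_factor_0: "moment_factor 0 = 1" "deriv moment_factor 0 = 0"
proof -
  show "moment_factor 0 = 1" by (simp add: moment_factor_def)
  have "((\<lambda>z::complex. exp z - 1) has_field_derivative exp 0) (at 0)" by (auto intro!: derivative_eq_intros)
  then have "((\<lambda>z. log_mean_coeff (exp z - 1)) has_field_derivative of_real meissel_mertens * exp 0) (at 0)"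
    using has_field_derivative_log_mean_coeff_0 by (intro DERIV_chain2[of log_mean_coeff]) auto
  then have "(moment_factor has_field_derivative 0) (at 0)"
    unfolding moment_factor_def by (auto intro!: derivative_eq_intros)
  then show "deriv moment_factor 0 = 0" by (rule DERIV_imp_deriv)
qed

lemma bernoulli_factor_0: "bernoulli_factor 0 = 1" "deriv bernoulli_factor 0 = 0"
proof -
  show "bernoulli_factor 0 = 1" by (simp add: bernoulli_factor_def)
  have "((\<lambda>z::complex. exp z - 1) has_field_derivative exp 0) (at 0)" by (auto intro!: derivative_eq_intros)
  moreover have "((\<lambda>v. prime_product v 0) has_field_derivative 0) (at 0)"
    using holomorphic_derivI[OF holomorphic_prime_product, of 0] deriv_prime_product_0 by simp
  ultimately have "((\<lambda>z. prime_product (exp z - 1) 0) has_field_derivative 0 * exp 0) (at 0)"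
    by (intro DERIV_chain2[of "\<lambda>v. prime_product v 0"]) auto
  then have "(bernoulli_factor has_field_derivative 0) (at 0)"
    unfolding bernoulli_factor_def by (auto intro!: derivative_eq_intros)
  then show "deriv bernoulli_factor 0 = 0" by (rule DERIV_imp_deriv)
qed

text \<open>With \<open>v = exp z - 1\<close> and \<open>a = meissel_mertens\<close>, the exponent
  \<open>v * (a - \<gamma>) - z * a\<close> equals \<open>- \<gamma> * v + a * (v - z)\<close>. So
  the quotient of the two factors involves only \<gamma> and the Gamma function.\<close>

lemma moment_factor_eq:
  "moment_factor z = exp (- of_real euler_mascheroni * (exp z - 1)) * rGamma (exp z) * bernoulli_factor z"
  unfolding moment_factor_def bernoulli_factor_def log_mean_coeff_def
  by (simp add: algebra_simps exp_add exp_diff exp_minus divide_inverse)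

lemma summable_ln_one_plus_over_primes:
  assumes "v \<ge> (0::real)"
  shows "summable (\<lambda>p. if prime p then ln (1 + v / real p) - v / real p else 0)"
proof (rule summable_comparison_test_ev)
  show "summable (\<lambda>p. v\<^sup>2 * (1 / real p ^ 2))"
    using inverse_power_summable[of 2, where ?'a = real] by (simp add: divide_inverse summable_mult)
  show "\<forall>\<^sub>F p in sequentially. norm (if prime p then ln (1 + v / real p) - v / real p else 0) \<le> v\<^sup>2 * (1 / real p ^ 2)"
    using eventually_ge_at_top[of "max 1 (nat \<lceil>v\<rceil>)"]
  proof eventually_elim
    case (elim p)
    then have "real p \<ge> 1" "v \<le> real p" by auto
    then have "\<bar>ln (1 + v / real p) - v / real p\<bar> \<le> (v / real p)\<^sup>2"
      using assms by (intro abs_ln_one_plus_x_minus_x_bound_nonneg) auto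
    then show ?case using assms by (auto simp: power_divide)
  qed
qed

definition prime_log_sum :: "real \<Rightarrow> real" where
  "prime_log_sum v = (\<Sum>p. if prime p then ln (1 + v / real p) - v / real p else 0)"

lemma prime_product_of_real:
  assumes "v \<ge> 0"
  shows "prime_product (of_real v) 0 = of_real (exp (prime_log_sum v))"
proof -
  let ?f = "\<lambda>p. if prime p then ln (1 + v / real p) - v / real p else 0"
  have "(\<lambda>N. complex_of_real (exp (\<Sum>p<N. ?f p))) \<longlonglongrightarrow> of_real (exp (prime_log_sum v))"
    using summable_LIMSEQ[OF summable_ln_one_plus_over_primes[OF assms]]
    by (intro tendsto_of_real tendsto_exp) (simp add: prime_log_sum_def)
  moreover have "complex_of_real (exp (\<Sum>p<N. ?f p)) = (\<Prod>p<N. prime_factor_at p (of_real v, 0))" for N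
  proof -
    have "complex_of_real (exp (\<Sum>p<N. ?f p)) = (\<Prod>p<N. complex_of_real (exp (?f p)))"
      by (simp add: exp_sum)
    also have "\<dots> = (\<Prod>p<N. prime_factor_at p (of_real v, 0))"
    proof (intro prod.cong refl)
      fix p
      show "complex_of_real (exp (?f p)) = prime_factor_at p (of_real v, 0)"
      proof (cases "prime p")
        case True
        then have p: "p > 0" using prime_gt_0_nat by blast
        have "0 < 1 + v / real p" using assms by (intro add_pos_nonneg) auto
        then have "exp (?f p) = (1 + v / real p) * exp (- (v / real p))"
          using True by (simp add: exp_diff exp_minus divide_inverse)
        then show ?thesis using True p
          by (simp add: prime_factor_at_def weierstrass_factor_def powr_minus divide_inverse flip: exp_of_real)
      qed (simp add: prime_factor_at_def)
    qed
    finally show ?thesis .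
  qed
  ultimately show ?thesis using prime_product_LIMSEQ[of 0 "of_real v"] LIMSEQ_unique by auto
qed

text \<open>Since \<open>1 + (1 + v) / (p - 1) = (1 + v / p) / (1 - 1 / p)\<close>, the factor of
  \<open>F\<close> at \<open>1 + v\<close> is \<open>(1 - 1/p) powr v * (1 + v / p)\<close>. Adding
  and subtracting \<open>v / p\<close> in its logarithm separates two convergent series, one of them
  \<open>v\<close> times that of the Meissel-Mertens constant.\<close>

lemma F_fun_eq:
  assumes v: "v \<ge> 0"
  shows "F_fun (1 + v) = exp (prime_log_sum v + v * (meissel_mertens - euler_mascheroni)) / Gamma (1 + v)"
proof -
  let ?f = "\<lambda>p. if prime p then ln (1 + v / real p) - v / real p else 0"
  let ?g = "\<lambda>p. if prime p then ln (1 - 1 / real p) + 1 / real p else 0"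
  have "(\<lambda>p. ?f p + v * ?g p) sums (prime_log_sum v + v * (meissel_mertens - euler_mascheroni))"
    unfolding prime_log_sum_def meissel_mertens_def
    using summable_sums[OF summable_ln_one_plus_over_primes[OF v]] summable_sums[OF summable_meissel_mertens]
    by (intro sums_add sums_mult) auto
  then have "(\<lambda>p. exp (?f p + v * ?g p)) has_prod exp (prime_log_sum v + v * (meissel_mertens - euler_mascheroni))"
    by (simp only: has_prod_def sums_imp_has_prod_exp simp_thms)
  also have "(\<lambda>p. exp (?f p + v * ?g p)) = (\<lambda>p. if prime p then of_real (1 - 1 / real p) powr (1 + v) * (1 + (1 + v) / (of_nat p - 1)) else 1)"
  proof
    fix p
    show "exp (?f p + v * ?g p) = (if prime p then of_real (1 - 1 / real p) powr (1 + v) * (1 + (1 + v) / (of_nat p - 1)) else 1)"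
    proof (cases "prime p")
      case True
      then have p: "real p > 1" using prime_gt_1_nat by simp
      have pos: "0 < 1 - 1 / real p" "0 < 1 + v / real p" using p v by (auto intro: add_pos_nonneg)
      have e: "1 + (1 + v) / (real p - 1) = (1 + v / real p) / (1 - 1 / real p)"
        using p by (simp add: field_simps)
      have "(1 - 1 / real p) powr (1 + v) * (1 + (1 + v) / (real p - 1)) = (1 - 1 / real p) powr v * (1 + v / real p)"
        unfolding e using pos by (simp add: powr_add)
      also have "\<dots> = exp (v * ln (1 - 1 / real p)) * exp (ln (1 + v / real p))"
        using pos p by (simp add: powr_def)
      also have "\<dots> = exp (?f p + v * ?g p)"
        using True by (simp add: exp_add[symmetric] algebra_simps)
      finally show ?thesis using True by simp
    qed simp
  qed
  finally show ?thesis unfolding F_fun_def by (simp add: has_prod_unique[symmetric])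
qed

definition gamma_factor :: "real \<Rightarrow> real" where
  "gamma_factor r = exp (- euler_mascheroni * (exp r - 1)) / Gamma (exp r)"

definition bernoulli_factor_real :: "real \<Rightarrow> real" where
  "bernoulli_factor_real r = exp (prime_log_sum (exp r - 1) + meissel_mertens * (exp r - 1 - r))"

lemma bernoulli_factor_of_real: "r \<ge> 0 \<Longrightarrow> bernoulli_factor (of_real r) = of_real (bernoulli_factor_real r)"
proof -
  assume r: "r \<ge> 0"
  have "exp (of_real r) - 1 = (of_real (exp r - 1) :: complex)" by (simp add: exp_of_real)
  moreover have "exp (of_real r) - 1 - of_real r = (of_real (exp r - 1 - r) :: complex)" by (simp add: exp_of_real)
  ultimately have "bernoulli_factor (of_real r) = prime_product (of_real (exp r - 1)) 0 * exp (of_real (meissel_mertens * (exp r - 1 - r)))"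
    unfolding bernoulli_factor_def by simp
  then have "bernoulli_factor (of_real r) = of_real (exp (prime_log_sum (exp r - 1))) * of_real (exp (meissel_mertens * (exp r - 1 - r)))"
    using r by (simp only: prime_product_of_real exp_of_real diff_ge_0_iff_ge one_le_exp_iff)
  then show ?thesis by (simp add: bernoulli_factor_real_def exp_add)
qed

lemma moment_factor_of_real:
  assumes "r \<ge> 0"
  shows "moment_factor (of_real r) = of_real (gamma_factor r * bernoulli_factor_real r)"
proof -
  have "rGamma (exp (of_real r)) = (of_real (rGamma (exp r)) :: complex)"
    by (simp add: exp_of_real rGamma_complex_of_real)
  moreover have "exp (- of_real euler_mascheroni * (exp (of_real r) - 1)) = (of_real (exp (- euler_mascheroni * (exp r - 1))) :: complex)"
    by (simp add: exp_of_real[symmetric])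
  ultimately show ?thesis
    unfolding moment_factor_eq bernoulli_factor_of_real[OF assms] gamma_factor_def
    by (simp add: rGamma_inverse_Gamma divide_inverse)
qed

lemma F_fun_factor:
  assumes "r \<ge> 0"
  shows "F_fun (exp r) / exp (r * meissel_mertens) = gamma_factor r * bernoulli_factor_real r"
proof -
  have "F_fun (1 + (exp r - 1)) = exp (prime_log_sum (exp r - 1) + (exp r - 1) * (meissel_mertens - euler_mascheroni)) / Gamma (1 + (exp r - 1))"
    using assms by (intro F_fun_eq) simp
  then have "F_fun (exp r) / exp (r * meissel_mertens) = exp (prime_log_sum (exp r - 1) + (exp r - 1) * (meissel_mertens - euler_mascheroni) - r * meissel_mertens) / Gamma (exp r)"
    by (simp add: exp_diff)
  also have "prime_log_sum (exp r - 1) + (exp r - 1) * (meissel_mertens - euler_mascheroni) - r * meissel_mertens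
     = - euler_mascheroni * (exp r - 1) + (prime_log_sum (exp r - 1) + meissel_mertens * (exp r - 1 - r))"
    by (simp add: algebra_simps)
  also have "exp (- euler_mascheroni * (exp r - 1) + (prime_log_sum (exp r - 1) + meissel_mertens * (exp r - 1 - r))) / Gamma (exp r)
     = gamma_factor r * bernoulli_factor_real r"
    unfolding gamma_factor_def bernoulli_factor_real_def exp_add[of "- euler_mascheroni * (exp r - 1)"] by simp
  finally show ?thesis .
qed

lemma gamma_factor_pos: "gamma_factor r > 0"
  by (simp add: gamma_factor_def Gamma_real_pos)

lemma bernoulli_factor_real_pos: "bernoulli_factor_real r > 0"
  by (simp add: bernoulli_factor_real_def)

lemma continuous_on_gamma_factor: "continuous_on A gamma_factor"
proof -
  have "exp x \<notin> \<int>\<^sub>\<le>\<^sub>0" for x :: real by (metis exp_gt_zero nonpos_Ints_nonpos not_less)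
  then have "continuous_on (exp ` A) (Gamma :: real \<Rightarrow> real)"
    by (intro continuous_on_Gamma) blast
  from continuous_on_compose[OF continuous_on_exp[OF continuous_on_id] this]
  have c2: "continuous_on A (\<lambda>r. Gamma (exp r :: real))" by (simp add: o_def)
  have c1: "continuous_on A (\<lambda>r::real. exp (- euler_mascheroni * (exp r - 1)) :: real)" by (intro continuous_intros)
  have "Gamma (exp r) \<noteq> 0" for r :: real using Gamma_real_pos[OF exp_gt_zero, of r] by linarith
  with c1 c2 show ?thesis unfolding gamma_factor_def by (intro continuous_on_divide) auto
qed

lemma continuous_on_bernoulli_factor_real: "continuous_on {0..R} bernoulli_factor_real"
proof -
  have "continuous_on {0..R} (\<lambda>r. Re (bernoulli_factor (of_real r)))"
    by (intro continuous_intros continuous_on_compose2[OF holomorphic_on_imp_continuous_on[OF holomorphic_bernoulli_factor]]) auto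
  then show ?thesis by (rule continuous_on_eq) (simp add: bernoulli_factor_of_real)
qed

lemma continuous_pos_bounds:
  fixes f :: "real \<Rightarrow> real"
  assumes "continuous_on {0..R} f" "\<And>r. f r > 0" "R \<ge> 0"
  obtains c C where "0 < c" "\<And>r. 0 \<le> r \<Longrightarrow> r \<le> R \<Longrightarrow> c \<le> f r \<and> f r \<le> C"
proof -
  obtain a where a: "a \<in> {0..R}" "\<And>r. r \<in> {0..R} \<Longrightarrow> f a \<le> f r"
    using continuous_attains_inf[of "{0..R}" f] assms by auto
  obtain b where b: "b \<in> {0..R}" "\<And>r. r \<in> {0..R} \<Longrightarrow> f r \<le> f b"
    using continuous_attains_sup[of "{0..R}" f] assms by auto
  show ?thesis using that[of "f a" "f b"] assms(2) a b by auto
qed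

lemma norm_exp_minus_1_le_exp: "norm (exp \<zeta> - 1) \<le> norm \<zeta> * exp (norm (\<zeta>::complex))"
proof -
  have "norm (exp \<zeta> - 1) \<le> exp \<bar>Re \<zeta>\<bar> * norm \<zeta>" using Taylor_exp[of \<zeta> 0] by simp
  also have "\<dots> \<le> exp (norm \<zeta>) * norm \<zeta>" by (intro mult_right_mono) (auto simp: abs_Re_le_cmod)
  finally show ?thesis by (simp add: mult.commute)
qed

text \<open>The shift \<open>e\<close> serves to pass from the centre \<open>ln (ln x) + meissel_mertens\<close> to the sum of the
  reciprocals of the primes.\<close>

lemma mean_exp_omega_asymp:
  obtains C where "C > 0" "\<And>z x e. norm z \<le> R \<Longrightarrow> x \<ge> exp 1 \<Longrightarrow> \<bar>e\<bar> \<le> 1 \<Longrightarrow>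
    norm (mean_upto x (\<lambda>n. exp (z * of_real (real (omega n) - ln (ln x) - meissel_mertens + e)))
      - moment_factor z * exp (z * of_real e) * poisson_fun (ln (ln x)) z)
    \<le> C * exp (ln (ln x) * (exp (norm z) - 1 - norm z)) * exp (- (1/200) * ln (ln x))"
proof -
  define V where "V = exp \<bar>R\<bar> + 1"
  \<comment> \<open>With \<eta> = 1/400 the loss in the exponent is
    \<open>2 * \<eta> = 1/200\<close>, half of the 1/100 provided by
    \<open>norm_exp_minus_1_le\<close>.\<close>
  obtain C1 where C1: "C1 > 0" "\<And>v u. norm (v::complex) \<le> V \<Longrightarrow> u \<ge> 1 \<Longrightarrow>
    norm (log_mean v u - log_mean_coeff v * of_real u powr v) \<le> C1 * u powr (norm v - 1 + 2 * (1/400))"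
    using log_mean_asymp[of "1/400" V] by auto
  obtain C2 where C2: "C2 > 0" "\<And>(w::complex) x. norm (w - 1) \<le> V \<Longrightarrow> x \<ge> exp 1 \<Longrightarrow>
    norm (mean_upto x (\<lambda>n. w ^ omega n) - log_mean (w - 1) (ln x)) \<le> C2 * ln x powr (norm (w - 1) - 1)"
    using mean_power_omega_log_mean[of V] by blast
  define C where "C = exp (\<bar>R\<bar> * (\<bar>meissel_mertens\<bar> + 1)) * (C1 + C2)"
  have "norm (mean_upto x (\<lambda>n. exp (z * of_real (real (omega n) - ln (ln x) - meissel_mertens + e)))
      - moment_factor z * exp (z * of_real e) * poisson_fun (ln (ln x)) z)
    \<le> C * exp (ln (ln x) * (exp (norm z) - 1 - norm z)) * exp (- (1/200) * ln (ln x))"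
    if z: "norm z \<le> R" and x: "x \<ge> exp 1" and e: "\<bar>e\<bar> \<le> 1" for z x e
  proof -
    define w v u L where "w = exp z" and "v = exp z - 1" and "u = ln x" and "L = ln (ln x)"
    have "x > 0" using x exp_gt_zero[of "1::real"] by linarith
    then have u: "u \<ge> 1" using x by (simp add: u_def ln_ge_iff)
    have L: "L \<ge> 0" "u = exp L" using u by (auto simp: L_def u_def)
    have upow: "u powr y = exp (L * y)" for y using u by (simp add: powr_def L_def u_def mult.commute)
    have nv: "norm v \<le> V"
    proof -
      have "norm (exp z) \<le> exp \<bar>R\<bar>" using z abs_Re_le_cmod[of z] by simp
      from order.trans[OF norm_triangle_ineq4[of "exp z" 1] add_right_mono[OF this]]
      show ?thesis unfolding v_def V_def by simp
    qed
    \<comment> \<open>The centring factor. Up to a constant its norm is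
      \<open>exp (- L * Re z)\<close>, which accounts for the term \<open>- Re z\<close> in
      \<open>norm_exp_minus_1_le\<close>.\<close>
    define S where "S = exp (z * of_real (e - L - meissel_mertens))"
    have "mean_upto x (\<lambda>n. exp (z * of_real (real (omega n) - L - meissel_mertens + e))) = S * mean_upto x (\<lambda>n. w ^ omega n)"
    proof -
      have "exp (z * of_real (real (omega n) - L - meissel_mertens + e)) = S * w ^ omega n" for n
        unfolding S_def w_def exp_of_nat_mult[symmetric] exp_add[symmetric] by (simp add: algebra_simps)
      then show ?thesis unfolding mean_upto_def by (simp add: sum_distrib_left)
    qed
    moreover have "moment_factor z * exp (z * of_real e) * poisson_fun L z = S * (log_mean_coeff v * of_real u powr v)"
    proof -
      have "of_real u powr v = exp (of_real L * v)" using u by (simp add: powr_def Ln_of_real L_def u_def mult.commute)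
      then show ?thesis
        unfolding moment_factor_def poisson_fun_def S_def v_def[symmetric] by (simp add: exp_add[symmetric] algebra_simps)
    qed
    ultimately have "norm (mean_upto x (\<lambda>n. exp (z * of_real (real (omega n) - L - meissel_mertens + e)))
      - moment_factor z * exp (z * of_real e) * poisson_fun L z) = norm S * norm (mean_upto x (\<lambda>n. w ^ omega n) - log_mean_coeff v * of_real u powr v)"
      by (simp add: right_diff_distrib[symmetric] norm_mult)
    moreover have "norm (mean_upto x (\<lambda>n. w ^ omega n) - log_mean_coeff v * of_real u powr v) \<le> (C1 + C2) * u powr (norm v - 1 + 1/200)"
    proof -
      have "norm (mean_upto x (\<lambda>n. w ^ omega n) - log_mean v u) \<le> C2 * u powr (norm v - 1)"
        using C2(2)[of w x] nv x by (simp add: w_def v_def u_def)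
      also have "\<dots> \<le> C2 * u powr (norm v - 1 + 1/200)" using C2(1) u by (intro mult_left_mono powr_mono) auto
      moreover have "norm (log_mean v u - log_mean_coeff v * of_real u powr v) \<le> C1 * u powr (norm v - 1 + 1/200)"
        using C1(2)[OF nv u] by simp
      ultimately have "norm ((mean_upto x (\<lambda>n. w ^ omega n) - log_mean v u) + (log_mean v u - log_mean_coeff v * of_real u powr v)) \<le> C2 * u powr (norm v - 1 + 1/200) + C1 * u powr (norm v - 1 + 1/200)"
        by (intro order.trans[OF norm_triangle_ineq] add_mono) auto
      then show ?thesis by (simp add: algebra_simps)
    qed
    moreover have "norm S \<le> exp (\<bar>R\<bar> * (\<bar>meissel_mertens\<bar> + 1)) * exp (- L * Re z)"
    proof -
      have "Re z * (e - meissel_mertens) \<le> \<bar>Re z * (e - meissel_mertens)\<bar>" by simp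
      also have "\<dots> \<le> \<bar>R\<bar> * (\<bar>meissel_mertens\<bar> + 1)"
        unfolding abs_mult using z e abs_Re_le_cmod[of z] by (intro mult_mono) auto
      finally have "Re z * (e - L - meissel_mertens) \<le> \<bar>R\<bar> * (\<bar>meissel_mertens\<bar> + 1) + - L * Re z" by (simp add: algebra_simps)
      then show ?thesis unfolding S_def exp_add[symmetric] by simp
    qed
    ultimately have "norm (mean_upto x (\<lambda>n. exp (z * of_real (real (omega n) - L - meissel_mertens + e)))
      - moment_factor z * exp (z * of_real e) * poisson_fun L z)
      \<le> exp (\<bar>R\<bar> * (\<bar>meissel_mertens\<bar> + 1)) * exp (- L * Re z) * ((C1 + C2) * u powr (norm v - 1 + 1/200))"
      by (simp only:) (intro mult_mono; simp)
    also have "\<dots> = C * exp (L * (norm v - 1 - Re z + 1/200))"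
      unfolding C_def upow by (simp add: exp_add[symmetric] algebra_simps)
    also have "\<dots> \<le> C * exp (L * (exp (norm z) - norm z - 1 / 100 - 1 + 1/200))"
    proof (intro mult_left_mono)
      have "L * (norm v - 1 - Re z + 1/200) \<le> L * (exp (norm z) - norm z - 1 / 100 - 1 + 1/200)"
        using norm_exp_minus_1_le[of z] L by (intro mult_left_mono) (auto simp: v_def)
      then show "exp (L * (norm v - 1 - Re z + 1/200)) \<le> exp (L * (exp (norm z) - norm z - 1 / 100 - 1 + 1/200))" by simp
    qed (use C1 C2 in \<open>auto simp: C_def\<close>)
    also have "\<dots> = C * exp (L * (exp (norm z) - 1 - norm z)) * exp (- (1/200) * L)"
      by (simp add: mult.assoc exp_add[symmetric] algebra_simps)
    finally show ?thesis by (simp add: L_def)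
  qed
  moreover have "C > 0" using C1 C2 by (simp add: C_def)
  ultimately show ?thesis using that by blast
qed

subsection \<open>Central moments of Poisson and Bernoulli sums\<close>

definition poisson_weight :: "real \<Rightarrow> nat \<Rightarrow> real" where
  "poisson_weight \<mu> n = \<mu> ^ n / fact n * exp (- \<mu>)"

lemma power_le_fact_exp: "\<bar>y\<bar> ^ k \<le> fact k * exp \<bar>y::real\<bar>"
  using sum_power_fact_le_exp[of "\<bar>y\<bar>" "{k}"] by (simp add: field_simps)

lemma summable_poisson_weight_exp:
  assumes "\<mu> \<ge> 0" "\<And>n. \<bar>f n\<bar> \<le> D * exp (real n)"
  shows "summable (\<lambda>n. \<bar>poisson_weight \<mu> n * f n\<bar>)"
proof (rule summable_comparison_test')
  show "summable (\<lambda>n. exp (- \<mu>) * D * ((exp 1 * \<mu>) ^ n /\<^sub>R fact n))"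
    by (intro summable_mult summable_exp_generic)
  fix n :: nat assume "n \<ge> 0"
  have "\<bar>poisson_weight \<mu> n * f n\<bar> \<le> poisson_weight \<mu> n * (D * exp (real n))"
    using assms(1) mult_left_mono[OF assms(2)[of n], of "poisson_weight \<mu> n"]
    by (simp add: abs_mult poisson_weight_def)
  also have "\<dots> = exp (- \<mu>) * D * ((exp 1 * \<mu>) ^ n /\<^sub>R fact n)"
    by (simp add: poisson_weight_def power_mult_distrib exp_of_nat_mult[symmetric] divide_inverse mult_ac)
  finally show "norm \<bar>poisson_weight \<mu> n * f n\<bar> \<le> exp (- \<mu>) * D * ((exp 1 * \<mu>) ^ n /\<^sub>R fact n)" by simp
qed

lemma summable_poisson_weight_shift:
  assumes "\<mu> \<ge> 0"
  shows "summable (\<lambda>n. \<bar>poisson_weight \<mu> n * (real n + c) ^ k\<bar>)"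
proof (rule summable_poisson_weight_exp[OF assms])
  fix n
  have "\<bar>(real n + c) ^ k\<bar> \<le> fact k * exp \<bar>real n + c\<bar>" using power_le_fact_exp[of "real n + c" k] by (simp add: power_abs)
  also have "\<dots> \<le> fact k * (exp \<bar>c\<bar> * exp (real n))" by (auto simp: exp_add[symmetric])
  finally show "\<bar>(real n + c) ^ k\<bar> \<le> (fact k * exp \<bar>c\<bar>) * exp (real n)" by (simp add: mult.assoc)
qed

text \<open>From \<open>\<mu> * w n = (n + 1) * w (n + 1)\<close> for the weights one gets
  \<open>E (X * (X - \<mu>) ^ k) = \<mu> * E ((X + 1 - \<mu>) ^ k)\<close>. Expanding the right side
  and subtracting \<open>\<mu> * E ((X - \<mu>) ^ k)\<close>, which cancels the top binomial term,
  gives the recursion of \<open>poisson_coeff\<close>.\<close>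

lemma poisson_central_moment_sums:
  assumes \<mu>: "\<mu> > 0"
  shows "(\<lambda>n. poisson_weight \<mu> n * (real n - \<mu>) ^ k) sums (fact k * poisson_coeff \<mu> k)"
proof -
  let ?w = "poisson_weight \<mu>"
  define A where "A = (\<lambda>k. \<Sum>n. ?w n * (real n - \<mu>) ^ k)"
  have sm: "summable (\<lambda>n. ?w n * (real n + c) ^ k)" for c k
    using summable_rabs_cancel[OF summable_poisson_weight_shift[of \<mu> c k]] \<mu> by simp
  have sA: "(\<lambda>n. ?w n * (real n - \<mu>) ^ k) sums A k" for k
    unfolding A_def using summable_sums[OF sm[of "-\<mu>" k]] by simp
  have A0: "A 0 = 1"
  proof -
    have "(\<lambda>n. exp (- \<mu>) * (\<mu> ^ n /\<^sub>R fact n)) sums (exp (- \<mu>) * exp \<mu>)"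
      by (rule sums_mult[OF exp_converges])
    moreover have "exp (- \<mu>) * (\<mu> ^ n /\<^sub>R fact n) = ?w n" for n by (simp add: poisson_weight_def divide_inverse mult_ac)
    ultimately have "?w sums 1" by (simp add: exp_minus)
    moreover have "?w sums A 0" using sA[of 0] by simp
    ultimately show ?thesis by (rule sums_unique2[symmetric])
  qed
  have rec: "A (Suc k) = \<mu> * (\<Sum>i<k. real (k choose i) * A i)" for k
  proof -
    let ?S = "\<Sum>i\<le>k. real (k choose i) * A i"
    have shift: "(\<lambda>n. \<Sum>i\<le>k. real (k choose i) * (?w n * (real n - \<mu>) ^ i)) = (\<lambda>n. ?w n * (real (Suc n) - \<mu>) ^ k)"
    proof (rule ext)
      fix n
      have "real (Suc n) - \<mu> = (real n - \<mu>) + 1" by simp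
      then have "(real (Suc n) - \<mu>) ^ k = ((real n - \<mu>) + 1) ^ k" by (rule arg_cong)
      also have "\<dots> = (\<Sum>i\<le>k. real (k choose i) * (real n - \<mu>) ^ i)"
        using binomial_ring[of "real n - \<mu>" 1 k] by simp
      finally show "(\<Sum>i\<le>k. real (k choose i) * (?w n * (real n - \<mu>) ^ i)) = ?w n * (real (Suc n) - \<mu>) ^ k"
        by (simp only: sum_distrib_left mult_ac)
    qed
    have weight: "(\<lambda>n. \<mu> * (?w n * (real (Suc n) - \<mu>) ^ k)) = (\<lambda>n. ?w (Suc n) * real (Suc n) * (real (Suc n) - \<mu>) ^ k)"
    proof (rule ext)
      fix n
      have "\<mu> * ?w n = ?w (Suc n) * real (Suc n)"
        by (simp add: poisson_weight_def fact_Suc del: of_nat_Suc)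
      then show "\<mu> * (?w n * (real (Suc n) - \<mu>) ^ k) = ?w (Suc n) * real (Suc n) * (real (Suc n) - \<mu>) ^ k"
        by (simp only: mult.assoc[symmetric])
    qed
    have "(\<lambda>n. \<Sum>i\<le>k. real (k choose i) * (?w n * (real n - \<mu>) ^ i)) sums ?S"
      by (rule sums_sum) (rule sums_mult[OF sA])
    from sums_mult[OF this[unfolded shift], of \<mu>]
    have "(\<lambda>n. ?w (Suc n) * real (Suc n) * (real (Suc n) - \<mu>) ^ k) sums (\<mu> * ?S)" unfolding weight .
    then have "(\<lambda>n. ?w n * real n * (real n - \<mu>) ^ k) sums (\<mu> * ?S)"
      using sums_Suc_iff[of "\<lambda>n. ?w n * real n * (real n - \<mu>) ^ k" "\<mu> * ?S"] by (simp del: of_nat_Suc)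
    from sums_diff[OF this sums_mult[OF sA[of k], of \<mu>]]
    have "(\<lambda>n. ?w n * real n * (real n - \<mu>) ^ k - \<mu> * (?w n * (real n - \<mu>) ^ k)) sums (\<mu> * ?S - \<mu> * A k)" .
    moreover have "(\<lambda>n. ?w n * real n * (real n - \<mu>) ^ k - \<mu> * (?w n * (real n - \<mu>) ^ k)) = (\<lambda>n. ?w n * (real n - \<mu>) ^ Suc k)"
      by (simp add: fun_eq_iff algebra_simps)
    ultimately have "A (Suc k) = \<mu> * ?S - \<mu> * A k" using sA[of "Suc k"] by (simp only: sums_unique2)
    moreover have "(\<Sum>i\<le>k. real (k choose i) * A i) = (\<Sum>i<k. real (k choose i) * A i) + A k"
      by (simp add: lessThan_Suc_atMost[symmetric])
    ultimately show ?thesis by (simp add: algebra_simps)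
  qed
  have "A k = fact k * poisson_coeff \<mu> k" for k
  proof (induction k rule: less_induct)
    case (less k)
    show ?case
    proof (cases k)
      case (Suc l)
      have "A k = \<mu> * (\<Sum>i<l. real (l choose i) * (fact i * poisson_coeff \<mu> i))"
        unfolding Suc rec using less Suc by (intro arg_cong[of _ _ "\<lambda>x. \<mu> * x"] sum.cong) auto
      also have "\<dots> = \<mu> * (\<Sum>i<l. fact l * (poisson_coeff \<mu> i / fact (l - i)))"
        by (intro arg_cong[of _ _ "\<lambda>x. \<mu> * x"] sum.cong) (auto simp: binomial_fact)
      also have "\<dots> = fact k * poisson_coeff \<mu> k"
        by (simp add: Suc poisson_coeff.simps(2) sum_distrib_left mult_ac)
      finally show ?thesis .
    qed (simp add: A0)
  qed
  with sA[of k] show ?thesis by simp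
qed

lemma poisson_pmf_central_moment:
  assumes \<mu>: "\<mu> > 0"
  shows "measure_pmf.expectation (poisson_pmf \<mu>) (\<lambda>n. (real n - \<mu>) ^ k) = fact k * poisson_coeff \<mu> k"
proof -
  have pmf: "pmf (poisson_pmf \<mu>) n = poisson_weight \<mu> n" for n using \<mu> by (simp add: poisson_weight_def)
  have "integrable (count_space UNIV) (\<lambda>n. pmf (poisson_pmf \<mu>) n *\<^sub>R (real n - \<mu>) ^ k)"
    unfolding integrable_count_space_nat_iff pmf
    using summable_poisson_weight_shift[of \<mu> "-\<mu>" k] \<mu> by simp
  from integral_count_space_nat[OF this]
  have "integral\<^sup>L (count_space UNIV) (\<lambda>n. pmf (poisson_pmf \<mu>) n *\<^sub>R (real n - \<mu>) ^ k) = fact k * poisson_coeff \<mu> k"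
    using poisson_central_moment_sums[OF \<mu>, of k] by (simp add: pmf sums_iff)
  then show ?thesis
    unfolding measure_pmf_eq_density by (subst integral_density) auto
qed

lemma (in prob_space) integral_finite_valued:
  fixes W :: "'a \<Rightarrow> nat" and f :: "nat \<Rightarrow> 'c :: {banach, second_countable_topology}"
  assumes W: "W \<in> measurable M (count_space UNIV)" "\<And>w. w \<in> space M \<Longrightarrow> W w \<le> N"
  shows "integral\<^sup>L M (\<lambda>w. f (W w)) = (\<Sum>j\<le>N. prob {w \<in> space M. W w = j} *\<^sub>R f j)"
proof -
  have meas: "{w \<in> space M. W w = j} \<in> sets M" for j
    using measurable_sets[OF W(1), of "{j}"] by (simp add: vimage_def Int_def conj_commute)
  have "integral\<^sup>L M (\<lambda>w. f (W w)) = integral\<^sup>L M (\<lambda>w. \<Sum>j\<le>N. indicator {w \<in> space M. W w = j} w *\<^sub>R f j)"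
  proof (rule Bochner_Integration.integral_cong[OF refl])
    fix w assume w: "w \<in> space M"
    have "(\<Sum>j\<le>N. indicator {w \<in> space M. W w = j} w *\<^sub>R f j) = (\<Sum>j\<in>{W w}. indicator {w \<in> space M. W w = j} w *\<^sub>R f j)"
      by (rule sum.mono_neutral_right) (use W(2)[OF w] in auto)
    then show "f (W w) = (\<Sum>j\<le>N. indicator {w \<in> space M. W w = j} w *\<^sub>R f j)" using w by simp
  qed
  also have "\<dots> = (\<Sum>j\<le>N. integral\<^sup>L M (\<lambda>w. indicator {w \<in> space M. W w = j} w *\<^sub>R f j))"
    using meas by (intro Bochner_Integration.integral_sum integrable_scaleR_left integrable_real_indicator) (auto simp: emeasure_eq_measure)
  also have "\<dots> = (\<Sum>j\<le>N. prob {w \<in> space M. W w = j} *\<^sub>R f j)"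
    using meas by (intro sum.cong refl) (simp add: emeasure_eq_measure)
  finally show ?thesis .
qed

text \<open>The sum takes finitely many values, so its generating function is a finite sum of
  exponentials and its Taylor coefficients are the moments without any interchange of limits.
  Independence factors the same function into the product.\<close>

lemma (in prob_space) bernoulli_sum_central_moment:
  fixes X :: "nat \<Rightarrow> 'a \<Rightarrow> bool" and q :: "nat \<Rightarrow> real"
  assumes P: "finite P" and indep: "indep_vars (\<lambda>_. count_space UNIV) X P"
    and distr: "\<And>p. p \<in> P \<Longrightarrow> distr M (count_space UNIV) (X p) = measure_pmf (bernoulli_pmf (q p))"
    and q: "\<And>p. p \<in> P \<Longrightarrow> 0 \<le> q p \<and> q p \<le> 1"
  shows "complex_of_real (integral\<^sup>L M (\<lambda>w. ((\<Sum>p\<in>P. of_bool (X p w)) - (\<Sum>p\<in>P. q p)) ^ k))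
    = fact k * taylor_coeff (\<lambda>z. \<Prod>p\<in>P. (1 + of_real (q p) * (exp z - 1)) * exp (- (of_real (q p) * z))) k"
proof -
  define W where "W = (\<lambda>w. \<Sum>p\<in>P. of_bool (X p w) :: nat)"
  define R where "R = (\<Sum>p\<in>P. q p)"
  define N where "N = card P"
  have meas: "X p \<in> measurable M (count_space UNIV)" if "p \<in> P" for p
    using indep that unfolding indep_vars_def by auto
  have W: "W \<in> measurable M (count_space UNIV)"
  proof -
    have "(\<lambda>w. of_bool (X p w) :: real) \<in> borel_measurable M" if "p \<in> P" for p
      by (rule measurable_compose[OF meas[OF that]]) simp
    then have "(\<lambda>w. \<Sum>p\<in>P. of_bool (X p w) :: real) \<in> borel_measurable M" by (rule borel_measurable_sum)
    moreover have "(\<lambda>w. \<Sum>p\<in>P. of_bool (X p w) :: real) = (\<lambda>w. real (W w))" by (simp add: W_def)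
    ultimately have "(\<lambda>w. real (W w)) \<in> borel_measurable M" by simp
    then have "(\<lambda>w. real (W w)) -` {real j} \<inter> space M \<in> sets M" for j
      by (rule measurable_sets) simp
    moreover have "(\<lambda>w. real (W w)) -` {real j} = W -` {j}" for j by auto
    ultimately show ?thesis by (simp add: measurable_count_space_eq2_countable)
  qed
  have WN: "W w \<le> N" for w
    unfolding W_def N_def using sum_bounded_above[of P "\<lambda>p. of_bool (X p w)" "1::nat"] by simp
  have Wr: "(\<Sum>p\<in>P. of_bool (X p w)) = real (W w)" for w by (simp add: W_def)
  define b c where "b = (\<lambda>j::nat. complex_of_real (real j - R))" and "c = (\<lambda>j. complex_of_real (prob {w \<in> space M. W w = j}))"
  have fin: "integral\<^sup>L M (\<lambda>w. f (W w)) = (\<Sum>j\<le>N. c j * f j)" for f :: "nat \<Rightarrow> complex"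
    using integral_finite_valued[OF W WN, of f] by (simp add: c_def scaleR_conv_of_real)
  have mgf: "(\<Sum>j\<le>N. c j * exp (b j * z)) = (\<Prod>p\<in>P. (1 + of_real (q p) * (exp z - 1)) * exp (- (of_real (q p) * z)))" for z
  proof -
    define Y where "Y = (\<lambda>p x. exp (z * (of_bool x - of_real (q p))) :: complex)"
    have "(\<Sum>j\<le>N. c j * exp (b j * z)) = integral\<^sup>L M (\<lambda>w. exp (b (W w) * z))" by (rule fin[symmetric])
    also have "\<dots> = integral\<^sup>L M (\<lambda>w. \<Prod>p\<in>P. Y p (X p w))"
    proof (rule Bochner_Integration.integral_cong[OF refl])
      fix w
      have "b (W w) * z = (\<Sum>p\<in>P. z * (of_bool (X p w) - of_real (q p)))"
        by (simp add: b_def W_def R_def sum_subtractf sum_distrib_left mult.commute right_diff_distrib)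
      then show "exp (b (W w) * z) = (\<Prod>p\<in>P. Y p (X p w))" using P by (simp add: Y_def exp_sum)
    qed
    also have "\<dots> = (\<Prod>p\<in>P. integral\<^sup>L M (\<lambda>w. Y p (X p w)))"
    proof (rule indep_vars_lebesgue_integral[OF P])
      show "indep_vars (\<lambda>_. borel) (\<lambda>p w. Y p (X p w)) P"
        by (rule indep_vars_compose2[OF indep]) auto
      fix p assume p: "p \<in> P"
      show "integrable M (\<lambda>w. Y p (X p w))"
      proof (rule integrable_const_bound[of _ "norm (Y p True) + norm (Y p False)"])
        show "(\<lambda>w. Y p (X p w)) \<in> borel_measurable M"
          by (rule measurable_compose[OF meas[OF p]]) auto
        show "AE w in M. norm (Y p (X p w)) \<le> norm (Y p True) + norm (Y p False)"
        proof (rule AE_I2)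
          fix w show "norm (Y p (X p w)) \<le> norm (Y p True) + norm (Y p False)" by (cases "X p w") auto
        qed
      qed
    qed
    also have "\<dots> = (\<Prod>p\<in>P. (1 + of_real (q p) * (exp z - 1)) * exp (- (of_real (q p) * z)))"
    proof (rule prod.cong[OF refl])
      fix p assume p: "p \<in> P"
      have "integral\<^sup>L M (\<lambda>w. Y p (X p w)) = integral\<^sup>L (distr M (count_space UNIV) (X p)) (Y p)"
        by (rule integral_distr[symmetric]) (use meas[OF p] in auto)
      also have "\<dots> = q p *\<^sub>R Y p True + (1 - q p) *\<^sub>R Y p False"
        unfolding distr[OF p] using q[OF p] by (subst integral_measure_pmf[of UNIV]) (auto simp: UNIV_bool)
      also have "\<dots> = (1 + of_real (q p) * (exp z - 1)) * exp (- (of_real (q p) * z))"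
        by (simp add: Y_def scaleR_conv_of_real right_diff_distrib exp_diff exp_minus field_simps)
      finally show "integral\<^sup>L M (\<lambda>w. Y p (X p w)) = (1 + of_real (q p) * (exp z - 1)) * exp (- (of_real (q p) * z))" .
    qed
    finally show ?thesis .
  qed
  have "complex_of_real (integral\<^sup>L M (\<lambda>w. (real (W w) - R) ^ k)) = integral\<^sup>L M (\<lambda>w. b (W w) ^ k)"
    unfolding b_def of_real_power[symmetric] by (rule integral_complex_of_real[symmetric])
  also have "\<dots> = (\<Sum>j\<le>N. c j * b j ^ k)" by (rule fin)
  also have "\<dots> = fact k * taylor_coeff (\<lambda>z. \<Sum>j\<le>N. c j * exp (b j * z)) k"
    unfolding taylor_coeff_exp_sum by simp
  finally show ?thesis unfolding mgf Wr R_def .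
qed

subsection \<open>Comparison of the moments\<close>

text \<open>Keeping \<open>r\<close> as a variable lets the estimates refer to \<mu> alone;
  \<open>r_of\<close> is substituted when the quotients are formed.\<close>

abbreviation saddle_range :: "real \<Rightarrow> real \<Rightarrow> nat \<Rightarrow> real \<Rightarrow> bool" where
  "saddle_range A \<mu> k r \<equiv> 2 \<le> k \<and> real k \<le> A * \<mu> \<and> r > 0 \<and> \<mu> * (r * (exp r - 1)) = real k"

lemma taylor_coeff_diff:
  assumes "f holomorphic_on UNIV" "g holomorphic_on UNIV"
  shows "taylor_coeff (\<lambda>z. f z - g z) k = taylor_coeff f k - taylor_coeff g k"
  unfolding taylor_coeff_def using higher_deriv_diff[OF assms, of 0 k] by (simp add: diff_divide_distrib)

lemma filterlim_ln_ln: "filterlim (\<lambda>x::real. ln (ln x)) at_top at_top"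
  by real_asymp

lemma eventually_ln_ln: "eventually P at_top \<Longrightarrow> \<forall>\<^sub>F x in at_top. P (ln (ln x))" for P :: "real \<Rightarrow> bool"
  using filterlim_ln_ln unfolding filterlim_iff by blast

lemma holomorphic_on_sphere_bounded:
  assumes "f holomorphic_on UNIV"
  obtains M where "M > 0" "\<And>z::complex. norm z = \<rho> \<Longrightarrow> norm (f z :: complex) \<le> M"
proof -
  have "bounded (f ` sphere 0 \<rho>)"
    using assms by (intro compact_imp_bounded compact_continuous_image holomorphic_on_imp_continuous_on) (auto intro: holomorphic_on_subset)
  then show ?thesis using that bounded_pos[of "f ` sphere 0 \<rho>"] by (auto simp: image_iff)
qed

text \<open>Three errors of \<open>\<epsilon> / 3\<close> each: the approximation of the generating
  function, by Cauchy's inequality on the circle of radius \<open>r\<close>; the shift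
  \<open>e x\<close>, as a perturbation of the entire factor; and the asymptotics for
  \<open>moment_factor\<close> itself.\<close>

lemma omega_moment_asymp:
  assumes e: "(e \<longlongrightarrow> 0) at_top" and A: "A > 0" and \<epsilon>: "\<epsilon> > 0"
  shows "\<forall>\<^sub>F x in at_top. \<forall>k r. saddle_range A (ln (ln x)) k r \<longrightarrow>
    \<bar>avg_upto x (\<lambda>n. (real (omega n) - ln (ln x) - meissel_mertens + e x) ^ k)
      - gamma_factor r * bernoulli_factor_real r * (fact k * poisson_coeff (ln (ln x)) k)\<bar> \<le> \<epsilon> * (fact k * poisson_coeff (ln (ln x)) k)"
proof -
  obtain C where C: "C > 0" "\<And>z x e. norm z \<le> sqrt A \<Longrightarrow> x \<ge> exp 1 \<Longrightarrow> \<bar>e\<bar> \<le> 1 \<Longrightarrow>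
    norm (mean_upto x (\<lambda>n. exp (z * of_real (real (omega n) - ln (ln x) - meissel_mertens + e)))
      - moment_factor z * exp (z * of_real e) * poisson_fun (ln (ln x)) z)
    \<le> C * exp (ln (ln x) * (exp (norm z) - 1 - norm z)) * exp (- (1/200) * ln (ln x))"
    using mean_exp_omega_asymp[of "sqrt A"] by blast
  obtain \<rho> where \<rho>: "\<rho> > 0" "\<And>f \<mu> k \<epsilon>. f holomorphic_on UNIV \<Longrightarrow> (\<And>z. norm z = \<rho> \<Longrightarrow> norm (f z) \<le> \<epsilon>) \<Longrightarrow>
     \<mu> > 0 \<Longrightarrow> 2 \<le> k \<Longrightarrow> real k \<le> A * \<mu> \<Longrightarrow>
     norm (taylor_coeff (\<lambda>z. f z * poisson_fun \<mu> z) k) \<le> 2 * \<epsilon> * poisson_coeff \<mu> k"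
    using taylor_coeff_perturb[OF A] by blast
  obtain M where M: "M > 0" "\<And>z. norm z = \<rho> \<Longrightarrow> norm (moment_factor z) \<le> M"
    using holomorphic_on_sphere_bounded[OF holomorphic_moment_factor] by blast
  have "((\<lambda>x. C * exp (- (1/400) * ln (ln x))) \<longlongrightarrow> 0) at_top" by real_asymp
  then have ev3: "\<forall>\<^sub>F x in at_top. C * exp (- (1/400) * ln (ln x)) < \<epsilon> / 3"
    using \<epsilon> by (intro order_tendstoD(2)) auto
  have "((\<lambda>x. M * (\<rho> * \<bar>e x\<bar> * exp (\<rho> * \<bar>e x\<bar>))) \<longlongrightarrow> 0) at_top" by (rule tendsto_eq_intros e refl | simp)+
  \<comment> \<open>The bound is \<open>\<epsilon> / 6\<close> because
    \<open>taylor_coeff_perturb\<close> doubles it.\<close>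
  then have ev4: "\<forall>\<^sub>F x in at_top. M * (\<rho> * \<bar>e x\<bar> * exp (\<rho> * \<bar>e x\<bar>)) < \<epsilon> / 6"
    using \<epsilon> by (intro order_tendstoD(2)) auto
  have ev5: "\<forall>\<^sub>F x in at_top. \<bar>e x\<bar> < 1"
    using tendsto_rabs_zero[OF e] by (rule order_tendstoD(2)) simp
  have "\<epsilon> / 3 > 0" using \<epsilon> by simp
  note ev1 = eventually_ln_ln[OF taylor_coeff_asymp[OF holomorphic_moment_factor moment_factor_0 A this]]
  \<comment> \<open>Of the saving \<open>exp (- L / 200)\<close> in
    \<open>mean_exp_omega_asymp\<close>, one half is spent on the lower bound for the Poisson
    coefficient; the other half tends to 0.\<close>
  have "(1/400 :: real) > 0" by simp
  note ev2 = eventually_ln_ln[OF poisson_coeff_ge_exp[OF A this]]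
  from ev1 ev2 ev3 ev4 ev5 eventually_ln_ln[OF eventually_gt_at_top[of 0]] eventually_ge_at_top[of "exp 1"]
  show ?thesis
  proof eventually_elim
    case (elim x)
    define L where "L = ln (ln x)"
    have L: "L > 0" using elim(6) by (simp add: L_def)
    have "x \<ge> 1" using elim(7) one_le_exp_iff[of "1::real"] by linarith
    define b where "b = (\<lambda>n. real (omega n) - L - meissel_mertens + e x)"
    define E where "E = (\<lambda>z::complex. mean_upto x (\<lambda>n. exp (z * of_real (b n))))"
    define G where "G = (\<lambda>z. moment_factor z * (exp (z * of_real (e x)) - 1))"
    have Esum: "E = (\<lambda>z. \<Sum>n | 1 \<le> n \<and> real n \<le> x. (1 / of_nat (nat \<lfloor>x\<rfloor>)) * exp (of_real (b n) * z))"
      by (simp add: E_def mean_upto_def sum_divide_distrib mult.commute)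
    have holE: "E holomorphic_on UNIV" unfolding Esum by (intro holomorphic_intros)
    have holG: "G holomorphic_on UNIV" unfolding G_def by (intro holomorphic_intros)
    have holH: "(\<lambda>z. moment_factor z * poisson_fun L z) holomorphic_on UNIV"
      "(\<lambda>z. G z * poisson_fun L z) holomorphic_on UNIV"
      "(\<lambda>z. moment_factor z * exp (z * of_real (e x)) * poisson_fun L z) holomorphic_on UNIV"
      by (intro holomorphic_intros holG)+
    show ?case
    proof (intro allI impI)
      fix k r assume kr: "saddle_range A (ln (ln x)) k r"
      then have k: "2 \<le> k" "real k \<le> A * L" and r: "r > 0" "L * (r * (exp r - 1)) = real k" by (auto simp: L_def)
      define \<phi> where "\<phi> = poisson_coeff L k"
      have \<phi>: "\<phi> > 0" using poisson_coeff_pos[OF L k(1)] by (simp add: \<phi>_def)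
      define m where "m = avg_upto x (\<lambda>n. b n ^ k)"
      \<comment> \<open>For fixed \<open>x\<close> the mean is a finite sum of exponentials, so its
        coefficients are exactly the moments divided by \<open>fact k\<close>.\<close>
      have TE: "taylor_coeff E k = of_real (m / fact k)"
        unfolding Esum taylor_coeff_exp_sum m_def avg_upto_eq_mean_upto[OF \<open>x \<ge> 1\<close>] mean_upto_def
        by (simp add: sum_divide_distrib)
      have t1: "norm (taylor_coeff (\<lambda>z. E z - moment_factor z * exp (z * of_real (e x)) * poisson_fun L z) k) \<le> \<epsilon> / 3 * \<phi>"
      proof -
        have rA: "r \<le> sqrt A" by (rule saddle_point_bounds(1)[OF L r k(2)])
        have "norm (taylor_coeff (\<lambda>z. E z - moment_factor z * exp (z * of_real (e x)) * poisson_fun L z) k)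
          \<le> C * exp (L * (exp r - 1 - r)) * exp (- (1/200) * L) / r ^ k"
        proof (rule norm_taylor_coeff_le)
          fix z :: complex assume z: "norm z = r"
          show "norm (E z - moment_factor z * exp (z * of_real (e x)) * poisson_fun L z) \<le> C * exp (L * (exp r - 1 - r)) * exp (- (1/200) * L)"
            using C(2)[of z x "e x"] z rA elim(5,7) by (simp add: E_def b_def L_def)
        qed (use r(1) holE holH(3) in \<open>auto intro: holomorphic_on_diff\<close>)
        also have "\<dots> \<le> C * exp (- (1/400) * L) * \<phi>"
        proof -
          have "exp (L * (exp r - 1 - r)) * exp (- (1/400) * L) \<le> \<phi> * r ^ k" using elim(2) kr by (simp add: L_def \<phi>_def)
          then have "C * exp (- (1/400) * L) * (exp (L * (exp r - 1 - r)) * exp (- (1/400) * L)) \<le> C * exp (- (1/400) * L) * (\<phi> * r ^ k)"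
            using C(1) by (intro mult_left_mono) auto
          moreover have "exp (- (1/200) * L) = exp (- (1/400) * L) * exp (- (1/400) * L)" by (simp add: exp_add[symmetric])
          ultimately show ?thesis using r(1) by (simp only: divide_le_eq zero_less_power if_True mult_ac)
        qed
        also have "\<dots> \<le> \<epsilon> / 3 * \<phi>" using elim(3) \<phi> by (intro mult_right_mono) (auto simp: L_def)
        finally show ?thesis .
      qed
      have t2: "norm (taylor_coeff (\<lambda>z. G z * poisson_fun L z) k) \<le> \<epsilon> / 3 * \<phi>"
      proof -
        have "norm (G z) \<le> \<epsilon> / 6" if z: "norm z = \<rho>" for z
        proof -
          have "norm (exp (z * of_real (e x)) - 1) \<le> \<rho> * \<bar>e x\<bar> * exp (\<rho> * \<bar>e x\<bar>)"
            using norm_exp_minus_1_le_exp[of "z * of_real (e x)"] by (simp add: norm_mult z)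
          then have "norm (G z) \<le> M * (\<rho> * \<bar>e x\<bar> * exp (\<rho> * \<bar>e x\<bar>))"
            unfolding G_def norm_mult using M z by (intro mult_mono) auto
          then show ?thesis using elim(4) by linarith
        qed
        from \<rho>(2)[OF holG this L k] show ?thesis by (simp add: \<phi>_def)
      qed
      have t3: "norm (taylor_coeff (\<lambda>z. moment_factor z * poisson_fun L z) k - of_real (gamma_factor r * bernoulli_factor_real r) * of_real \<phi>) \<le> \<epsilon> / 3 * \<phi>"
        using elim(1)[rule_format, OF kr] moment_factor_of_real[of r] r(1) by (simp add: L_def \<phi>_def)
      have "(\<lambda>z. G z * poisson_fun L z) = (\<lambda>z. moment_factor z * exp (z * of_real (e x)) * poisson_fun L z - moment_factor z * poisson_fun L z)"
        by (simp add: G_def algebra_simps)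
      then have d2: "taylor_coeff (\<lambda>z. G z * poisson_fun L z) k = taylor_coeff (\<lambda>z. moment_factor z * exp (z * of_real (e x)) * poisson_fun L z) k
          - taylor_coeff (\<lambda>z. moment_factor z * poisson_fun L z) k"
        using taylor_coeff_diff[OF holH(3,1), of k] by simp
      have "of_real (m / fact k - gamma_factor r * bernoulli_factor_real r * \<phi>) =
         taylor_coeff (\<lambda>z. E z - moment_factor z * exp (z * of_real (e x)) * poisson_fun L z) k + taylor_coeff (\<lambda>z. G z * poisson_fun L z) k
         + (taylor_coeff (\<lambda>z. moment_factor z * poisson_fun L z) k - of_real (gamma_factor r * bernoulli_factor_real r) * of_real \<phi>)"
        unfolding d2 taylor_coeff_diff[OF holE holH(3)] TE by simp
      then have "norm (complex_of_real (m / fact k - gamma_factor r * bernoulli_factor_real r * \<phi>)) \<le> \<epsilon> / 3 * \<phi> + \<epsilon> / 3 * \<phi> + \<epsilon> / 3 * \<phi>"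
        using t1 t2 t3 by (simp only:) (intro norm_triangle_le add_mono; assumption)
      then have "\<bar>m / fact k - gamma_factor r * bernoulli_factor_real r * \<phi>\<bar> \<le> \<epsilon> * \<phi>" by (simp only: norm_of_real)
      then have "fact k * \<bar>m / fact k - gamma_factor r * bernoulli_factor_real r * \<phi>\<bar> \<le> fact k * (\<epsilon> * \<phi>)" by (intro mult_left_mono) auto
      moreover have "fact k * \<bar>m / fact k - gamma_factor r * bernoulli_factor_real r * \<phi>\<bar> = \<bar>m - gamma_factor r * bernoulli_factor_real r * (fact k * \<phi>)\<bar>"
        by (subst abs_of_pos[of "fact k :: real", symmetric], simp, subst abs_mult[symmetric]) (simp add: right_diff_distrib mult_ac)
      ultimately have "\<bar>m - gamma_factor r * bernoulli_factor_real r * (fact k * \<phi>)\<bar> \<le> \<epsilon> * (fact k * \<phi>)"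
        by (simp only: mult.left_commute)
      then show "\<bar>avg_upto x (\<lambda>n. (real (omega n) - ln (ln x) - meissel_mertens + e x) ^ k)
        - gamma_factor r * bernoulli_factor_real r * (fact k * poisson_coeff (ln (ln x)) k)\<bar> \<le> \<epsilon> * (fact k * poisson_coeff (ln (ln x)) k)"
        unfolding m_def b_def L_def \<phi>_def .
    qed
  qed
qed

section \<open>The moments of the Bernoulli sum\<close>

definition bernoulli_mgf :: "real \<Rightarrow> complex \<Rightarrow> complex" where
  "bernoulli_mgf x z = (\<Prod>p\<in>primes_le x. (1 + of_real (1 / real p) * (exp z - 1)) * exp (- (of_real (1 / real p) * z)))"

definition bernoulli_factor_upto :: "real \<Rightarrow> complex \<Rightarrow> complex" where
  "bernoulli_factor_upto x z = (\<Prod>p\<in>primes_le x. weierstrass_factor 1 (- (exp z - 1) / of_nat p))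
     * exp ((exp z - 1 - z) * of_real ((\<Sum>p\<in>primes_le x. 1 / real p) - ln (ln x)))"

text \<open>For each prime the exponential is regrouped into a Weierstrass factor and
  \<open>exp ((exp z - 1 - z) / p)\<close>. The latter multiply to the Poisson function of mean
  \<open>\<Sum>p\<in>primes_le x. 1 / real p\<close>, and only its deviation from
  \<open>ln (ln x)\<close> stays in the factor.\<close>

lemma bernoulli_mgf_eq: "bernoulli_mgf x z = bernoulli_factor_upto x z * poisson_fun (ln (ln x)) z"
proof -
  have "(1 + of_real (1 / real p) * (exp z - 1)) * exp (- (of_real (1 / real p) * z)) =
      weierstrass_factor 1 (- (exp z - 1) / of_nat p) * exp ((exp z - 1 - z) * of_real (1 / real p))" for p
  proof -
    define q v where "q = complex_of_real (1 / real p)" and "v = exp z - 1"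
    have "- v / of_nat p = - (q * v)" by (simp add: q_def)
    moreover have "exp (- (q * z)) = exp (- (q * v)) * exp ((v - z) * q)" by (simp add: exp_add[symmetric] algebra_simps)
    ultimately show ?thesis
      unfolding q_def[symmetric] v_def[symmetric] by (simp only: weierstrass_factor_1_minus mult.assoc)
  qed
  then have "bernoulli_mgf x z = (\<Prod>p\<in>primes_le x. weierstrass_factor 1 (- (exp z - 1) / of_nat p)) * exp (\<Sum>p\<in>primes_le x. (exp z - 1 - z) * of_real (1 / real p))"
    unfolding bernoulli_mgf_def by (simp only: prod.distrib exp_sum[OF finite_primes_le])
  also have "(\<Sum>p\<in>primes_le x. (exp z - 1 - z) * of_real (1 / real p)) = (exp z - 1 - z) * of_real (\<Sum>p\<in>primes_le x. 1 / real p)"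
    by (simp only: of_real_sum sum_distrib_left)
  also have "\<dots> = (exp z - 1 - z) * of_real ((\<Sum>p\<in>primes_le x. 1 / real p) - ln (ln x)) + of_real (ln (ln x)) * (exp z - 1 - z)"
    unfolding of_real_diff right_diff_distrib[of _ _ "of_real (ln (ln x))"] by (simp only: mult.commute[of _ "of_real (ln (ln x))"] diff_add_cancel)
  finally show ?thesis
    by (simp add: bernoulli_factor_upto_def poisson_fun_def exp_add mult.assoc)
qed

lemma holomorphic_bernoulli_factor_upto: "bernoulli_factor_upto x holomorphic_on UNIV"
  unfolding bernoulli_factor_upto_def weierstrass_factor_1_minus
  by (intro holomorphic_intros) (auto simp: primes_le_def prime_gt_0_nat)

text \<open>The products converge because their argument \<open>exp z - 1\<close> is bounded on the
  circle, the exponent by Mertens' second theorem.\<close>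

lemma uniform_limit_bernoulli_factor_upto:
  "uniform_limit (sphere 0 \<rho>) bernoulli_factor_upto bernoulli_factor at_top"
proof -
  have bnd: "norm (exp z - 1) \<le> exp \<rho> + 1" if "z \<in> sphere 0 \<rho>" for z :: complex
    using norm_triangle_ineq4[of "exp z" 1] that abs_Re_le_cmod[of z] by (auto intro: order.trans)
  have "uniform_limit (sphere 0 \<rho>) (\<lambda>x z. \<Prod>p\<in>primes_le x. weierstrass_factor 1 (- (exp z - 1) / of_nat p)) (\<lambda>z. prime_product (exp z - 1) 0) at_top"
    by (rule uniform_limit_compose'[OF uniform_limit_primes_le[of "exp \<rho> + 1"]]) (use bnd in auto)
  moreover have "uniform_limit (sphere 0 \<rho>) (\<lambda>x z::complex. exp ((exp z - 1 - z) * of_real ((\<Sum>p\<in>primes_le x. 1 / real p) - ln (ln x))))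
     (\<lambda>z. exp (of_real meissel_mertens * (exp z - 1 - z))) at_top"
  proof (rule uniform_limitI)
    fix \<epsilon> :: real assume \<epsilon>: "\<epsilon> > 0"
    define W where "W = exp \<rho> + 1 + \<rho>"
    have W0: "W \<ge> 0" if "z \<in> sphere (0::complex) \<rho>" for z using that by (auto simp: W_def)
    define d where "d = (\<lambda>x. \<bar>(\<Sum>p\<in>primes_le x. 1 / real p) - ln (ln x) - meissel_mertens\<bar>)"
    have "(d \<longlongrightarrow> 0) at_top" unfolding d_def using Mertens_second by (intro tendsto_rabs_zero LIM_zero)
    then have "((\<lambda>x. exp (\<bar>meissel_mertens\<bar> * W) * (W * d x * exp (W * d x))) \<longlongrightarrow> 0) at_top"
      by (auto intro!: tendsto_eq_intros)
    then have "\<forall>\<^sub>F x in at_top. exp (\<bar>meissel_mertens\<bar> * W) * (W * d x * exp (W * d x)) < \<epsilon>"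
      using \<epsilon> by (rule order_tendstoD(2))
    then show "\<forall>\<^sub>F x in at_top. \<forall>z\<in>sphere (0::complex) \<rho>. dist (exp ((exp z - 1 - z) * of_real ((\<Sum>p\<in>primes_le x. 1 / real p) - ln (ln x))))
       (exp (of_real meissel_mertens * (exp z - 1 - z))) < \<epsilon>"
    proof eventually_elim
      case (elim x)
      show ?case
      proof
        fix z :: complex assume z: "z \<in> sphere 0 \<rho>"
        define w t where "w = exp z - 1 - z" and "t = (\<Sum>p\<in>primes_le x. 1 / real p) - ln (ln x)"
        have w: "norm w \<le> W" using norm_triangle_ineq4[of "exp z - 1" z] bnd[OF z] z by (simp add: w_def W_def)
        have "exp (w * of_real t) - exp (of_real meissel_mertens * w) = exp (of_real meissel_mertens * w) * (exp (w * of_real (t - meissel_mertens)) - 1)"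
          by (simp add: right_diff_distrib exp_add[symmetric] algebra_simps)
        then have "norm (exp (w * of_real t) - exp (of_real meissel_mertens * w)) = norm (exp (of_real meissel_mertens * w)) * norm (exp (w * of_real (t - meissel_mertens)) - 1)"
          by (simp only: norm_mult)
        also have "\<dots> \<le> exp (\<bar>meissel_mertens\<bar> * W) * (W * d x * exp (W * d x))"
        proof (intro mult_mono)
          have "meissel_mertens * Re w \<le> \<bar>meissel_mertens\<bar> * \<bar>Re w\<bar>" by (metis abs_ge_self abs_mult)
          also have "\<dots> \<le> \<bar>meissel_mertens\<bar> * W" using w abs_Re_le_cmod[of w] by (intro mult_left_mono) auto
          finally show "norm (exp (of_real meissel_mertens * w)) \<le> exp (\<bar>meissel_mertens\<bar> * W)" by simp
          have "norm (exp (w * of_real (t - meissel_mertens)) - 1) \<le> norm w * d x * exp (norm w * d x)"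
            using norm_exp_minus_1_le_exp[of "w * of_real (t - meissel_mertens)"] by (simp only: norm_mult norm_of_real d_def t_def)
          also have "\<dots> \<le> W * d x * exp (W * d x)"
            using w W0[OF z] by (intro mult_mono) (auto simp: d_def intro: mult_right_mono)
          finally show "norm (exp (w * of_real (t - meissel_mertens)) - 1) \<le> W * d x * exp (W * d x)" .
        qed auto
        finally show "dist (exp ((exp z - 1 - z) * of_real ((\<Sum>p\<in>primes_le x. 1 / real p) - ln (ln x)))) (exp (of_real meissel_mertens * (exp z - 1 - z))) < \<epsilon>"
          using elim by (simp add: dist_norm w_def t_def)
      qed
    qed
  qed
  moreover have "bounded ((\<lambda>z. prime_product (exp z - 1) 0) ` sphere 0 \<rho>)" "bounded ((\<lambda>z::complex. exp (of_real meissel_mertens * (exp z - 1 - z))) ` sphere 0 \<rho>)"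
  proof -
    have "(\<lambda>z::complex. exp z - 1) holomorphic_on UNIV" by (intro holomorphic_intros)
    from holomorphic_on_compose_gen[OF this holomorphic_prime_product]
    have "(\<lambda>z. prime_product (exp z - 1) 0) holomorphic_on UNIV" by (simp add: o_def)
    then show "bounded ((\<lambda>z. prime_product (exp z - 1) 0) ` sphere 0 \<rho>)"
      by (intro compact_imp_bounded compact_continuous_image holomorphic_on_imp_continuous_on) (auto intro: holomorphic_on_subset)
    show "bounded ((\<lambda>z::complex. exp (of_real meissel_mertens * (exp z - 1 - z))) ` sphere 0 \<rho>)"
      by (intro compact_imp_bounded compact_continuous_image continuous_intros) auto
  qed
  ultimately show ?thesis
    unfolding bernoulli_factor_upto_def bernoulli_factor_def by (intro uniform_lim_mult)
qed

text \<open>The asymptotic theorem is applied to the limit factor, which does not depend on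
  \<open>x\<close>; the difference from the factor for finite \<open>x\<close> is a perturbation
  that is small on one circle.\<close>

lemma bernoulli_mgf_asymp:
  assumes A: "A > 0" and \<epsilon>: "\<epsilon> > 0"
  shows "\<forall>\<^sub>F x in at_top. \<forall>k r. saddle_range A (ln (ln x)) k r \<longrightarrow>
    norm (taylor_coeff (bernoulli_mgf x) k - of_real (bernoulli_factor_real r * poisson_coeff (ln (ln x)) k)) \<le> \<epsilon> * poisson_coeff (ln (ln x)) k"
proof -
  obtain \<rho> where \<rho>: "\<rho> > 0" "\<And>f \<mu> k \<epsilon>. f holomorphic_on UNIV \<Longrightarrow> (\<And>z. norm z = \<rho> \<Longrightarrow> norm (f z) \<le> \<epsilon>) \<Longrightarrow>
     \<mu> > 0 \<Longrightarrow> 2 \<le> k \<Longrightarrow> real k \<le> A * \<mu> \<Longrightarrow>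
     norm (taylor_coeff (\<lambda>z. f z * poisson_fun \<mu> z) k) \<le> 2 * \<epsilon> * poisson_coeff \<mu> k"
    using taylor_coeff_perturb[OF A] by blast
  have "\<epsilon> / 4 > 0" "\<epsilon> / 2 > 0" using \<epsilon> by auto
  note ev1 = uniform_limitD[OF uniform_limit_bernoulli_factor_upto[of \<rho>] this(1)]
   and ev2 = eventually_ln_ln[OF taylor_coeff_asymp[OF holomorphic_bernoulli_factor bernoulli_factor_0 A this(2)]]
  from ev1 ev2 eventually_ln_ln[OF eventually_gt_at_top[of 0]] show ?thesis
  proof eventually_elim
    case (elim x)
    show ?case
    proof (intro allI impI)
      fix k r assume kr: "saddle_range A (ln (ln x)) k r"
      let ?L = "ln (ln x)"
      let ?\<phi> = "poisson_coeff ?L k"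
      let ?D = "\<lambda>z. (bernoulli_factor_upto x z - bernoulli_factor z) * poisson_fun ?L z"
      have "taylor_coeff (bernoulli_mgf x) k - taylor_coeff (\<lambda>z. bernoulli_factor z * poisson_fun ?L z) k = taylor_coeff ?D k"
        unfolding left_diff_distrib bernoulli_mgf_eq[abs_def]
        by (intro taylor_coeff_diff[symmetric] holomorphic_intros holomorphic_bernoulli_factor_upto)
      moreover have "norm (taylor_coeff ?D k) \<le> 2 * (\<epsilon> / 4) * ?\<phi>"
      proof (rule \<rho>(2))
        show "(\<lambda>z. bernoulli_factor_upto x z - bernoulli_factor z) holomorphic_on UNIV"
          by (intro holomorphic_intros holomorphic_bernoulli_factor_upto)
        show "norm (bernoulli_factor_upto x z - bernoulli_factor z) \<le> \<epsilon> / 4" if "norm z = \<rho>" for z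
          using elim(1) that by (auto simp: dist_norm intro: less_imp_le)
      qed (use kr elim(3) in auto)
      moreover have "norm (taylor_coeff (\<lambda>z. bernoulli_factor z * poisson_fun ?L z) k - of_real (bernoulli_factor_real r * ?\<phi>)) \<le> \<epsilon> / 2 * ?\<phi>"
        using elim(2)[rule_format, OF kr] kr bernoulli_factor_of_real[of r] by simp
      ultimately have "norm ((taylor_coeff (bernoulli_mgf x) k - taylor_coeff (\<lambda>z. bernoulli_factor z * poisson_fun ?L z) k)
         + (taylor_coeff (\<lambda>z. bernoulli_factor z * poisson_fun ?L z) k - of_real (bernoulli_factor_real r * ?\<phi>))) \<le> 2 * (\<epsilon> / 4) * ?\<phi> + \<epsilon> / 2 * ?\<phi>"
        by (intro norm_triangle_le add_mono) simp_all
      then show "norm (taylor_coeff (bernoulli_mgf x) k - of_real (bernoulli_factor_real r * ?\<phi>)) \<le> \<epsilon> * ?\<phi>" by simp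
    qed
  qed
qed

section \<open>From differences to quotients\<close>

lemma r_of_saddle:
  assumes "x \<ge> 3" "k > 0"
  shows "r_of k x > 0" "ln (ln x) * (r_of k x * (exp (r_of k x) - 1)) = real k"
proof -
  have "r_of k x > 0 \<and> r_of k x * (exp (r_of k x) - 1) = real k / ln (ln x)"
    unfolding r_of_def by (rule theI'[OF r_of_ex1[OF assms]])
  then show "r_of k x > 0" "ln (ln x) * (r_of k x * (exp (r_of k x) - 1)) = real k"
    using ln_ln_pos[OF assms(1)] by auto
qed

lemma abs_quotient_minus_1_le:
  fixes N D h \<kappa> w :: real
  assumes N: "\<bar>N - h * \<kappa> * w\<bar> \<le> \<epsilon> * w" and D: "\<bar>D - \<kappa> * w\<bar> \<le> \<epsilon> * w" and w: "w > 0"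
    and h: "0 < h0" "h0 \<le> h" "h \<le> h1" and \<kappa>: "0 < \<kappa>0" "\<kappa>0 \<le> \<kappa>" and \<epsilon>: "\<epsilon> \<le> \<kappa>0 / 2"
  shows "\<bar>N / (h * D) - 1\<bar> \<le> \<epsilon> * (2 * (1 + h1) / (h0 * \<kappa>0))"
proof -
  have "0 \<le> \<epsilon> * w" using N abs_ge_zero order.trans by blast
  then have \<epsilon>0: "\<epsilon> \<ge> 0" using w by (simp add: zero_le_mult_iff)
  have "\<kappa>0 / 2 * w \<le> (\<kappa> - \<epsilon>) * w" using \<kappa> \<epsilon> w by (intro mult_right_mono) auto
  then have D0: "\<kappa>0 / 2 * w \<le> D" using D by (simp add: left_diff_distrib abs_le_iff)
  have Dpos: "D > 0" using D0 \<kappa>(1) w by (smt (verit) divide_pos_pos mult_pos_pos)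
  have "h0 * (\<kappa>0 / 2 * w) \<le> h * D" using h D0 \<kappa> w by (intro mult_mono) auto
  then have low: "h0 * \<kappa>0 / 2 * w \<le> h * D" by (simp add: mult_ac)
  have "N - h * D = (N - h * \<kappa> * w) - h * (D - \<kappa> * w)" by (simp add: algebra_simps)
  then have "\<bar>N - h * D\<bar> \<le> \<bar>N - h * \<kappa> * w\<bar> + \<bar>h * (D - \<kappa> * w)\<bar>" by linarith
  also have "\<dots> \<le> \<epsilon> * w + h1 * (\<epsilon> * w)"
    unfolding abs_mult using N D h by (intro add_mono mult_mono) auto
  finally have "\<bar>N - h * D\<bar> \<le> \<epsilon> * w * (1 + h1)" by (simp add: algebra_simps)
  moreover have "N / (h * D) - 1 = (N - h * D) / (h * D)" using Dpos h by (simp add: field_simps)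
  ultimately have "\<bar>N / (h * D) - 1\<bar> \<le> \<epsilon> * w * (1 + h1) / (h * D)"
    using Dpos h by (simp add: abs_divide abs_mult divide_right_mono)
  also have "\<dots> \<le> \<epsilon> * w * (1 + h1) / (h0 * \<kappa>0 / 2 * w)"
    using low \<epsilon>0 w h \<kappa> Dpos by (intro divide_left_mono mult_nonneg_nonneg mult_pos_pos) auto
  also have "\<dots> = \<epsilon> * (2 * (1 + h1) / (h0 * \<kappa>0))" using w by simp
  finally show ?thesis .
qed

text \<open>Here \<open>h\<close> is the asserted quotient, and \<kappa> is the factor of the
  comparison moment against the Poisson moment: 1 for the Poisson variable,
  \<open>bernoulli_factor_real\<close> for the Bernoulli sum. As \<open>r \<le> sqrt A\<close>,
  continuity on a compact interval bounds both away from 0, so absolute errors become relative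
  ones.\<close>

lemma uniformly_asymp_saddle:
  assumes A: "A > 0"
    and N: "\<And>\<epsilon>. \<epsilon> > 0 \<Longrightarrow> \<forall>\<^sub>F x in at_top. \<forall>k r. saddle_range A (ln (ln x)) k r \<longrightarrow>
      \<bar>f k x - h r * \<kappa> r * (fact k * poisson_coeff (ln (ln x)) k)\<bar> \<le> \<epsilon> * (fact k * poisson_coeff (ln (ln x)) k)"
    and D: "\<And>\<epsilon>. \<epsilon> > 0 \<Longrightarrow> \<forall>\<^sub>F x in at_top. \<forall>k r. saddle_range A (ln (ln x)) k r \<longrightarrow>
      \<bar>g k x - \<kappa> r * (fact k * poisson_coeff (ln (ln x)) k)\<bar> \<le> \<epsilon> * (fact k * poisson_coeff (ln (ln x)) k)"
    and h: "continuous_on {0..sqrt A} h" "\<And>r. h r > 0" and \<kappa>: "continuous_on {0..sqrt A} \<kappa>" "\<And>r. \<kappa> r > 0"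
  shows "uniformly_asymp A f (\<lambda>k x. h (r_of k x) * g k x)"
  unfolding uniformly_asymp_def
proof (intro allI impI)
  fix \<epsilon> :: real assume \<epsilon>: "\<epsilon> > 0"
  have "sqrt A \<ge> 0" using A by simp
  obtain h0 h1 where hb: "0 < h0" "\<And>r. 0 \<le> r \<Longrightarrow> r \<le> sqrt A \<Longrightarrow> h0 \<le> h r \<and> h r \<le> h1"
    using continuous_pos_bounds[OF h \<open>sqrt A \<ge> 0\<close>] by metis
  obtain \<kappa>0 \<kappa>1 where \<kappa>b: "0 < \<kappa>0" "\<And>r. 0 \<le> r \<Longrightarrow> r \<le> sqrt A \<Longrightarrow> \<kappa>0 \<le> \<kappa> r \<and> \<kappa> r \<le> \<kappa>1"
    using continuous_pos_bounds[OF \<kappa> \<open>sqrt A \<ge> 0\<close>] by metis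
  have h1: "h1 > 0" using hb(1) hb(2)[of 0] A by simp
  define B where "B = 2 * (1 + h1) / (h0 * \<kappa>0)"
  have B: "B > 0" using h1 hb(1) \<kappa>b(1) by (simp add: B_def)
  define \<eta> where "\<eta> = min (\<kappa>0 / 2) (\<epsilon> / (2 * B))"
  have \<eta>: "\<eta> > 0" using \<kappa>b(1) \<epsilon> B by (simp add: \<eta>_def)
  have "\<eta> * B \<le> \<epsilon> / (2 * B) * B" using B by (intro mult_right_mono) (auto simp: \<eta>_def)
  also have "\<dots> < \<epsilon>" using B \<epsilon> by simp
  finally have \<eta>B: "\<eta> * B < \<epsilon>" .
  from N[OF \<eta>] D[OF \<eta>] eventually_ge_at_top[of 3]
  show "\<forall>\<^sub>F x in at_top. \<forall>k. 2 \<le> k \<and> real k \<le> A * ln (ln x) \<longrightarrow> \<bar>f k x / (h (r_of k x) * g k x) - 1\<bar> < \<epsilon>"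
  proof eventually_elim
    case (elim x)
    show ?case
    proof (intro allI impI)
      fix k assume k: "2 \<le> k \<and> real k \<le> A * ln (ln x)"
      define r where "r = r_of k x"
      have L: "ln (ln x) > 0" using elim(3) by (rule ln_ln_pos)
      have r: "r > 0" "ln (ln x) * (r * (exp r - 1)) = real k"
        using r_of_saddle[OF elim(3), of k] k by (auto simp: r_def)
      have rng: "saddle_range A (ln (ln x)) k r" using k r by simp
      have "r \<le> sqrt A" using saddle_point_bounds(1)[OF L r] k by simp
      then have b: "h0 \<le> h r" "h r \<le> h1" "\<kappa>0 \<le> \<kappa> r" using hb(2)[of r] \<kappa>b(2)[of r] r(1) by auto
      have "fact k * poisson_coeff (ln (ln x)) k > 0" using poisson_coeff_pos[OF L] k by simp
      moreover have "\<eta> \<le> \<kappa>0 / 2" by (simp add: \<eta>_def)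
      ultimately have "\<bar>f k x / (h r * g k x) - 1\<bar> \<le> \<eta> * B"
        unfolding B_def using elim(1)[rule_format, OF rng] elim(2)[rule_format, OF rng] hb(1) b \<kappa>b(1)
        by (intro abs_quotient_minus_1_le[where \<kappa> = "\<kappa> r"])
      then show "\<bar>f k x / (h (r_of k x) * g k x) - 1\<bar> < \<epsilon>" using \<eta>B by (simp add: r_def)
    qed
  qed
qed

lemma uniformly_asymp_cong:
  assumes "\<And>k x. x \<ge> 3 \<Longrightarrow> 2 \<le> k \<Longrightarrow> f k x = f' k x" "\<And>k x. x \<ge> 3 \<Longrightarrow> 2 \<le> k \<Longrightarrow> g k x = g' k x"
    and "uniformly_asymp A f g"
  shows "uniformly_asymp A f' g'"
  unfolding uniformly_asymp_def
proof (intro allI impI)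
  fix \<epsilon> :: real assume "\<epsilon> > 0"
  with assms(3) have "\<forall>\<^sub>F x in at_top. \<forall>k. 2 \<le> k \<and> real k \<le> A * ln (ln x) \<longrightarrow> \<bar>f k x / g k x - 1\<bar> < \<epsilon>"
    by (simp add: uniformly_asymp_def)
  then show "\<forall>\<^sub>F x in at_top. \<forall>k. 2 \<le> k \<and> real k \<le> A * ln (ln x) \<longrightarrow> \<bar>f' k x / g' k x - 1\<bar> < \<epsilon>"
    using eventually_ge_at_top[of 3] by eventually_elim (use assms(1,2) in auto)
qed

lemma tendsto_r_of:
  assumes "\<forall>\<^sub>F x in at_top. 2 \<le> k x" "(\<lambda>x. real (k x)) \<in> o(\<lambda>x. ln (ln x))"
  shows "((\<lambda>x. r_of (k x) x) \<longlongrightarrow> 0) at_top" "\<forall>\<^sub>F x in at_top. r_of (k x) x > 0"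
proof -
  have ev: "\<forall>\<^sub>F x in at_top. 0 < r_of (k x) x \<and> r_of (k x) x \<le> sqrt (real (k x) / ln (ln x))"
    using assms(1) eventually_ge_at_top[of 3]
  proof eventually_elim
    case (elim x)
    have r: "r_of (k x) x > 0" "ln (ln x) * (r_of (k x) x * (exp (r_of (k x) x) - 1)) = real (k x)"
      using r_of_saddle[OF elim(2), of "k x"] elim(1) by auto
    have "r_of (k x) x * (exp (r_of (k x) x) - 1) = real (k x) / ln (ln x)"
      using r(2) ln_ln_pos[OF elim(2)] by (simp add: field_simps)
    then show ?case using saddle_point_le_sqrt[OF r(1)] r(1) by simp
  qed
  then show "\<forall>\<^sub>F x in at_top. r_of (k x) x > 0" by eventually_elim simp
  have "((\<lambda>x. sqrt (real (k x) / ln (ln x))) \<longlongrightarrow> sqrt 0) at_top"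
    by (intro tendsto_real_sqrt smalloD_tendsto[OF assms(2)])
  then have lim: "((\<lambda>x. sqrt (real (k x) / ln (ln x))) \<longlongrightarrow> 0) at_top" by simp
  show "((\<lambda>x. r_of (k x) x) \<longlongrightarrow> 0) at_top"
    by (rule tendsto_sandwich[OF _ _ tendsto_const lim]) (use ev in \<open>auto elim: eventually_mono\<close>)
qed

lemma gamma_factor_tendsto_1: "(r \<longlongrightarrow> 0) F \<Longrightarrow> ((\<lambda>x. gamma_factor (r x)) \<longlongrightarrow> 1) F"
proof -
  assume r: "(r \<longlongrightarrow> 0) F"
  have "gamma_factor 0 = 1" by (simp add: gamma_factor_def)
  then show ?thesis using continuous_on_tendsto_compose[OF continuous_on_gamma_factor[of UNIV] r] by simp
qed

lemma bernoulli_factor_real_tendsto_1: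
  assumes r: "(r \<longlongrightarrow> 0) F" "\<forall>\<^sub>F x in F. r x > 0"
  shows "((\<lambda>x. bernoulli_factor_real (r x)) \<longlongrightarrow> 1) F"
proof -
  have "complex_of_real (bernoulli_factor_real 0) = 1"
    using bernoulli_factor_of_real[of 0] bernoulli_factor_0(1) by simp
  then have "bernoulli_factor_real 0 = 1" by simp
  moreover have "\<forall>\<^sub>F x in F. r x \<in> {0..1}"
    using r(2) order_tendstoD(2)[OF r(1) zero_less_one] by eventually_elim auto
  ultimately show ?thesis using continuous_on_tendsto_compose[OF continuous_on_bernoulli_factor_real[of 1] r(1)] by simp
qed

theorem theorem1p1:
  fixes A :: real
    and P :: "real \<Rightarrow> 'a measure" and Y :: "real \<Rightarrow> 'a \<Rightarrow> nat"
    and Q :: "real \<Rightarrow> 'b measure" and X :: "real \<Rightarrow> nat \<Rightarrow> 'b \<Rightarrow> bool"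
  assumes A: "A > 0"
    and P: "\<And>x. x \<ge> 3 \<Longrightarrow> prob_space (P x)"
    and Y: "\<And>x. x \<ge> 3 \<Longrightarrow> Y x \<in> measurable (P x) (count_space UNIV)"
    and Y_poisson: "\<And>x. x \<ge> 3 \<Longrightarrow>
      distr (P x) (count_space UNIV) (Y x) = measure_pmf (poisson_pmf (ln (ln x)))"
    and Q: "\<And>x. x \<ge> 3 \<Longrightarrow> prob_space (Q x)"
    and X_indep: "\<And>x. x \<ge> 3 \<Longrightarrow>
      prob_space.indep_vars (Q x) (\<lambda>_. count_space UNIV) (X x) (primes_le x)"
    and X_bernoulli: "\<And>x p. x \<ge> 3 \<Longrightarrow> p \<in> primes_le x \<Longrightarrow>
      distr (Q x) (count_space UNIV) (X x p) = measure_pmf (bernoulli_pmf (1 / real p))"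
  shows
    "uniformly_asymp A
       (\<lambda>k x. avg_upto x (\<lambda>n. (real (omega n) - ln (ln x) - meissel_mertens) ^ k))
       (\<lambda>k x. F_fun (exp (r_of k x)) / exp (r_of k x * meissel_mertens)
          * (\<integral>w. (real (Y x w) - ln (ln x)) ^ k \<partial>P x))
   \<and> uniformly_asymp A
       (\<lambda>k x. avg_upto x (\<lambda>n. (real (omega n) - (\<Sum>p\<in>primes_le x. 1 / real p)) ^ k))
       (\<lambda>k x. exp (- euler_mascheroni * (exp (r_of k x) - 1)) / Gamma (exp (r_of k x))
          * (\<integral>w. ((\<Sum>p\<in>primes_le x. of_bool (X x p w)) - (\<Sum>p\<in>primes_le x. 1 / real p)) ^ k \<partial>Q x))
   \<and> (\<forall>k :: real \<Rightarrow> nat.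
        (\<forall>\<^sub>F x in at_top. 2 \<le> k x) \<and> (\<lambda>x. real (k x)) \<in> o(\<lambda>x. ln (ln x)) \<longrightarrow>
          (\<lambda>x. r_of (k x) x) \<in> o(\<lambda>_. 1) \<and>
          (\<lambda>x. F_fun (exp (r_of (k x) x)) / exp (r_of (k x) x * meissel_mertens))
            \<sim>[at_top] (\<lambda>x. exp (- euler_mascheroni * (exp (r_of (k x) x) - 1)) / Gamma (exp (r_of (k x) x))) \<and>
          (\<lambda>x. exp (- euler_mascheroni * (exp (r_of (k x) x) - 1)) / Gamma (exp (r_of (k x) x)))
            \<sim>[at_top] (\<lambda>_. 1))"
proof (intro conjI allI impI)
  have cont: "continuous_on {0..sqrt A} gamma_factor" "continuous_on {0..sqrt A} bernoulli_factor_real"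
    by (rule continuous_on_gamma_factor continuous_on_bernoulli_factor_real)+
  show "uniformly_asymp A
       (\<lambda>k x. avg_upto x (\<lambda>n. (real (omega n) - ln (ln x) - meissel_mertens) ^ k))
       (\<lambda>k x. F_fun (exp (r_of k x)) / exp (r_of k x * meissel_mertens)
          * (\<integral>w. (real (Y x w) - ln (ln x)) ^ k \<partial>P x))"
  proof (rule uniformly_asymp_cong)
    show "uniformly_asymp A
       (\<lambda>k x. avg_upto x (\<lambda>n. (real (omega n) - ln (ln x) - meissel_mertens + 0) ^ k))
       (\<lambda>k x. (\<lambda>r. gamma_factor r * bernoulli_factor_real r) (r_of k x) * (fact k * poisson_coeff (ln (ln x)) k))"
    \<comment> \<open>The Poisson moment equals \<open>fact k * poisson_coeff\<close> exactly, so
      the estimate of the denominator is trivial.\<close>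
    proof (rule uniformly_asymp_saddle[where \<kappa> = "\<lambda>_. 1", OF A])
      fix \<epsilon> :: real assume \<epsilon>: "\<epsilon> > 0"
      show "\<forall>\<^sub>F x in at_top. \<forall>k r. saddle_range A (ln (ln x)) k r \<longrightarrow>
        \<bar>avg_upto x (\<lambda>n. (real (omega n) - ln (ln x) - meissel_mertens + 0) ^ k)
          - gamma_factor r * bernoulli_factor_real r * 1 * (fact k * poisson_coeff (ln (ln x)) k)\<bar> \<le> \<epsilon> * (fact k * poisson_coeff (ln (ln x)) k)"
        unfolding mult_1_right by (rule omega_moment_asymp[where e = "\<lambda>_. 0", OF tendsto_const A \<epsilon>])
      show "\<forall>\<^sub>F x in at_top. \<forall>k r. saddle_range A (ln (ln x)) k r \<longrightarrow>
        \<bar>fact k * poisson_coeff (ln (ln x)) k - 1 * (fact k * poisson_coeff (ln (ln x)) k)\<bar> \<le> \<epsilon> * (fact k * poisson_coeff (ln (ln x)) k)"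
        using eventually_ln_ln[OF eventually_gt_at_top[of 0]]
        by eventually_elim (use \<epsilon> in \<open>auto simp: poisson_coeff_nonneg\<close>)
    qed (use cont gamma_factor_pos bernoulli_factor_real_pos in \<open>auto intro!: continuous_intros\<close>)
  next
    fix k :: nat and x :: real assume x: "x \<ge> 3" and k: "2 \<le> k"
    have "r_of k x > 0" using r_of_saddle[OF x, of k] k by simp
    moreover have "(\<integral>w. (real (Y x w) - ln (ln x)) ^ k \<partial>P x) = fact k * poisson_coeff (ln (ln x)) k"
    proof -
      have "(\<integral>w. (real (Y x w) - ln (ln x)) ^ k \<partial>P x) = (\<integral>n. (real n - ln (ln x)) ^ k \<partial>distr (P x) (count_space UNIV) (Y x))"
        using Y[OF x] by (intro integral_distr[symmetric]) auto
      then show ?thesis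
        unfolding Y_poisson[OF x] poisson_pmf_central_moment[OF ln_ln_pos[OF x]] .
    qed
    ultimately show "gamma_factor (r_of k x) * bernoulli_factor_real (r_of k x) * (fact k * poisson_coeff (ln (ln x)) k)
      = F_fun (exp (r_of k x)) / exp (r_of k x * meissel_mertens) * (\<integral>w. (real (Y x w) - ln (ln x)) ^ k \<partial>P x)"
      by (simp add: F_fun_factor)
  qed simp
next
  define S where "S = (\<lambda>x. \<Sum>p\<in>primes_le x. 1 / real p)"
  \<comment> \<open>This shift turns the centre \<open>ln (ln x) + meissel_mertens\<close> into
    \<open>S x\<close>; it tends to 0 by Mertens' second theorem.\<close>
  define e where "e = (\<lambda>x. ln (ln x) + meissel_mertens - S x)"
  have e: "(e \<longlongrightarrow> 0) at_top"
    using tendsto_diff[OF tendsto_const[of meissel_mertens] Mertens_second] by (simp add: e_def S_def algebra_simps)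
  define J where "J = (\<lambda>k x. \<integral>w. ((\<Sum>p\<in>primes_le x. of_bool (X x p w)) - S x) ^ k \<partial>Q x)"
  have J: "complex_of_real (J k x) = fact k * taylor_coeff (bernoulli_mgf x) k" if x: "x \<ge> 3" for k x
    unfolding J_def S_def bernoulli_mgf_def[abs_def]
  proof (rule prob_space.bernoulli_sum_central_moment[OF Q[OF x] finite_primes_le X_indep[OF x] X_bernoulli[OF x]])
    fix p assume "p \<in> primes_le x"
    then have "p > 0" by (auto simp: primes_le_def prime_gt_0_nat)
    then show "0 \<le> 1 / real p \<and> 1 / real p \<le> 1" by simp
  qed
  have "uniformly_asymp A
     (\<lambda>k x. avg_upto x (\<lambda>n. (real (omega n) - ln (ln x) - meissel_mertens + e x) ^ k))
     (\<lambda>k x. gamma_factor (r_of k x) * J k x)"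
  proof (rule uniformly_asymp_saddle[where \<kappa> = bernoulli_factor_real, OF A])
    fix \<epsilon> :: real assume \<epsilon>: "\<epsilon> > 0"
    show "\<forall>\<^sub>F x in at_top. \<forall>k r. saddle_range A (ln (ln x)) k r \<longrightarrow>
      \<bar>avg_upto x (\<lambda>n. (real (omega n) - ln (ln x) - meissel_mertens + e x) ^ k)
        - gamma_factor r * bernoulli_factor_real r * (fact k * poisson_coeff (ln (ln x)) k)\<bar> \<le> \<epsilon> * (fact k * poisson_coeff (ln (ln x)) k)"
      by (rule omega_moment_asymp[OF e A \<epsilon>])
    from bernoulli_mgf_asymp[OF A \<epsilon>] eventually_ge_at_top[of 3]
    show "\<forall>\<^sub>F x in at_top. \<forall>k r. saddle_range A (ln (ln x)) k r \<longrightarrow>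
      \<bar>J k x - bernoulli_factor_real r * (fact k * poisson_coeff (ln (ln x)) k)\<bar> \<le> \<epsilon> * (fact k * poisson_coeff (ln (ln x)) k)"
    proof eventually_elim
      case (elim x)
      show ?case
      proof (intro allI impI)
        fix k r assume kr: "saddle_range A (ln (ln x)) k r"
        let ?\<phi> = "poisson_coeff (ln (ln x)) k"
        have "complex_of_real (J k x - bernoulli_factor_real r * (fact k * ?\<phi>)) = fact k * (taylor_coeff (bernoulli_mgf x) k - of_real (bernoulli_factor_real r * ?\<phi>))"
          using J[OF elim(2), of k] by (simp add: algebra_simps)
        then have "norm (complex_of_real (J k x - bernoulli_factor_real r * (fact k * ?\<phi>))) = fact k * norm (taylor_coeff (bernoulli_mgf x) k - of_real (bernoulli_factor_real r * ?\<phi>))"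
          by (simp only: norm_mult norm_fact)
        also have "\<dots> \<le> fact k * (\<epsilon> * ?\<phi>)" using elim(1)[rule_format, OF kr] by (intro mult_left_mono) auto
        finally show "\<bar>J k x - bernoulli_factor_real r * (fact k * ?\<phi>)\<bar> \<le> \<epsilon> * (fact k * ?\<phi>)"
          by (simp only: norm_of_real mult.left_commute)
      qed
    qed
  qed (use gamma_factor_pos bernoulli_factor_real_pos continuous_on_gamma_factor continuous_on_bernoulli_factor_real in auto)
  then show "uniformly_asymp A
       (\<lambda>k x. avg_upto x (\<lambda>n. (real (omega n) - (\<Sum>p\<in>primes_le x. 1 / real p)) ^ k))
       (\<lambda>k x. exp (- euler_mascheroni * (exp (r_of k x) - 1)) / Gamma (exp (r_of k x))
          * (\<integral>w. ((\<Sum>p\<in>primes_le x. of_bool (X x p w)) - (\<Sum>p\<in>primes_le x. 1 / real p)) ^ k \<partial>Q x))"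
    by (simp add: e_def S_def J_def gamma_factor_def)
next
  fix k :: "real \<Rightarrow> nat"
  assume "(\<forall>\<^sub>F x in at_top. 2 \<le> k x) \<and> (\<lambda>x. real (k x)) \<in> o(\<lambda>x. ln (ln x))"
  then have k: "\<forall>\<^sub>F x in at_top. 2 \<le> k x" "(\<lambda>x. real (k x)) \<in> o(\<lambda>x. ln (ln x))" by auto
  note r = tendsto_r_of[OF k]
  show "(\<lambda>x. r_of (k x) x) \<in> o(\<lambda>_. 1)" using r(1) by (intro smalloI_tendsto) auto
  have "((\<lambda>x. gamma_factor (r_of (k x) x)) \<longlongrightarrow> 1) at_top" by (rule gamma_factor_tendsto_1[OF r(1)])
  moreover have "((\<lambda>x. gamma_factor (r_of (k x) x) * bernoulli_factor_real (r_of (k x) x)) \<longlongrightarrow> 1 * 1) at_top"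
    by (intro tendsto_mult gamma_factor_tendsto_1 bernoulli_factor_real_tendsto_1 r)
  moreover have "\<forall>\<^sub>F x in at_top. gamma_factor (r_of (k x) x) * bernoulli_factor_real (r_of (k x) x) =
      F_fun (exp (r_of (k x) x)) / exp (r_of (k x) x * meissel_mertens)"
    using r(2) by eventually_elim (simp add: F_fun_factor)
  \<comment> \<open>Both factors are continuous with value 1 at the origin, so both sides of the
    comparison tend to 1 as \<open>r_of (k x) x\<close> tends to 0.\<close>
  ultimately have lims: "((\<lambda>x. gamma_factor (r_of (k x) x)) \<longlongrightarrow> 1) at_top"
    "((\<lambda>x. F_fun (exp (r_of (k x) x)) / exp (r_of (k x) x * meissel_mertens)) \<longlongrightarrow> 1) at_top"
    by (auto intro: Lim_transform_eventually)
  show g: "(\<lambda>x. exp (- euler_mascheroni * (exp (r_of (k x) x) - 1)) / Gamma (exp (r_of (k x) x))) \<sim>[at_top] (\<lambda>_. 1)"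
    using tendsto_imp_asymp_equiv_const[OF lims(1)] by (simp add: gamma_factor_def)
  have "(\<lambda>x. F_fun (exp (r_of (k x) x)) / exp (r_of (k x) x * meissel_mertens)) \<sim>[at_top] (\<lambda>_. 1)"
    using tendsto_imp_asymp_equiv_const[OF lims(2)] by simp
  then show "(\<lambda>x. F_fun (exp (r_of (k x) x)) / exp (r_of (k x) x * meissel_mertens))
      \<sim>[at_top] (\<lambda>x. exp (- euler_mascheroni * (exp (r_of (k x) x) - 1)) / Gamma (exp (r_of (k x) x)))"
    using g asymp_equiv_sym asymp_equiv_trans by blast
qed

end
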